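(* For every positive integer $n$, the sesqui-functor $\pi_0^{(n)}:n\mathbf{Gpd}\to(n-1)\mathbf{Gpd}$ is left adjoint to the $n$-discrete sesqui-functor $D^{(n)}:(n-1)\mathbf{Gpd}\to n\mathbf{Gpd}$, that is, $\pi_0^{(n)}\dashv D^{(n)}$.
   Context: **Strict $n$-categories** (all small), by induction on $n$. For $n=0$: $0$-categories are sets, $0$-functors are maps, the only 2-morphisms are identities. For $n\ge1$ ($n=1$ gives ordinary categories, functors, natural transformations): an $n$-category $\mathbb{C}$ consists of a set $\mathbb{C}_0$ of objects, an $(n-1)$-category $\mathbb{C}_1(c_0,c_0')$ for each pair of objects, and $(n-1)$-functors $u(c_0):\mathbb{I}\to\mathbb{C}_1(c_0,c_0)$ and $\circ:\mathbb{C}_1(c_0,c_0')\times\mathbb{C}_1(c_0',c_0'')\to\mathbb{C}_1(c_0,c_0'')$ (diagrammatic order), strictly associative and unital. Products are taken on objects and on homs; $\mathbb{I}$ is the terminal $n$-category. Objects of $\mathbb{C}_1(c_0,c_0')$ are 1-cells; a 1-cell $c_1$ induces $(n-1)$-functors $c_1\circ-$ and $-\circ c_1$ on homs. An $n$-functor $F:\mathbb{C}\to\mathbb{D}$ is a map $F_0$ on objects with $(n-1)$-functors $F_1^{c_0,c_0'}$ on homs strictly preserving $\circ$ and $u$; composites are written $F\bullet^0G$ ($F$ first). A 2-morphism (lax natural $n$-transformation) $\alpha:F\Rightarrow G:\mathbb{C}\to\mathbb{D}$ consists of 1-cells $\alpha_{c_0}:Fc_0\to Gc_0$ and 2-morphisms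 of $(n-1)$-categories $\alpha_1^{c_0,c_0'}:G_1^{c_0,c_0'}\bullet^0(\alpha_{c_0}\circ-)\Rightarrow F_1^{c_0,c_0'}\bullet^0(-\circ\alpha_{c_0'})$ such that $u(c_0)\bullet^0\alpha_1^{c_0,c_0}$ is the identity on the constant functor $[\alpha_{c_0}]$, and $(\circ)\bullet^0\alpha_1^{c_0,c_0''}=(\alpha_1^{c_0,c_0'}\circ G_1^{c_0',c_0''})\bullet^1(F_1^{c_0,c_0'}\circ\alpha_1^{c_0',c_0''})$, where $\alpha_1\circ G_1$ is the product 2-morphism $\alpha_1\times\mathrm{id}_{G_1}$ whiskered with the composition functor of $\mathbb{D}$ (similarly $F_1\circ\alpha_1$). Vertical composition: $(\omega\bullet^1\alpha)_{c_0}=\omega_{c_0}\circ\alpha_{c_0}$, $[\omega\bullet^1\alpha]_1=(\alpha_1\bullet^0(\omega_{c_0}\circ-))\bullet^1(\omega_1\bullet^0(-\circ\alpha_{c_0'}))$. Whiskerings: $(N\bullet^0\alpha)_{b_0}=\alpha_{Nb_0}$, $[N\bullet^0\alpha]_1^{b_0,b_0'}=N_1^{b_0,b_0'}\bullet^0\alpha_1^{Nb_0,Nb_0'}$; $(\alpha\bullet^0L)_{c_0}=L(\alpha_{c_0})$, $[\alpha\bullet^0L]_1^{c_0,c_0'}=\alpha_1^{c_0,c_0'}\bullet^0L_1^{Fc_0,Gc_0'}$. **Groupoids.** A $0$-functor is an equivalence if bijective. For $n\ge1$, $F:\mathbb{C}\to\mathbb{D}$ is an equivalence if each $d_0\in\mathbb{D}_0$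 admits a 1-cell $d_1:Fc_0\to d_0$ which is an equivalence and all $F_1^{c_0,c_0'}$ are equivalences; a 1-cell $d_1$ is an equivalence if all functors $d_1\circ-$, $-\circ d_1$ on homs are equivalences of $(n-1)$-categories. A $0$-groupoid is a set; for $n\ge1$ an $n$-groupoid is an $n$-category whose 1-cells are equivalences and whose homs are $(n-1)$-groupoids. $n\mathbf{Gpd}$ is the sesqui-category of $n$-groupoids, all $n$-functors and all 2-morphisms between them. **$\pi_0$.** $\pi_0^{(1)}$ sends a groupoid to its set of isomorphism classes (2-morphisms go to identities). For $n\ge2$: $[\pi_0^{(n)}\mathbb{C}]_0=\mathbb{C}_0$, $[\pi_0^{(n)}\mathbb{C}]_1(c_0,c_0')=\pi_0^{(n-1)}(\mathbb{C}_1(c_0,c_0'))$ with compositions and units the images under $\pi_0^{(n-1)}$; $[\pi_0^{(n)}F]_0=F_0$, $[\pi_0^{(n)}F]_1=\pi_0^{(n-1)}(F_1)$; $(\pi_0^{(n)}\alpha)_{c_0}=\alpha_{c_0}$ (its isomorphism class if $n=2$), $[\pi_0^{(n)}\alpha]_1=\pi_0^{(n-1)}(\alpha_1)$. **$D$.** $D^{(1)}$ sends a set to the discrete groupoid on it. For $n\ge2$: $[D^{(n)}\mathbb{C}]_0=\mathbb{C}_0$, $[D^{(n)}\mathbb{C}]_1(c_0,c_0')=D^{(n-1)}(\mathbb{C}_1(c_0,c_0'))$ with compositions and units the images under $D^{(n-1)}$; $[D^{(n)}F]_0=F_0$, $[D^{(n)}F]_1=D^{(n-1)}(F_1)$; $(D^{(n)}\alpha)_{c_0}=\alpha_{c_0}$,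 $[D^{(n)}\alpha]_1=D^{(n-1)}(\alpha_1)$. **Adjunction of sesqui-functors.** A (strict) natural transformation of sesqui-functors $\mathcal{F}\Rightarrow\mathcal{G}:\mathcal{C}\to\mathcal{D}$ is a natural transformation $\Delta$ of underlying functors such that $\mathcal{F}(\alpha)\bullet\Delta_B=\Delta_A\bullet\mathcal{G}(\alpha)$ for every 2-cell $\alpha:f\Rightarrow g:A\to B$. An adjunction of sesqui-functors is given by strict natural transformations (unit and counit) satisfying the usual triangular identities. *)

theory Defs
  imports "HOL-Library.FuncSet"
begin

section \<open>Strict n-categories, n-functors and 2-morphisms\<close>

text \<open>
  The raw data of n-categories, n-functors and 2-morphisms, for all n at once; the level n is an
  argument of the predicates \<open>is_cat\<close>, \<open>is_fun\<close>, \<open>is_tr\<close> and of all operations. In an n-functor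
  \<open>fhom F c c'\<close> is the (n-1)-functor induced on the hom from c to c'.
  The maps in n-functors and 2-morphisms are extensional (\<open>undefined\<close> off the objects of the
  domain), so that HOL equality is equality of n-functors and of 2-morphisms; for this reason
  operations producing them take the domain as an argument. The data of an n-category at
  arguments that are not objects are irrelevant.
\<close>

datatype ('a, 'b) nfun =
    Map0 (fob: "'a \<Rightarrow> 'b")
  | Fun (fob: "'a \<Rightarrow> 'b") (fhom: "'a \<Rightarrow> 'a \<Rightarrow> ('a, 'b) nfun")

datatype 'a ncat =
    Set0 (ob: "'a set")
  | Cat (ob: "'a set")
        (hom: "'a \<Rightarrow> 'a \<Rightarrow> 'a ncat")
        (unt: "'a \<Rightarrow> (unit, 'a) nfun")
        (cmp: "'a \<Rightarrow> 'a \<Rightarrow> 'a \<Rightarrow> ('a \<times> 'a, 'a) nfun")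

text \<open>
  A 2-morphism carries its source and target n-functor; \<open>Id0 F\<close> is the identity of a 0-functor F.
\<close>

datatype ('a, 'b) ntr =
    Id0 (src: "('a, 'b) nfun")
  | Tr (src: "('a, 'b) nfun") (tgt: "('a, 'b) nfun")
       (tob: "'a \<Rightarrow> 'b") (thom: "'a \<Rightarrow> 'a \<Rightarrow> ('a, 'b) ntr")
  where "tgt (Id0 F) = F"

subsection \<open>Functors between terminal categories, products and general categories\<close>

fun id_fun :: "nat \<Rightarrow> 'a ncat \<Rightarrow> ('a, 'a) nfun" where
  "id_fun 0 C = Map0 (\<lambda>x\<in>ob C. x)"
| "id_fun (Suc n) C =
     Fun (\<lambda>x\<in>ob C. x) (\<lambda>x\<in>ob C. \<lambda>y\<in>ob C. id_fun n (hom C x y))"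

text \<open>\<open>fcomp n C F G\<close> is F followed by G, where C is the domain of F.\<close>

fun fcomp :: "nat \<Rightarrow> 'a ncat \<Rightarrow> ('a, 'b) nfun \<Rightarrow> ('b, 'c) nfun \<Rightarrow> ('a, 'c) nfun" where
  "fcomp 0 C F G = Map0 (\<lambda>x\<in>ob C. fob G (fob F x))"
| "fcomp (Suc n) C F G =
     Fun (\<lambda>x\<in>ob C. fob G (fob F x))
         (\<lambda>x\<in>ob C. \<lambda>y\<in>ob C. fcomp n (hom C x y) (fhom F x y) (fhom G (fob F x) (fob F y)))"

fun bang_fun :: "nat \<Rightarrow> 'a ncat \<Rightarrow> ('a, unit) nfun" where
  "bang_fun 0 C = Map0 (\<lambda>x\<in>ob C. ())"
| "bang_fun (Suc n) C =
     Fun (\<lambda>x\<in>ob C. ()) (\<lambda>x\<in>ob C. \<lambda>y\<in>ob C. bang_fun n (hom C x y))"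

text \<open>The functor to the terminal category from one in which all values of the type are objects.\<close>

fun triv_fun :: "nat \<Rightarrow> ('a, unit) nfun" where
  "triv_fun 0 = Map0 (\<lambda>_. ())"
| "triv_fun (Suc n) = Fun (\<lambda>_. ()) (\<lambda>_ _. triv_fun n)"

fun terminal :: "nat \<Rightarrow> unit ncat" where
  "terminal 0 = Set0 {()}"
| "terminal (Suc n) = Cat {()} (\<lambda>_ _. terminal n) (\<lambda>_. triv_fun n) (\<lambda>_ _ _. triv_fun n)"

fun pair_fun :: "nat \<Rightarrow> 'e ncat \<Rightarrow> ('e, 'a) nfun \<Rightarrow> ('e, 'b) nfun \<Rightarrow> ('e, 'a \<times> 'b) nfun" where
  "pair_fun 0 E F G = Map0 (\<lambda>x\<in>ob E. (fob F x, fob G x))"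
| "pair_fun (Suc n) E F G =
     Fun (\<lambda>x\<in>ob E. (fob F x, fob G x))
         (\<lambda>x\<in>ob E. \<lambda>y\<in>ob E. pair_fun n (hom E x y) (fhom F x y) (fhom G x y))"

text \<open>
  The product \<open>F \<times> G\<close> of two functors with domains A and B; the projections of \<open>A \<times> B\<close>; the
  associativity isomorphism \<open>(A \<times> B) \<times> C \<rightarrow> A \<times> (B \<times> C)\<close>; and, for functors
  \<open>M: A \<times> A' \<rightarrow> A''\<close> and \<open>N: B \<times> B' \<rightarrow> B''\<close>, the functor
  \<open>(A \<times> B) \<times> (A' \<times> B') \<rightarrow> A'' \<times> B''\<close> sending \<open>((a, b), (a', b'))\<close> to \<open>(M (a, a'), N (b, b'))\<close>.
\<close>

fun prod_fun :: "nat \<Rightarrow> 'a ncat \<Rightarrow> 'b ncat \<Rightarrow> ('a, 'c) nfun \<Rightarrow> ('b, 'd) nfun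
    \<Rightarrow> ('a \<times> 'b, 'c \<times> 'd) nfun" where
  "prod_fun 0 A B F G = Map0 (\<lambda>(a, b)\<in>ob A \<times> ob B. (fob F a, fob G b))"
| "prod_fun (Suc n) A B F G =
     Fun (\<lambda>(a, b)\<in>ob A \<times> ob B. (fob F a, fob G b))
         (\<lambda>(a, b)\<in>ob A \<times> ob B. \<lambda>(a', b')\<in>ob A \<times> ob B.
            prod_fun n (hom A a a') (hom B b b') (fhom F a a') (fhom G b b'))"

fun fst_fun :: "nat \<Rightarrow> 'a ncat \<Rightarrow> 'b ncat \<Rightarrow> ('a \<times> 'b, 'a) nfun" where
  "fst_fun 0 A B = Map0 (\<lambda>(a, b)\<in>ob A \<times> ob B. a)"
| "fst_fun (Suc n) A B =
     Fun (\<lambda>(a, b)\<in>ob A \<times> ob B. a)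
         (\<lambda>(a, b)\<in>ob A \<times> ob B. \<lambda>(a', b')\<in>ob A \<times> ob B. fst_fun n (hom A a a') (hom B b b'))"

fun snd_fun :: "nat \<Rightarrow> 'a ncat \<Rightarrow> 'b ncat \<Rightarrow> ('a \<times> 'b, 'b) nfun" where
  "snd_fun 0 A B = Map0 (\<lambda>(a, b)\<in>ob A \<times> ob B. b)"
| "snd_fun (Suc n) A B =
     Fun (\<lambda>(a, b)\<in>ob A \<times> ob B. b)
         (\<lambda>(a, b)\<in>ob A \<times> ob B. \<lambda>(a', b')\<in>ob A \<times> ob B. snd_fun n (hom A a a') (hom B b b'))"

fun assoc_fun :: "nat \<Rightarrow> 'a ncat \<Rightarrow> 'b ncat \<Rightarrow> 'c ncat
    \<Rightarrow> (('a \<times> 'b) \<times> 'c, 'a \<times> ('b \<times> 'c)) nfun" where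
  "assoc_fun 0 A B C = Map0 (\<lambda>((a, b), c)\<in>(ob A \<times> ob B) \<times> ob C. (a, (b, c)))"
| "assoc_fun (Suc n) A B C =
     Fun (\<lambda>((a, b), c)\<in>(ob A \<times> ob B) \<times> ob C. (a, (b, c)))
         (\<lambda>((a, b), c)\<in>(ob A \<times> ob B) \<times> ob C. \<lambda>((a', b'), c')\<in>(ob A \<times> ob B) \<times> ob C.
            assoc_fun n (hom A a a') (hom B b b') (hom C c c'))"

fun prod_cmp :: "nat \<Rightarrow> 'a ncat \<Rightarrow> 'b ncat \<Rightarrow> 'a ncat \<Rightarrow> 'b ncat
    \<Rightarrow> ('a \<times> 'a, 'a) nfun \<Rightarrow> ('b \<times> 'b, 'b) nfun
    \<Rightarrow> (('a \<times> 'b) \<times> ('a \<times> 'b), 'a \<times> 'b) nfun" where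
  "prod_cmp 0 A B A' B' M N =
     Map0 (\<lambda>((a, b), (a', b'))\<in>(ob A \<times> ob B) \<times> (ob A' \<times> ob B'). (fob M (a, a'), fob N (b, b')))"
| "prod_cmp (Suc n) A B A' B' M N =
     Fun (\<lambda>((a, b), (a', b'))\<in>(ob A \<times> ob B) \<times> (ob A' \<times> ob B'). (fob M (a, a'), fob N (b, b')))
         (\<lambda>((a, b), (a', b'))\<in>(ob A \<times> ob B) \<times> (ob A' \<times> ob B').
          \<lambda>((x, y), (x', y'))\<in>(ob A \<times> ob B) \<times> (ob A' \<times> ob B').
            prod_cmp n (hom A a x) (hom B b y) (hom A' a' x') (hom B' b' y')
              (fhom M (a, a') (x, x')) (fhom N (b, b') (y, y')))"

fun prod_cat :: "nat \<Rightarrow> 'a ncat \<Rightarrow> 'b ncat \<Rightarrow> ('a \<times> 'b) ncat" where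
  "prod_cat 0 C D = Set0 (ob C \<times> ob D)"
| "prod_cat (Suc n) C D =
     Cat (ob C \<times> ob D)
         (\<lambda>(c, d) (c', d'). prod_cat n (hom C c c') (hom D d d'))
         (\<lambda>(c, d). pair_fun n (terminal n) (unt C c) (unt D d))
         (\<lambda>(c, d) (c', d') (c'', d'').
            prod_cmp n (hom C c c') (hom D d d') (hom C c' c'') (hom D d' d'')
              (cmp C c c' c'') (cmp D d d' d''))"

text \<open>The constant functor \<open>[y]\<close> from the terminal n-category, and from X, to Y.\<close>

fun point_fun :: "nat \<Rightarrow> 'a ncat \<Rightarrow> 'a \<Rightarrow> (unit, 'a) nfun" where
  "point_fun 0 Y y = Map0 (\<lambda>_. y)"
| "point_fun (Suc n) Y y = Fun (\<lambda>_. y) (\<lambda>_ _. unt Y y)"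

definition const_fun :: "nat \<Rightarrow> 'a ncat \<Rightarrow> 'b ncat \<Rightarrow> 'b \<Rightarrow> ('a, 'b) nfun" where
  "const_fun n X Y y = fcomp n X (bang_fun n X) (point_fun n Y y)"

text \<open>
  For an (n+1)-category D: the n-functor \<open>f \<circ> -\<close> from \<open>hom D y z\<close> to \<open>hom D x z\<close> for a 1-cell f
  from x to y, and the n-functor \<open>- \<circ> g\<close> from \<open>hom D x y\<close> to \<open>hom D x z\<close> for a 1-cell g
  from y to z. Composition is in diagrammatic order.
\<close>

definition precomp :: "nat \<Rightarrow> 'a ncat \<Rightarrow> 'a \<Rightarrow> 'a \<Rightarrow> 'a \<Rightarrow> 'a \<Rightarrow> ('a, 'a) nfun" where
  "precomp n D x y z f =
     fcomp n (hom D y z)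
       (pair_fun n (hom D y z) (const_fun n (hom D y z) (hom D x y) f) (id_fun n (hom D y z)))
       (cmp D x y z)"

definition postcomp :: "nat \<Rightarrow> 'a ncat \<Rightarrow> 'a \<Rightarrow> 'a \<Rightarrow> 'a \<Rightarrow> 'a \<Rightarrow> ('a, 'a) nfun" where
  "postcomp n D x y z g =
     fcomp n (hom D x y)
       (pair_fun n (hom D x y) (id_fun n (hom D x y)) (const_fun n (hom D x y) (hom D y z) g))
       (cmp D x y z)"

subsection \<open>n-functors and n-categories\<close>

fun is_fun :: "nat \<Rightarrow> 'a ncat \<Rightarrow> 'b ncat \<Rightarrow> ('a, 'b) nfun \<Rightarrow> bool" where
  "is_fun 0 C D F \<longleftrightarrow> (\<exists>f\<in>ob C \<rightarrow>\<^sub>E ob D. F = Map0 f)"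
| "is_fun (Suc n) C D F \<longleftrightarrow>
     (\<exists>f\<in>ob C \<rightarrow>\<^sub>E ob D. \<exists>h\<in>ob C \<rightarrow>\<^sub>E (ob C \<rightarrow>\<^sub>E UNIV). F = Fun f h \<and>
        (\<forall>c\<in>ob C. \<forall>c'\<in>ob C. is_fun n (hom C c c') (hom D (f c) (f c')) (h c c')) \<and>
        (\<forall>c\<in>ob C. fcomp n (terminal n) (unt C c) (h c c) = unt D (f c)) \<and>
        (\<forall>c\<in>ob C. \<forall>c'\<in>ob C. \<forall>c''\<in>ob C.
           fcomp n (prod_cat n (hom C c c') (hom C c' c'')) (cmp C c c' c'') (h c c'') =
           fcomp n (prod_cat n (hom C c c') (hom C c' c''))
             (prod_fun n (hom C c c') (hom C c' c'') (h c c') (h c' c''))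
             (cmp D (f c) (f c') (f c''))))"

fun is_cat :: "nat \<Rightarrow> 'a ncat \<Rightarrow> bool" where
  "is_cat 0 C \<longleftrightarrow> (\<exists>A. C = Set0 A)"
| "is_cat (Suc n) C \<longleftrightarrow>
     (\<exists>A H u m. C = Cat A H u m \<and>
        (\<forall>c\<in>A. \<forall>c'\<in>A. is_cat n (H c c')) \<and>
        (\<forall>c\<in>A. is_fun n (terminal n) (H c c) (u c)) \<and>
        (\<forall>c\<in>A. \<forall>c'\<in>A. \<forall>c''\<in>A.
           is_fun n (prod_cat n (H c c') (H c' c'')) (H c c'') (m c c' c'')) \<and>
        (\<forall>c\<in>A. \<forall>c'\<in>A.
           fcomp n (prod_cat n (terminal n) (H c c'))
             (prod_fun n (terminal n) (H c c') (u c) (id_fun n (H c c'))) (m c c c')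
           = snd_fun n (terminal n) (H c c')) \<and>
        (\<forall>c\<in>A. \<forall>c'\<in>A.
           fcomp n (prod_cat n (H c c') (terminal n))
             (prod_fun n (H c c') (terminal n) (id_fun n (H c c')) (u c')) (m c c' c')
           = fst_fun n (H c c') (terminal n)) \<and>
        (\<forall>c\<in>A. \<forall>c'\<in>A. \<forall>c''\<in>A. \<forall>c'''\<in>A.
           let X = H c c'; Y = H c' c''; Z = H c'' c''';
               XY = prod_cat n X Y; YZ = prod_cat n Y Z in
           fcomp n (prod_cat n XY Z)
             (prod_fun n XY Z (m c c' c'') (id_fun n Z)) (m c c'' c''')
           = fcomp n (prod_cat n XY Z) (assoc_fun n X Y Z)
               (fcomp n (prod_cat n X YZ)
                 (prod_fun n X YZ (id_fun n X) (m c' c'' c''')) (m c c' c'''))))"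

subsection \<open>2-morphisms\<close>

fun id_tr :: "nat \<Rightarrow> 'a ncat \<Rightarrow> 'b ncat \<Rightarrow> ('a, 'b) nfun \<Rightarrow> ('a, 'b) ntr" where
  "id_tr 0 C D F = Id0 F"
| "id_tr (Suc n) C D F =
     Tr F F (\<lambda>c\<in>ob C. fob (unt D (fob F c)) ())
       (\<lambda>c\<in>ob C. \<lambda>c'\<in>ob C. id_tr n (hom C c c') (hom D (fob F c) (fob F c')) (fhom F c c'))"

text \<open>\<open>whisker_l n B N \<alpha>\<close> is \<open>N \<bullet>\<^sup>0 \<alpha>\<close>, B being the domain of N;
  \<open>whisker_r n C \<alpha> L\<close> is \<open>\<alpha> \<bullet>\<^sup>0 L\<close>, C being the domain of the source of \<open>\<alpha>\<close>.\<close>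

fun whisker_l :: "nat \<Rightarrow> 'a ncat \<Rightarrow> ('a, 'b) nfun \<Rightarrow> ('b, 'c) ntr \<Rightarrow> ('a, 'c) ntr" where
  "whisker_l 0 B N \<alpha> = Id0 (fcomp 0 B N (src \<alpha>))"
| "whisker_l (Suc n) B N \<alpha> =
     Tr (fcomp (Suc n) B N (src \<alpha>)) (fcomp (Suc n) B N (tgt \<alpha>))
       (\<lambda>b\<in>ob B. tob \<alpha> (fob N b))
       (\<lambda>b\<in>ob B. \<lambda>b'\<in>ob B. whisker_l n (hom B b b') (fhom N b b') (thom \<alpha> (fob N b) (fob N b')))"

fun whisker_r :: "nat \<Rightarrow> 'a ncat \<Rightarrow> ('a, 'b) ntr \<Rightarrow> ('b, 'c) nfun \<Rightarrow> ('a, 'c) ntr" where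
  "whisker_r 0 C \<alpha> L = Id0 (fcomp 0 C (src \<alpha>) L)"
| "whisker_r (Suc n) C \<alpha> L =
     Tr (fcomp (Suc n) C (src \<alpha>) L) (fcomp (Suc n) C (tgt \<alpha>) L)
       (\<lambda>c\<in>ob C. fob (fhom L (fob (src \<alpha>) c) (fob (tgt \<alpha>) c)) (tob \<alpha> c))
       (\<lambda>c\<in>ob C. \<lambda>c'\<in>ob C.
          whisker_r n (hom C c c') (thom \<alpha> c c') (fhom L (fob (src \<alpha>) c) (fob (tgt \<alpha>) c')))"

text \<open>\<open>vcomp n C D \<omega> \<alpha>\<close> is \<open>\<omega> \<bullet>\<^sup>1 \<alpha>\<close>, for \<open>\<omega>: F \<Rightarrow> G\<close> and \<open>\<alpha>: G \<Rightarrow> H\<close> between functors from C to D.\<close>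

fun vcomp :: "nat \<Rightarrow> 'a ncat \<Rightarrow> 'b ncat \<Rightarrow> ('a, 'b) ntr \<Rightarrow> ('a, 'b) ntr \<Rightarrow> ('a, 'b) ntr" where
  "vcomp 0 C D \<omega> \<alpha> = \<omega>"
| "vcomp (Suc n) C D \<omega> \<alpha> =
     (let F = fob (src \<omega>); G = fob (tgt \<omega>); H = fob (tgt \<alpha>) in
      Tr (src \<omega>) (tgt \<alpha>)
        (\<lambda>c\<in>ob C. fob (cmp D (F c) (G c) (H c)) (tob \<omega> c, tob \<alpha> c))
        (\<lambda>c\<in>ob C. \<lambda>c'\<in>ob C.
           vcomp n (hom C c c') (hom D (F c) (H c'))
             (whisker_r n (hom C c c') (thom \<alpha> c c') (precomp n D (F c) (G c) (H c') (tob \<omega> c)))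
             (whisker_r n (hom C c c') (thom \<omega> c c') (postcomp n D (F c) (G c') (H c') (tob \<alpha> c')))))"

text \<open>The product \<open>\<alpha> \<times> \<beta>\<close>, where A and B are the domains.\<close>

fun prod_tr :: "nat \<Rightarrow> 'a ncat \<Rightarrow> 'b ncat \<Rightarrow> ('a, 'c) ntr \<Rightarrow> ('b, 'd) ntr
    \<Rightarrow> ('a \<times> 'b, 'c \<times> 'd) ntr" where
  "prod_tr 0 A B \<alpha> \<beta> = Id0 (prod_fun 0 A B (src \<alpha>) (src \<beta>))"
| "prod_tr (Suc n) A B \<alpha> \<beta> =
     Tr (prod_fun (Suc n) A B (src \<alpha>) (src \<beta>)) (prod_fun (Suc n) A B (tgt \<alpha>) (tgt \<beta>))
       (\<lambda>(a, b)\<in>ob A \<times> ob B. (tob \<alpha> a, tob \<beta> b))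
       (\<lambda>(a, b)\<in>ob A \<times> ob B. \<lambda>(a', b')\<in>ob A \<times> ob B.
          prod_tr n (hom A a a') (hom B b b') (thom \<alpha> a a') (thom \<beta> b b'))"

text \<open>\<open>is_tr n C D \<alpha>\<close>: \<open>\<alpha>\<close> is a 2-morphism from \<open>src \<alpha>\<close> to \<open>tgt \<alpha>\<close>, both n-functors from C to D.\<close>

fun is_tr :: "nat \<Rightarrow> 'a ncat \<Rightarrow> 'b ncat \<Rightarrow> ('a, 'b) ntr \<Rightarrow> bool" where
  "is_tr 0 C D \<alpha> \<longleftrightarrow> (\<exists>F. is_fun 0 C D F \<and> \<alpha> = Id0 F)"
| "is_tr (Suc n) C D \<alpha> \<longleftrightarrow>
     (\<exists>F G a. \<exists>t\<in>ob C \<rightarrow>\<^sub>E (ob C \<rightarrow>\<^sub>E UNIV). \<alpha> = Tr F G a t \<and>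
        is_fun (Suc n) C D F \<and> is_fun (Suc n) C D G \<and>
        a \<in> (\<Pi>\<^sub>E c\<in>ob C. ob (hom D (fob F c) (fob G c))) \<and>
        (\<forall>c\<in>ob C. \<forall>c'\<in>ob C.
           is_tr n (hom C c c') (hom D (fob F c) (fob G c')) (t c c') \<and>
           src (t c c') =
             fcomp n (hom C c c') (fhom G c c') (precomp n D (fob F c) (fob G c) (fob G c') (a c)) \<and>
           tgt (t c c') =
             fcomp n (hom C c c') (fhom F c c') (postcomp n D (fob F c) (fob F c') (fob G c') (a c'))) \<and>
        (\<forall>c\<in>ob C.
           whisker_l n (terminal n) (unt C c) (t c c) =
           id_tr n (terminal n) (hom D (fob F c) (fob G c))
             (point_fun n (hom D (fob F c) (fob G c)) (a c))) \<and>
        (\<forall>c\<in>ob C. \<forall>c'\<in>ob C. \<forall>c''\<in>ob C.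
           let X = hom C c c'; Y = hom C c' c''; XY = prod_cat n X Y in
           whisker_l n XY (cmp C c c' c'') (t c c'') =
           vcomp n XY (hom D (fob F c) (fob G c''))
             (whisker_r n XY
               (prod_tr n X Y (t c c') (id_tr n Y (hom D (fob G c') (fob G c'')) (fhom G c' c'')))
               (cmp D (fob F c) (fob G c') (fob G c'')))
             (whisker_r n XY
               (prod_tr n X Y (id_tr n X (hom D (fob F c) (fob F c')) (fhom F c c')) (t c' c''))
               (cmp D (fob F c) (fob F c') (fob G c'')))))"

section \<open>Equivalences and n-groupoids\<close>

text \<open>
  \<open>is_equiv1 E n D x y f\<close>: the 1-cell f from x to y of the (n+1)-category D is an equivalence, if E
  is the property of n-functors to be an equivalence.
\<close>

definition is_equiv1 :: "('a ncat \<Rightarrow> 'a ncat \<Rightarrow> ('a, 'a) nfun \<Rightarrow> bool) \<Rightarrow> nat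
    \<Rightarrow> 'a ncat \<Rightarrow> 'a \<Rightarrow> 'a \<Rightarrow> 'a \<Rightarrow> bool" where
  "is_equiv1 E n D x y f \<longleftrightarrow>
     (\<forall>z\<in>ob D. E (hom D y z) (hom D x z) (precomp n D x y z f)) \<and>
     (\<forall>z\<in>ob D. E (hom D z x) (hom D z y) (postcomp n D z x y f))"

fun is_equiv :: "nat \<Rightarrow> 'a ncat \<Rightarrow> 'a ncat \<Rightarrow> ('a, 'a) nfun \<Rightarrow> bool" where
  "is_equiv 0 C D F \<longleftrightarrow> bij_betw (fob F) (ob C) (ob D)"
| "is_equiv (Suc n) C D F \<longleftrightarrow>
     (\<forall>d\<in>ob D. \<exists>c\<in>ob C. \<exists>f\<in>ob (hom D (fob F c) d). is_equiv1 (is_equiv n) n D (fob F c) d f) \<and>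
     (\<forall>c\<in>ob C. \<forall>c'\<in>ob C. is_equiv n (hom C c c') (hom D (fob F c) (fob F c')) (fhom F c c'))"

fun is_gpd :: "nat \<Rightarrow> 'a ncat \<Rightarrow> bool" where
  "is_gpd 0 C \<longleftrightarrow> is_cat 0 C"
| "is_gpd (Suc n) C \<longleftrightarrow>
     is_cat (Suc n) C \<and>
     (\<forall>c\<in>ob C. \<forall>c'\<in>ob C. \<forall>f\<in>ob (hom C c c'). is_equiv1 (is_equiv n) n C c c' f) \<and>
     (\<forall>c\<in>ob C. \<forall>c'\<in>ob C. is_gpd n (hom C c c'))"

section \<open>Small sets\<close>

text \<open>
  The functor \<open>\<pi>\<^sub>0\<close> replaces cells by sets of cells, so the cells of all n-groupoids are taken from
  a universe in which nonempty small sets of elements are again elements: every nonempty small set S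
  has a code, from which S is recovered by \<open>elts\<close>. Small means of cardinality at most that of
  the type \<open>'k\<close>, which is arbitrary.
\<close>

datatype 'k univ = Elt 'k | Coll "'k \<Rightarrow> 'k univ"

definition small :: "'k univ set \<Rightarrow> bool" where
  "small S \<longleftrightarrow> (\<exists>f :: 'k \<Rightarrow> 'k univ. S \<subseteq> range f)"

definition code :: "'k univ set \<Rightarrow> 'k univ" where
  "code S = Coll (SOME f. range f = S)"

fun elts :: "'k univ \<Rightarrow> 'k univ set" where
  "elts (Elt a) = {}"
| "elts (Coll f) = range f"

lemma elts_code:
  assumes "small S" "S \<noteq> {}"
  shows "elts (code S) = S"
proof -
  obtain f :: "'a \<Rightarrow> 'a univ" and s where f: "S \<subseteq> range f" and s: "s \<in> S"
    using assms by (auto simp: small_def)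
  have "range (\<lambda>k. if f k \<in> S then f k else s) = S"
    using f s by (auto split: if_splits)
  then have "range (SOME f :: 'a \<Rightarrow> 'a univ. range f = S) = S"
    by (rule someI[where P = "\<lambda>f :: 'a \<Rightarrow> 'a univ. range f = S"])
  then show ?thesis
    by (simp add: code_def)
qed

definition rep :: "'k univ \<Rightarrow> 'k univ" where
  "rep x = (SOME y. y \<in> elts x)"

fun small_cat :: "nat \<Rightarrow> 'k univ ncat \<Rightarrow> bool" where
  "small_cat 0 C \<longleftrightarrow> small (ob C)"
| "small_cat (Suc n) C \<longleftrightarrow>
     small (ob C) \<and> (\<forall>c\<in>ob C. \<forall>c'\<in>ob C. small_cat n (hom C c c'))"

section \<open>The functor of isomorphism classes\<close>

text \<open>The isomorphism class of the object x of a 1-category.\<close>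

definition iso_class :: "'k univ ncat \<Rightarrow> 'k univ \<Rightarrow> 'k univ" where
  "iso_class C x = code {y \<in> ob C. \<exists>f\<in>ob (hom C x y). \<exists>g\<in>ob (hom C y x).
     fob (cmp C x y x) (f, g) = fob (unt C x) () \<and> fob (cmp C y x y) (g, f) = fob (unt C y) ()}"

text \<open>
  The image of a functor F into D under \<open>\<pi>\<^sub>0\<close>. Its domain P is \<open>\<pi>\<^sub>0 C\<close> for the domain C of F, or,
  when F is a composition functor or a unit, \<open>\<pi>\<^sub>0 A \<times> \<pi>\<^sub>0 B\<close> (identified with \<open>\<pi>\<^sub>0 (A \<times> B)\<close>) or the
  terminal category. The function r selects representatives: \<open>rep\<close>, \<open>map_prod rep rep\<close> or \<open>id\<close>,
  respectively. \<open>\<pi>\<^sub>0\<close> is defined only at levels \<open>n \<ge> 1\<close>.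
\<close>

fun pi0_map :: "nat \<Rightarrow> ('p \<Rightarrow> 'p) \<Rightarrow> 'p ncat \<Rightarrow> 'k univ ncat \<Rightarrow> ('p, 'k univ) nfun
    \<Rightarrow> ('p, 'k univ) nfun" where
  "pi0_map (Suc 0) r P D F = Map0 (\<lambda>p\<in>ob P. iso_class D (fob F (r p)))"
| "pi0_map (Suc (Suc n)) r P D F =
     Fun (\<lambda>p\<in>ob P. fob F p)
         (\<lambda>p\<in>ob P. \<lambda>q\<in>ob P.
            pi0_map (Suc n) r (hom P p q) (hom D (fob F p) (fob F q)) (fhom F p q))"

fun pi0_cat :: "nat \<Rightarrow> 'k univ ncat \<Rightarrow> 'k univ ncat" where
  "pi0_cat (Suc 0) C = Set0 (iso_class C ` ob C)"
| "pi0_cat (Suc (Suc n)) C =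
     Cat (ob C)
         (\<lambda>c c'. pi0_cat (Suc n) (hom C c c'))
         (\<lambda>c. pi0_map (Suc n) id (terminal n) (hom C c c) (unt C c))
         (\<lambda>c c' c''. pi0_map (Suc n) (map_prod rep rep)
            (prod_cat n (pi0_cat (Suc n) (hom C c c')) (pi0_cat (Suc n) (hom C c' c'')))
            (hom C c c'') (cmp C c c' c''))"

definition pi0_fun :: "nat \<Rightarrow> 'k univ ncat \<Rightarrow> 'k univ ncat \<Rightarrow> ('k univ, 'k univ) nfun
    \<Rightarrow> ('k univ, 'k univ) nfun" where
  "pi0_fun n C D F = pi0_map n rep (pi0_cat n C) D F"

fun pi0_tr :: "nat \<Rightarrow> 'k univ ncat \<Rightarrow> 'k univ ncat \<Rightarrow> ('k univ, 'k univ) ntr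
    \<Rightarrow> ('k univ, 'k univ) ntr" where
  "pi0_tr (Suc 0) C D \<alpha> = Id0 (pi0_fun (Suc 0) C D (src \<alpha>))"
| "pi0_tr (Suc (Suc n)) C D \<alpha> =
     Tr (pi0_fun (Suc (Suc n)) C D (src \<alpha>)) (pi0_fun (Suc (Suc n)) C D (tgt \<alpha>))
       (\<lambda>c\<in>ob C. if n = 0
          then iso_class (hom D (fob (src \<alpha>) c) (fob (tgt \<alpha>) c)) (tob \<alpha> c)
          else tob \<alpha> c)
       (\<lambda>c\<in>ob C. \<lambda>c'\<in>ob C.
          pi0_tr (Suc n) (hom C c c') (hom D (fob (src \<alpha>) c) (fob (tgt \<alpha>) c')) (thom \<alpha> c c'))"

section \<open>The discrete functor\<close>

text \<open>
  In the discrete groupoid on a set, the identity of x is x itself. With this choice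
  \<open>D (A \<times> B) = D A \<times> D B\<close> and D preserves the terminal category (as far as objects and homs
  between them are concerned), so that no comparison functors are needed.
\<close>

definition disc_hom :: "'a \<Rightarrow> 'a \<Rightarrow> 'a set" where
  "disc_hom x y = (if x = y then {x} else {})"

fun disc_fun :: "nat \<Rightarrow> 'a ncat \<Rightarrow> ('a, 'b) nfun \<Rightarrow> ('a, 'b) nfun" where
  "disc_fun (Suc 0) C F =
     Fun (\<lambda>x\<in>ob C. fob F x) (\<lambda>x\<in>ob C. \<lambda>y\<in>ob C. Map0 (\<lambda>z\<in>disc_hom x y. fob F z))"
| "disc_fun (Suc (Suc n)) C F =
     Fun (\<lambda>x\<in>ob C. fob F x)
         (\<lambda>x\<in>ob C. \<lambda>y\<in>ob C. disc_fun (Suc n) (hom C x y) (fhom F x y))"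

fun disc_cat :: "nat \<Rightarrow> 'a ncat \<Rightarrow> 'a ncat" where
  "disc_cat (Suc 0) C =
     Cat (ob C) (\<lambda>x y. Set0 (disc_hom x y)) (\<lambda>x. Map0 (\<lambda>_. x))
         (\<lambda>x y z. Map0 (\<lambda>(f, g)\<in>disc_hom x y \<times> disc_hom y z. f))"
| "disc_cat (Suc (Suc n)) C =
     Cat (ob C)
         (\<lambda>c c'. disc_cat (Suc n) (hom C c c'))
         (\<lambda>c. disc_fun (Suc n) (terminal n) (unt C c))
         (\<lambda>c c' c''. disc_fun (Suc n) (prod_cat n (hom C c c') (hom C c' c'')) (cmp C c c' c''))"

fun disc_tr :: "nat \<Rightarrow> 'a ncat \<Rightarrow> 'b ncat \<Rightarrow> ('a, 'b) ntr \<Rightarrow> ('a, 'b) ntr" where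
  "disc_tr (Suc 0) C D \<alpha> =
     id_tr (Suc 0) (disc_cat (Suc 0) C) (disc_cat (Suc 0) D) (disc_fun (Suc 0) C (src \<alpha>))"
| "disc_tr (Suc (Suc n)) C D \<alpha> =
     Tr (disc_fun (Suc (Suc n)) C (src \<alpha>)) (disc_fun (Suc (Suc n)) C (tgt \<alpha>))
       (\<lambda>c\<in>ob C. tob \<alpha> c)
       (\<lambda>c\<in>ob C. \<lambda>c'\<in>ob C.
          disc_tr (Suc n) (hom C c c') (hom D (fob (src \<alpha>) c) (fob (tgt \<alpha>) c')) (thom \<alpha> c c'))"

section \<open>Sesqui-categories\<close>

text \<open>
  Composition of 1-cells and vertical composition of 2-cells are in diagrammatic order. The object
  arguments of an operation are those between which its operands lie, in order.
\<close>

record ('o, 'f, 't) sesqui =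
  Ob :: "'o set"
  Arr :: "'o \<Rightarrow> 'o \<Rightarrow> 'f set"
  Id1 :: "'o \<Rightarrow> 'f"
  Comp1 :: "'o \<Rightarrow> 'o \<Rightarrow> 'o \<Rightarrow> 'f \<Rightarrow> 'f \<Rightarrow> 'f"
  Cell :: "'o \<Rightarrow> 'o \<Rightarrow> 'f \<Rightarrow> 'f \<Rightarrow> 't set"
  Id2 :: "'o \<Rightarrow> 'o \<Rightarrow> 'f \<Rightarrow> 't"
  VComp :: "'o \<Rightarrow> 'o \<Rightarrow> 't \<Rightarrow> 't \<Rightarrow> 't"
  WhiskL :: "'o \<Rightarrow> 'o \<Rightarrow> 'o \<Rightarrow> 'f \<Rightarrow> 't \<Rightarrow> 't"
  WhiskR :: "'o \<Rightarrow> 'o \<Rightarrow> 'o \<Rightarrow> 't \<Rightarrow> 'f \<Rightarrow> 't"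

definition is_sesqui :: "('o, 'f, 't) sesqui \<Rightarrow> bool" where
  "is_sesqui S \<longleftrightarrow>
    \<comment> \<open>the underlying category\<close>
    (\<forall>A\<in>Ob S. Id1 S A \<in> Arr S A A) \<and>
    (\<forall>A\<in>Ob S. \<forall>B\<in>Ob S. \<forall>C\<in>Ob S. \<forall>f\<in>Arr S A B. \<forall>g\<in>Arr S B C. Comp1 S A B C f g \<in> Arr S A C) \<and>
    (\<forall>A\<in>Ob S. \<forall>B\<in>Ob S. \<forall>f\<in>Arr S A B.
       Comp1 S A A B (Id1 S A) f = f \<and> Comp1 S A B B f (Id1 S B) = f) \<and>
    (\<forall>A\<in>Ob S. \<forall>B\<in>Ob S. \<forall>C\<in>Ob S. \<forall>E\<in>Ob S. \<forall>f\<in>Arr S A B. \<forall>g\<in>Arr S B C. \<forall>h\<in>Arr S C E.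
       Comp1 S A C E (Comp1 S A B C f g) h = Comp1 S A B E f (Comp1 S B C E g h)) \<and>
    \<comment> \<open>the hom-categories\<close>
    (\<forall>A\<in>Ob S. \<forall>B\<in>Ob S. \<forall>f\<in>Arr S A B. Id2 S A B f \<in> Cell S A B f f) \<and>
    (\<forall>A\<in>Ob S. \<forall>B\<in>Ob S. \<forall>f\<in>Arr S A B. \<forall>g\<in>Arr S A B. \<forall>h\<in>Arr S A B.
       \<forall>\<alpha>\<in>Cell S A B f g. \<forall>\<beta>\<in>Cell S A B g h. VComp S A B \<alpha> \<beta> \<in> Cell S A B f h) \<and>
    (\<forall>A\<in>Ob S. \<forall>B\<in>Ob S. \<forall>f\<in>Arr S A B. \<forall>g\<in>Arr S A B. \<forall>\<alpha>\<in>Cell S A B f g.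
       VComp S A B (Id2 S A B f) \<alpha> = \<alpha> \<and> VComp S A B \<alpha> (Id2 S A B g) = \<alpha>) \<and>
    (\<forall>A\<in>Ob S. \<forall>B\<in>Ob S. \<forall>f\<in>Arr S A B. \<forall>g\<in>Arr S A B. \<forall>h\<in>Arr S A B. \<forall>k\<in>Arr S A B.
       \<forall>\<alpha>\<in>Cell S A B f g. \<forall>\<beta>\<in>Cell S A B g h. \<forall>\<gamma>\<in>Cell S A B h k.
         VComp S A B (VComp S A B \<alpha> \<beta>) \<gamma> = VComp S A B \<alpha> (VComp S A B \<beta> \<gamma>)) \<and>
    \<comment> \<open>left whiskering\<close>
    (\<forall>A\<in>Ob S. \<forall>B\<in>Ob S. \<forall>C\<in>Ob S. \<forall>f\<in>Arr S A B. \<forall>g\<in>Arr S B C. \<forall>h\<in>Arr S B C. \<forall>\<alpha>\<in>Cell S B C g h.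
       WhiskL S A B C f \<alpha> \<in> Cell S A C (Comp1 S A B C f g) (Comp1 S A B C f h)) \<and>
    (\<forall>A\<in>Ob S. \<forall>B\<in>Ob S. \<forall>C\<in>Ob S. \<forall>f\<in>Arr S A B. \<forall>g\<in>Arr S B C.
       WhiskL S A B C f (Id2 S B C g) = Id2 S A C (Comp1 S A B C f g)) \<and>
    (\<forall>A\<in>Ob S. \<forall>B\<in>Ob S. \<forall>C\<in>Ob S. \<forall>f\<in>Arr S A B. \<forall>g\<in>Arr S B C. \<forall>h\<in>Arr S B C. \<forall>k\<in>Arr S B C.
       \<forall>\<alpha>\<in>Cell S B C g h. \<forall>\<beta>\<in>Cell S B C h k.
         WhiskL S A B C f (VComp S B C \<alpha> \<beta>) =
         VComp S A C (WhiskL S A B C f \<alpha>) (WhiskL S A B C f \<beta>)) \<and>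
    (\<forall>A\<in>Ob S. \<forall>B\<in>Ob S. \<forall>g\<in>Arr S A B. \<forall>h\<in>Arr S A B. \<forall>\<alpha>\<in>Cell S A B g h.
       WhiskL S A A B (Id1 S A) \<alpha> = \<alpha>) \<and>
    (\<forall>A\<in>Ob S. \<forall>B\<in>Ob S. \<forall>C\<in>Ob S. \<forall>E\<in>Ob S. \<forall>e\<in>Arr S A B. \<forall>f\<in>Arr S B C.
       \<forall>g\<in>Arr S C E. \<forall>h\<in>Arr S C E. \<forall>\<alpha>\<in>Cell S C E g h.
         WhiskL S A C E (Comp1 S A B C e f) \<alpha> = WhiskL S A B E e (WhiskL S B C E f \<alpha>)) \<and>
    \<comment> \<open>right whiskering\<close>
    (\<forall>A\<in>Ob S. \<forall>B\<in>Ob S. \<forall>C\<in>Ob S. \<forall>f\<in>Arr S A B. \<forall>g\<in>Arr S A B. \<forall>h\<in>Arr S B C. \<forall>\<alpha>\<in>Cell S A B f g.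
       WhiskR S A B C \<alpha> h \<in> Cell S A C (Comp1 S A B C f h) (Comp1 S A B C g h)) \<and>
    (\<forall>A\<in>Ob S. \<forall>B\<in>Ob S. \<forall>C\<in>Ob S. \<forall>f\<in>Arr S A B. \<forall>h\<in>Arr S B C.
       WhiskR S A B C (Id2 S A B f) h = Id2 S A C (Comp1 S A B C f h)) \<and>
    (\<forall>A\<in>Ob S. \<forall>B\<in>Ob S. \<forall>C\<in>Ob S. \<forall>f\<in>Arr S A B. \<forall>g\<in>Arr S A B. \<forall>k\<in>Arr S A B. \<forall>h\<in>Arr S B C.
       \<forall>\<alpha>\<in>Cell S A B f g. \<forall>\<beta>\<in>Cell S A B g k.
         WhiskR S A B C (VComp S A B \<alpha> \<beta>) h =
         VComp S A C (WhiskR S A B C \<alpha> h) (WhiskR S A B C \<beta> h)) \<and>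
    (\<forall>A\<in>Ob S. \<forall>B\<in>Ob S. \<forall>f\<in>Arr S A B. \<forall>g\<in>Arr S A B. \<forall>\<alpha>\<in>Cell S A B f g.
       WhiskR S A B B \<alpha> (Id1 S B) = \<alpha>) \<and>
    (\<forall>A\<in>Ob S. \<forall>B\<in>Ob S. \<forall>C\<in>Ob S. \<forall>E\<in>Ob S. \<forall>f\<in>Arr S A B. \<forall>g\<in>Arr S A B.
       \<forall>h\<in>Arr S B C. \<forall>k\<in>Arr S C E. \<forall>\<alpha>\<in>Cell S A B f g.
         WhiskR S A B E \<alpha> (Comp1 S B C E h k) = WhiskR S A C E (WhiskR S A B C \<alpha> h) k) \<and>
    \<comment> \<open>both whiskerings\<close>
    (\<forall>A\<in>Ob S. \<forall>B\<in>Ob S. \<forall>C\<in>Ob S. \<forall>E\<in>Ob S. \<forall>e\<in>Arr S A B. \<forall>f\<in>Arr S B C. \<forall>g\<in>Arr S B C.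
       \<forall>h\<in>Arr S C E. \<forall>\<alpha>\<in>Cell S B C f g.
         WhiskR S A C E (WhiskL S A B C e \<alpha>) h = WhiskL S A B E e (WhiskR S B C E \<alpha> h))"

record ('o, 'f, 't, 'p, 'g, 'u) sfunctor =
  on_Ob :: "'o \<Rightarrow> 'p"
  on_Arr :: "'o \<Rightarrow> 'o \<Rightarrow> 'f \<Rightarrow> 'g"
  on_Cell :: "'o \<Rightarrow> 'o \<Rightarrow> 't \<Rightarrow> 'u"

definition is_sfunctor :: "('o, 'f, 't) sesqui \<Rightarrow> ('p, 'g, 'u) sesqui
    \<Rightarrow> ('o, 'f, 't, 'p, 'g, 'u) sfunctor \<Rightarrow> bool" where
  "is_sfunctor S T F \<longleftrightarrow>
    (\<forall>A\<in>Ob S. on_Ob F A \<in> Ob T) \<and>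
    (\<forall>A\<in>Ob S. \<forall>B\<in>Ob S. \<forall>f\<in>Arr S A B. on_Arr F A B f \<in> Arr T (on_Ob F A) (on_Ob F B)) \<and>
    (\<forall>A\<in>Ob S. on_Arr F A A (Id1 S A) = Id1 T (on_Ob F A)) \<and>
    (\<forall>A\<in>Ob S. \<forall>B\<in>Ob S. \<forall>C\<in>Ob S. \<forall>f\<in>Arr S A B. \<forall>g\<in>Arr S B C.
       on_Arr F A C (Comp1 S A B C f g) =
       Comp1 T (on_Ob F A) (on_Ob F B) (on_Ob F C) (on_Arr F A B f) (on_Arr F B C g)) \<and>
    (\<forall>A\<in>Ob S. \<forall>B\<in>Ob S. \<forall>f\<in>Arr S A B. \<forall>g\<in>Arr S A B. \<forall>\<alpha>\<in>Cell S A B f g.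
       on_Cell F A B \<alpha> \<in> Cell T (on_Ob F A) (on_Ob F B) (on_Arr F A B f) (on_Arr F A B g)) \<and>
    (\<forall>A\<in>Ob S. \<forall>B\<in>Ob S. \<forall>f\<in>Arr S A B.
       on_Cell F A B (Id2 S A B f) = Id2 T (on_Ob F A) (on_Ob F B) (on_Arr F A B f)) \<and>
    (\<forall>A\<in>Ob S. \<forall>B\<in>Ob S. \<forall>f\<in>Arr S A B. \<forall>g\<in>Arr S A B. \<forall>h\<in>Arr S A B.
       \<forall>\<alpha>\<in>Cell S A B f g. \<forall>\<beta>\<in>Cell S A B g h.
         on_Cell F A B (VComp S A B \<alpha> \<beta>) =
         VComp T (on_Ob F A) (on_Ob F B) (on_Cell F A B \<alpha>) (on_Cell F A B \<beta>)) \<and>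
    (\<forall>A\<in>Ob S. \<forall>B\<in>Ob S. \<forall>C\<in>Ob S. \<forall>f\<in>Arr S A B. \<forall>g\<in>Arr S B C. \<forall>h\<in>Arr S B C. \<forall>\<alpha>\<in>Cell S B C g h.
       on_Cell F A C (WhiskL S A B C f \<alpha>) =
       WhiskL T (on_Ob F A) (on_Ob F B) (on_Ob F C) (on_Arr F A B f) (on_Cell F B C \<alpha>)) \<and>
    (\<forall>A\<in>Ob S. \<forall>B\<in>Ob S. \<forall>C\<in>Ob S. \<forall>f\<in>Arr S A B. \<forall>g\<in>Arr S A B. \<forall>h\<in>Arr S B C. \<forall>\<alpha>\<in>Cell S A B f g.
       on_Cell F A C (WhiskR S A B C \<alpha> h) =
       WhiskR T (on_Ob F A) (on_Ob F B) (on_Ob F C) (on_Cell F A B \<alpha>) (on_Arr F B C h))"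

definition sid :: "('o, 'f, 't, 'o, 'f, 't) sfunctor" where
  "sid = \<lparr>on_Ob = (\<lambda>A. A), on_Arr = (\<lambda>A B f. f), on_Cell = (\<lambda>A B \<alpha>. \<alpha>)\<rparr>"

text \<open>\<open>scomp F G\<close> is F followed by G.\<close>

definition scomp :: "('o, 'f, 't, 'p, 'g, 'u) sfunctor \<Rightarrow> ('p, 'g, 'u, 'q, 'h, 'v) sfunctor
    \<Rightarrow> ('o, 'f, 't, 'q, 'h, 'v) sfunctor" where
  "scomp F G =
    \<lparr>on_Ob = (\<lambda>A. on_Ob G (on_Ob F A)),
     on_Arr = (\<lambda>A B f. on_Arr G (on_Ob F A) (on_Ob F B) (on_Arr F A B f)),
     on_Cell = (\<lambda>A B \<alpha>. on_Cell G (on_Ob F A) (on_Ob F B) (on_Cell F A B \<alpha>))\<rparr>"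

definition is_strict_nat :: "('o, 'f, 't) sesqui \<Rightarrow> ('p, 'g, 'u) sesqui
    \<Rightarrow> ('o, 'f, 't, 'p, 'g, 'u) sfunctor \<Rightarrow> ('o, 'f, 't, 'p, 'g, 'u) sfunctor
    \<Rightarrow> ('o \<Rightarrow> 'g) \<Rightarrow> bool" where
  "is_strict_nat S T F G \<Delta> \<longleftrightarrow>
    (\<forall>A\<in>Ob S. \<Delta> A \<in> Arr T (on_Ob F A) (on_Ob G A)) \<and>
    (\<forall>A\<in>Ob S. \<forall>B\<in>Ob S. \<forall>f\<in>Arr S A B.
       Comp1 T (on_Ob F A) (on_Ob F B) (on_Ob G B) (on_Arr F A B f) (\<Delta> B) =
       Comp1 T (on_Ob F A) (on_Ob G A) (on_Ob G B) (\<Delta> A) (on_Arr G A B f)) \<and>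
    (\<forall>A\<in>Ob S. \<forall>B\<in>Ob S. \<forall>f\<in>Arr S A B. \<forall>g\<in>Arr S A B. \<forall>\<alpha>\<in>Cell S A B f g.
       WhiskR T (on_Ob F A) (on_Ob F B) (on_Ob G B) (on_Cell F A B \<alpha>) (\<Delta> B) =
       WhiskL T (on_Ob F A) (on_Ob G A) (on_Ob G B) (\<Delta> A) (on_Cell G A B \<alpha>))"

definition sesqui_left_adjoint :: "('o, 'f, 't) sesqui \<Rightarrow> ('p, 'g, 'u) sesqui
    \<Rightarrow> ('o, 'f, 't, 'p, 'g, 'u) sfunctor \<Rightarrow> ('p, 'g, 'u, 'o, 'f, 't) sfunctor \<Rightarrow> bool" where
  "sesqui_left_adjoint S T L R \<longleftrightarrow>
    is_sesqui S \<and> is_sesqui T \<and> is_sfunctor S T L \<and> is_sfunctor T S R \<and>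
    (\<exists>\<eta> \<epsilon>.
       is_strict_nat S S sid (scomp L R) \<eta> \<and>
       is_strict_nat T T (scomp R L) sid \<epsilon> \<and>
       (\<forall>A\<in>Ob S.
          Comp1 T (on_Ob L A) (on_Ob L (on_Ob R (on_Ob L A))) (on_Ob L A)
            (on_Arr L A (on_Ob R (on_Ob L A)) (\<eta> A)) (\<epsilon> (on_Ob L A)) = Id1 T (on_Ob L A)) \<and>
       (\<forall>B\<in>Ob T.
          Comp1 S (on_Ob R B) (on_Ob R (on_Ob L (on_Ob R B))) (on_Ob R B)
            (\<eta> (on_Ob R B)) (on_Arr R (on_Ob L (on_Ob R B)) B (\<epsilon> B)) = Id1 S (on_Ob R B)))"

section \<open>The sesqui-category of n-groupoids, and the two sesqui-functors\<close>

definition nGpd :: "nat \<Rightarrow> ('k univ ncat, ('k univ, 'k univ) nfun, ('k univ, 'k univ) ntr) sesqui"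
  where
  "nGpd n =
    \<lparr>Ob = {C. is_gpd n C \<and> small_cat n C},
     Arr = (\<lambda>C D. {F. is_fun n C D F}),
     Id1 = id_fun n,
     Comp1 = (\<lambda>B C D F G. fcomp n B F G),
     Cell = (\<lambda>C D F G. {\<alpha>. is_tr n C D \<alpha> \<and> src \<alpha> = F \<and> tgt \<alpha> = G}),
     Id2 = id_tr n,
     VComp = vcomp n,
     WhiskL = (\<lambda>B C D N \<alpha>. whisker_l n B N \<alpha>),
     WhiskR = (\<lambda>B C D \<alpha> L. whisker_r n B \<alpha> L)\<rparr>"

definition pi0 :: "nat \<Rightarrow> ('k univ ncat, ('k univ, 'k univ) nfun, ('k univ, 'k univ) ntr,
    'k univ ncat, ('k univ, 'k univ) nfun, ('k univ, 'k univ) ntr) sfunctor" where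
  "pi0 n = \<lparr>on_Ob = pi0_cat n, on_Arr = pi0_fun n, on_Cell = pi0_tr n\<rparr>"

definition Disc :: "nat \<Rightarrow> ('k univ ncat, ('k univ, 'k univ) nfun, ('k univ, 'k univ) ntr,
    'k univ ncat, ('k univ, 'k univ) nfun, ('k univ, 'k univ) ntr) sfunctor" where
  "Disc n = \<lparr>on_Ob = disc_cat n, on_Arr = (\<lambda>C D F. disc_fun n C F), on_Cell = disc_tr n\<rparr>"

end

theory Submission
  imports Defs
begin

text \<open>
  On 1-groupoids, taking isomorphism classes is left adjoint to forming discrete groupoids: the unit
  \<open>\<eta>\<close> sends an object to its class, and the counit extracts the element of a singleton class. For
  n-groupoids everything happens in the homs of the highest level, so unit and counit (\<open>eta\<close> and
  \<open>eps\<close>) are given by recursion on the level. The work lies in the laws, and four observations make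
  them manageable.

  Equations. A functor is determined by its action on cells (\<open>gmap_eqI\<close>), even if it is not known to
  preserve units and composition, and similarly for 2-morphisms (\<open>gtr_eqI\<close>). So the strict equations
  between functors and between whiskerings of 2-morphisms are elementwise computations. Vertical
  composition needs an induction on the level. That it preserves the composition law of 2-morphisms
  (\<open>is_tr_vcomp\<close>) rests on the interchange of 2-morphisms acting on different factors of a product
  (\<open>prod_interchange\<close>). This yields the sesqui-category of n-groupoids.

  The discrete functor. \<open>D C\<close> has the cells of C and identities over the cells of top dimension.
  Hence D commutes with all operations, is injective on functors and 2-morphisms, and both preserves
  and reflects the properties of being a category, a functor or a 2-morphism (\<open>is_cat_disc_iff\<close>,
  \<open>is_fun_disc_iff\<close>, \<open>is_tr_disc_iff\<close>).

  The unit. The functor \<open>\<eta>\<close> from C to \<open>D (\<pi>\<^sub>0 C)\<close> is surjective on objects and full at every level.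
  Therefore it can be cancelled on the left, and laws descend along it (\<open>is_cat_quotient\<close>,
  \<open>is_fun_cancel\<close>, \<open>is_tr_cancel\<close>). Its naturality, \<open>\<eta> \<cdot> D (\<pi>\<^sub>0 F) = F \<cdot> \<eta>\<close>, is where
  the chosen representatives of isomorphism classes are dealt with (\<open>pi0_map_natural\<close>). Together with
  cancellation it characterises \<open>\<pi>\<^sub>0 F\<close>, and the same holds for 2-morphisms (\<open>eta_natural_tr\<close>,
  \<open>eta_cancel_tr\<close>). So each law for \<open>\<pi>\<^sub>0\<close> is proved by applying D, composing with \<open>\<eta>\<close>, and
  using the corresponding statement about the domain of \<open>\<pi>\<^sub>0\<close>. In the same way the counit is
  characterised by the triangular identity \<open>eta_eps\<close>, from which its naturality and the other
  triangular identity follow.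

  Groupoids. Both \<open>\<pi>\<^sub>0\<close> and D send the functors of composition with a 1-cell to functors of this kind
  (\<open>pi0_precomp\<close>, \<open>disc_precomp\<close>), so they preserve equivalences and n-groupoids.
\<close>

section \<open>Cells and globular maps\<close>

text \<open>
  \<open>Top x\<close> is an object x, and \<open>Step x y z\<close> is the cell z of the hom from x to y. A cell thus carries
  all of its iterated boundary, which is what a functor needs in order to act on it.
\<close>

datatype 'a cell = Top 'a | Step 'a 'a "'a cell"

primrec dim :: "'a cell \<Rightarrow> nat" where
  "dim (Top x) = 0"
| "dim (Step x y z) = Suc (dim z)"

fun is_cell :: "nat \<Rightarrow> 'a ncat \<Rightarrow> 'a cell \<Rightarrow> bool" where
  "is_cell n C (Top x) \<longleftrightarrow> x \<in> ob C"
| "is_cell 0 C (Step x y z) \<longleftrightarrow> False"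
| "is_cell (Suc n) C (Step x y z) \<longleftrightarrow> x \<in> ob C \<and> y \<in> ob C \<and> is_cell n (hom C x y) z"

primrec capp :: "('a, 'b) nfun \<Rightarrow> 'a cell \<Rightarrow> 'b cell" where
  capp_Top: "\<And>F. capp F (Top x) = Top (fob F x)"
| capp_Step: "\<And>F. capp F (Step x y z) = Step (fob F x) (fob F y) (capp (fhom F x y) z)"

abbreviation cfst :: "('a \<times> 'b) cell \<Rightarrow> 'a cell" where "cfst \<equiv> map_cell fst"
abbreviation csnd :: "('a \<times> 'b) cell \<Rightarrow> 'b cell" where "csnd \<equiv> map_cell snd"
abbreviation cbang :: "'a cell \<Rightarrow> unit cell" where "cbang \<equiv> map_cell (\<lambda>_. ())"

text \<open>The cells of a product are the pairs of cells of equal dimension; other pairs have no meaning.\<close>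

fun cpair :: "'a cell \<Rightarrow> 'b cell \<Rightarrow> ('a \<times> 'b) cell" where
  "cpair (Top x) (Top y) = Top (x, y)"
| "cpair (Step x x' z) (Step y y' w) = Step (x, y) (x', y') (cpair z w)"
| "cpair _ _ = undefined"

lemma dim_capp [simp]: "dim (capp F z) = dim z"
  by (induction z arbitrary: F) auto

lemma dim_map_cell [simp]: "dim (map_cell f z) = dim z"
  by (induction z) auto

lemma cfst_cpair [simp]: "dim a = dim b \<Longrightarrow> cfst (cpair a b) = a"
  by (induction a b rule: cpair.induct) auto

lemma csnd_cpair [simp]: "dim a = dim b \<Longrightarrow> csnd (cpair a b) = b"
  by (induction a b rule: cpair.induct) auto

lemma dim_cpair [simp]: "dim a = dim b \<Longrightarrow> dim (cpair a b) = dim b"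
  by (induction a b rule: cpair.induct) auto

lemma cpair_surj [simp]: "cpair (cfst z) (csnd z) = z"
  by (induction z) auto

lemma cbang_cpair [simp]: "dim a = dim b \<Longrightarrow> cbang (cpair a b) = cbang a"
  by (induction a b rule: cpair.induct) auto

lemma cbang_capp [simp]: "cbang (capp F z) = cbang z"
  by (induction z arbitrary: F) auto

lemma cbang_map_cell [simp]: "cbang (map_cell f z) = cbang z"
  by (induction z) auto

lemma unit_cell_eqI: "dim s = dim t \<Longrightarrow> s = (t :: unit cell)"
  by (induction s arbitrary: t; case_tac t) auto

text \<open>
  A globular map has the shape of a functor but need not preserve units and composition. Equality of
  functors can be decided at this generality (lemma \<open>gmap_eqI\<close>), so equations can be proved without
  first verifying that both sides are functors.
\<close>

fun gmap :: "nat \<Rightarrow> 'a ncat \<Rightarrow> 'b ncat \<Rightarrow> ('a, 'b) nfun \<Rightarrow> bool" where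
  "gmap 0 C D F \<longleftrightarrow> (\<exists>f\<in>ob C \<rightarrow>\<^sub>E ob D. F = Map0 f)"
| "gmap (Suc n) C D F \<longleftrightarrow>
     (\<exists>f\<in>ob C \<rightarrow>\<^sub>E ob D. \<exists>h\<in>ob C \<rightarrow>\<^sub>E (ob C \<rightarrow>\<^sub>E UNIV). F = Fun f h \<and>
        (\<forall>c\<in>ob C. \<forall>c'\<in>ob C. gmap n (hom C c c') (hom D (f c) (f c')) (h c c')))"

text \<open>Likewise, the operations have the right sources and targets but need not satisfy any law.\<close>

fun gcat :: "nat \<Rightarrow> 'a ncat \<Rightarrow> bool" where
  "gcat 0 C \<longleftrightarrow> (\<exists>A. C = Set0 A)"
| "gcat (Suc n) C \<longleftrightarrow>
     (\<exists>A H u m. C = Cat A H u m \<and>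
        (\<forall>c\<in>A. \<forall>c'\<in>A. gcat n (H c c')) \<and>
        (\<forall>c\<in>A. gmap n (terminal n) (H c c) (u c)) \<and>
        (\<forall>c\<in>A. \<forall>c'\<in>A. \<forall>c''\<in>A. gmap n (prod_cat n (H c c') (H c' c'')) (H c c'') (m c c' c'')))"

lemma gmap_Map0 [simp]: "gmap 0 C D (Map0 f) \<longleftrightarrow> f \<in> ob C \<rightarrow>\<^sub>E ob D"
  by auto

lemma gmap_Fun [simp]:
  "gmap (Suc n) C D (Fun f h) \<longleftrightarrow> f \<in> ob C \<rightarrow>\<^sub>E ob D \<and> h \<in> ob C \<rightarrow>\<^sub>E (ob C \<rightarrow>\<^sub>E UNIV) \<and>
     (\<forall>c\<in>ob C. \<forall>c'\<in>ob C. gmap n (hom C c c') (hom D (f c) (f c')) (h c c'))"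
  by auto

declare gmap.simps [simp del]

lemma gmap_fob: "gmap n C D F \<Longrightarrow> x \<in> ob C \<Longrightarrow> fob F x \<in> ob D"
  by (cases n) (auto simp: gmap.simps)

lemma gmap_fhom:
  "gmap (Suc n) C D F \<Longrightarrow> x \<in> ob C \<Longrightarrow> y \<in> ob C
   \<Longrightarrow> gmap n (hom C x y) (hom D (fob F x) (fob F y)) (fhom F x y)"
  by (auto simp: gmap.simps)

lemma gmap_cell: "gmap n C D F \<Longrightarrow> is_cell n C z \<Longrightarrow> is_cell n D (capp F z)"
  by (induction n C z arbitrary: D F rule: is_cell.induct) (auto intro: gmap_fob gmap_fhom)

text \<open>
  Each map in the recursive structure of F is seen by the cells that pass through its domain, and off
  the objects it is \<open>undefined\<close>. This turns all laws of functors and categories into elementwise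
  equations.
\<close>

lemma gmap_eqI:
  assumes "gmap n C D F" "gmap n C D' G" "\<And>z. is_cell n C z \<Longrightarrow> capp F z = capp G z"
  shows "F = G"
  using assms
proof (induction n arbitrary: C D D' F G)
  case 0
  obtain f g where "F = Map0 f" "G = Map0 g" "f \<in> ob C \<rightarrow>\<^sub>E ob D" "g \<in> ob C \<rightarrow>\<^sub>E ob D'"
    using 0 by (auto simp: gmap.simps)
  moreover from this 0(3)[of "Top _"] have "f x = g x" if "x \<in> ob C" for x using that by auto
  ultimately show ?case by (auto intro: PiE_ext)
next
  case (Suc n)
  obtain f h where F: "F = Fun f h" "f \<in> ob C \<rightarrow>\<^sub>E ob D" "h \<in> ob C \<rightarrow>\<^sub>E (ob C \<rightarrow>\<^sub>E UNIV)"
    "\<And>x y. x \<in> ob C \<Longrightarrow> y \<in> ob C \<Longrightarrow> gmap n (hom C x y) (hom D (f x) (f y)) (h x y)"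
    using Suc(2) by (auto simp: gmap.simps)
  obtain g k where G: "G = Fun g k" "g \<in> ob C \<rightarrow>\<^sub>E ob D'" "k \<in> ob C \<rightarrow>\<^sub>E (ob C \<rightarrow>\<^sub>E UNIV)"
    "\<And>x y. x \<in> ob C \<Longrightarrow> y \<in> ob C \<Longrightarrow> gmap n (hom C x y) (hom D' (g x) (g y)) (k x y)"
    using Suc(3) by (auto simp: gmap.simps)
  from Suc(4)[of "Top _"] F G have "f x = g x" if "x \<in> ob C" for x using that by auto
  then have "f = g" using F(2) G(2) by (auto intro: PiE_ext)
  moreover have "h x y = k x y" if xy: "x \<in> ob C" "y \<in> ob C" for x y
    using Suc(4)[of "Step x y _"] xy F(1) G(1)
    by (intro Suc.IH[OF F(4)[OF xy] G(4)[OF xy]]) auto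
  then have "h x = k x" if "x \<in> ob C" for x
    using that F(3) G(3) by (metis PiE_ext PiE_mem)
  then have "h = k" using F(3) G(3) by (auto intro: PiE_ext)
  ultimately show ?case using F(1) G(1) by simp
qed

subsection \<open>Constructions of globular maps\<close>

lemma ob_prod_cat [simp]: "ob (prod_cat n C D) = ob C \<times> ob D"
  by (cases n) auto

lemma hom_prod_cat [simp]:
  "hom (prod_cat (Suc n) C D) x y = prod_cat n (hom C (fst x) (fst y)) (hom D (snd x) (snd y))"
  by (cases x; cases y) simp

lemma cell_prod_cat: "is_cell n (prod_cat n C D) z \<longleftrightarrow> is_cell n C (cfst z) \<and> is_cell n D (csnd z)"
proof (induction z arbitrary: n C D)
  case (Step x y z)
  then show ?case by (cases n; cases x; cases y) (auto simp del: prod_cat.simps)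
qed auto

lemma ob_terminal [simp]: "ob (terminal n) = UNIV"
  by (cases n) (auto simp: UNIV_unit)

lemma hom_terminal [simp]: "hom (terminal (Suc n)) x y = terminal n"
  by simp

lemma cell_cbang: "is_cell n C z \<Longrightarrow> is_cell n (terminal n) (cbang z)"
  by (induction n C z rule: is_cell.induct) auto

lemma capp_unit [simp]: "capp F z = (cbang z :: unit cell)"
  by (rule unit_cell_eqI) simp

lemma capp_id_fun [simp]: "is_cell n C z \<Longrightarrow> capp (id_fun n C) z = z"
proof (induction n C z rule: is_cell.induct)
  case (1 n C x) then show ?case by (cases n) auto
qed auto

lemma capp_fcomp [simp]: "is_cell n C z \<Longrightarrow> capp (fcomp n C F G) z = capp G (capp F z)"
proof (induction n C z arbitrary: F G rule: is_cell.induct)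
  case (1 n C x) then show ?case by (cases n) auto
qed auto

lemma capp_pair_fun [simp]:
  "is_cell n C z \<Longrightarrow> capp (pair_fun n C F G) z = cpair (capp F z) (capp G z)"
proof (induction n C z arbitrary: F G rule: is_cell.induct)
  case (1 n C x) then show ?case by (cases n) auto
qed auto

lemma capp_prod_fun [simp]:
  "is_cell n A (cfst z) \<Longrightarrow> is_cell n B (csnd z)
   \<Longrightarrow> capp (prod_fun n A B F G) z = cpair (capp F (cfst z)) (capp G (csnd z))"
proof (induction z arbitrary: n A B F G)
  case (Top x) then show ?case by (cases n; cases x) auto
next
  case (Step x y z) then show ?case by (cases n; cases x; cases y) auto
qed

lemma capp_fst_fun [simp]:
  "is_cell n A (cfst z) \<Longrightarrow> is_cell n B (csnd z) \<Longrightarrow> capp (fst_fun n A B) z = cfst z"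
proof (induction z arbitrary: n A B)
  case (Top x) then show ?case by (cases n; cases x) auto
next
  case (Step x y z) then show ?case by (cases n; cases x; cases y) auto
qed

lemma capp_snd_fun [simp]:
  "is_cell n A (cfst z) \<Longrightarrow> is_cell n B (csnd z) \<Longrightarrow> capp (snd_fun n A B) z = csnd z"
proof (induction z arbitrary: n A B)
  case (Top x) then show ?case by (cases n; cases x) auto
next
  case (Step x y z) then show ?case by (cases n; cases x; cases y) auto
qed

lemma capp_assoc_fun [simp]:
  "is_cell n A (cfst (cfst z)) \<Longrightarrow> is_cell n B (csnd (cfst z)) \<Longrightarrow> is_cell n C (csnd z)
   \<Longrightarrow> capp (assoc_fun n A B C) z = cpair (cfst (cfst z)) (cpair (csnd (cfst z)) (csnd z))"
proof (induction z arbitrary: n A B C)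
  case (Top x) then show ?case by (cases n; cases x; cases "fst x") auto
next
  case (Step x y z) then show ?case
    by (cases n; cases x; cases y; cases "fst x"; cases "fst y") auto
qed

lemma capp_prod_cmp [simp]:
  "is_cell n A (cfst (cfst z)) \<Longrightarrow> is_cell n B (csnd (cfst z)) \<Longrightarrow> is_cell n A' (cfst (csnd z))
   \<Longrightarrow> is_cell n B' (csnd (csnd z))
   \<Longrightarrow> capp (prod_cmp n A B A' B' M N) z =
      cpair (capp M (cpair (cfst (cfst z)) (cfst (csnd z))))
            (capp N (cpair (csnd (cfst z)) (csnd (csnd z))))"
proof (induction z arbitrary: n A B A' B' M N)
  case (Top x) then show ?case by (cases n; cases x; cases "fst x"; cases "snd x") auto
next
  case (Step x y z) then show ?case
    by (cases n; cases x; cases y; cases "fst x"; cases "fst y"; cases "snd x"; cases "snd y") auto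
qed

lemma capp_const_fun [simp]:
  "is_cell n X z \<Longrightarrow> capp (const_fun n X Y y) z = capp (point_fun n Y y) (cbang z)"
  by (simp add: const_fun_def)

lemma gmap_id: "gmap n C C (id_fun n C)"
  by (induction n arbitrary: C) auto

lemma gmap_0D: "gmap 0 C D F \<Longrightarrow> \<forall>c\<in>ob C. fob F c \<in> ob D"
  by (blast intro: gmap_fob)

lemma gmap_fcomp: "gmap n C D F \<Longrightarrow> gmap n D E G \<Longrightarrow> gmap n C E (fcomp n C F G)"
proof (induction n arbitrary: C D E F G)
  case 0 then show ?case by (auto dest!: gmap_0D)
next
  case (Suc n)
  show ?case
    by (simp add: gmap_fob[OF Suc.prems(1)] gmap_fob[OF Suc.prems(2)]
        Suc.IH[OF gmap_fhom[OF Suc.prems(1)] gmap_fhom[OF Suc.prems(2)]])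
qed

lemma gmap_pair: "gmap n E A F \<Longrightarrow> gmap n E B G \<Longrightarrow> gmap n E (prod_cat n A B) (pair_fun n E F G)"
proof (induction n arbitrary: E A B F G)
  case 0 then show ?case by (auto dest!: gmap_0D)
next
  case (Suc n)
  show ?case
    by (simp add: gmap_fob[OF Suc.prems(1)] gmap_fob[OF Suc.prems(2)]
        Suc.IH[OF gmap_fhom[OF Suc.prems(1)] gmap_fhom[OF Suc.prems(2)]] del: prod_cat.simps)
qed

lemma gmap_prod:
  "gmap n A C F \<Longrightarrow> gmap n B D G
   \<Longrightarrow> gmap n (prod_cat n A B) (prod_cat n C D) (prod_fun n A B F G)"
proof (induction n arbitrary: A B C D F G)
  case 0 then show ?case by (auto dest!: gmap_0D)
next
  case (Suc n)
  show ?case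
    by (auto simp: gmap_fob[OF Suc.prems(1)] gmap_fob[OF Suc.prems(2)]
        Suc.IH[OF gmap_fhom[OF Suc.prems(1)] gmap_fhom[OF Suc.prems(2)]] simp del: prod_cat.simps split: if_splits)
qed

lemma gmap_fst: "gmap n (prod_cat n A B) A (fst_fun n A B)"
  by (induction n arbitrary: A B) (auto simp del: prod_cat.simps split: if_splits)

lemma gmap_snd: "gmap n (prod_cat n A B) B (snd_fun n A B)"
  by (induction n arbitrary: A B) (auto simp del: prod_cat.simps split: if_splits)

lemma gmap_assoc:
  "gmap n (prod_cat n (prod_cat n A B) C) (prod_cat n A (prod_cat n B C)) (assoc_fun n A B C)"
  by (induction n arbitrary: A B C) (auto simp del: prod_cat.simps split: if_splits)

lemma gmap_prod_cmp:
  "gmap n (prod_cat n A A') A'' M \<Longrightarrow> gmap n (prod_cat n B B') B'' N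
   \<Longrightarrow> gmap n (prod_cat n (prod_cat n A B) (prod_cat n A' B')) (prod_cat n A'' B'')
         (prod_cmp n A B A' B' M N)"
proof (induction n arbitrary: A B A' B' A'' B'' M N)
  case 0 then show ?case by (auto dest!: gmap_0D simp del: prod_cat.simps)
next
  case (Suc n)
  have 1: "fob M (a, a') \<in> ob A''" if "a \<in> ob A" "a' \<in> ob A'" for a a'
    using gmap_fob[OF Suc.prems(1)] that by simp
  have 2: "fob N (a, a') \<in> ob B''" if "a \<in> ob B" "a' \<in> ob B'" for a a'
    using gmap_fob[OF Suc.prems(2)] that by simp
  have 3: "gmap n (prod_cat n (hom A a b) (hom A' a' b')) (hom A'' (fob M (a, a')) (fob M (b, b')))
      (fhom M (a, a') (b, b'))" if "a \<in> ob A" "a' \<in> ob A'" "b \<in> ob A" "b' \<in> ob A'" for a a' b b'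
    using gmap_fhom[OF Suc.prems(1), of "(a, a')" "(b, b')"] that by (simp del: prod_cat.simps)
  have 4: "gmap n (prod_cat n (hom B a b) (hom B' a' b')) (hom B'' (fob N (a, a')) (fob N (b, b')))
      (fhom N (a, a') (b, b'))" if "a \<in> ob B" "a' \<in> ob B'" "b \<in> ob B" "b' \<in> ob B'" for a a' b b'
    using gmap_fhom[OF Suc.prems(2), of "(a, a')" "(b, b')"] that by (simp del: prod_cat.simps)
  show ?case
    by (auto simp: 1 2 3 4 Suc.IH simp del: prod_cat.simps split: if_splits)
qed

lemma gmap_triv: "gmap n (terminal n) (terminal n) (triv_fun n)"
  by (induction n) auto

lemma gmap_triv_prod: "gmap n (prod_cat n (terminal n) (terminal n)) (terminal n) (triv_fun n)"
  by (induction n) auto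

lemma gmap_bang: "gmap n C (terminal n) (bang_fun n C)"
  by (induction n arbitrary: C) auto

lemma gmap_point: "gcat n Y \<Longrightarrow> y \<in> ob Y \<Longrightarrow> gmap n (terminal n) Y (point_fun n Y y)"
  by (cases n) auto

lemma gmap_const: "gcat n Y \<Longrightarrow> y \<in> ob Y \<Longrightarrow> gmap n X Y (const_fun n X Y y)"
  unfolding const_fun_def by (meson gmap_fcomp gmap_bang gmap_point)

section \<open>Functors and categories in terms of cells\<close>

lemma gcat_hom: "gcat (Suc n) C \<Longrightarrow> x \<in> ob C \<Longrightarrow> y \<in> ob C \<Longrightarrow> gcat n (hom C x y)"
  by auto

lemma gcat_unt: "gcat (Suc n) C \<Longrightarrow> x \<in> ob C \<Longrightarrow> gmap n (terminal n) (hom C x x) (unt C x)"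
  by auto

lemma gcat_cmp:
  "gcat (Suc n) C \<Longrightarrow> x \<in> ob C \<Longrightarrow> y \<in> ob C \<Longrightarrow> z \<in> ob C
   \<Longrightarrow> gmap n (prod_cat n (hom C x y) (hom C y z)) (hom C x z) (cmp C x y z)"
  by auto

lemma gcat_SucI:
  assumes "\<And>x y. x \<in> ob C \<Longrightarrow> y \<in> ob C \<Longrightarrow> gcat n (hom C x y)"
    "\<And>x. x \<in> ob C \<Longrightarrow> gmap n (terminal n) (hom C x x) (unt C x)"
    "\<And>x y z. x \<in> ob C \<Longrightarrow> y \<in> ob C \<Longrightarrow> z \<in> ob C
      \<Longrightarrow> gmap n (prod_cat n (hom C x y) (hom C y z)) (hom C x z) (cmp C x y z)"
    "C = Cat A H u m"
  shows "gcat (Suc n) C"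
  using assms by auto

lemma gcat_terminal: "gcat n (terminal n)"
  by (induction n) (auto simp: gmap_triv gmap_triv_prod)

lemma gcat_prod: "gcat n C \<Longrightarrow> gcat n D \<Longrightarrow> gcat n (prod_cat n C D)"
proof (induction n arbitrary: C D)
  case (Suc n)
  then show ?case by (auto intro!: gmap_pair gmap_prod_cmp)
qed auto

lemma is_fun_gmap: "is_fun n C D F \<Longrightarrow> gmap n C D F"
  by (induction n arbitrary: C D F) (auto simp: gmap.simps)

lemma is_cat_gcat: "is_cat n C \<Longrightarrow> gcat n C"
  by (induction n arbitrary: C) (auto intro!: is_fun_gmap)

lemma fcomp_eq_capp:
  assumes "fcomp n C F G = fcomp n C F' G'" "is_cell n C z"
  shows "capp G (capp F z) = capp G' (capp F' z)"
  using arg_cong[OF assms(1), of "\<lambda>F. capp F z"] assms(2) by simp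

lemma is_fun_hom:
  "is_fun (Suc n) C D F \<Longrightarrow> x \<in> ob C \<Longrightarrow> y \<in> ob C
   \<Longrightarrow> is_fun n (hom C x y) (hom D (fob F x) (fob F y)) (fhom F x y)"
  by auto

lemma is_fun_fob: "is_fun n C D F \<Longrightarrow> x \<in> ob C \<Longrightarrow> fob F x \<in> ob D"
  by (blast dest: is_fun_gmap intro: gmap_fob)

lemma is_fun_unt_eq:
  "is_fun (Suc n) C D F \<Longrightarrow> x \<in> ob C
   \<Longrightarrow> fcomp n (terminal n) (unt C x) (fhom F x x) = unt D (fob F x)"
  by auto

lemma is_fun_unt:
  assumes "is_fun (Suc n) C D F" "x \<in> ob C" "is_cell n (terminal n) t"
  shows "capp (fhom F x x) (capp (unt C x) t) = capp (unt D (fob F x)) t"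
  using arg_cong[OF is_fun_unt_eq[OF assms(1,2)], of "\<lambda>F. capp F t"] assms(3) by simp

lemma is_fun_cmp_eq:
  "is_fun (Suc n) C D F \<Longrightarrow> x \<in> ob C \<Longrightarrow> y \<in> ob C \<Longrightarrow> z \<in> ob C
   \<Longrightarrow> fcomp n (prod_cat n (hom C x y) (hom C y z)) (cmp C x y z) (fhom F x z) =
      fcomp n (prod_cat n (hom C x y) (hom C y z))
        (prod_fun n (hom C x y) (hom C y z) (fhom F x y) (fhom F y z))
        (cmp D (fob F x) (fob F y) (fob F z))"
  by auto

lemma is_fun_cmp:
  assumes "is_fun (Suc n) C D F" "x \<in> ob C" "y \<in> ob C" "z \<in> ob C"
    "is_cell n (hom C x y) a" "is_cell n (hom C y z) b" "dim a = dim b"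
  shows "capp (fhom F x z) (capp (cmp C x y z) (cpair a b)) =
    capp (cmp D (fob F x) (fob F y) (fob F z)) (cpair (capp (fhom F x y) a) (capp (fhom F y z) b))"
  using fcomp_eq_capp[OF is_fun_cmp_eq[OF assms(1-4)], of "cpair a b"] assms(5-)
  by (simp add: cell_prod_cat)

lemma is_fun_SucI_eq:
  assumes F: "gmap (Suc n) C D F"
    and "\<And>x y. x \<in> ob C \<Longrightarrow> y \<in> ob C
      \<Longrightarrow> is_fun n (hom C x y) (hom D (fob F x) (fob F y)) (fhom F x y)"
    and "\<And>x. x \<in> ob C \<Longrightarrow> fcomp n (terminal n) (unt C x) (fhom F x x) = unt D (fob F x)"
    and "\<And>x y z. x \<in> ob C \<Longrightarrow> y \<in> ob C \<Longrightarrow> z \<in> ob C \<Longrightarrow>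
      fcomp n (prod_cat n (hom C x y) (hom C y z)) (cmp C x y z) (fhom F x z) =
      fcomp n (prod_cat n (hom C x y) (hom C y z))
        (prod_fun n (hom C x y) (hom C y z) (fhom F x y) (fhom F y z))
        (cmp D (fob F x) (fob F y) (fob F z))"
  shows "is_fun (Suc n) C D F"
  using assms unfolding gmap.simps is_fun.simps
  by (elim bexE conjE) (intro bexI conjI ballI; assumption?; simp)

text \<open>The two laws of a functor are equations between globular maps, so they can be checked on cells.\<close>

lemma is_fun_SucI:
  assumes C: "gcat (Suc n) C" and D: "gcat (Suc n) D" and F: "gmap (Suc n) C D F"
    and h: "\<And>x y. x \<in> ob C \<Longrightarrow> y \<in> ob C
      \<Longrightarrow> is_fun n (hom C x y) (hom D (fob F x) (fob F y)) (fhom F x y)"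
    and u: "\<And>x t. x \<in> ob C \<Longrightarrow> is_cell n (terminal n) t
      \<Longrightarrow> capp (fhom F x x) (capp (unt C x) t) = capp (unt D (fob F x)) t"
    and m: "\<And>x y z a b. x \<in> ob C \<Longrightarrow> y \<in> ob C \<Longrightarrow> z \<in> ob C
      \<Longrightarrow> is_cell n (hom C x y) a \<Longrightarrow> is_cell n (hom C y z) b \<Longrightarrow> dim a = dim b
      \<Longrightarrow> capp (fhom F x z) (capp (cmp C x y z) (cpair a b)) =
         capp (cmp D (fob F x) (fob F y) (fob F z))
           (cpair (capp (fhom F x y) a) (capp (fhom F y z) b))"
  shows "is_fun (Suc n) C D F"
proof (rule is_fun_SucI_eq[OF F h])
  fix x assume x: "x \<in> ob C"
  show "fcomp n (terminal n) (unt C x) (fhom F x x) = unt D (fob F x)"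
    by (rule gmap_eqI[OF gmap_fcomp[OF gcat_unt[OF C x] gmap_fhom[OF F x x]]
          gcat_unt[OF D gmap_fob[OF F x]]]) (use u x in simp)
next
  fix x y z assume x: "x \<in> ob C" "y \<in> ob C" "z \<in> ob C"
  show "fcomp n (prod_cat n (hom C x y) (hom C y z)) (cmp C x y z) (fhom F x z) =
      fcomp n (prod_cat n (hom C x y) (hom C y z))
        (prod_fun n (hom C x y) (hom C y z) (fhom F x y) (fhom F y z))
        (cmp D (fob F x) (fob F y) (fob F z))"
  proof (rule gmap_eqI)
    show "gmap n (prod_cat n (hom C x y) (hom C y z)) (hom D (fob F x) (fob F z))
       (fcomp n (prod_cat n (hom C x y) (hom C y z)) (cmp C x y z) (fhom F x z))"
      using x by (intro gmap_fcomp[OF gcat_cmp[OF C]] gmap_fhom[OF F])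
    show "gmap n (prod_cat n (hom C x y) (hom C y z)) (hom D (fob F x) (fob F z))
      (fcomp n (prod_cat n (hom C x y) (hom C y z))
        (prod_fun n (hom C x y) (hom C y z) (fhom F x y) (fhom F y z))
        (cmp D (fob F x) (fob F y) (fob F z)))"
      using x by (intro gmap_fcomp[OF gmap_prod[OF gmap_fhom[OF F] gmap_fhom[OF F]]]
          gcat_cmp[OF D] gmap_fob[OF F])
    fix c assume "is_cell n (prod_cat n (hom C x y) (hom C y z)) c"
    then show "capp (fcomp n (prod_cat n (hom C x y) (hom C y z)) (cmp C x y z) (fhom F x z)) c =
      capp (fcomp n (prod_cat n (hom C x y) (hom C y z))
        (prod_fun n (hom C x y) (hom C y z) (fhom F x y) (fhom F y z))
        (cmp D (fob F x) (fob F y) (fob F z))) c"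
      using m[OF x, of "cfst c" "csnd c"] by (simp add: cell_prod_cat)
  qed
qed

lemma is_cat_hom: "is_cat (Suc n) C \<Longrightarrow> x \<in> ob C \<Longrightarrow> y \<in> ob C \<Longrightarrow> is_cat n (hom C x y)"
  by auto

lemma is_cat_unt: "is_cat (Suc n) C \<Longrightarrow> x \<in> ob C \<Longrightarrow> is_fun n (terminal n) (hom C x x) (unt C x)"
  by auto

lemma is_cat_cmp:
  "is_cat (Suc n) C \<Longrightarrow> x \<in> ob C \<Longrightarrow> y \<in> ob C \<Longrightarrow> z \<in> ob C
   \<Longrightarrow> is_fun n (prod_cat n (hom C x y) (hom C y z)) (hom C x z) (cmp C x y z)"
  by auto

text \<open>
  The unit and associativity laws on cells. The argument of the unit functor is a cell of the terminal
  category, which is determined by its dimension.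
\<close>

lemma cat_unit_left:
  assumes "is_cat (Suc n) C" "x \<in> ob C" "y \<in> ob C" "is_cell n (hom C x y) a" "dim t = dim a"
  shows "capp (cmp C x x y) (cpair (capp (unt C x) t) a) = a"
proof -
  let ?P = "prod_cat n (terminal n) (hom C x y)"
  have "fcomp n ?P (prod_fun n (terminal n) (hom C x y) (unt C x) (id_fun n (hom C x y))) (cmp C x x y)
    = snd_fun n (terminal n) (hom C x y)"
    using assms(1-3) by auto
  from arg_cong[OF this, of "\<lambda>F. capp F (cpair (cbang a) a)"] show ?thesis
    using assms cell_cbang[OF assms(4)] unit_cell_eqI[of t "cbang a"] by (simp add: cell_prod_cat)
qed

lemma cat_unit_right:
  assumes "is_cat (Suc n) C" "x \<in> ob C" "y \<in> ob C" "is_cell n (hom C x y) a" "dim t = dim a"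
  shows "capp (cmp C x y y) (cpair a (capp (unt C y) t)) = a"
proof -
  let ?P = "prod_cat n (hom C x y) (terminal n)"
  have "fcomp n ?P (prod_fun n (hom C x y) (terminal n) (id_fun n (hom C x y)) (unt C y)) (cmp C x y y)
    = fst_fun n (hom C x y) (terminal n)"
    using assms(1-3) by auto
  from arg_cong[OF this, of "\<lambda>F. capp F (cpair a (cbang a))"] show ?thesis
    using assms cell_cbang[OF assms(4)] unit_cell_eqI[of t "cbang a"] by (simp add: cell_prod_cat)
qed

lemma gcat_cmp_cell:
  assumes "gcat (Suc n) C" "x \<in> ob C" "y \<in> ob C" "z \<in> ob C"
    "is_cell n (hom C x y) a" "is_cell n (hom C y z) b" "dim a = dim b"
  shows "is_cell n (hom C x z) (capp (cmp C x y z) (cpair a b))"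
  using gmap_cell[OF gcat_cmp[OF assms(1-4)], of "cpair a b"] assms(5-) by (simp add: cell_prod_cat)

lemma cat_assoc:
  assumes C: "is_cat (Suc n) C" "w \<in> ob C" "x \<in> ob C" "y \<in> ob C" "z \<in> ob C"
    and "is_cell n (hom C w x) a" "is_cell n (hom C x y) b" "is_cell n (hom C y z) c"
    and "dim a = dim b" "dim b = dim c"
  shows "capp (cmp C w y z) (cpair (capp (cmp C w x y) (cpair a b)) c) =
    capp (cmp C w x z) (cpair a (capp (cmp C x y z) (cpair b c)))"
proof -
  let ?X = "hom C w x" and ?Y = "hom C x y" and ?Z = "hom C y z"
  let ?XY = "prod_cat n ?X ?Y" and ?YZ = "prod_cat n ?Y ?Z"
  have "fcomp n (prod_cat n ?XY ?Z)
      (prod_fun n ?XY ?Z (cmp C w x y) (id_fun n ?Z)) (cmp C w y z)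
    = fcomp n (prod_cat n ?XY ?Z) (assoc_fun n ?X ?Y ?Z)
       (fcomp n (prod_cat n ?X ?YZ) (prod_fun n ?X ?YZ (id_fun n ?X) (cmp C x y z)) (cmp C w x z))"
    using C by (auto simp: Let_def)
  from fcomp_eq_capp[OF this, of "cpair (cpair a b) c"] show ?thesis
    using assms by (simp add: cell_prod_cat)
qed

lemma is_cat_SucI:
  assumes C: "gcat (Suc n) C"
    and h: "\<And>x y. x \<in> ob C \<Longrightarrow> y \<in> ob C \<Longrightarrow> is_cat n (hom C x y)"
    and u: "\<And>x. x \<in> ob C \<Longrightarrow> is_fun n (terminal n) (hom C x x) (unt C x)"
    and m: "\<And>x y z. x \<in> ob C \<Longrightarrow> y \<in> ob C \<Longrightarrow> z \<in> ob C
      \<Longrightarrow> is_fun n (prod_cat n (hom C x y) (hom C y z)) (hom C x z) (cmp C x y z)"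
    and ul: "\<And>x y a. x \<in> ob C \<Longrightarrow> y \<in> ob C \<Longrightarrow> is_cell n (hom C x y) a
      \<Longrightarrow> capp (cmp C x x y) (cpair (capp (unt C x) (cbang a)) a) = a"
    and ur: "\<And>x y a. x \<in> ob C \<Longrightarrow> y \<in> ob C \<Longrightarrow> is_cell n (hom C x y) a
      \<Longrightarrow> capp (cmp C x y y) (cpair a (capp (unt C y) (cbang a))) = a"
    and as: "\<And>w x y z a b c. w \<in> ob C \<Longrightarrow> x \<in> ob C \<Longrightarrow> y \<in> ob C \<Longrightarrow> z \<in> ob C
      \<Longrightarrow> is_cell n (hom C w x) a \<Longrightarrow> is_cell n (hom C x y) b \<Longrightarrow> is_cell n (hom C y z) c
      \<Longrightarrow> dim a = dim b \<Longrightarrow> dim b = dim c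
      \<Longrightarrow> capp (cmp C w y z) (cpair (capp (cmp C w x y) (cpair a b)) c) =
         capp (cmp C w x z) (cpair a (capp (cmp C x y z) (cpair b c)))"
  shows "is_cat (Suc n) C"
proof -
  have L: "fcomp n (prod_cat n (terminal n) (hom C x y))
      (prod_fun n (terminal n) (hom C x y) (unt C x) (id_fun n (hom C x y))) (cmp C x x y)
    = snd_fun n (terminal n) (hom C x y)" if x: "x \<in> ob C" "y \<in> ob C" for x y
  proof (rule gmap_eqI[OF gmap_fcomp[OF gmap_prod[OF gcat_unt[OF C] gmap_id] gcat_cmp[OF C]] gmap_snd])
    fix z assume "is_cell n (prod_cat n (terminal n) (hom C x y)) z"
    moreover have "cfst z = cbang (csnd z)" by (rule unit_cell_eqI) simp
    ultimately show "capp (fcomp n (prod_cat n (terminal n) (hom C x y))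
      (prod_fun n (terminal n) (hom C x y) (unt C x) (id_fun n (hom C x y))) (cmp C x x y)) z
      = capp (snd_fun n (terminal n) (hom C x y)) z"
      using ul[OF x, of "csnd z"] by (simp add: cell_prod_cat)
  qed (use x in auto)
  have R: "fcomp n (prod_cat n (hom C x y) (terminal n))
      (prod_fun n (hom C x y) (terminal n) (id_fun n (hom C x y)) (unt C y)) (cmp C x y y)
    = fst_fun n (hom C x y) (terminal n)" if x: "x \<in> ob C" "y \<in> ob C" for x y
  proof (rule gmap_eqI[OF gmap_fcomp[OF gmap_prod[OF gmap_id gcat_unt[OF C]] gcat_cmp[OF C]] gmap_fst])
    fix z assume "is_cell n (prod_cat n (hom C x y) (terminal n)) z"
    moreover have "csnd z = cbang (cfst z)" by (rule unit_cell_eqI) simp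
    ultimately show "capp (fcomp n (prod_cat n (hom C x y) (terminal n))
      (prod_fun n (hom C x y) (terminal n) (id_fun n (hom C x y)) (unt C y)) (cmp C x y y)) z
      = capp (fst_fun n (hom C x y) (terminal n)) z"
      using ur[OF x, of "cfst z"] by (simp add: cell_prod_cat)
  qed (use x in auto)
  have A: "fcomp n (prod_cat n (prod_cat n (hom C w x) (hom C x y)) (hom C y z))
      (prod_fun n (prod_cat n (hom C w x) (hom C x y)) (hom C y z) (cmp C w x y) (id_fun n (hom C y z)))
      (cmp C w y z)
    = fcomp n (prod_cat n (prod_cat n (hom C w x) (hom C x y)) (hom C y z))
       (assoc_fun n (hom C w x) (hom C x y) (hom C y z))
       (fcomp n (prod_cat n (hom C w x) (prod_cat n (hom C x y) (hom C y z)))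
         (prod_fun n (hom C w x) (prod_cat n (hom C x y) (hom C y z)) (id_fun n (hom C w x)) (cmp C x y z))
         (cmp C w x z))" if x: "w \<in> ob C" "x \<in> ob C" "y \<in> ob C" "z \<in> ob C" for w x y z
  proof (rule gmap_eqI[OF gmap_fcomp[OF gmap_prod[OF gcat_cmp[OF C] gmap_id] gcat_cmp[OF C]]
        gmap_fcomp[OF gmap_assoc gmap_fcomp[OF gmap_prod[OF gmap_id gcat_cmp[OF C]] gcat_cmp[OF C]]]])
    fix v assume "is_cell n (prod_cat n (prod_cat n (hom C w x) (hom C x y)) (hom C y z)) v"
    then show "capp (fcomp n (prod_cat n (prod_cat n (hom C w x) (hom C x y)) (hom C y z))
      (prod_fun n (prod_cat n (hom C w x) (hom C x y)) (hom C y z) (cmp C w x y) (id_fun n (hom C y z)))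
      (cmp C w y z)) v
    = capp (fcomp n (prod_cat n (prod_cat n (hom C w x) (hom C x y)) (hom C y z))
       (assoc_fun n (hom C w x) (hom C x y) (hom C y z))
       (fcomp n (prod_cat n (hom C w x) (prod_cat n (hom C x y) (hom C y z)))
         (prod_fun n (hom C w x) (prod_cat n (hom C x y) (hom C y z)) (id_fun n (hom C w x)) (cmp C x y z))
         (cmp C w x z))) v"
      using as[OF x, of "cfst (cfst v)" "csnd (cfst v)" "csnd v"] by (simp add: cell_prod_cat)
  qed (use x in auto)
  obtain A H u m where "C = Cat A H u m" using C by auto
  then show ?thesis
    using h u m L R A unfolding is_cat.simps Let_def
    by (intro exI[of _ A] exI[of _ H] exI[of _ u] exI[of _ m] conjI ballI) auto
qed

subsection \<open>Closure properties of functors\<close>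

lemma is_fun_id: "gcat n C \<Longrightarrow> is_fun n C C (id_fun n C)"
proof (induction n arbitrary: C)
  case 0 then show ?case by auto
next
  case (Suc n)
  show ?case
    by (rule is_fun_SucI[OF Suc.prems Suc.prems gmap_id])
      (use Suc.prems in \<open>simp_all add: gcat_hom[OF Suc.prems] Suc.IH gcat_cmp_cell[OF Suc.prems]
         gmap_cell[OF gcat_unt[OF Suc.prems]] del: gcat.simps\<close>)
qed

lemma is_fun_fcomp:
  "gcat n C \<Longrightarrow> gcat n D \<Longrightarrow> gcat n E \<Longrightarrow> is_fun n C D F \<Longrightarrow> is_fun n D E G \<Longrightarrow> is_fun n C E (fcomp n C F G)"
proof (induction n arbitrary: C D E F G)
  case 0 then show ?case by fastforce
next
  case (Suc n)
  note C = Suc.prems(1) and D = Suc.prems(2) and E = Suc.prems(3) and F = Suc.prems(4)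
    and G = Suc.prems(5)
  note F' = is_fun_gmap[OF F] and G' = is_fun_gmap[OF G]
  note fob = gmap_fob[OF F'] gmap_fob[OF G']
  show ?case
  proof (rule is_fun_SucI[OF C E gmap_fcomp[OF F' G']])
    fix x y assume "x \<in> ob C" "y \<in> ob C"
    then show "is_fun n (hom C x y) (hom E (fob (fcomp (Suc n) C F G) x) (fob (fcomp (Suc n) C F G) y))
            (fhom (fcomp (Suc n) C F G) x y)"
      using fob by (simp add: Suc.IH[OF gcat_hom[OF C] gcat_hom[OF D] gcat_hom[OF E]
          is_fun_hom[OF F] is_fun_hom[OF G]] del: gcat.simps is_fun.simps)
  qed (simp_all add: gcat_cmp_cell[OF C] gmap_cell[OF gcat_unt[OF C]] is_fun_unt[OF F]
      is_fun_unt[OF G] is_fun_cmp[OF F] is_fun_cmp[OF G] fob gmap_cell[OF gmap_fhom[OF F']])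
qed

lemma unt_prod: "fst x \<in> ob A \<Longrightarrow> snd x \<in> ob B \<Longrightarrow> is_cell n (terminal n) t
  \<Longrightarrow> capp (unt (prod_cat (Suc n) A B) x) t = cpair (capp (unt A (fst x)) t) (capp (unt B (snd x)) t)"
  by (cases x) simp

lemma cmp_prod:
  "is_cell n (hom A (fst x) (fst y)) (cfst a) \<Longrightarrow> is_cell n (hom B (snd x) (snd y)) (csnd a)
   \<Longrightarrow> is_cell n (hom A (fst y) (fst z)) (cfst b) \<Longrightarrow> is_cell n (hom B (snd y) (snd z)) (csnd b)
   \<Longrightarrow> dim a = dim b
   \<Longrightarrow> capp (cmp (prod_cat (Suc n) A B) x y z) (cpair a b) =
      cpair (capp (cmp A (fst x) (fst y) (fst z)) (cpair (cfst a) (cfst b)))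
            (capp (cmp B (snd x) (snd y) (snd z)) (cpair (csnd a) (csnd b)))"
  by (cases x; cases y; cases z) simp

lemma is_fun_pair:
  "gcat n E \<Longrightarrow> gcat n A \<Longrightarrow> gcat n B \<Longrightarrow> is_fun n E A F \<Longrightarrow> is_fun n E B G
   \<Longrightarrow> is_fun n E (prod_cat n A B) (pair_fun n E F G)"
proof (induction n arbitrary: E A B F G)
  case 0 then show ?case by fastforce
next
  case (Suc n)
  note E = Suc.prems(1) and A = Suc.prems(2) and B = Suc.prems(3) and F = Suc.prems(4)
    and G = Suc.prems(5)
  note F' = is_fun_gmap[OF F] and G' = is_fun_gmap[OF G]
  note fob = gmap_fob[OF F'] gmap_fob[OF G']
  show ?case
  proof (rule is_fun_SucI[OF E gcat_prod[OF A B] gmap_pair[OF F' G']])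
    fix x y assume "x \<in> ob E" "y \<in> ob E"
    then show "is_fun n (hom E x y) (hom (prod_cat (Suc n) A B) (fob (pair_fun (Suc n) E F G) x)
        (fob (pair_fun (Suc n) E F G) y)) (fhom (pair_fun (Suc n) E F G) x y)"
      using fob by (simp add: Suc.IH[OF gcat_hom[OF E] gcat_hom[OF A] gcat_hom[OF B]
          is_fun_hom[OF F] is_fun_hom[OF G]] del: gcat.simps is_fun.simps prod_cat.simps)
  qed (simp_all add: gcat_cmp_cell[OF E] gmap_cell[OF gcat_unt[OF E]] is_fun_unt[OF F]
      is_fun_unt[OF G] is_fun_cmp[OF F] is_fun_cmp[OF G] fob gmap_cell[OF gmap_fhom[OF F']]
      gmap_cell[OF gmap_fhom[OF G']] unt_prod cmp_prod
      del: prod_cat.simps)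
qed

lemma is_fun_prod:
  "gcat n A \<Longrightarrow> gcat n B \<Longrightarrow> gcat n C \<Longrightarrow> gcat n D \<Longrightarrow> is_fun n A C F \<Longrightarrow> is_fun n B D G
   \<Longrightarrow> is_fun n (prod_cat n A B) (prod_cat n C D) (prod_fun n A B F G)"
proof (induction n arbitrary: A B C D F G)
  case 0 then show ?case by (fastforce split: if_splits)
next
  case (Suc n)
  note A = Suc.prems(1) and B = Suc.prems(2) and C = Suc.prems(3) and D = Suc.prems(4)
    and F = Suc.prems(5) and G = Suc.prems(6)
  note F' = is_fun_gmap[OF F] and G' = is_fun_gmap[OF G]
  note fob = gmap_fob[OF F'] gmap_fob[OF G']
  show ?case
  proof (rule is_fun_SucI[OF gcat_prod[OF A B] gcat_prod[OF C D] gmap_prod[OF F' G']])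
    fix x y assume "x \<in> ob (prod_cat (Suc n) A B)" "y \<in> ob (prod_cat (Suc n) A B)"
    then show "is_fun n (hom (prod_cat (Suc n) A B) x y)
       (hom (prod_cat (Suc n) C D) (fob (prod_fun (Suc n) A B F G) x)
        (fob (prod_fun (Suc n) A B F G) y)) (fhom (prod_fun (Suc n) A B F G) x y)"
      using fob by (auto simp add: Suc.IH[OF gcat_hom[OF A] gcat_hom[OF B] gcat_hom[OF C] gcat_hom[OF D]
          is_fun_hom[OF F] is_fun_hom[OF G]] simp del: gcat.simps is_fun.simps prod_cat.simps)
  qed (auto simp add: gcat_cmp_cell[OF A] gcat_cmp_cell[OF B] gmap_cell[OF gcat_unt[OF A]] gmap_cell[OF gcat_unt[OF B]] is_fun_unt[OF F]
      is_fun_unt[OF G] is_fun_cmp[OF F] is_fun_cmp[OF G] fob gmap_cell[OF gmap_fhom[OF F']]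
      gmap_cell[OF gmap_fhom[OF G']] unt_prod cmp_prod cell_prod_cat
      simp del: prod_cat.simps)
qed

subsection \<open>Constant functors and composition with a 1-cell\<close>

lemma cbang_unit [simp]: "cbang t = (t :: unit cell)"
  by (rule unit_cell_eqI) simp

lemma is_fun_bang: "gcat n C \<Longrightarrow> is_fun n C (terminal n) (bang_fun n C)"
proof (induction n arbitrary: C)
  case (Suc n)
  show ?case
    by (rule is_fun_SucI[OF Suc.prems gcat_terminal gmap_bang])
      (auto simp: Suc.IH gcat_hom[OF Suc.prems] intro!: unit_cell_eqI)
qed auto

lemma is_fun_point:
  assumes "is_cat n Y" "y \<in> ob Y"
  shows "is_fun n (terminal n) Y (point_fun n Y y)"
proof (cases n)
  case (Suc m)
  note Y = assms(1)[unfolded Suc] 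
  show ?thesis unfolding Suc
  proof (rule is_fun_SucI[OF gcat_terminal is_cat_gcat[OF Y] gmap_point[OF is_cat_gcat[OF Y] assms(2)]])
    fix x y' z and a b :: "unit cell"
    assume "dim a = dim b"
      and a: "is_cell m (hom (terminal (Suc m)) x y') a" and "is_cell m (hom (terminal (Suc m)) y' z) b"
    then have b: "is_cell m (terminal m) b" by simp
    then have "is_cell m (hom Y y y) (capp (unt Y y) b)"
      by (rule gmap_cell[OF gcat_unt[OF is_cat_gcat[OF Y] assms(2)]])
    with \<open>dim a = dim b\<close>
    show "capp (fhom (point_fun (Suc m) Y y) x z) (capp (cmp (terminal (Suc m)) x y' z) (cpair a b)) =
       capp (cmp Y (fob (point_fun (Suc m) Y y) x) (fob (point_fun (Suc m) Y y) y')
         (fob (point_fun (Suc m) Y y) z))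
        (cpair (capp (fhom (point_fun (Suc m) Y y) x y') a) (capp (fhom (point_fun (Suc m) Y y) y' z) b))"
      using cat_unit_left[OF Y assms(2,2), of "capp (unt Y y) b" a] unit_cell_eqI[of "cbang (cpair a b)" b]
      by simp
  qed (use is_cat_unt[OF Y assms(2)] in \<open>auto simp del: is_cat.simps\<close>)
qed (use assms in auto)

lemma is_fun_const:
  assumes "gcat n X" "is_cat n Y" "y \<in> ob Y"
  shows "is_fun n X Y (const_fun n X Y y)"
  unfolding const_fun_def
  using is_fun_fcomp[OF assms(1) gcat_terminal is_cat_gcat[OF assms(2)] is_fun_bang[OF assms(1)]
      is_fun_point[OF assms(2,3)]] .

text \<open>
  A point functor sends the k-dimensional cell of the terminal category to the k-fold iterated
  identity on y, and functors preserve identities.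
\<close>

lemma capp_point:
  assumes "is_fun n Y Z L" "y \<in> ob Y" "is_cell n (terminal n) t"
  shows "capp L (capp (point_fun n Y y) t) = capp (point_fun n Z (fob L y)) t"
proof (cases n)
  case 0 with assms show ?thesis by (cases t) auto
next
  case (Suc m)
  then show ?thesis
    using assms is_fun_unt[of m Y Z L y] by (cases t) (auto simp del: is_fun.simps)
qed

lemma capp_point_prod:
  assumes "a \<in> ob A" "b \<in> ob B" "is_cell n (terminal n) t"
  shows "capp (point_fun n (prod_cat n A B) (a, b)) t =
    cpair (capp (point_fun n A a) t) (capp (point_fun n B b) t)"
  using assms by (cases n; cases t) (auto simp del: prod_cat.simps simp add: unt_prod)

lemma capp_point_unt:
  assumes "is_cat (Suc n) D" "x \<in> ob D" "is_cell n (terminal n) t"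
  shows "capp (point_fun n (hom D x x) (fob (unt D x) ())) t = capp (unt D x) t"
  using capp_point[OF is_cat_unt[OF assms(1,2)] _ assms(3), of "()"]
    unit_cell_eqI[of "capp (point_fun n (terminal n) ()) t" t] by simp

lemma cell_point:
  "gcat n Y \<Longrightarrow> y \<in> ob Y \<Longrightarrow> is_cell n (terminal n) t \<Longrightarrow> is_cell n Y (capp (point_fun n Y y) t)"
  by (rule gmap_cell[OF gmap_point])

lemma capp_precomp [simp]:
  "is_cell n (hom D y z) c \<Longrightarrow> capp (precomp n D x y z f) c =
     capp (cmp D x y z) (cpair (capp (point_fun n (hom D x y) f) (cbang c)) c)"
  by (simp add: precomp_def)

lemma capp_postcomp [simp]:
  "is_cell n (hom D x y) c \<Longrightarrow> capp (postcomp n D x y z g) c =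
     capp (cmp D x y z) (cpair c (capp (point_fun n (hom D y z) g) (cbang c)))"
  by (simp add: postcomp_def)

context
  fixes n D x y z
  assumes D: "is_cat (Suc n) D" and x: "x \<in> ob D" and y: "y \<in> ob D" and z: "z \<in> ob D"
begin

lemma is_fun_precomp:
  assumes "f \<in> ob (hom D x y)"
  shows "is_fun n (hom D y z) (hom D x z) (precomp n D x y z f)"
proof -
  note g = gcat_hom[OF is_cat_gcat[OF D]]
  show ?thesis unfolding precomp_def
    by (rule is_fun_fcomp[OF g gcat_prod[OF g g] g is_fun_pair[OF g g g is_fun_const[OF g]
          is_fun_id[OF g]] is_cat_cmp[OF D]])
      (use x y z D assms in \<open>auto simp del: is_cat.simps gcat.simps intro: is_cat_hom\<close>)
qed

lemma is_fun_postcomp: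
  assumes "g \<in> ob (hom D y z)"
  shows "is_fun n (hom D x y) (hom D x z) (postcomp n D x y z g)"
proof -
  note g = gcat_hom[OF is_cat_gcat[OF D]]
  show ?thesis unfolding postcomp_def
    by (rule is_fun_fcomp[OF g gcat_prod[OF g g] g is_fun_pair[OF g g g is_fun_id[OF g]
          is_fun_const[OF g]] is_cat_cmp[OF D]])
      (use x y z D assms in \<open>auto simp del: is_cat.simps gcat.simps intro: is_cat_hom\<close>)
qed

lemmas gmap_precomp = is_fun_precomp[THEN is_fun_gmap]
lemmas gmap_postcomp = is_fun_postcomp[THEN is_fun_gmap]

lemma point_cmp:
  assumes "f \<in> ob (hom D x y)" "g \<in> ob (hom D y z)" "is_cell n (terminal n) t"
  shows "capp (cmp D x y z) (cpair (capp (point_fun n (hom D x y) f) t) (capp (point_fun n (hom D y z) g) t))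
    = capp (point_fun n (hom D x z) (fob (cmp D x y z) (f, g))) t"
  using capp_point[OF is_cat_cmp[OF D x y z], of "(f, g)" t] assms
  by (simp add: capp_point_prod)

end

lemma gmap_precomp_weak:
  assumes D: "gcat (Suc n) D" and "x \<in> ob D" "y \<in> ob D" "z \<in> ob D" "f \<in> ob (hom D x y)"
  shows "gmap n (hom D y z) (hom D x z) (precomp n D x y z f)"
  unfolding precomp_def
  by (rule gmap_fcomp[OF gmap_pair[OF gmap_const gmap_id] gcat_cmp[OF D]])
    (use assms gcat_hom[OF D] in auto)

lemma gmap_postcomp_weak:
  assumes D: "gcat (Suc n) D" and "x \<in> ob D" "y \<in> ob D" "z \<in> ob D" "g \<in> ob (hom D y z)"
  shows "gmap n (hom D x y) (hom D x z) (postcomp n D x y z g)"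
  unfolding postcomp_def
  by (rule gmap_fcomp[OF gmap_pair[OF gmap_id gmap_const] gcat_cmp[OF D]])
    (use assms gcat_hom[OF D] in auto)

text \<open>
  The unit, associativity and functoriality laws in the form in which 2-morphisms need them: the
  source and target of the components of a 2-morphism are composites with the functors \<open>f \<circ> -\<close> and
  \<open>- \<circ> g\<close>.
\<close>

lemma precomp_unit:
  assumes D: "is_cat (Suc n) D" and x: "x \<in> ob D" "y \<in> ob D"
  shows "precomp n D x x y (fob (unt D x) ()) = id_fun n (hom D x y)"
proof -
  have "fob (unt D x) () \<in> ob (hom D x x)"
    using is_fun_fob[OF is_cat_unt[OF D x(1)]] by simp
  then show ?thesis
    by (rule gmap_eqI[OF gmap_precomp[OF D x(1,1,2)] gmap_id])
     (simp add: capp_point_unt[OF D x(1)] cat_unit_left[OF D x] cell_cbang)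
qed

lemma postcomp_unit:
  assumes D: "is_cat (Suc n) D" and x: "x \<in> ob D" "y \<in> ob D"
  shows "postcomp n D x y y (fob (unt D y) ()) = id_fun n (hom D x y)"
proof -
  have "fob (unt D y) () \<in> ob (hom D y y)"
    using is_fun_fob[OF is_cat_unt[OF D x(2)]] by simp
  then show ?thesis
    by (rule gmap_eqI[OF gmap_postcomp[OF D x(1,2,2)] gmap_id])
     (simp add: capp_point_unt[OF D x(2)] cat_unit_right[OF D x] cell_cbang)
qed

lemma precomp_fun:
  assumes D: "is_cat (Suc n) D" and E: "gcat (Suc n) E" and L: "is_fun (Suc n) D E L"
    and x: "x \<in> ob D" "y \<in> ob D" "z \<in> ob D" and f: "f \<in> ob (hom D x y)"
  shows "fcomp n (hom D y z) (precomp n D x y z f) (fhom L x z) =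
    fcomp n (hom D y z) (fhom L y z)
      (precomp n E (fob L x) (fob L y) (fob L z) (fob (fhom L x y) f))"
proof (rule gmap_eqI)
  note L1 = is_fun_hom[OF L] and Lo = is_fun_fob[OF L]
  show "gmap n (hom D y z) (hom E (fob L x) (fob L z))
      (fcomp n (hom D y z) (precomp n D x y z f) (fhom L x z))"
    by (intro gmap_fcomp[OF gmap_precomp[OF D x f]] is_fun_gmap L1 x)
  show "gmap n (hom D y z) (hom E (fob L x) (fob L z)) (fcomp n (hom D y z) (fhom L y z)
      (precomp n E (fob L x) (fob L y) (fob L z) (fob (fhom L x y) f)))"
    by (rule gmap_fcomp[OF is_fun_gmap[OF L1] gmap_precomp_weak[OF E]])
      (use x f Lo is_fun_fob[OF L1] in auto)
  fix c assume c: "is_cell n (hom D y z) c"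
  then show "capp (fcomp n (hom D y z) (precomp n D x y z f) (fhom L x z)) c =
    capp (fcomp n (hom D y z) (fhom L y z)
      (precomp n E (fob L x) (fob L y) (fob L z) (fob (fhom L x y) f))) c"
    using x f by (simp add: is_fun_cmp[OF L] capp_point[OF L1] cell_cbang
        cell_point[OF gcat_hom[OF is_cat_gcat[OF D]]] gmap_cell[OF is_fun_gmap[OF L1]])
qed

lemma postcomp_fun:
  assumes D: "is_cat (Suc n) D" and E: "gcat (Suc n) E" and L: "is_fun (Suc n) D E L"
    and x: "x \<in> ob D" "y \<in> ob D" "z \<in> ob D" and g: "g \<in> ob (hom D y z)"
  shows "fcomp n (hom D x y) (postcomp n D x y z g) (fhom L x z) =
    fcomp n (hom D x y) (fhom L x y)
      (postcomp n E (fob L x) (fob L y) (fob L z) (fob (fhom L y z) g))"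
proof (rule gmap_eqI)
  note L1 = is_fun_hom[OF L] and Lo = is_fun_fob[OF L]
  show "gmap n (hom D x y) (hom E (fob L x) (fob L z))
      (fcomp n (hom D x y) (postcomp n D x y z g) (fhom L x z))"
    by (intro gmap_fcomp[OF gmap_postcomp[OF D x g]] is_fun_gmap L1 x)
  show "gmap n (hom D x y) (hom E (fob L x) (fob L z)) (fcomp n (hom D x y) (fhom L x y)
      (postcomp n E (fob L x) (fob L y) (fob L z) (fob (fhom L y z) g)))"
    by (rule gmap_fcomp[OF is_fun_gmap[OF L1] gmap_postcomp_weak[OF E]])
      (use x g Lo is_fun_fob[OF L1] in auto)
  fix c assume c: "is_cell n (hom D x y) c"
  then show "capp (fcomp n (hom D x y) (postcomp n D x y z g) (fhom L x z)) c =
    capp (fcomp n (hom D x y) (fhom L x y)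
      (postcomp n E (fob L x) (fob L y) (fob L z) (fob (fhom L y z) g))) c"
    using x g by (simp add: is_fun_cmp[OF L] capp_point[OF L1] cell_cbang
        cell_point[OF gcat_hom[OF is_cat_gcat[OF D]]] gmap_cell[OF is_fun_gmap[OF L1]])
qed

context
  fixes n D w x y z
  assumes D: "is_cat (Suc n) D"
    and w: "w \<in> ob D" and x: "x \<in> ob D" and y: "y \<in> ob D" and z: "z \<in> ob D"
begin

private lemmas gh = gcat_hom[OF is_cat_gcat[OF D]]
private lemmas cmp_fob = is_fun_fob[OF is_cat_cmp[OF D]]

lemma precomp_precomp:
  assumes "f \<in> ob (hom D w x)" "g \<in> ob (hom D x y)"
  shows "fcomp n (hom D y z) (precomp n D x y z g) (precomp n D w x z f) =
    precomp n D w y z (fob (cmp D w x y) (f, g))"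
  by (rule gmap_eqI[OF gmap_fcomp[OF gmap_precomp[OF D x y z assms(2)] gmap_precomp[OF D w x z assms(1)]]
        gmap_precomp[OF D w y z]])
    (use w x y z assms in \<open>simp_all add: cmp_fob gcat_cmp_cell[OF is_cat_gcat[OF D]] cell_cbang
       cell_point gh cat_assoc[OF D] point_cmp[OF D, symmetric]\<close>)

lemma postcomp_postcomp:
  assumes "f \<in> ob (hom D x y)" "g \<in> ob (hom D y z)"
  shows "fcomp n (hom D w x) (postcomp n D w x y f) (postcomp n D w y z g) =
    postcomp n D w x z (fob (cmp D x y z) (f, g))"
  by (rule gmap_eqI[OF gmap_fcomp[OF gmap_postcomp[OF D w x y assms(1)] gmap_postcomp[OF D w y z assms(2)]]
        gmap_postcomp[OF D w x z]])
    (use w x y z assms in \<open>simp_all add: cmp_fob gcat_cmp_cell[OF is_cat_gcat[OF D]] cell_cbang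
       cell_point gh cat_assoc[OF D] point_cmp[OF D, symmetric]\<close>)

lemma precomp_postcomp:
  assumes "f \<in> ob (hom D w x)" "g \<in> ob (hom D y z)"
  shows "fcomp n (hom D x y) (precomp n D w x y f) (postcomp n D w y z g) =
    fcomp n (hom D x y) (postcomp n D x y z g) (precomp n D w x z f)"
  by (rule gmap_eqI[OF gmap_fcomp[OF gmap_precomp[OF D w x y assms(1)] gmap_postcomp[OF D w y z assms(2)]]
        gmap_fcomp[OF gmap_postcomp[OF D x y z assms(2)] gmap_precomp[OF D w x z assms(1)]]])
    (use w x y z assms in \<open>simp_all add: cmp_fob gcat_cmp_cell[OF is_cat_gcat[OF D]] cell_cbang
       cell_point gh cat_assoc[OF D]\<close>)

end

lemma precomp_prod:
  assumes A: "gcat (Suc n) A" and B: "gcat (Suc n) B"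
    and a: "a1 \<in> ob A" "a2 \<in> ob A" "a3 \<in> ob A" "f \<in> ob (hom A a1 a2)"
    and b: "b1 \<in> ob B" "b2 \<in> ob B" "b3 \<in> ob B" "g \<in> ob (hom B b1 b2)"
  shows "precomp n (prod_cat (Suc n) A B) (a1, b1) (a2, b2) (a3, b3) (f, g) =
    prod_fun n (hom A a2 a3) (hom B b2 b3) (precomp n A a1 a2 a3 f) (precomp n B b1 b2 b3 g)"
proof (rule gmap_eqI)
  let ?P = "prod_cat (Suc n) A B"
  show "gmap n (hom ?P (a2, b2) (a3, b3)) (hom ?P (a1, b1) (a3, b3))
      (precomp n ?P (a1, b1) (a2, b2) (a3, b3) (f, g))"
    using a b by (intro gmap_precomp_weak gcat_prod A B) simp_all
  show "gmap n (hom ?P (a2, b2) (a3, b3)) (hom ?P (a1, b1) (a3, b3))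
      (prod_fun n (hom A a2 a3) (hom B b2 b3) (precomp n A a1 a2 a3 f) (precomp n B b1 b2 b3 g))"
    unfolding hom_prod_cat fst_conv snd_conv
    using a b by (intro gmap_prod gmap_precomp_weak A B) simp_all
  fix c assume c: "is_cell n (hom ?P (a2, b2) (a3, b3)) c"
  then have "is_cell n (hom A a2 a3) (cfst c)" "is_cell n (hom B b2 b3) (csnd c)"
    by (simp_all add: cell_prod_cat)
  then show "capp (precomp n ?P (a1, b1) (a2, b2) (a3, b3) (f, g)) c =
    capp (prod_fun n (hom A a2 a3) (hom B b2 b3) (precomp n A a1 a2 a3 f) (precomp n B b1 b2 b3 g)) c"
    using c a b cell_cbang[of n "hom A a2 a3" "cfst c"]
    by (simp add: capp_point_prod cmp_prod cell_point gcat_hom[OF A] gcat_hom[OF B]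
        del: prod_cat.simps)
qed

lemma postcomp_prod:
  assumes A: "gcat (Suc n) A" and B: "gcat (Suc n) B"
    and a: "a1 \<in> ob A" "a2 \<in> ob A" "a3 \<in> ob A" "f \<in> ob (hom A a2 a3)"
    and b: "b1 \<in> ob B" "b2 \<in> ob B" "b3 \<in> ob B" "g \<in> ob (hom B b2 b3)"
  shows "postcomp n (prod_cat (Suc n) A B) (a1, b1) (a2, b2) (a3, b3) (f, g) =
    prod_fun n (hom A a1 a2) (hom B b1 b2) (postcomp n A a1 a2 a3 f) (postcomp n B b1 b2 b3 g)"
proof (rule gmap_eqI)
  let ?P = "prod_cat (Suc n) A B"
  show "gmap n (hom ?P (a1, b1) (a2, b2)) (hom ?P (a1, b1) (a3, b3))
      (postcomp n ?P (a1, b1) (a2, b2) (a3, b3) (f, g))"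
    using a b by (intro gmap_postcomp_weak gcat_prod A B) simp_all
  show "gmap n (hom ?P (a1, b1) (a2, b2)) (hom ?P (a1, b1) (a3, b3))
      (prod_fun n (hom A a1 a2) (hom B b1 b2) (postcomp n A a1 a2 a3 f) (postcomp n B b1 b2 b3 g))"
    unfolding hom_prod_cat fst_conv snd_conv
    using a b by (intro gmap_prod gmap_postcomp_weak A B) simp_all
  fix c assume c: "is_cell n (hom ?P (a1, b1) (a2, b2)) c"
  then have "is_cell n (hom A a1 a2) (cfst c)" "is_cell n (hom B b1 b2) (csnd c)"
    by (simp_all add: cell_prod_cat)
  then show "capp (postcomp n ?P (a1, b1) (a2, b2) (a3, b3) (f, g)) c =
    capp (prod_fun n (hom A a1 a2) (hom B b1 b2) (postcomp n A a1 a2 a3 f) (postcomp n B b1 b2 b3 g)) c"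
    using c a b cell_cbang[of n "hom A a1 a2" "cfst c"]
    by (simp add: capp_point_prod cmp_prod cell_point gcat_hom[OF A] gcat_hom[OF B]
        del: prod_cat.simps)
qed

subsection \<open>Laws for composites of globular maps\<close>

lemma fcomp_id_left: "gmap n C D F \<Longrightarrow> fcomp n C (id_fun n C) F = F"
  by (rule gmap_eqI[OF gmap_fcomp[OF gmap_id]]) simp_all

lemma fcomp_id_right: "gmap n C D F \<Longrightarrow> fcomp n C F (id_fun n D) = F"
  by (rule gmap_eqI[OF gmap_fcomp[OF _ gmap_id]]) (simp_all add: gmap_cell)

lemma fcomp_assoc:
  "gmap n B C F \<Longrightarrow> gmap n C D G \<Longrightarrow> gmap n D E H
   \<Longrightarrow> fcomp n B (fcomp n B F G) H = fcomp n B F (fcomp n C G H)"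
  by (rule gmap_eqI[OF gmap_fcomp[OF gmap_fcomp] gmap_fcomp[OF _ gmap_fcomp]])
    (simp_all add: gmap_cell)

lemma fcomp_prod:
  "gmap n A C F \<Longrightarrow> gmap n B D G \<Longrightarrow> gmap n C E H \<Longrightarrow> gmap n D E' K
   \<Longrightarrow> fcomp n (prod_cat n A B) (prod_fun n A B F G) (prod_fun n C D H K) =
      prod_fun n A B (fcomp n A F H) (fcomp n B G K)"
  by (rule gmap_eqI[OF gmap_fcomp[OF gmap_prod gmap_prod] gmap_prod[OF gmap_fcomp gmap_fcomp]])
    (simp_all add: gmap_cell cell_prod_cat)

section \<open>Globular transformations\<close>

text \<open>
  The data of a 2-morphism, with the right sources and targets, but without its unit and composition
  laws. All operations on 2-morphisms preserve this weaker notion and satisfy their equations for it;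
  this separates the equations from the proof that the two laws are preserved.
\<close>

fun gtr :: "nat \<Rightarrow> 'a ncat \<Rightarrow> 'b ncat \<Rightarrow> ('a, 'b) ntr \<Rightarrow> bool" where
  "gtr 0 C D \<alpha> \<longleftrightarrow> (\<exists>F. gmap 0 C D F \<and> \<alpha> = Id0 F)"
| "gtr (Suc n) C D \<alpha> \<longleftrightarrow>
     (\<exists>F G a. \<exists>t\<in>ob C \<rightarrow>\<^sub>E (ob C \<rightarrow>\<^sub>E UNIV). \<alpha> = Tr F G a t \<and>
        gmap (Suc n) C D F \<and> gmap (Suc n) C D G \<and>
        a \<in> (\<Pi>\<^sub>E c\<in>ob C. ob (hom D (fob F c) (fob G c))) \<and>
        (\<forall>c\<in>ob C. \<forall>c'\<in>ob C.
           gtr n (hom C c c') (hom D (fob F c) (fob G c')) (t c c') \<and>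
           src (t c c') =
             fcomp n (hom C c c') (fhom G c c') (precomp n D (fob F c) (fob G c) (fob G c') (a c)) \<and>
           tgt (t c c') =
             fcomp n (hom C c c') (fhom F c c') (postcomp n D (fob F c) (fob F c') (fob G c') (a c'))))"

lemma gtr_src: "gtr n C D \<alpha> \<Longrightarrow> gmap n C D (src \<alpha>)"
  by (cases n) (auto simp del: gmap_Fun)

lemma gtr_tgt: "gtr n C D \<alpha> \<Longrightarrow> gmap n C D (tgt \<alpha>)"
  by (cases n) (auto simp del: gmap_Fun)

context
  fixes n C D \<alpha>
  assumes \<alpha>: "gtr (Suc n) C D \<alpha>"
begin

lemma gtr_eta: "\<alpha> = Tr (src \<alpha>) (tgt \<alpha>) (tob \<alpha>) (thom \<alpha>)"
  using \<alpha> by auto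

lemma gtr_tob_PiE: "tob \<alpha> \<in> (\<Pi>\<^sub>E c\<in>ob C. ob (hom D (fob (src \<alpha>) c) (fob (tgt \<alpha>) c)))"
  using \<alpha> by auto

lemma gtr_tob: "c \<in> ob C \<Longrightarrow> tob \<alpha> c \<in> ob (hom D (fob (src \<alpha>) c) (fob (tgt \<alpha>) c))"
  using gtr_tob_PiE by (rule PiE_mem)

lemma gtr_thom_PiE: "thom \<alpha> \<in> ob C \<rightarrow>\<^sub>E (ob C \<rightarrow>\<^sub>E UNIV)"
  using \<alpha> unfolding gtr.simps by (elim exE bexE conjE) simp

lemma gtr_fob_src: "c \<in> ob C \<Longrightarrow> fob (src \<alpha>) c \<in> ob D"
  by (rule gmap_fob[OF gtr_src[OF \<alpha>]])

lemma gtr_fob_tgt: "c \<in> ob C \<Longrightarrow> fob (tgt \<alpha>) c \<in> ob D"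
  by (rule gmap_fob[OF gtr_tgt[OF \<alpha>]])

lemma gtr_thom:
  "c \<in> ob C \<Longrightarrow> c' \<in> ob C
   \<Longrightarrow> gtr n (hom C c c') (hom D (fob (src \<alpha>) c) (fob (tgt \<alpha>) c')) (thom \<alpha> c c')"
  using \<alpha> by auto

lemma gtr_thom_src:
  "c \<in> ob C \<Longrightarrow> c' \<in> ob C \<Longrightarrow> src (thom \<alpha> c c') = fcomp n (hom C c c') (fhom (tgt \<alpha>) c c')
     (precomp n D (fob (src \<alpha>) c) (fob (tgt \<alpha>) c) (fob (tgt \<alpha>) c') (tob \<alpha> c))"
  using \<alpha> by auto

lemma gtr_thom_tgt:
  "c \<in> ob C \<Longrightarrow> c' \<in> ob C \<Longrightarrow> tgt (thom \<alpha> c c') = fcomp n (hom C c c') (fhom (src \<alpha>) c c')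
     (postcomp n D (fob (src \<alpha>) c) (fob (src \<alpha>) c') (fob (tgt \<alpha>) c') (tob \<alpha> c'))"
  using \<alpha> by auto

end

lemma gtr_TrI:
  assumes "gmap (Suc n) C D F" "gmap (Suc n) C D G"
    "\<And>c. c \<in> ob C \<Longrightarrow> a c \<in> ob (hom D (fob F c) (fob G c))"
    "\<And>c c'. c \<in> ob C \<Longrightarrow> c' \<in> ob C \<Longrightarrow> gtr n (hom C c c') (hom D (fob F c) (fob G c')) (t c c')"
    "\<And>c c'. c \<in> ob C \<Longrightarrow> c' \<in> ob C \<Longrightarrow> src (t c c') =
       fcomp n (hom C c c') (fhom G c c') (precomp n D (fob F c) (fob G c) (fob G c') (a c))"
    "\<And>c c'. c \<in> ob C \<Longrightarrow> c' \<in> ob C \<Longrightarrow> tgt (t c c') =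
       fcomp n (hom C c c') (fhom F c c') (postcomp n D (fob F c) (fob F c') (fob G c') (a c'))"
  shows "gtr (Suc n) C D (Tr F G (\<lambda>c\<in>ob C. a c) (\<lambda>c\<in>ob C. \<lambda>c'\<in>ob C. t c c'))"
  using assms by (auto simp del: gmap_Fun)

lemma gtr_Suc_eqI:
  assumes \<alpha>: "gtr (Suc n) C D \<alpha>" and \<beta>: "gtr (Suc n) C D \<beta>"
    and s: "src \<alpha> = src \<beta>" "tgt \<alpha> = tgt \<beta>"
    and a: "\<And>c. c \<in> ob C \<Longrightarrow> tob \<alpha> c = tob \<beta> c"
    and t: "\<And>c c'. c \<in> ob C \<Longrightarrow> c' \<in> ob C \<Longrightarrow> thom \<alpha> c c' = thom \<beta> c c'"
  shows "\<alpha> = \<beta>"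
proof -
  have "tob \<alpha> = tob \<beta>"
    by (rule PiE_ext[OF gtr_tob_PiE[OF \<alpha>]]) (use gtr_tob_PiE[OF \<beta>] s a in simp_all)
  moreover have "thom \<alpha> c = thom \<beta> c" if "c \<in> ob C" for c
    using that t gtr_thom_PiE[OF \<alpha>] gtr_thom_PiE[OF \<beta>] by (metis PiE_ext PiE_mem)
  then have "thom \<alpha> = thom \<beta>"
    using gtr_thom_PiE[OF \<alpha>] gtr_thom_PiE[OF \<beta>] by (auto intro: PiE_ext)
  ultimately show ?thesis
    using gtr_eta[OF \<alpha>] gtr_eta[OF \<beta>] s by metis
qed

text \<open>
  The action on cells: a cell of dimension k goes to a cell of dimension k + 1 whose boundary involves
  F and G. In the top dimension, where all 2-morphisms are identities, it goes to its image instead.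
\<close>

fun tapp :: "('a, 'b) ntr \<Rightarrow> 'a cell \<Rightarrow> 'b cell" where
  "tapp (Id0 F) z = capp F z"
| "tapp (Tr F G a t) (Top x) = Step (fob F x) (fob G x) (Top (a x))"
| "tapp (Tr F G a t) (Step x y z) = Step (fob F x) (fob G y) (tapp (t x y) z)"

lemma gtr_0: "gtr 0 C D \<alpha> \<Longrightarrow> \<alpha> = Id0 (src \<alpha>) \<and> tgt \<alpha> = src \<alpha>"
  by auto

lemma gtr_tapp_Top:
  "gtr (Suc n) C D \<alpha> \<Longrightarrow> tapp \<alpha> (Top x) = Step (fob (src \<alpha>) x) (fob (tgt \<alpha>) x) (Top (tob \<alpha> x))"
  by auto

lemma gtr_tapp_Step:
  "gtr (Suc n) C D \<alpha>
   \<Longrightarrow> tapp \<alpha> (Step x y z) = Step (fob (src \<alpha>) x) (fob (tgt \<alpha>) y) (tapp (thom \<alpha> x y) z)"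
  by auto

lemma is_cell_tapp: "gtr n C D \<alpha> \<Longrightarrow> is_cell n C z \<Longrightarrow> is_cell n D (tapp \<alpha> z)"
proof (induction n arbitrary: C D \<alpha> z)
  case 0
  then show ?case by (cases z) (auto dest: gmap_fob)
next
  case (Suc n)
  then show ?case
    by (cases z) (auto simp: gtr_tapp_Top[OF Suc.prems(1)] gtr_tapp_Step[OF Suc.prems(1)]
        gtr_tob gtr_fob_src gtr_fob_tgt Suc.IH[OF gtr_thom[OF Suc.prems(1)]] simp del: gtr.simps)
qed

text \<open>
  Unlike for functors, the cells do not determine everything: they show only the values of the source
  and target on boundary objects, so the source and target are compared separately.
\<close>

lemma gtr_eqI:
  "gtr n C D \<alpha> \<Longrightarrow> gtr n C D \<beta> \<Longrightarrow> src \<alpha> = src \<beta> \<Longrightarrow> tgt \<alpha> = tgt \<beta>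
   \<Longrightarrow> (\<And>z. is_cell n C z \<Longrightarrow> tapp \<alpha> z = tapp \<beta> z) \<Longrightarrow> \<alpha> = \<beta>"
proof (induction n arbitrary: C D \<alpha> \<beta>)
  case 0
  then show ?case using gtr_0[of C D \<alpha>] gtr_0[of C D \<beta>] by metis
next
  case (Suc n)
  note \<alpha> = Suc.prems(1) and \<beta> = Suc.prems(2)
  have a: "tob \<alpha> c = tob \<beta> c" if "c \<in> ob C" for c
    using Suc.prems(5)[of "Top c"] that by (simp add: gtr_tapp_Top[OF \<alpha>] gtr_tapp_Top[OF \<beta>])
  show ?case
  proof (rule gtr_Suc_eqI[OF \<alpha> \<beta> Suc.prems(3,4) a])
    fix c c' assume c: "c \<in> ob C" "c' \<in> ob C"
    show "thom \<alpha> c c' = thom \<beta> c c'"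
    proof (rule Suc.IH[OF gtr_thom[OF \<alpha> c]])
      show "gtr n (hom C c c') (hom D (fob (src \<alpha>) c) (fob (tgt \<alpha>) c')) (thom \<beta> c c')"
        using gtr_thom[OF \<beta> c] Suc.prems(3,4) by simp
      fix z assume "is_cell n (hom C c c') z"
      then show "tapp (thom \<alpha> c c') z = tapp (thom \<beta> c c') z"
        using Suc.prems(5)[of "Step c c' z"] c
        by (simp add: gtr_tapp_Step[OF \<alpha>] gtr_tapp_Step[OF \<beta>])
    qed (simp_all add: gtr_thom_src[OF \<alpha> c] gtr_thom_src[OF \<beta> c] gtr_thom_tgt[OF \<alpha> c]
        gtr_thom_tgt[OF \<beta> c] Suc.prems(3,4) a c)
  qed
qed

subsection \<open>Sources and targets\<close>

lemma src_id_tr [simp]: "src (id_tr n C D F) = F"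
  by (cases n) auto

lemma tgt_id_tr [simp]: "tgt (id_tr n C D F) = F"
  by (cases n) auto

lemma src_whisker_l [simp]: "src (whisker_l n B N \<alpha>) = fcomp n B N (src \<alpha>)"
  by (cases n) auto

lemma tgt_whisker_l: "gtr n C D \<alpha> \<Longrightarrow> tgt (whisker_l n B N \<alpha>) = fcomp n B N (tgt \<alpha>)"
  using gtr_0 by (cases n) auto

lemma src_whisker_r [simp]: "src (whisker_r n C \<alpha> L) = fcomp n C (src \<alpha>) L"
  by (cases n) auto

lemma tgt_whisker_r: "gtr n C D \<alpha> \<Longrightarrow> tgt (whisker_r n C \<alpha> L) = fcomp n C (tgt \<alpha>) L"
  using gtr_0 by (cases n) auto

lemma src_prod_tr [simp]: "src (prod_tr n A B \<alpha> \<beta>) = prod_fun n A B (src \<alpha>) (src \<beta>)"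
  by (cases n) auto

lemma tgt_prod_tr:
  "gtr n A C \<alpha> \<Longrightarrow> gtr n B D \<beta> \<Longrightarrow> tgt (prod_tr n A B \<alpha> \<beta>) = prod_fun n A B (tgt \<alpha>) (tgt \<beta>)"
  using gtr_0[of A C \<alpha>] gtr_0[of B D \<beta>] by (cases n) auto

lemma src_vcomp [simp]: "src (vcomp n C D \<omega> \<alpha>) = src \<omega>"
  by (cases n) (auto simp: Let_def)

lemma tgt_vcomp:
  "gtr n C D \<omega> \<Longrightarrow> gtr n C D \<alpha> \<Longrightarrow> tgt \<omega> = src \<alpha> \<Longrightarrow> tgt (vcomp n C D \<omega> \<alpha>) = tgt \<alpha>"
  using gtr_0[of C D \<alpha>] by (cases n) (auto simp: Let_def)

subsection \<open>Closure properties\<close>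

lemma gtr_id:
  "is_cat n D \<Longrightarrow> gmap n C D F \<Longrightarrow> gtr n C D (id_tr n C D F)"
proof (induction n arbitrary: C D F)
  case (Suc n)
  note D = Suc.prems(1) and F = Suc.prems(2)
  note fob = gmap_fob[OF F]
  show ?case unfolding id_tr.simps
  proof (rule gtr_TrI[OF F F])
    show "fob (unt D (fob F c)) () \<in> ob (hom D (fob F c) (fob F c))" if "c \<in> ob C" for c
      using is_fun_fob[OF is_cat_unt[OF D fob[OF that]]] by simp
  qed (simp_all add: Suc.IH is_cat_hom[OF D] fob gmap_fhom[OF F] precomp_unit[OF D]
      postcomp_unit[OF D] fcomp_id_right[OF gmap_fhom[OF F]] del: is_cat.simps)
qed auto

lemma gtr_wl:
  "gcat n D \<Longrightarrow> gmap n B C N \<Longrightarrow> gtr n C D \<alpha> \<Longrightarrow> gtr n B D (whisker_l n B N \<alpha>)"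
proof (induction n arbitrary: B C D N \<alpha>)
  case 0 then show ?case
    using gmap_fcomp[OF 0(2) gtr_src[OF 0(3)]] by (simp del: fcomp.simps)
next
  case (Suc n)
  note D = Suc.prems(1) and N = Suc.prems(2) and \<alpha> = Suc.prems(3)
  note gm = gmap_fcomp[OF N gtr_src[OF \<alpha>]] gmap_fcomp[OF N gtr_tgt[OF \<alpha>]]
  note fob = gmap_fob[OF N] gtr_fob_src[OF \<alpha>] gtr_fob_tgt[OF \<alpha>]
  note hom = gmap_fhom[OF N] gmap_fhom[OF gtr_src[OF \<alpha>]] gmap_fhom[OF gtr_tgt[OF \<alpha>]]
  show ?case unfolding whisker_l.simps
    by (rule gtr_TrI[OF gm])
      (simp_all add: fob gtr_tob[OF \<alpha>] Suc.IH[OF gcat_hom[OF D] hom(1) gtr_thom[OF \<alpha>]]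
        gtr_thom_src[OF \<alpha>] tgt_whisker_l[OF gtr_thom[OF \<alpha>]] gtr_thom_tgt[OF \<alpha>]
        fcomp_assoc[OF hom(1) hom(2) gmap_postcomp_weak[OF D]]
        fcomp_assoc[OF hom(1) hom(3) gmap_precomp_weak[OF D]] del: gtr.simps gcat.simps)
qed

lemma gtr_wr:
  "is_cat n D \<Longrightarrow> gcat n E \<Longrightarrow> gtr n C D \<alpha> \<Longrightarrow> is_fun n D E L \<Longrightarrow> gtr n C E (whisker_r n C \<alpha> L)"
proof (induction n arbitrary: C D E L \<alpha>)
  case 0 then show ?case
    using gmap_fcomp[OF gtr_src[OF 0(3)] is_fun_gmap[OF 0(4)]] by (simp del: fcomp.simps)
next
  case (Suc n)
  note D = Suc.prems(1) and E = Suc.prems(2) and \<alpha> = Suc.prems(3) and L = Suc.prems(4)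
  note L' = is_fun_gmap[OF L]
  note D' = is_cat_gcat[OF D]
  note gm = gmap_fcomp[OF gtr_src[OF \<alpha>] L'] gmap_fcomp[OF gtr_tgt[OF \<alpha>] L']
  note fob = gmap_fob[OF L'] gtr_fob_src[OF \<alpha>] gtr_fob_tgt[OF \<alpha>]
  note hom = gmap_fhom[OF L'] gmap_fhom[OF gtr_src[OF \<alpha>]] gmap_fhom[OF gtr_tgt[OF \<alpha>]]
  show ?case unfolding whisker_r.simps
    by (rule gtr_TrI[OF gm])
      (simp_all add: fob gtr_tob[OF \<alpha>] gmap_fob[OF hom(1)]
        Suc.IH[OF is_cat_hom[OF D] gcat_hom[OF E] gtr_thom[OF \<alpha>] is_fun_hom[OF L]]
        gtr_thom_src[OF \<alpha>] tgt_whisker_r[OF gtr_thom[OF \<alpha>]] gtr_thom_tgt[OF \<alpha>]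
        fcomp_assoc[OF hom(2) gmap_postcomp_weak[OF D'] hom(1)] 
        fcomp_assoc[OF hom(3) gmap_precomp_weak[OF D'] hom(1)] 
        fcomp_assoc[OF hom(2) hom(1) gmap_postcomp_weak[OF E]]
        fcomp_assoc[OF hom(3) hom(1) gmap_precomp_weak[OF E]]
        precomp_fun[OF D E L] postcomp_fun[OF D E L]
        del: gtr.simps gcat.simps is_cat.simps is_fun.simps)
qed

lemma gtr_prod:
  "gcat n C \<Longrightarrow> gcat n D \<Longrightarrow> gtr n A C \<alpha> \<Longrightarrow> gtr n B D \<beta>
   \<Longrightarrow> gtr n (prod_cat n A B) (prod_cat n C D) (prod_tr n A B \<alpha> \<beta>)"
proof (induction n arbitrary: A B C D \<alpha> \<beta>)
  case 0 then show ?case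
    by (auto intro!: gmap_prod simp del: prod_fun.simps prod_cat.simps)
next
  case (Suc n)
  note C = Suc.prems(1) and D = Suc.prems(2) and \<alpha> = Suc.prems(3) and \<beta> = Suc.prems(4)
  note gm = gmap_prod[OF gtr_src[OF \<alpha>] gtr_src[OF \<beta>]] gmap_prod[OF gtr_tgt[OF \<alpha>] gtr_tgt[OF \<beta>]]
  note fob = gtr_fob_src[OF \<alpha>] gtr_fob_tgt[OF \<alpha>] gtr_fob_src[OF \<beta>] gtr_fob_tgt[OF \<beta>]
  note hom = gmap_fhom[OF gtr_src[OF \<alpha>]] gmap_fhom[OF gtr_tgt[OF \<alpha>]]
    gmap_fhom[OF gtr_src[OF \<beta>]] gmap_fhom[OF gtr_tgt[OF \<beta>]]
  have eq: "prod_tr (Suc n) A B \<alpha> \<beta> =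
    Tr (prod_fun (Suc n) A B (src \<alpha>) (src \<beta>)) (prod_fun (Suc n) A B (tgt \<alpha>) (tgt \<beta>))
     (\<lambda>p\<in>ob (prod_cat (Suc n) A B). (tob \<alpha> (fst p), tob \<beta> (snd p)))
     (\<lambda>p\<in>ob (prod_cat (Suc n) A B). \<lambda>q\<in>ob (prod_cat (Suc n) A B).
        prod_tr n (hom A (fst p) (fst q)) (hom B (snd p) (snd q)) (thom \<alpha> (fst p) (fst q))
          (thom \<beta> (snd p) (snd q)))"
    by (simp add: case_prod_beta')
  show ?case unfolding eq
    by (rule gtr_TrI[OF gm])
      (auto simp add: fob gtr_tob[OF \<alpha>] gtr_tob[OF \<beta>]
        Suc.IH[OF gcat_hom[OF C] gcat_hom[OF D] gtr_thom[OF \<alpha>] gtr_thom[OF \<beta>]]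
        gtr_thom_src[OF \<alpha>] gtr_thom_tgt[OF \<alpha>] gtr_thom_src[OF \<beta>] gtr_thom_tgt[OF \<beta>]
        tgt_prod_tr[OF gtr_thom[OF \<alpha>] gtr_thom[OF \<beta>]]
        precomp_prod[OF C D] postcomp_prod[OF C D]
        fcomp_prod[OF hom(1) hom(3) gmap_postcomp_weak[OF C] gmap_postcomp_weak[OF D]]
        fcomp_prod[OF hom(2) hom(4) gmap_precomp_weak[OF C] gmap_precomp_weak[OF D]]
        simp del: gtr.simps gcat.simps prod_cat.simps)
qed

lemma gtr_vcomp:
  "is_cat n D \<Longrightarrow> gtr n C D \<omega> \<Longrightarrow> gtr n C D \<alpha> \<Longrightarrow> tgt \<omega> = src \<alpha> \<Longrightarrow> gtr n C D (vcomp n C D \<omega> \<alpha>)"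
proof (induction n arbitrary: C D \<omega> \<alpha>)
  case (Suc n)
  note D = Suc.prems(1) and \<omega> = Suc.prems(2) and \<alpha> = Suc.prems(3) and eq = Suc.prems(4)
  note D' = is_cat_gcat[OF D]
  note fob = gtr_fob_src[OF \<omega>] gtr_fob_src[OF \<alpha>] gtr_fob_tgt[OF \<alpha>]
  note hom = gmap_fhom[OF gtr_src[OF \<omega>]] gmap_fhom[OF gtr_src[OF \<alpha>]] gmap_fhom[OF gtr_tgt[OF \<alpha>]]
  note tob = gtr_tob[OF \<omega>, unfolded eq] gtr_tob[OF \<alpha>]
  note wr = gtr_wr[OF is_cat_hom[OF D] gcat_hom[OF D'] gtr_thom[OF \<alpha>] is_fun_precomp[OF D]]
    gtr_wr[OF is_cat_hom[OF D] gcat_hom[OF D'] gtr_thom[OF \<omega>, unfolded eq] is_fun_postcomp[OF D]]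
  (* The two whiskered components can be composed because composing with the component of \<omega>
     on one side commutes with composing with that of \<alpha> on the other. *)
  have mid: "tgt (whisker_r n (hom C c c') (thom \<alpha> c c') (precomp n D (fob (src \<omega>) c)
          (fob (src \<alpha>) c) (fob (tgt \<alpha>) c') (tob \<omega> c))) =
      src (whisker_r n (hom C c c') (thom \<omega> c c') (postcomp n D (fob (src \<omega>) c)
          (fob (src \<alpha>) c') (fob (tgt \<alpha>) c') (tob \<alpha> c')))" if c: "c \<in> ob C" "c' \<in> ob C" for c c'
    using c by (simp add: tgt_whisker_r[OF gtr_thom[OF \<alpha>]] gtr_thom_tgt[OF \<alpha>] gtr_thom_src[OF \<omega>] eq
        fcomp_assoc[OF hom(2) gmap_postcomp_weak[OF D'] gmap_precomp_weak[OF D']]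
        fcomp_assoc[OF hom(2) gmap_precomp_weak[OF D'] gmap_postcomp_weak[OF D']]
        fob tob precomp_postcomp[OF D] del: gcat.simps is_cat.simps)
  show ?case unfolding vcomp.simps Let_def eq
    by (rule gtr_TrI[OF gtr_src[OF \<omega>] gtr_tgt[OF \<alpha>]])
      (simp_all add: fob tob is_fun_fob[OF is_cat_cmp[OF D]] wr mid
        Suc.IH[OF is_cat_hom[OF D] wr] tgt_vcomp[OF wr] tgt_whisker_r[OF gtr_thom[OF \<omega>, unfolded eq]]
        gtr_thom_tgt[OF \<omega>, unfolded eq] gtr_thom_src[OF \<alpha>]
        fcomp_assoc[OF hom(1) gmap_postcomp_weak[OF D'] gmap_postcomp_weak[OF D']]
        fcomp_assoc[OF hom(3) gmap_precomp_weak[OF D'] gmap_precomp_weak[OF D']]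
        precomp_precomp[OF D] postcomp_postcomp[OF D]
        del: gtr.simps gcat.simps is_cat.simps is_fun.simps)
qed auto

subsection \<open>Products of categories\<close>

lemma is_fun_prod_cmp:
  "gcat n A \<Longrightarrow> gcat n A' \<Longrightarrow> gcat n A'' \<Longrightarrow> gcat n B \<Longrightarrow> gcat n B' \<Longrightarrow> gcat n B''
   \<Longrightarrow> is_fun n (prod_cat n A A') A'' M \<Longrightarrow> is_fun n (prod_cat n B B') B'' N
   \<Longrightarrow> is_fun n (prod_cat n (prod_cat n A B) (prod_cat n A' B')) (prod_cat n A'' B'')
         (prod_cmp n A B A' B' M N)"
proof (induction n arbitrary: A A' A'' B B' B'' M N)
  case 0
  then show ?case
    using gmap_prod_cmp[OF is_fun_gmap[OF 0(7)] is_fun_gmap[OF 0(8)]]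
    by (simp only: gmap.simps is_fun.simps)
next
  case (Suc n)
  note A = Suc.prems(1) and A' = Suc.prems(2) and A'' = Suc.prems(3) and B = Suc.prems(4)
    and B' = Suc.prems(5) and B'' = Suc.prems(6) and M = Suc.prems(7) and N = Suc.prems(8)
  have Mo: "fob M (a, a') \<in> ob A''" if "a \<in> ob A" "a' \<in> ob A'" for a a'
    using is_fun_fob[OF M] that by simp
  have No: "fob N (a, a') \<in> ob B''" if "a \<in> ob B" "a' \<in> ob B'" for a a'
    using is_fun_fob[OF N] that by simp
  have Mh: "is_fun n (prod_cat n (hom A a b) (hom A' a' b')) (hom A'' (fob M (a, a')) (fob M (b, b')))
      (fhom M (a, a') (b, b'))" if "a \<in> ob A" "a' \<in> ob A'" "b \<in> ob A" "b' \<in> ob A'" for a a' b b'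
    using is_fun_hom[OF M, of "(a, a')" "(b, b')"] that by (simp del: prod_cat.simps is_fun.simps)
  have Nh: "is_fun n (prod_cat n (hom B a b) (hom B' a' b')) (hom B'' (fob N (a, a')) (fob N (b, b')))
      (fhom N (a, a') (b, b'))" if "a \<in> ob B" "a' \<in> ob B'" "b \<in> ob B" "b' \<in> ob B'" for a a' b b'
    using is_fun_hom[OF N, of "(a, a')" "(b, b')"] that by (simp del: prod_cat.simps is_fun.simps)
  have Mu: "capp (fhom M (a, a') (a, a')) (cpair (capp (unt A a) t) (capp (unt A' a') t)) =
      capp (unt A'' (fob M (a, a'))) t"
    if "a \<in> ob A" "a' \<in> ob A'" "is_cell n (terminal n) t" for a a' t
    using is_fun_unt[OF M, of "(a, a')" t] that by (simp del: prod_cat.simps add: unt_prod)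
  have Nu: "capp (fhom N (a, a') (a, a')) (cpair (capp (unt B a) t) (capp (unt B' a') t)) =
      capp (unt B'' (fob N (a, a'))) t"
    if "a \<in> ob B" "a' \<in> ob B'" "is_cell n (terminal n) t" for a a' t
    using is_fun_unt[OF N, of "(a, a')" t] that by (simp del: prod_cat.simps add: unt_prod)
  have Mm: "capp (fhom M (x, x') (z, z')) (cpair (capp (cmp A x y z) (cpair a b))
      (capp (cmp A' x' y' z') (cpair a' b'))) =
      capp (cmp A'' (fob M (x, x')) (fob M (y, y')) (fob M (z, z')))
      (cpair (capp (fhom M (x, x') (y, y')) (cpair a a')) (capp (fhom M (y, y') (z, z')) (cpair b b')))"
    if "x \<in> ob A" "x' \<in> ob A'" "y \<in> ob A" "y' \<in> ob A'" "z \<in> ob A" "z' \<in> ob A'"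
      "is_cell n (hom A x y) a" "is_cell n (hom A' x' y') a'" "is_cell n (hom A y z) b"
      "is_cell n (hom A' y' z') b'" "dim a = dim a'" "dim a' = dim b" "dim b = dim b'"
    for x x' y y' z z' a a' b b'
    using is_fun_cmp[OF M, of "(x, x')" "(y, y')" "(z, z')" "cpair a a'" "cpair b b'"] that
    by (simp del: prod_cat.simps add: cmp_prod cell_prod_cat)
  have Nm: "capp (fhom N (x, x') (z, z')) (cpair (capp (cmp B x y z) (cpair a b))
      (capp (cmp B' x' y' z') (cpair a' b'))) =
      capp (cmp B'' (fob N (x, x')) (fob N (y, y')) (fob N (z, z')))
      (cpair (capp (fhom N (x, x') (y, y')) (cpair a a')) (capp (fhom N (y, y') (z, z')) (cpair b b')))"
    if "x \<in> ob B" "x' \<in> ob B'" "y \<in> ob B" "y' \<in> ob B'" "z \<in> ob B" "z' \<in> ob B'"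
      "is_cell n (hom B x y) a" "is_cell n (hom B' x' y') a'" "is_cell n (hom B y z) b"
      "is_cell n (hom B' y' z') b'" "dim a = dim a'" "dim a' = dim b" "dim b = dim b'"
    for x x' y y' z z' a a' b b'
    using is_fun_cmp[OF N, of "(x, x')" "(y, y')" "(z, z')" "cpair a a'" "cpair b b'"] that
    by (simp del: prod_cat.simps add: cmp_prod cell_prod_cat)
  note gh = gcat_hom[OF A] gcat_hom[OF B] gcat_hom[OF A'] gcat_hom[OF B'] gcat_hom[OF A''] gcat_hom[OF B'']
  note uc = gmap_cell[OF gcat_unt[OF A]] gmap_cell[OF gcat_unt[OF A']] gmap_cell[OF gcat_unt[OF B]] gmap_cell[OF gcat_unt[OF B']]
  note mc = gcat_cmp_cell[OF A] gcat_cmp_cell[OF A'] gcat_cmp_cell[OF B] gcat_cmp_cell[OF B']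
  have Mc: "is_cell n (hom A'' (fob M (x, x')) (fob M (y, y'))) (capp (fhom M (x, x') (y, y')) (cpair a a'))"
    if "x \<in> ob A" "x' \<in> ob A'" "y \<in> ob A" "y' \<in> ob A'"
      "is_cell n (hom A x y) a" "is_cell n (hom A' x' y') a'" "dim a = dim a'" for x x' y y' a a'
    using gmap_cell[OF is_fun_gmap[OF Mh]] that by (simp add: cell_prod_cat)
  have Nc: "is_cell n (hom B'' (fob N (x, x')) (fob N (y, y'))) (capp (fhom N (x, x') (y, y')) (cpair a a'))"
    if "x \<in> ob B" "x' \<in> ob B'" "y \<in> ob B" "y' \<in> ob B'"
      "is_cell n (hom B x y) a" "is_cell n (hom B' x' y') a'" "dim a = dim a'" for x x' y y' a a'
    using gmap_cell[OF is_fun_gmap[OF Nh]] that by (simp add: cell_prod_cat)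
  show ?case
    by (rule is_fun_SucI[OF gcat_prod[OF gcat_prod[OF A B] gcat_prod[OF A' B']] gcat_prod[OF A'' B'']
          gmap_prod_cmp[OF is_fun_gmap[OF M] is_fun_gmap[OF N]]])
      (auto simp add: Suc.IH Mo No Mh Nh gh unt_prod cmp_prod cell_prod_cat uc mc Mu Nu Mm Nm Mc Nc
        simp del: prod_cat.simps is_fun.simps)
qed

lemma is_cat_prod: "is_cat n C \<Longrightarrow> is_cat n D \<Longrightarrow> is_cat n (prod_cat n C D)"
proof (induction n arbitrary: C D)
  case (Suc n)
  note C = Suc.prems(1) and D = Suc.prems(2)
  note C' = is_cat_gcat[OF C] and D' = is_cat_gcat[OF D]
  note gh = gcat_hom[OF C'] gcat_hom[OF D']
  show ?case
  proof (rule is_cat_SucI[OF gcat_prod[OF C' D']])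
    fix x y assume "x \<in> ob (prod_cat (Suc n) C D)" "y \<in> ob (prod_cat (Suc n) C D)"
    then show "is_cat n (hom (prod_cat (Suc n) C D) x y)"
      using Suc.IH is_cat_hom[OF C] is_cat_hom[OF D]
      by (auto simp del: is_cat.simps prod_cat.simps)
  next
    fix x assume "x \<in> ob (prod_cat (Suc n) C D)"
    then show "is_fun n (terminal n) (hom (prod_cat (Suc n) C D) x x) (unt (prod_cat (Suc n) C D) x)"
      using is_fun_pair[OF gcat_terminal gh is_cat_unt[OF C] is_cat_unt[OF D]] by auto
  next
    fix x y z assume "x \<in> ob (prod_cat (Suc n) C D)" "y \<in> ob (prod_cat (Suc n) C D)"
      "z \<in> ob (prod_cat (Suc n) C D)"
    then show "is_fun n (prod_cat n (hom (prod_cat (Suc n) C D) x y) (hom (prod_cat (Suc n) C D) y z))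
        (hom (prod_cat (Suc n) C D) x z) (cmp (prod_cat (Suc n) C D) x y z)"
      using is_fun_prod_cmp[OF gh(1,1,1) gh(2,2,2) is_cat_cmp[OF C] is_cat_cmp[OF D]] by auto
  next
    fix x y a assume x: "x \<in> ob (prod_cat (Suc n) C D)" "y \<in> ob (prod_cat (Suc n) C D)"
      "is_cell n (hom (prod_cat (Suc n) C D) x y) a"
    then have "is_cell n (terminal n) (cbang a)"
      using cell_cbang[of n "hom C (fst x) (fst y)" "cfst a"]
      by (auto simp add: cell_prod_cat simp del: prod_cat.simps)
    then show "capp (cmp (prod_cat (Suc n) C D) x x y)
        (cpair (capp (unt (prod_cat (Suc n) C D) x) (cbang a)) a) = a"
      "capp (cmp (prod_cat (Suc n) C D) x y y)
        (cpair a (capp (unt (prod_cat (Suc n) C D) y) (cbang a))) = a"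
      using x by (auto simp add: unt_prod cmp_prod cell_prod_cat
          gmap_cell[OF gcat_unt[OF C']] gmap_cell[OF gcat_unt[OF D']] cat_unit_left[OF C]
          cat_unit_left[OF D] cat_unit_right[OF C] cat_unit_right[OF D] simp del: prod_cat.simps)
  qed (auto simp add: cmp_prod cell_prod_cat gcat_cmp_cell[OF C'] gcat_cmp_cell[OF D']
      cat_assoc[OF C] cat_assoc[OF D] simp del: prod_cat.simps is_fun.simps)
qed auto

section \<open>Laws for globular transformations\<close>

text \<open>
  Whiskerings, products and identities act on cells by simple formulas, so the laws among them follow
  from \<open>gtr_eqI\<close>.
\<close>

lemma tapp_wl:
  "gtr n C D \<alpha> \<Longrightarrow> gmap n B C N \<Longrightarrow> is_cell n B z \<Longrightarrow> tapp (whisker_l n B N \<alpha>) z = tapp \<alpha> (capp N z)"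
proof (induction n arbitrary: B C D N \<alpha> z)
  case 0 then show ?case by (cases z) auto
next
  case (Suc n)
  note \<alpha> = Suc.prems(1) and N = Suc.prems(2)
  note fob = gmap_fob[OF N]
  show ?case using Suc.prems(3)
    by (cases z) (simp_all add: fob Suc.IH[OF gtr_thom[OF \<alpha>] gmap_fhom[OF N]]
        gtr_tapp_Top[OF \<alpha>] gtr_tapp_Step[OF \<alpha>] del: gtr.simps)
qed

lemma tapp_wr:
  "gtr n C D \<alpha> \<Longrightarrow> is_cell n C z \<Longrightarrow> tapp (whisker_r n C \<alpha> L) z = capp L (tapp \<alpha> z)"
proof (induction n arbitrary: C D L \<alpha> z)
  case 0 then show ?case by (cases z) auto
next
  case (Suc n)
  note \<alpha> = Suc.prems(1)
  show ?case using Suc.prems(2)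
    by (cases z) (simp_all add: Suc.IH[OF gtr_thom[OF \<alpha>]] 
        gtr_tapp_Top[OF \<alpha>] gtr_tapp_Step[OF \<alpha>] del: gtr.simps)
qed

lemma tapp_prod:
  "gtr n A C \<alpha> \<Longrightarrow> gtr n B D \<beta> \<Longrightarrow> is_cell n A (cfst z) \<Longrightarrow> is_cell n B (csnd z)
   \<Longrightarrow> tapp (prod_tr n A B \<alpha> \<beta>) z = cpair (tapp \<alpha> (cfst z)) (tapp \<beta> (csnd z))"
proof (induction n arbitrary: A B C D \<alpha> \<beta> z)
  case 0 then show ?case by (cases z) auto
next
  case (Suc n)
  note \<alpha> = Suc.prems(1) and \<beta> = Suc.prems(2)
  show ?case using Suc.prems(3,4)
    by (cases z) (auto simp add: Suc.IH[OF gtr_thom[OF \<alpha>] gtr_thom[OF \<beta>]] 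
        gtr_tapp_Top[OF \<alpha>] gtr_tapp_Step[OF \<alpha>] gtr_tapp_Top[OF \<beta>] gtr_tapp_Step[OF \<beta>] simp del: gtr.simps)
qed

text \<open>A cell of top dimension is its own identity, in agreement with \<open>tapp\<close>.\<close>

fun id_cell :: "nat \<Rightarrow> 'a ncat \<Rightarrow> 'a cell \<Rightarrow> 'a cell" where
  "id_cell 0 D z = z"
| "id_cell (Suc n) D (Top x) = Step x x (Top (fob (unt D x) ()))"
| "id_cell (Suc n) D (Step x y z) = Step x y (id_cell n (hom D x y) z)"

lemma tapp_id: "is_cell n C z \<Longrightarrow> tapp (id_tr n C D F) z = id_cell n D (capp F z)"
proof (induction n C z arbitrary: D F rule: is_cell.induct)
  case (1 n C x) then show ?case by (cases n) auto
qed auto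

lemma capp_id_cell:
  "is_fun n D E L \<Longrightarrow> is_cell n D z \<Longrightarrow> capp L (id_cell n D z) = id_cell n E (capp L z)"
proof (induction n D z arbitrary: E L rule: is_cell.induct)
  case (1 n C x)
  show ?case
  proof (cases n)
    case (Suc m)
    show ?thesis
      using is_fun_unt[of m C E L x "Top ()"] 1 Suc by (simp del: is_fun.simps)
  qed simp
next
  case (3 n C x y z)
  then show ?case using is_fun_hom[of n C E L x y] by (simp del: is_fun.simps)
qed auto

lemma id_cell_prod:
  "is_cell n A (cfst z) \<Longrightarrow> is_cell n B (csnd z)
   \<Longrightarrow> id_cell n (prod_cat n A B) z = cpair (id_cell n A (cfst z)) (id_cell n B (csnd z))"
proof (induction z arbitrary: n A B)
  case (Top x)
  show ?case
  proof (cases n)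
    case (Suc m)
    show ?thesis
      using Top unt_prod[of x A B m "Top ()"] Suc by (cases x) (simp del: prod_cat.simps)
  qed (use Top in \<open>cases x; simp\<close>)
next
  case (Step x y z)
  then show ?case by (cases n; cases x; cases y) (simp_all del: prod_cat.simps)
qed

lemma wl_fcomp:
  assumes "gcat n D" "gmap n A B N" "gmap n B C M" "gtr n C D \<alpha>"
  shows "whisker_l n A (fcomp n A N M) \<alpha> = whisker_l n A N (whisker_l n B M \<alpha>)"
proof -
  note [simp] = fcomp_assoc[OF assms(2,3) gtr_src[OF assms(4)]]
    fcomp_assoc[OF assms(2,3) gtr_tgt[OF assms(4)]]
  note wl = gtr_wl[OF assms(1,3,4)]
  show ?thesis
    by (rule gtr_eqI[OF gtr_wl[OF assms(1) gmap_fcomp[OF assms(2,3)] assms(4)]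
          gtr_wl[OF assms(1,2) wl]])
      (simp_all add: tgt_whisker_l[OF assms(4)] tgt_whisker_l[OF wl] tapp_wl[OF wl assms(2)]
        tapp_wl[OF assms(4,3)] tapp_wl[OF assms(4) gmap_fcomp[OF assms(2,3)]] gmap_cell[OF assms(2)])
qed

lemma wl_id_fun:
  assumes "gcat n D" "gtr n C D \<alpha>"
  shows "whisker_l n C (id_fun n C) \<alpha> = \<alpha>"
  by (rule gtr_eqI[OF gtr_wl[OF assms(1) gmap_id assms(2)] assms(2)])
    (simp_all add: tgt_whisker_l[OF assms(2)] fcomp_id_left[OF gtr_src[OF assms(2)]]
      fcomp_id_left[OF gtr_tgt[OF assms(2)]] tapp_wl[OF assms(2) gmap_id])

lemma wr_fcomp:
  assumes "is_cat n D" "is_cat n E" "gcat n E'" "gtr n C D \<alpha>" "is_fun n D E L" "is_fun n E E' M"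
  shows "whisker_r n C \<alpha> (fcomp n D L M) = whisker_r n C (whisker_r n C \<alpha> L) M"
proof -
  note D' = is_cat_gcat[OF assms(1)] and E' = is_cat_gcat[OF assms(2)]
  note LM = is_fun_gmap[OF assms(5)] is_fun_gmap[OF assms(6)]
  note wr = gtr_wr[OF assms(1) E' assms(4,5)]
  show ?thesis
    by (rule gtr_eqI[OF gtr_wr[OF assms(1,3,4) is_fun_fcomp[OF D' E' assms(3,5,6)]]
          gtr_wr[OF assms(2,3) wr assms(6)]])
      (simp_all add: tgt_whisker_r[OF assms(4)] tgt_whisker_r[OF wr] tapp_wr[OF wr]
        tapp_wr[OF assms(4)] is_cell_tapp[OF assms(4)]
        fcomp_assoc[OF gtr_src[OF assms(4)] LM] fcomp_assoc[OF gtr_tgt[OF assms(4)] LM])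
qed

lemma wr_id_fun:
  assumes "is_cat n D" "gtr n C D \<alpha>"
  shows "whisker_r n C \<alpha> (id_fun n D) = \<alpha>"
  by (rule gtr_eqI[OF gtr_wr[OF assms(1) is_cat_gcat[OF assms(1)] assms(2) is_fun_id[OF is_cat_gcat[OF assms(1)]]] assms(2)])
    (simp_all add: tgt_whisker_r[OF assms(2)] fcomp_id_right[OF gtr_src[OF assms(2)]]
      fcomp_id_right[OF gtr_tgt[OF assms(2)]] tapp_wr[OF assms(2)] is_cell_tapp[OF assms(2)])

lemma wl_wr:
  assumes "is_cat n D" "gcat n E" "gmap n B C N" "gtr n C D \<alpha>" "is_fun n D E L"
  shows "whisker_l n B N (whisker_r n C \<alpha> L) = whisker_r n B (whisker_l n B N \<alpha>) L"
proof -
  note wl = gtr_wl[OF is_cat_gcat[OF assms(1)] assms(3,4)]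
  note wr = gtr_wr[OF assms(1,2,4,5)]
  note L = is_fun_gmap[OF assms(5)]
  show ?thesis
    by (rule gtr_eqI[OF gtr_wl[OF assms(2,3) wr] gtr_wr[OF assms(1,2) wl assms(5)]])
      (simp_all add: tgt_whisker_r[OF assms(4)] tgt_whisker_r[OF wl] tgt_whisker_l[OF assms(4)]
        tgt_whisker_l[OF wr] fcomp_assoc[OF assms(3) gtr_src[OF assms(4)] L]
        fcomp_assoc[OF assms(3) gtr_tgt[OF assms(4)] L] tapp_wl[OF wr assms(3)] tapp_wl[OF assms(4,3)]
        tapp_wr[OF wl] tapp_wr[OF assms(4)] gmap_cell[OF assms(3)])
qed

lemma wl_id:
  assumes "is_cat n D" "gmap n B C N" "gmap n C D F"
  shows "whisker_l n B N (id_tr n C D F) = id_tr n B D (fcomp n B N F)"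
  by (rule gtr_eqI[OF gtr_wl[OF is_cat_gcat[OF assms(1)] assms(2) gtr_id[OF assms(1,3)]]
        gtr_id[OF assms(1) gmap_fcomp[OF assms(2,3)]]])
    (simp_all add: tgt_whisker_l[OF gtr_id[OF assms(1,3)]] tapp_wl[OF gtr_id[OF assms(1,3)] assms(2)]
      tapp_id gmap_cell[OF assms(2)])

lemma wr_id:
  assumes "is_cat n D" "is_cat n E" "gmap n C D F" "is_fun n D E L"
  shows "whisker_r n C (id_tr n C D F) L = id_tr n C E (fcomp n C F L)"
  by (rule gtr_eqI[OF gtr_wr[OF assms(1) is_cat_gcat[OF assms(2)] gtr_id[OF assms(1,3)] assms(4)]
        gtr_id[OF assms(2) gmap_fcomp[OF assms(3) is_fun_gmap[OF assms(4)]]]])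
    (simp_all add: tgt_whisker_r[OF gtr_id[OF assms(1,3)]] tapp_wr[OF gtr_id[OF assms(1,3)]]
      tapp_id gmap_cell[OF assms(3)] capp_id_cell[OF assms(4)])

lemma prod_id:
  assumes "is_cat n C" "is_cat n D" "gmap n A C F" "gmap n B D G"
  shows "prod_tr n A B (id_tr n A C F) (id_tr n B D G) =
    id_tr n (prod_cat n A B) (prod_cat n C D) (prod_fun n A B F G)"
  by (rule gtr_eqI[OF gtr_prod[OF is_cat_gcat[OF assms(1)] is_cat_gcat[OF assms(2)]
          gtr_id[OF assms(1,3)] gtr_id[OF assms(2,4)]]
        gtr_id[OF is_cat_prod[OF assms(1,2)] gmap_prod[OF assms(3,4)]]])
    (simp_all add: tgt_prod_tr[OF gtr_id[OF assms(1,3)] gtr_id[OF assms(2,4)]] cell_prod_cat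
      tapp_prod[OF gtr_id[OF assms(1,3)] gtr_id[OF assms(2,4)]] tapp_id id_cell_prod
      gmap_cell[OF assms(3)] gmap_cell[OF assms(4)])

lemma wl_prod:
  assumes "gcat n C" "gcat n D" "gmap n A' A N" "gmap n B' B M" "gtr n A C \<alpha>" "gtr n B D \<beta>"
  shows "whisker_l n (prod_cat n A' B') (prod_fun n A' B' N M) (prod_tr n A B \<alpha> \<beta>) =
    prod_tr n A' B' (whisker_l n A' N \<alpha>) (whisker_l n B' M \<beta>)"
proof -
  note wl = gtr_wl[OF assms(1,3,5)] gtr_wl[OF assms(2,4,6)]
  note p = gtr_prod[OF assms(1,2,5,6)]
  show ?thesis
    by (rule gtr_eqI[OF gtr_wl[OF gcat_prod[OF assms(1,2)] gmap_prod[OF assms(3,4)] p]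
          gtr_prod[OF assms(1,2) wl]])
      (simp_all add: tgt_whisker_l[OF p] tgt_prod_tr[OF assms(5,6)] tgt_prod_tr[OF wl]
        tgt_whisker_l[OF assms(5)] tgt_whisker_l[OF assms(6)] cell_prod_cat
        fcomp_prod[OF assms(3,4) gtr_src[OF assms(5)] gtr_src[OF assms(6)]]
        fcomp_prod[OF assms(3,4) gtr_tgt[OF assms(5)] gtr_tgt[OF assms(6)]]
        tapp_wl[OF p gmap_prod[OF assms(3,4)]] tapp_prod[OF assms(5,6)] tapp_prod[OF wl]
        tapp_wl[OF assms(5,3)] tapp_wl[OF assms(6,4)] gmap_cell[OF assms(3)] gmap_cell[OF assms(4)])
qed

lemma dim_tapp: "gtr n C D \<alpha> \<Longrightarrow> is_cell n C z \<Longrightarrow> dim (tapp \<alpha> z) = min n (Suc (dim z))"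
proof (induction n arbitrary: C D \<alpha> z)
  case 0
  then show ?case by (cases z) auto
next
  case (Suc n)
  then show ?case
    by (cases z) (auto simp: gtr_tapp_Top[OF Suc.prems(1)] gtr_tapp_Step[OF Suc.prems(1)]
        Suc.IH[OF gtr_thom[OF Suc.prems(1)]] simp del: gtr.simps)
qed

lemma wr_prod:
  assumes "is_cat n C" "is_cat n D" "gcat n C'" "gcat n D'" "gtr n A C \<alpha>" "gtr n B D \<beta>"
    "is_fun n C C' L" "is_fun n D D' M"
  shows "whisker_r n (prod_cat n A B) (prod_tr n A B \<alpha> \<beta>) (prod_fun n C D L M) =
    prod_tr n A B (whisker_r n A \<alpha> L) (whisker_r n B \<beta> M)"
proof -
  note C' = is_cat_gcat[OF assms(1)] and D' = is_cat_gcat[OF assms(2)]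
  note wr = gtr_wr[OF assms(1,3,5,7)] gtr_wr[OF assms(2,4,6,8)]
  note p = gtr_prod[OF C' D' assms(5,6)]
  note LM = is_fun_gmap[OF assms(7)] is_fun_gmap[OF assms(8)]
  show ?thesis
    by (rule gtr_eqI[OF gtr_wr[OF is_cat_prod[OF assms(1,2)] gcat_prod[OF assms(3,4)] p
            is_fun_prod[OF C' D' assms(3,4,7,8)]] gtr_prod[OF assms(3,4) wr]])
      (simp_all add: tgt_whisker_r[OF p] tgt_prod_tr[OF assms(5,6)] tgt_prod_tr[OF wr]
        tgt_whisker_r[OF assms(5)] tgt_whisker_r[OF assms(6)] cell_prod_cat
        fcomp_prod[OF gtr_src[OF assms(5)] gtr_src[OF assms(6)] LM]
        fcomp_prod[OF gtr_tgt[OF assms(5)] gtr_tgt[OF assms(6)] LM]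
        tapp_wr[OF p] tapp_prod[OF assms(5,6)] tapp_prod[OF wr]
        tapp_wr[OF assms(5)] tapp_wr[OF assms(6)] is_cell_tapp[OF assms(5)] is_cell_tapp[OF assms(6)]
        dim_tapp[OF assms(5)] dim_tapp[OF assms(6)])
qed

subsection \<open>Laws for composites of 1-cells\<close>

lemma fob_cmp:
  "gcat (Suc n) C \<Longrightarrow> x \<in> ob C \<Longrightarrow> y \<in> ob C \<Longrightarrow> z \<in> ob C \<Longrightarrow> f \<in> ob (hom C x y) \<Longrightarrow> g \<in> ob (hom C y z)
   \<Longrightarrow> fob (cmp C x y z) (f, g) \<in> ob (hom C x z)"
  using gmap_fob[OF gcat_cmp[of n C x y z], of "(f, g)"] by (simp del: gcat.simps)

lemma fob_unt: "gcat (Suc n) C \<Longrightarrow> x \<in> ob C \<Longrightarrow> fob (unt C x) () \<in> ob (hom C x x)"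
  using gmap_fob[OF gcat_unt[of n C x], of "()"] by (simp del: gcat.simps)

lemma fob_unit_left:
  "is_cat (Suc n) C \<Longrightarrow> x \<in> ob C \<Longrightarrow> y \<in> ob C \<Longrightarrow> f \<in> ob (hom C x y)
   \<Longrightarrow> fob (cmp C x x y) (fob (unt C x) (), f) = f"
  using cat_unit_left[of n C x y "Top f" "Top ()"] by (simp del: is_cat.simps)

lemma fob_unit_right:
  "is_cat (Suc n) C \<Longrightarrow> x \<in> ob C \<Longrightarrow> y \<in> ob C \<Longrightarrow> f \<in> ob (hom C x y)
   \<Longrightarrow> fob (cmp C x y y) (f, fob (unt C y) ()) = f"
  using cat_unit_right[of n C x y "Top f" "Top ()"] by (simp del: is_cat.simps)

lemma fob_cmp_assoc:
  "is_cat (Suc n) C \<Longrightarrow> w \<in> ob C \<Longrightarrow> x \<in> ob C \<Longrightarrow> y \<in> ob C \<Longrightarrow> z \<in> ob C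
   \<Longrightarrow> f \<in> ob (hom C w x) \<Longrightarrow> g \<in> ob (hom C x y) \<Longrightarrow> h \<in> ob (hom C y z)
   \<Longrightarrow> fob (cmp C w y z) (fob (cmp C w x y) (f, g), h) = fob (cmp C w x z) (f, fob (cmp C x y z) (g, h))"
  using cat_assoc[of n C w x y z "Top f" "Top g" "Top h"] by (simp del: is_cat.simps)

lemma fob_fhom_cmp:
  "is_fun (Suc n) C D F \<Longrightarrow> x \<in> ob C \<Longrightarrow> y \<in> ob C \<Longrightarrow> z \<in> ob C
   \<Longrightarrow> f \<in> ob (hom C x y) \<Longrightarrow> g \<in> ob (hom C y z)
   \<Longrightarrow> fob (fhom F x z) (fob (cmp C x y z) (f, g)) =
      fob (cmp D (fob F x) (fob F y) (fob F z)) (fob (fhom F x y) f, fob (fhom F y z) g)"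
  using is_fun_cmp[of n C D F x y z "Top f" "Top g"] by (simp del: is_fun.simps)

lemma fob_cmp_prod:
  "f \<in> ob (hom A x y) \<Longrightarrow> f' \<in> ob (hom B x' y') \<Longrightarrow> g \<in> ob (hom A y z) \<Longrightarrow> g' \<in> ob (hom B y' z')
   \<Longrightarrow> fob (cmp (prod_cat (Suc n) A B) (x, x') (y, y') (z, z')) ((f, f'), (g, g')) =
     (fob (cmp A x y z) (f, g), fob (cmp B x' y' z') (f', g'))"
  using cmp_prod[of n A "(x, x')" "(y, y')" "Top (f, f')" B "(z, z')" "Top (g, g')"]
  by (simp del: prod_cat.simps)

subsection \<open>Laws for vertical composition\<close>

text \<open>
  A vertical composite has no simple action on cells, since its components are whiskered anew at every
  level. Its laws are therefore proved by induction on the level, componentwise: whiskering is moved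
  out of the way by the laws above, and the components meet the induction hypothesis because of
  \<open>vcomp_mid\<close>.
\<close>

lemma tob_vcomp:
  "c \<in> ob C \<Longrightarrow> tob (vcomp (Suc n) C D \<omega> \<alpha>) c =
     fob (cmp D (fob (src \<omega>) c) (fob (tgt \<omega>) c) (fob (tgt \<alpha>) c)) (tob \<omega> c, tob \<alpha> c)"
  by (simp add: Let_def)

lemma thom_vcomp:
  "c \<in> ob C \<Longrightarrow> c' \<in> ob C \<Longrightarrow> thom (vcomp (Suc n) C D \<omega> \<alpha>) c c' =
     vcomp n (hom C c c') (hom D (fob (src \<omega>) c) (fob (tgt \<alpha>) c'))
       (whisker_r n (hom C c c') (thom \<alpha> c c')
         (precomp n D (fob (src \<omega>) c) (fob (tgt \<omega>) c) (fob (tgt \<alpha>) c') (tob \<omega> c)))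
       (whisker_r n (hom C c c') (thom \<omega> c c')
         (postcomp n D (fob (src \<omega>) c) (fob (tgt \<omega>) c') (fob (tgt \<alpha>) c') (tob \<alpha> c')))"
  by (simp add: Let_def)

lemma tob_id_tr: "c \<in> ob C \<Longrightarrow> tob (id_tr (Suc n) C D F) c = fob (unt D (fob F c)) ()"
  by simp

lemma thom_id_tr:
  "c \<in> ob C \<Longrightarrow> c' \<in> ob C \<Longrightarrow> thom (id_tr (Suc n) C D F) c c' =
     id_tr n (hom C c c') (hom D (fob F c) (fob F c')) (fhom F c c')"
  by simp

lemma tob_whisker_l: "c \<in> ob B \<Longrightarrow> tob (whisker_l (Suc n) B N \<alpha>) c = tob \<alpha> (fob N c)"
  by simp

lemma tob_whisker_r:
  "c \<in> ob C \<Longrightarrow> tob (whisker_r (Suc n) C \<alpha> L) c =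
     fob (fhom L (fob (src \<alpha>) c) (fob (tgt \<alpha>) c)) (tob \<alpha> c)"
  by simp

lemma fob_fcomp [simp]: "x \<in> ob C \<Longrightarrow> fob (fcomp n C F G) x = fob G (fob F x)"
  by (cases n) simp_all

lemma thom_whisker_l:
  "c \<in> ob B \<Longrightarrow> c' \<in> ob B \<Longrightarrow> thom (whisker_l (Suc n) B N \<alpha>) c c' =
     whisker_l n (hom B c c') (fhom N c c') (thom \<alpha> (fob N c) (fob N c'))"
  by simp

lemma thom_whisker_r:
  "c \<in> ob C \<Longrightarrow> c' \<in> ob C \<Longrightarrow> thom (whisker_r (Suc n) C \<alpha> L) c c' =
     whisker_r n (hom C c c') (thom \<alpha> c c') (fhom L (fob (src \<alpha>) c) (fob (tgt \<alpha>) c'))"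
  by simp

lemma vcomp_mid:
  assumes D: "is_cat (Suc n) D" and \<omega>: "gtr (Suc n) C D \<omega>" and \<alpha>: "gtr (Suc n) C D \<alpha>"
    and eq: "tgt \<omega> = src \<alpha>" and c: "c \<in> ob C" "c' \<in> ob C"
  shows "gtr n (hom C c c') (hom D (fob (src \<omega>) c) (fob (tgt \<alpha>) c'))
     (whisker_r n (hom C c c') (thom \<alpha> c c')
       (precomp n D (fob (src \<omega>) c) (fob (tgt \<omega>) c) (fob (tgt \<alpha>) c') (tob \<omega> c)))" (is ?A)
   and "gtr n (hom C c c') (hom D (fob (src \<omega>) c) (fob (tgt \<alpha>) c'))
     (whisker_r n (hom C c c') (thom \<omega> c c')
       (postcomp n D (fob (src \<omega>) c) (fob (tgt \<omega>) c') (fob (tgt \<alpha>) c') (tob \<alpha> c')))" (is ?B)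
   and "tgt (whisker_r n (hom C c c') (thom \<alpha> c c')
       (precomp n D (fob (src \<omega>) c) (fob (tgt \<omega>) c) (fob (tgt \<alpha>) c') (tob \<omega> c))) =
     src (whisker_r n (hom C c c') (thom \<omega> c c')
       (postcomp n D (fob (src \<omega>) c) (fob (tgt \<omega>) c') (fob (tgt \<alpha>) c') (tob \<alpha> c')))" (is ?C)
proof -
  note D' = is_cat_gcat[OF D]
  note fob = gtr_fob_src[OF \<omega>] gtr_fob_src[OF \<alpha>] gtr_fob_tgt[OF \<alpha>]
  note hom = gmap_fhom[OF gtr_src[OF \<omega>]] gmap_fhom[OF gtr_src[OF \<alpha>]] gmap_fhom[OF gtr_tgt[OF \<alpha>]]
  note tob = gtr_tob[OF \<omega>, unfolded eq] gtr_tob[OF \<alpha>]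
  show ?A ?B unfolding eq
    using c by (auto intro!: fob tob gtr_wr[OF is_cat_hom[OF D] gcat_hom[OF D'] gtr_thom[OF \<alpha>] is_fun_precomp[OF D]]
    gtr_wr[OF is_cat_hom[OF D] gcat_hom[OF D'] gtr_thom[OF \<omega>, unfolded eq] is_fun_postcomp[OF D]]
    simp del: is_cat.simps)
  show ?C
    using c by (simp add: tgt_whisker_r[OF gtr_thom[OF \<alpha>]] gtr_thom_tgt[OF \<alpha>] gtr_thom_src[OF \<omega>] eq
        fcomp_assoc[OF hom(2) gmap_postcomp_weak[OF D'] gmap_precomp_weak[OF D']]
        fcomp_assoc[OF hom(2) gmap_precomp_weak[OF D'] gmap_postcomp_weak[OF D']]
        fob tob precomp_postcomp[OF D] del: gcat.simps is_cat.simps)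
qed

lemma vcomp_id:
  "is_cat n D \<Longrightarrow> gtr n C D \<alpha> \<Longrightarrow>
     vcomp n C D (id_tr n C D (src \<alpha>)) \<alpha> = \<alpha> \<and> vcomp n C D \<alpha> (id_tr n C D (tgt \<alpha>)) = \<alpha>"
proof (induction n arbitrary: C D \<alpha>)
  case 0
  then show ?case by auto
next
  case (Suc n)
  note D = Suc.prems(1) and \<alpha> = Suc.prems(2)
  note D' = is_cat_gcat[OF D]
  note fob = gtr_fob_src[OF \<alpha>] gtr_fob_tgt[OF \<alpha>]
  note ids = gtr_id[OF D gtr_src[OF \<alpha>]] gtr_id[OF D gtr_tgt[OF \<alpha>]]
  note hom = gmap_fhom[OF gtr_src[OF \<alpha>]] gmap_fhom[OF gtr_tgt[OF \<alpha>]]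
  note thom = gtr_thom[OF \<alpha>]
  note dh = is_cat_hom[OF D]
  have IH: "vcomp n (hom C c c') (hom D (fob (src \<alpha>) c) (fob (tgt \<alpha>) c'))
        (id_tr n (hom C c c') (hom D (fob (src \<alpha>) c) (fob (tgt \<alpha>) c')) (src (thom \<alpha> c c'))) (thom \<alpha> c c')
      = thom \<alpha> c c'"
    "vcomp n (hom C c c') (hom D (fob (src \<alpha>) c) (fob (tgt \<alpha>) c')) (thom \<alpha> c c')
        (id_tr n (hom C c c') (hom D (fob (src \<alpha>) c) (fob (tgt \<alpha>) c')) (tgt (thom \<alpha> c c')))
      = thom \<alpha> c c'" if c: "c \<in> ob C" "c' \<in> ob C" for c c'
    using Suc.IH[OF dh[OF fob(1)[OF c(1)] fob(2)[OF c(2)]] thom[OF c]] by blast+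
  show ?case
  proof (intro conjI)
    show "vcomp (Suc n) C D (id_tr (Suc n) C D (src \<alpha>)) \<alpha> = \<alpha>"
    proof (rule gtr_Suc_eqI[OF gtr_vcomp[OF D ids(1) \<alpha>] \<alpha>])
      fix c c' assume c: "c \<in> ob C" "c' \<in> ob C"
      show "thom (vcomp (Suc n) C D (id_tr (Suc n) C D (src \<alpha>)) \<alpha>) c c' = thom \<alpha> c c'"
        using c IH[OF c]
        unfolding thom_vcomp[OF c] thom_id_tr[OF c] tob_id_tr[OF c(1)] tob_id_tr[OF c(2)]
          src_id_tr tgt_id_tr
        by (simp add: fob precomp_unit[OF D] wr_id_fun[OF dh thom]
            wr_id[OF dh dh hom(1) is_fun_postcomp[OF D]] gtr_tob[OF \<alpha>]
            gtr_thom_tgt[OF \<alpha>] del: is_cat.simps gtr.simps)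
    qed (simp_all add: tgt_vcomp[OF ids(1) \<alpha>] tob_vcomp fob_unit_left[OF D] fob gtr_tob[OF \<alpha>]
        tob_id_tr del: vcomp.simps is_cat.simps id_tr.simps)
    show "vcomp (Suc n) C D \<alpha> (id_tr (Suc n) C D (tgt \<alpha>)) = \<alpha>"
    proof (rule gtr_Suc_eqI[OF gtr_vcomp[OF D \<alpha> ids(2)] \<alpha>])
      fix c c' assume c: "c \<in> ob C" "c' \<in> ob C"
      show "thom (vcomp (Suc n) C D \<alpha> (id_tr (Suc n) C D (tgt \<alpha>))) c c' = thom \<alpha> c c'"
        using c IH[OF c]
        unfolding thom_vcomp[OF c] thom_id_tr[OF c] tob_id_tr[OF c(1)] tob_id_tr[OF c(2)]
          src_id_tr tgt_id_tr
        by (simp add: fob postcomp_unit[OF D] wr_id_fun[OF dh thom]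
            wr_id[OF dh dh hom(2) is_fun_precomp[OF D]] gtr_tob[OF \<alpha>]
            gtr_thom_src[OF \<alpha>] del: is_cat.simps gtr.simps)
    qed (simp_all add: tgt_vcomp[OF \<alpha> ids(2)] tob_vcomp fob_unit_right[OF D] fob gtr_tob[OF \<alpha>]
        tob_id_tr del: vcomp.simps is_cat.simps id_tr.simps)
  qed
qed

lemma wl_vcomp:
  "is_cat n D \<Longrightarrow> gmap n B C N \<Longrightarrow> gtr n C D \<omega> \<Longrightarrow> gtr n C D \<alpha> \<Longrightarrow> tgt \<omega> = src \<alpha>
   \<Longrightarrow> whisker_l n B N (vcomp n C D \<omega> \<alpha>) = vcomp n B D (whisker_l n B N \<omega>) (whisker_l n B N \<alpha>)"
proof (induction n arbitrary: B C D N \<omega> \<alpha>)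
  case 0
  then show ?case by auto
next
  case (Suc n)
  note D = Suc.prems(1) and N = Suc.prems(2) and \<omega> = Suc.prems(3) and \<alpha> = Suc.prems(4)
    and eq = Suc.prems(5)
  note D' = is_cat_gcat[OF D]
  note wl = gtr_wl[OF D' N \<omega>] gtr_wl[OF D' N \<alpha>]
  have eq': "tgt (whisker_l (Suc n) B N \<omega>) = src (whisker_l (Suc n) B N \<alpha>)"
    by (simp only: tgt_whisker_l[OF \<omega>] src_whisker_l eq)
  note fob = gtr_fob_src[OF \<omega>] gtr_fob_src[OF \<alpha>] gtr_fob_tgt[OF \<alpha>] gmap_fob[OF N]
  note tob = gtr_tob[OF \<omega>, unfolded eq] gtr_tob[OF \<alpha>]
  show ?case
  proof (rule gtr_Suc_eqI[OF gtr_wl[OF D' N gtr_vcomp[OF D \<omega> \<alpha> eq]] gtr_vcomp[OF D wl eq']])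
    fix c c' assume c: "c \<in> ob B" "c' \<in> ob B"
    note c2 = fob(4)[OF c(1)] fob(4)[OF c(2)]
    show "thom (whisker_l (Suc n) B N (vcomp (Suc n) C D \<omega> \<alpha>)) c c' =
      thom (vcomp (Suc n) B D (whisker_l (Suc n) B N \<omega>) (whisker_l (Suc n) B N \<alpha>)) c c'"
      unfolding thom_vcomp[OF c] thom_whisker_l[OF c] thom_vcomp[OF c2]
      using c c2 wl_wr[OF is_cat_hom[OF D] gcat_hom[OF D'] gmap_fhom[OF N] gtr_thom[OF \<omega>, unfolded eq] is_fun_postcomp[OF D]]
       wl_wr[OF is_cat_hom[OF D] gcat_hom[OF D'] gmap_fhom[OF N] gtr_thom[OF \<alpha>] is_fun_precomp[OF D]]
      by (simp add: Suc.IH[OF is_cat_hom[OF D] gmap_fhom[OF N] vcomp_mid[OF D \<omega> \<alpha> eq], unfolded eq] tob fob eq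
          tgt_whisker_l[OF \<omega>] tgt_whisker_l[OF \<alpha>] del: gtr.simps is_cat.simps gcat.simps)
  qed (simp_all add: tgt_whisker_l[OF gtr_vcomp[OF D \<omega> \<alpha> eq]] tgt_vcomp[OF wl eq'] tgt_vcomp[OF \<omega> \<alpha> eq]
      tgt_whisker_l[OF \<alpha>] tgt_whisker_l[OF \<omega>] fob tob_vcomp tob_whisker_l
      del: vcomp.simps fcomp.simps whisker_l.simps)
qed

lemma wr_vcomp:
  "is_cat n D \<Longrightarrow> is_cat n E \<Longrightarrow> is_fun n D E L \<Longrightarrow> gtr n C D \<omega> \<Longrightarrow> gtr n C D \<alpha> \<Longrightarrow> tgt \<omega> = src \<alpha>
   \<Longrightarrow> whisker_r n C (vcomp n C D \<omega> \<alpha>) L = vcomp n C E (whisker_r n C \<omega> L) (whisker_r n C \<alpha> L)"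
proof (induction n arbitrary: C D E L \<omega> \<alpha>)
  case 0
  then show ?case by auto
next
  case (Suc n)
  note D = Suc.prems(1) and E = Suc.prems(2) and L = Suc.prems(3) and \<omega> = Suc.prems(4)
    and \<alpha> = Suc.prems(5) and eq = Suc.prems(6)
  note D' = is_cat_gcat[OF D] and E' = is_cat_gcat[OF E]
  note wr = gtr_wr[OF D E' \<omega> L] gtr_wr[OF D E' \<alpha> L]
  have eq': "tgt (whisker_r (Suc n) C \<omega> L) = src (whisker_r (Suc n) C \<alpha> L)"
    by (simp only: tgt_whisker_r[OF \<omega>] src_whisker_r eq)
  note fob = gtr_fob_src[OF \<omega>] gtr_fob_src[OF \<alpha>] gtr_fob_tgt[OF \<alpha>] is_fun_fob[OF L]
  note tob = gtr_tob[OF \<omega>, unfolded eq] gtr_tob[OF \<alpha>]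
  note dh = is_cat_hom[OF D] and eh = is_cat_hom[OF E] and Lh = is_fun_hom[OF L]
  show ?case
  proof (rule gtr_Suc_eqI[OF gtr_wr[OF D E' gtr_vcomp[OF D \<omega> \<alpha> eq] L] gtr_vcomp[OF E wr eq']])
    fix c c' assume c: "c \<in> ob C" "c' \<in> ob C"
    let ?F = "fob (src \<omega>)" and ?G = "fob (src \<alpha>)" and ?H = "fob (tgt \<alpha>)" and ?L = "fob L"
    note t = fob(1)[OF c(1)] fob(1)[OF c(2)] fob(2)[OF c(1)] fob(2)[OF c(2)] fob(3)[OF c(1)] fob(3)[OF c(2)]
      fob(4) c tob
    (* L carries composition with the component of \<omega> to composition with its image; the next
       step is the same for \<alpha> on the other side. *)
    have 1: "whisker_r n (hom C c c') (whisker_r n (hom C c c') (thom \<alpha> c c')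
         (precomp n D (?F c) (?G c) (?H c') (tob \<omega> c))) (fhom L (?F c) (?H c'))
       = whisker_r n (hom C c c') (whisker_r n (hom C c c') (thom \<alpha> c c') (fhom L (?G c) (?H c')))
         (precomp n E (?L (?F c)) (?L (?G c)) (?L (?H c')) (fob (fhom L (?F c) (?G c)) (tob \<omega> c)))" (is "?lhs = ?rhs")
    proof -
      have "?lhs = whisker_r n (hom C c c') (thom \<alpha> c c') (fcomp n (hom D (?G c) (?H c')) (precomp n D (?F c) (?G c) (?H c') (tob \<omega> c)) (fhom L (?F c) (?H c')))"
        by (rule wr_fcomp[symmetric, OF dh dh gcat_hom[OF E'] gtr_thom[OF \<alpha> c] is_fun_precomp[OF D] Lh])
          (simp_all add: t del: is_cat.simps)
      also have "\<dots> = whisker_r n (hom C c c') (thom \<alpha> c c') (fcomp n (hom D (?G c) (?H c')) (fhom L (?G c) (?H c'))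
          (precomp n E (?L (?F c)) (?L (?G c)) (?L (?H c')) (fob (fhom L (?F c) (?G c)) (tob \<omega> c))))"
        by (simp add: t precomp_fun[OF D E' L] del: is_cat.simps)
      also have "\<dots> = ?rhs"
        by (rule wr_fcomp[OF dh eh gcat_hom[OF E'] gtr_thom[OF \<alpha> c] Lh is_fun_precomp[OF E]])
          (simp_all add: t is_fun_fob[OF Lh] del: is_cat.simps)
      finally show ?thesis .
    qed
    have 2: "whisker_r n (hom C c c') (whisker_r n (hom C c c') (thom \<omega> c c')
         (postcomp n D (?F c) (?G c') (?H c') (tob \<alpha> c'))) (fhom L (?F c) (?H c'))
       = whisker_r n (hom C c c') (whisker_r n (hom C c c') (thom \<omega> c c') (fhom L (?F c) (?G c')))
         (postcomp n E (?L (?F c)) (?L (?G c')) (?L (?H c')) (fob (fhom L (?G c') (?H c')) (tob \<alpha> c')))" (is "?lhs = ?rhs")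
    proof -
      have "?lhs = whisker_r n (hom C c c') (thom \<omega> c c') (fcomp n (hom D (?F c) (?G c')) (postcomp n D (?F c) (?G c') (?H c') (tob \<alpha> c')) (fhom L (?F c) (?H c')))"
        by (rule wr_fcomp[symmetric, OF dh dh gcat_hom[OF E'] gtr_thom[OF \<omega> c, unfolded eq] is_fun_postcomp[OF D] Lh])
          (simp_all add: t del: is_cat.simps)
      also have "\<dots> = whisker_r n (hom C c c') (thom \<omega> c c') (fcomp n (hom D (?F c) (?G c')) (fhom L (?F c) (?G c'))
          (postcomp n E (?L (?F c)) (?L (?G c')) (?L (?H c')) (fob (fhom L (?G c') (?H c')) (tob \<alpha> c'))))"
        by (simp add: t postcomp_fun[OF D E' L] del: is_cat.simps)
      also have "\<dots> = ?rhs"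
        by (rule wr_fcomp[OF dh eh gcat_hom[OF E'] gtr_thom[OF \<omega> c, unfolded eq] Lh is_fun_postcomp[OF E]])
          (simp_all add: t is_fun_fob[OF Lh] del: is_cat.simps)
      finally show ?thesis .
    qed
    show "thom (whisker_r (Suc n) C (vcomp (Suc n) C D \<omega> \<alpha>) L) c c' =
      thom (vcomp (Suc n) C E (whisker_r (Suc n) C \<omega> L) (whisker_r (Suc n) C \<alpha> L)) c c'"
      unfolding thom_vcomp[OF c] thom_whisker_r[OF c]
      using 1 2
      by (simp add: Suc.IH[OF dh eh Lh vcomp_mid[OF D \<omega> \<alpha> eq], unfolded eq] t eq tgt_vcomp[OF \<omega> \<alpha> eq]
          tgt_whisker_r[OF \<omega>] tgt_whisker_r[OF \<alpha>] del: gtr.simps is_cat.simps gcat.simps vcomp.simps is_fun.simps)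
  qed (simp_all add: tgt_whisker_r[OF gtr_vcomp[OF D \<omega> \<alpha> eq]] tgt_vcomp[OF wr eq'] tgt_vcomp[OF \<omega> \<alpha> eq]
      tgt_whisker_r[OF \<alpha>] tgt_whisker_r[OF \<omega>] fob tob tob_vcomp tob_whisker_r
      fob_fhom_cmp[OF L] eq del: vcomp.simps fcomp.simps whisker_r.simps)
qed

lemma prod_vcomp:
  "is_cat n C \<Longrightarrow> is_cat n D \<Longrightarrow> gtr n A C \<omega> \<Longrightarrow> gtr n A C \<alpha> \<Longrightarrow> tgt \<omega> = src \<alpha>
   \<Longrightarrow> gtr n B D \<omega>' \<Longrightarrow> gtr n B D \<alpha>' \<Longrightarrow> tgt \<omega>' = src \<alpha>'
   \<Longrightarrow> prod_tr n A B (vcomp n A C \<omega> \<alpha>) (vcomp n B D \<omega>' \<alpha>') =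
      vcomp n (prod_cat n A B) (prod_cat n C D) (prod_tr n A B \<omega> \<omega>') (prod_tr n A B \<alpha> \<alpha>')"
proof (induction n arbitrary: A B C D \<omega> \<alpha> \<omega>' \<alpha>')
  case 0
  then show ?case by auto
next
  case (Suc n)
  note C = Suc.prems(1) and D = Suc.prems(2) and \<omega> = Suc.prems(3) and \<alpha> = Suc.prems(4)
    and eq = Suc.prems(5) and \<omega>' = Suc.prems(6) and \<alpha>' = Suc.prems(7) and eq' = Suc.prems(8)
  note C' = is_cat_gcat[OF C] and D' = is_cat_gcat[OF D]
  note p = gtr_prod[OF C' D' \<omega> \<omega>'] gtr_prod[OF C' D' \<alpha> \<alpha>']
  note v = gtr_vcomp[OF C \<omega> \<alpha> eq] gtr_vcomp[OF D \<omega>' \<alpha>' eq']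
  have eqp: "tgt (prod_tr (Suc n) A B \<omega> \<omega>') = src (prod_tr (Suc n) A B \<alpha> \<alpha>')"
    by (simp only: tgt_prod_tr[OF \<omega> \<omega>'] src_prod_tr eq eq')
  note fob = gtr_fob_src[OF \<omega>] gtr_fob_src[OF \<alpha>] gtr_fob_tgt[OF \<alpha>]
    gtr_fob_src[OF \<omega>'] gtr_fob_src[OF \<alpha>'] gtr_fob_tgt[OF \<alpha>']
  note tob = gtr_tob[OF \<omega>, unfolded eq] gtr_tob[OF \<alpha>] gtr_tob[OF \<omega>', unfolded eq'] gtr_tob[OF \<alpha>']
  note ch = is_cat_hom[OF C] gcat_hom[OF C'] and dh = is_cat_hom[OF D] gcat_hom[OF D']
  show ?case
  proof (rule gtr_Suc_eqI[OF gtr_prod[OF C' D' v] gtr_vcomp[OF is_cat_prod[OF C D] p eqp]])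
    fix c assume "c \<in> ob (prod_cat (Suc n) A B)"
    then show "tob (prod_tr (Suc n) A B (vcomp (Suc n) A C \<omega> \<alpha>) (vcomp (Suc n) B D \<omega>' \<alpha>')) c =
       tob (vcomp (Suc n) (prod_cat (Suc n) A B) (prod_cat (Suc n) C D)
           (prod_tr (Suc n) A B \<omega> \<omega>') (prod_tr (Suc n) A B \<alpha> \<alpha>')) c"
      by (auto simp: tob_vcomp tgt_prod_tr[OF \<omega> \<omega>'] tgt_prod_tr[OF \<alpha> \<alpha>'] eq eq' fob_cmp_prod tob
          simp del: vcomp.simps prod_cat.simps)
  next
    fix c c' assume cc: "c \<in> ob (prod_cat (Suc n) A B)" "c' \<in> ob (prod_cat (Suc n) A B)"
    then obtain a b a' b' where c: "c = (a, b)" "c' = (a', b')"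
      and ab: "a \<in> ob A" "b \<in> ob B" "a' \<in> ob A" "b' \<in> ob B" by auto
    let ?F = "fob (src \<omega>)" and ?G = "fob (src \<alpha>)" and ?H = "fob (tgt \<alpha>)"
    let ?F' = "fob (src \<omega>')" and ?G' = "fob (src \<alpha>')" and ?H' = "fob (tgt \<alpha>')"
    have 1: "whisker_r n (prod_cat n (hom A a a') (hom B b b'))
        (prod_tr n (hom A a a') (hom B b b') (thom \<alpha> a a') (thom \<alpha>' b b'))
        (precomp n (prod_cat (Suc n) C D) (?F a, ?F' b) (?G a, ?G' b) (?H a', ?H' b') (tob \<omega> a, tob \<omega>' b))
      = prod_tr n (hom A a a') (hom B b b')
         (whisker_r n (hom A a a') (thom \<alpha> a a') (precomp n C (?F a) (?G a) (?H a') (tob \<omega> a)))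
         (whisker_r n (hom B b b') (thom \<alpha>' b b') (precomp n D (?F' b) (?G' b) (?H' b') (tob \<omega>' b)))"
      using ab fob tob
      by (simp add: precomp_prod[OF C' D'] wr_prod[OF ch(1) dh(1) ch(2) dh(2) gtr_thom[OF \<alpha>] gtr_thom[OF \<alpha>']
           is_fun_precomp[OF C] is_fun_precomp[OF D]] del: is_cat.simps gcat.simps prod_cat.simps)
    have 2: "whisker_r n (prod_cat n (hom A a a') (hom B b b'))
        (prod_tr n (hom A a a') (hom B b b') (thom \<omega> a a') (thom \<omega>' b b'))
        (postcomp n (prod_cat (Suc n) C D) (?F a, ?F' b) (?G a', ?G' b') (?H a', ?H' b') (tob \<alpha> a', tob \<alpha>' b'))
      = prod_tr n (hom A a a') (hom B b b')
         (whisker_r n (hom A a a') (thom \<omega> a a') (postcomp n C (?F a) (?G a') (?H a') (tob \<alpha> a')))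
         (whisker_r n (hom B b b') (thom \<omega>' b b') (postcomp n D (?F' b) (?G' b') (?H' b') (tob \<alpha>' b')))"
      using ab fob tob
      by (simp add: postcomp_prod[OF C' D'] wr_prod[OF ch(1) dh(1) ch(2) dh(2) gtr_thom[OF \<omega>, unfolded eq]
           gtr_thom[OF \<omega>', unfolded eq'] is_fun_postcomp[OF C] is_fun_postcomp[OF D]]
          del: is_cat.simps gcat.simps prod_cat.simps)
    have 3: "thom (prod_tr (Suc n) A B \<beta> \<gamma>) (a, b) (a', b') =
        prod_tr n (hom A a a') (hom B b b') (thom \<beta> a a') (thom \<gamma> b b')" for \<beta> \<gamma>
      using ab by simp
    show "thom (prod_tr (Suc n) A B (vcomp (Suc n) A C \<omega> \<alpha>) (vcomp (Suc n) B D \<omega>' \<alpha>')) c c' =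
       thom (vcomp (Suc n) (prod_cat (Suc n) A B) (prod_cat (Suc n) C D)
           (prod_tr (Suc n) A B \<omega> \<omega>') (prod_tr (Suc n) A B \<alpha> \<alpha>')) c c'"
      unfolding thom_vcomp[OF cc] unfolding c 3 thom_vcomp[OF ab(1,3)] thom_vcomp[OF ab(2,4)]
      using ab fob 1 2
      by (simp add: Suc.IH[OF ch(1) dh(1) vcomp_mid[OF C \<omega> \<alpha> eq] vcomp_mid[OF D \<omega>' \<alpha>' eq'], unfolded eq eq']
          tgt_prod_tr[OF \<omega> \<omega>'] tgt_prod_tr[OF \<alpha> \<alpha>'] eq eq'
          del: is_cat.simps gcat.simps prod_cat.simps(2))
  qed (simp_all add: tgt_prod_tr[OF v] tgt_vcomp[OF p eqp] tgt_vcomp[OF \<omega> \<alpha> eq] tgt_vcomp[OF \<omega>' \<alpha>' eq']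
      tgt_prod_tr[OF \<alpha> \<alpha>'] del: vcomp.simps prod_cat.simps prod_tr.simps prod_fun.simps)
qed

lemma vcomp_assoc:
  "is_cat n D \<Longrightarrow> gtr n C D \<omega> \<Longrightarrow> gtr n C D \<alpha> \<Longrightarrow> gtr n C D \<beta> \<Longrightarrow> tgt \<omega> = src \<alpha> \<Longrightarrow> tgt \<alpha> = src \<beta>
   \<Longrightarrow> vcomp n C D (vcomp n C D \<omega> \<alpha>) \<beta> = vcomp n C D \<omega> (vcomp n C D \<alpha> \<beta>)"
proof (induction n arbitrary: C D \<omega> \<alpha> \<beta>)
  case 0
  then show ?case by auto
next
  case (Suc n)
  note D = Suc.prems(1) and \<omega> = Suc.prems(2) and \<alpha> = Suc.prems(3) and \<beta> = Suc.prems(4)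
    and e1 = Suc.prems(5) and e2 = Suc.prems(6)
  note D' = is_cat_gcat[OF D]
  note \<omega>\<alpha> = gtr_vcomp[OF D \<omega> \<alpha> e1] and \<alpha>\<beta> = gtr_vcomp[OF D \<alpha> \<beta> e2]
  note tv = tgt_vcomp[OF \<omega> \<alpha> e1] tgt_vcomp[OF \<alpha> \<beta> e2]
  have e3: "tgt (vcomp (Suc n) C D \<omega> \<alpha>) = src \<beta>" and e4: "tgt \<omega> = src (vcomp (Suc n) C D \<alpha> \<beta>)"
    by (simp_all only: tv e1 e2 src_vcomp)
  note fob = gtr_fob_src[OF \<omega>] gtr_fob_src[OF \<alpha>] gtr_fob_src[OF \<beta>] gtr_fob_tgt[OF \<beta>]
  note tob = gtr_tob[OF \<omega>, unfolded e1] gtr_tob[OF \<alpha>, unfolded e2] gtr_tob[OF \<beta>]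
  note dh = is_cat_hom[OF D] and dg = gcat_hom[OF D']
  show ?case
  proof (rule gtr_Suc_eqI[OF gtr_vcomp[OF D \<omega>\<alpha> \<beta> e3] gtr_vcomp[OF D \<omega> \<alpha>\<beta> e4]])
    fix c c' assume c: "c \<in> ob C" "c' \<in> ob C"
    let ?F = "fob (src \<omega>)" and ?G = "fob (src \<alpha>)" and ?H = "fob (src \<beta>)" and ?K = "fob (tgt \<beta>)"
    let ?X = "hom C c c'"
    let ?w = "whisker_r n ?X" and ?v = "vcomp n ?X (hom D (?F c) (?K c'))"
    note t = fob[OF c(1)] fob[OF c(2)] tob[OF c(1)] tob[OF c(2)]
    note th = gtr_thom[OF \<omega> c, unfolded e1] gtr_thom[OF \<alpha> c, unfolded e2] gtr_thom[OF \<beta> c]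
    let ?\<omega>\<alpha> = "fob (cmp D (?F c) (?G c) (?H c)) (tob \<omega> c, tob \<alpha> c)"
    let ?\<alpha>\<beta> = "fob (cmp D (?G c') (?H c') (?K c')) (tob \<alpha> c', tob \<beta> c')"
    (* Both sides become a threefold vertical composite in the hom: composing with two 1-cells
       in turn is composing with their composite (1, 2), and the compositions with the outer
       components on the two sides of the component of \<alpha> commute (3). *)
    have 1: "?w (?w (thom \<beta> c c') (precomp n D (?G c) (?H c) (?K c') (tob \<alpha> c)))
         (precomp n D (?F c) (?G c) (?K c') (tob \<omega> c))
       = ?w (thom \<beta> c c') (precomp n D (?F c) (?H c) (?K c') ?\<omega>\<alpha>)"
      by (subst wr_fcomp[symmetric, OF dh dh dg th(3) is_fun_precomp[OF D] is_fun_precomp[OF D]])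
        (simp_all add: t precomp_precomp[OF D] del: is_cat.simps)
    have 2: "?w (?w (thom \<omega> c c') (postcomp n D (?F c) (?G c') (?H c') (tob \<alpha> c')))
         (postcomp n D (?F c) (?H c') (?K c') (tob \<beta> c'))
       = ?w (thom \<omega> c c') (postcomp n D (?F c) (?G c') (?K c') ?\<alpha>\<beta>)"
      by (subst wr_fcomp[symmetric, OF dh dh dg th(1) is_fun_postcomp[OF D] is_fun_postcomp[OF D]])
        (simp_all add: t postcomp_postcomp[OF D] del: is_cat.simps)
    have 3: "?w (?w (thom \<alpha> c c') (precomp n D (?F c) (?G c) (?H c') (tob \<omega> c)))
         (postcomp n D (?F c) (?H c') (?K c') (tob \<beta> c'))
       = ?w (?w (thom \<alpha> c c') (postcomp n D (?G c) (?H c') (?K c') (tob \<beta> c')))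
         (precomp n D (?F c) (?G c) (?K c') (tob \<omega> c))" (is "?l = ?r")
    proof -
      have "?l = ?w (thom \<alpha> c c') (fcomp n (hom D (?G c) (?H c'))
          (precomp n D (?F c) (?G c) (?H c') (tob \<omega> c)) (postcomp n D (?F c) (?H c') (?K c') (tob \<beta> c')))"
        by (rule wr_fcomp[symmetric, OF dh dh dg th(2) is_fun_precomp[OF D] is_fun_postcomp[OF D]])
          (simp_all add: t)
      also have "\<dots> = ?w (thom \<alpha> c c') (fcomp n (hom D (?G c) (?H c'))
          (postcomp n D (?G c) (?H c') (?K c') (tob \<beta> c')) (precomp n D (?F c) (?G c) (?K c') (tob \<omega> c)))"
        by (simp add: precomp_postcomp[OF D] t)
      also have "\<dots> = ?r"
        by (rule wr_fcomp[OF dh dh dg th(2) is_fun_postcomp[OF D] is_fun_precomp[OF D]])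
          (simp_all add: t)
      finally show ?thesis .
    qed
    note m1 = vcomp_mid[OF D \<omega> \<alpha> e1 c, unfolded e1 e2] and m2 = vcomp_mid[OF D \<alpha> \<beta> e2 c, unfolded e1 e2]
      and m3 = vcomp_mid[OF D \<omega>\<alpha> \<beta> e3 c, unfolded tv e1 e2 src_vcomp thom_vcomp[OF c] tob_vcomp[OF c(1)] tob_vcomp[OF c(2)]]
      and m4 = vcomp_mid[OF D \<omega> \<alpha>\<beta> e4 c, unfolded tv e1 e2 src_vcomp thom_vcomp[OF c] tob_vcomp[OF c(1)] tob_vcomp[OF c(2)]]
    have 4: "?w (vcomp n ?X (hom D (?F c) (?H c'))
        (?w (thom \<alpha> c c') (precomp n D (?F c) (?G c) (?H c') (tob \<omega> c)))
        (?w (thom \<omega> c c') (postcomp n D (?F c) (?G c') (?H c') (tob \<alpha> c'))))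
        (postcomp n D (?F c) (?H c') (?K c') (tob \<beta> c'))
      = ?v (?w (?w (thom \<alpha> c c') (precomp n D (?F c) (?G c) (?H c') (tob \<omega> c)))
            (postcomp n D (?F c) (?H c') (?K c') (tob \<beta> c')))
          (?w (?w (thom \<omega> c c') (postcomp n D (?F c) (?G c') (?H c') (tob \<alpha> c')))
            (postcomp n D (?F c) (?H c') (?K c') (tob \<beta> c')))"
      by (rule wr_vcomp[OF dh dh is_fun_postcomp[OF D] m1]) (simp_all add: t)
    have 5: "?w (vcomp n ?X (hom D (?G c) (?K c'))
        (?w (thom \<beta> c c') (precomp n D (?G c) (?H c) (?K c') (tob \<alpha> c)))
        (?w (thom \<alpha> c c') (postcomp n D (?G c) (?H c') (?K c') (tob \<beta> c'))))
        (precomp n D (?F c) (?G c) (?K c') (tob \<omega> c))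
      = ?v (?w (?w (thom \<beta> c c') (precomp n D (?G c) (?H c) (?K c') (tob \<alpha> c)))
            (precomp n D (?F c) (?G c) (?K c') (tob \<omega> c)))
          (?w (?w (thom \<alpha> c c') (postcomp n D (?G c) (?H c') (?K c') (tob \<beta> c')))
            (precomp n D (?F c) (?G c) (?K c') (tob \<omega> c)))"
      by (rule wr_vcomp[OF dh dh is_fun_precomp[OF D] m2]) (simp_all add: t)
    have Dh: "is_cat n (hom D (?F c) (?K c'))" using t by (intro dh)
    have g1: "gtr n ?X (hom D (?F c) (?K c')) (?w (thom \<beta> c c') (precomp n D (?F c) (?H c) (?K c') ?\<omega>\<alpha>))"
      by (rule m3(1))
    have g2: "gtr n ?X (hom D (?F c) (?K c')) (?w (thom \<omega> c c') (postcomp n D (?F c) (?G c') (?K c') ?\<alpha>\<beta>))"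
      by (rule m4(2))
    have g3: "gtr n ?X (hom D (?F c) (?K c')) (?w (?w (thom \<alpha> c c') (precomp n D (?F c) (?G c) (?H c') (tob \<omega> c)))
            (postcomp n D (?F c) (?H c') (?K c') (tob \<beta> c')))"
      by (rule gtr_wr[OF dh dg m1(1) is_fun_postcomp[OF D]]) (simp_all add: t)
    have c1: "tgt (?w (thom \<beta> c c') (precomp n D (?F c) (?H c) (?K c') ?\<omega>\<alpha>)) =
        src (?w (?w (thom \<alpha> c c') (precomp n D (?F c) (?G c) (?H c') (tob \<omega> c)))
            (postcomp n D (?F c) (?H c') (?K c') (tob \<beta> c')))"
      using m3(3) by (simp only: 4 src_vcomp)
    have c2: "tgt (?w (?w (thom \<alpha> c c') (precomp n D (?F c) (?G c) (?H c') (tob \<omega> c)))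
            (postcomp n D (?F c) (?H c') (?K c') (tob \<beta> c'))) =
        src (?w (thom \<omega> c c') (postcomp n D (?F c) (?G c') (?K c') ?\<alpha>\<beta>))"
      by (simp only: 2[symmetric] src_whisker_r tgt_whisker_r[OF m1(1)] m1(3))
    show "thom (vcomp (Suc n) C D (vcomp (Suc n) C D \<omega> \<alpha>) \<beta>) c c' =
      thom (vcomp (Suc n) C D \<omega> (vcomp (Suc n) C D \<alpha> \<beta>)) c c'"
      unfolding thom_vcomp[OF c] tv src_vcomp e1 e2 tob_vcomp[OF c(1)] tob_vcomp[OF c(2)] 4 5 1 2
        3[symmetric]
      by (rule Suc.IH[OF Dh g1 g3 g2 c1 c2, symmetric])
  qed (simp_all add: tgt_vcomp[OF \<omega>\<alpha> \<beta> e3] tgt_vcomp[OF \<omega> \<alpha>\<beta> e4] tv tob_vcomp e1 e2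
      fob_cmp_assoc[OF D] fob tob del: vcomp.simps is_cat.simps)
qed

text \<open>
  Both sides are \<open>\<alpha> \<times> \<beta>\<close>, by the unit laws for vertical composition. This independence of the order is
  what makes vertical composites of 2-morphisms satisfy the composition law.
\<close>

lemma prod_interchange:
  assumes "is_cat n A'" "is_cat n B'" "gtr n A A' \<alpha>" "gtr n B B' \<beta>"
  shows "vcomp n (prod_cat n A B) (prod_cat n A' B')
      (prod_tr n A B (id_tr n A A' (src \<alpha>)) \<beta>) (prod_tr n A B \<alpha> (id_tr n B B' (tgt \<beta>)))
    = vcomp n (prod_cat n A B) (prod_cat n A' B')
      (prod_tr n A B \<alpha> (id_tr n B B' (src \<beta>))) (prod_tr n A B (id_tr n A A' (tgt \<alpha>)) \<beta>)"
  by (simp add: prod_vcomp[symmetric] gtr_id assms gtr_src[OF assms(3)] gtr_tgt[OF assms(3)]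
      gtr_src[OF assms(4)] gtr_tgt[OF assms(4)] vcomp_id[OF assms(1,3)] vcomp_id[OF assms(2,4)])

section \<open>Closure properties of 2-morphisms\<close>

lemma is_tr_gtr: "is_tr n C D \<alpha> \<Longrightarrow> gtr n C D \<alpha>"
proof (induction n arbitrary: C D \<alpha>)
  case 0
  then show ?case by (auto simp del: is_fun.simps intro: is_fun_gmap)
next
  case (Suc n)
  then show ?case
    by (auto simp del: is_fun.simps gmap_Fun simp: is_fun_gmap Suc.IH)
qed

lemma is_tr_src: "is_tr n C D \<alpha> \<Longrightarrow> is_fun n C D (src \<alpha>)"
  by (cases n) (auto simp del: is_fun.simps)

lemma is_tr_tgt: "is_tr n C D \<alpha> \<Longrightarrow> is_fun n C D (tgt \<alpha>)"
  by (cases n) (auto simp del: is_fun.simps)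

lemma is_tr_thom:
  "is_tr (Suc n) C D \<alpha> \<Longrightarrow> c \<in> ob C \<Longrightarrow> c' \<in> ob C
   \<Longrightarrow> is_tr n (hom C c c') (hom D (fob (src \<alpha>) c) (fob (tgt \<alpha>) c')) (thom \<alpha> c c')"
  by (auto simp del: is_fun.simps)

lemma is_tr_unt:
  "is_tr (Suc n) C D \<alpha> \<Longrightarrow> c \<in> ob C \<Longrightarrow>
     whisker_l n (terminal n) (unt C c) (thom \<alpha> c c) =
     id_tr n (terminal n) (hom D (fob (src \<alpha>) c) (fob (tgt \<alpha>) c))
       (point_fun n (hom D (fob (src \<alpha>) c) (fob (tgt \<alpha>) c)) (tob \<alpha> c))"
  by (auto simp del: is_fun.simps)

text \<open>The right-hand side of the composition law of a 2-morphism.\<close>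

definition tr_comp :: "nat \<Rightarrow> 'a ncat \<Rightarrow> 'b ncat \<Rightarrow> ('a, 'b) ntr \<Rightarrow> 'a \<Rightarrow> 'a \<Rightarrow> 'a \<Rightarrow> ('a \<times> 'a, 'b) ntr"
  where "tr_comp n C D \<alpha> c c' c'' =
    (let X = hom C c c'; Y = hom C c' c''; XY = prod_cat n X Y; F = src \<alpha>; G = tgt \<alpha>; t = thom \<alpha> in
     vcomp n XY (hom D (fob F c) (fob G c''))
       (whisker_r n XY
         (prod_tr n X Y (t c c') (id_tr n Y (hom D (fob G c') (fob G c'')) (fhom G c' c'')))
         (cmp D (fob F c) (fob G c') (fob G c'')))
       (whisker_r n XY
         (prod_tr n X Y (id_tr n X (hom D (fob F c) (fob F c')) (fhom F c c')) (t c' c''))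
         (cmp D (fob F c) (fob F c') (fob G c''))))"

lemma is_tr_cmp:
  "is_tr (Suc n) C D \<alpha> \<Longrightarrow> c \<in> ob C \<Longrightarrow> c' \<in> ob C \<Longrightarrow> c'' \<in> ob C \<Longrightarrow>
     whisker_l n (prod_cat n (hom C c c') (hom C c' c'')) (cmp C c c' c'') (thom \<alpha> c c'') =
     tr_comp n C D \<alpha> c c' c''"
  by (auto simp: Let_def tr_comp_def simp del: is_fun.simps)

lemma is_tr_SucI:
  assumes \<alpha>: "gtr (Suc n) C D \<alpha>" and "is_fun (Suc n) C D (src \<alpha>)" "is_fun (Suc n) C D (tgt \<alpha>)"
    and "\<And>c c'. c \<in> ob C \<Longrightarrow> c' \<in> ob C
      \<Longrightarrow> is_tr n (hom C c c') (hom D (fob (src \<alpha>) c) (fob (tgt \<alpha>) c')) (thom \<alpha> c c')"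
    and "\<And>c. c \<in> ob C \<Longrightarrow> whisker_l n (terminal n) (unt C c) (thom \<alpha> c c) =
     id_tr n (terminal n) (hom D (fob (src \<alpha>) c) (fob (tgt \<alpha>) c))
       (point_fun n (hom D (fob (src \<alpha>) c) (fob (tgt \<alpha>) c)) (tob \<alpha> c))"
    and "\<And>c c' c''. c \<in> ob C \<Longrightarrow> c' \<in> ob C \<Longrightarrow> c'' \<in> ob C
      \<Longrightarrow> whisker_l n (prod_cat n (hom C c c') (hom C c' c'')) (cmp C c c' c'') (thom \<alpha> c c'') =
         tr_comp n C D \<alpha> c c' c''"
  shows "is_tr (Suc n) C D \<alpha>"
  unfolding is_tr.simps
  by (intro exI[of _ "src \<alpha>"] exI[of _ "tgt \<alpha>"] exI[of _ "tob \<alpha>"] bexI[of _ "thom \<alpha>"] conjI ballI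
      gtr_eta[OF \<alpha>] gtr_tob_PiE[OF \<alpha>] gtr_thom_PiE[OF \<alpha>] gtr_thom_src[OF \<alpha>] gtr_thom_tgt[OF \<alpha>])
    (use assms in \<open>simp_all add: tr_comp_def Let_def del: is_fun.simps gtr.simps\<close>)

lemma point_unt:
  assumes D: "is_cat (Suc n) D" and x: "x \<in> ob D"
  shows "point_fun n (hom D x x) (fob (unt D x) ()) = unt D x"
  by (rule gmap_eqI[OF gmap_point[OF gcat_hom[OF is_cat_gcat[OF D] x x] fob_unt[OF is_cat_gcat[OF D] x]]
        gcat_unt[OF is_cat_gcat[OF D] x]])
    (simp add: capp_point_unt[OF D x])

lemma point_fun_fcomp:
  assumes "gcat n Y" "gcat n Z" "is_fun n Y Z L" "y \<in> ob Y"
  shows "fcomp n (terminal n) (point_fun n Y y) L = point_fun n Z (fob L y)"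
  by (rule gmap_eqI[OF gmap_fcomp[OF gmap_point is_fun_gmap] gmap_point])
    (use assms in \<open>simp_all add: capp_point is_fun_fob\<close>)

lemma is_tr_id: "gcat n C \<Longrightarrow> is_cat n D \<Longrightarrow> is_fun n C D F \<Longrightarrow> is_tr n C D (id_tr n C D F)"
proof (induction n arbitrary: C D F)
  case 0
  then show ?case by auto
next
  case (Suc n)
  note C = Suc.prems(1) and D = Suc.prems(2) and F = Suc.prems(3)
  note F' = is_fun_gmap[OF F]
  note dh = is_cat_hom[OF D] and hom = gmap_fhom[OF F'] and fob = gmap_fob[OF F']
  show ?case
  proof (rule is_tr_SucI[OF gtr_id[OF D F']])
    fix c c' assume "c \<in> ob C" "c' \<in> ob C"
    then show "is_tr n (hom C c c') (hom D (fob (src (id_tr (Suc n) C D F)) c)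
        (fob (tgt (id_tr (Suc n) C D F)) c')) (thom (id_tr (Suc n) C D F) c c')"
      using Suc.IH[OF gcat_hom[OF C] dh is_fun_hom[OF F]] fob by (simp del: is_cat.simps)
  next
    fix c assume "c \<in> ob C"
    then show "whisker_l n (terminal n) (unt C c) (thom (id_tr (Suc n) C D F) c c) =
     id_tr n (terminal n) (hom D (fob (src (id_tr (Suc n) C D F)) c) (fob (tgt (id_tr (Suc n) C D F)) c))
       (point_fun n (hom D (fob (src (id_tr (Suc n) C D F)) c) (fob (tgt (id_tr (Suc n) C D F)) c))
        (tob (id_tr (Suc n) C D F) c))"
      using wl_id[OF dh gcat_unt[OF C] hom] is_fun_unt_eq[OF F] fob
      by (simp add: point_unt[OF D] del: is_cat.simps)
  next
    fix c c' c'' assume c: "c \<in> ob C" "c' \<in> ob C" "c'' \<in> ob C"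
    let ?XY = "prod_cat n (hom C c c') (hom C c' c'')"
    let ?P = "prod_fun n (hom C c c') (hom C c' c'') (fhom F c c') (fhom F c' c'')"
    let ?m = "cmp D (fob F c) (fob F c') (fob F c'')"
    let ?i = "id_tr n ?XY (hom D (fob F c) (fob F c''))"
    note p = gmap_prod[OF hom hom, OF c(1,2,2,3)]
    have "whisker_r n ?XY (id_tr n ?XY (prod_cat n (hom D (fob F c) (fob F c')) (hom D (fob F c') (fob F c''))) ?P) ?m
        = ?i (fcomp n ?XY ?P ?m)"
      by (rule wr_id[OF is_cat_prod[OF dh dh] dh p is_cat_cmp[OF D]]) (use c fob in auto)
    moreover have "vcomp n ?XY (hom D (fob F c) (fob F c'')) (?i (fcomp n ?XY ?P ?m)) (?i (fcomp n ?XY ?P ?m))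
        = ?i (fcomp n ?XY ?P ?m)"
      using vcomp_id[OF dh gtr_id[OF dh gmap_fcomp[OF p gcat_cmp[OF is_cat_gcat[OF D]]]]] c fob by simp
    moreover have "whisker_l n ?XY (cmp C c c' c'') (id_tr n (hom C c c'') (hom D (fob F c) (fob F c'')) (fhom F c c''))
        = ?i (fcomp n ?XY ?P ?m)"
      using wl_id[OF dh gcat_cmp[OF C] hom] is_fun_cmp_eq[OF F] c fob by (simp del: is_cat.simps gcat.simps is_fun.simps)
    ultimately show "whisker_l n (prod_cat n (hom C c c') (hom C c' c'')) (cmp C c c' c'')
        (thom (id_tr (Suc n) C D F) c c'') = tr_comp n C D (id_tr (Suc n) C D F) c c' c''"
      using c fob by (simp add: tr_comp_def Let_def prod_id[OF dh dh hom hom] del: is_cat.simps)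
  qed (use F in \<open>simp_all add: point_unt[OF D] del: is_cat.simps is_fun.simps\<close>)
qed

text \<open>
  The horizontal composite of two 2-morphisms a and b is their product whiskered with the composition
  functor. By associativity of composition, composing it with a 1-cell at either end amounts to
  composing the adjacent factor with that 1-cell, and a 1-cell in the middle can be absorbed into
  either factor.
\<close>

context
  fixes n D x y z
  assumes D: "is_cat (Suc n) D" and x: "x \<in> ob D" and y: "y \<in> ob D" and z: "z \<in> ob D"
begin

private lemmas D' = is_cat_gcat[OF D]
private lemmas dh = is_cat_hom[OF D]
private lemmas dg = gcat_hom[OF D']

lemma gtr_hcomp:
  assumes "gtr n X (hom D x y) a" "gtr n Y (hom D y z) b"
  shows "gtr n (prod_cat n X Y) (hom D x z)
    (whisker_r n (prod_cat n X Y) (prod_tr n X Y a b) (cmp D x y z))"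
  using assms x y z
  by (intro gtr_wr[OF is_cat_prod[OF dh dh] dg gtr_prod[OF dg dg] is_cat_cmp[OF D]])

lemma tgt_hcomp:
  assumes "gtr n X (hom D x y) a" "gtr n Y (hom D y z) b"
  shows "tgt (whisker_r n (prod_cat n X Y) (prod_tr n X Y a b) (cmp D x y z)) =
    fcomp n (prod_cat n X Y) (prod_fun n X Y (tgt a) (tgt b)) (cmp D x y z)"
  using assms x y z
  by (simp add: tgt_whisker_r[OF gtr_prod[OF dg dg assms]] tgt_prod_tr[OF assms])

lemma hcomp_fun:
  assumes E: "is_cat (Suc n) E" and L: "is_fun (Suc n) D E L"
    and a: "gtr n X (hom D x y) a" and b: "gtr n Y (hom D y z) b"
  shows "whisker_r n (prod_cat n X Y)
      (whisker_r n (prod_cat n X Y) (prod_tr n X Y a b) (cmp D x y z)) (fhom L x z) =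
    whisker_r n (prod_cat n X Y)
      (prod_tr n X Y (whisker_r n X a (fhom L x y)) (whisker_r n Y b (fhom L y z)))
      (cmp E (fob L x) (fob L y) (fob L z))"
proof -
  note E' = is_cat_gcat[OF E]
  note Lo = is_fun_fob[OF L x] is_fun_fob[OF L y] is_fun_fob[OF L z]
  note eh = is_cat_hom[OF E] and eg = gcat_hom[OF E']
  note p = gtr_prod[OF dg[OF x y] dg[OF y z] a b]
  note pc = is_cat_prod[OF dh[OF x y] dh[OF y z]]
    is_cat_prod[OF eh[OF Lo(1,2)] eh[OF Lo(2,3)]]
  note Lh = is_fun_hom[OF L x y] is_fun_hom[OF L y z] is_fun_hom[OF L x z]
  note Lp = is_fun_prod[OF dg[OF x y] dg[OF y z] eg[OF Lo(1,2)] eg[OF Lo(2,3)] Lh(1,2)]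
  show ?thesis
    by (simp only: wr_fcomp[symmetric, OF pc(1) dh[OF x z] eg[OF Lo(1,3)] p is_cat_cmp[OF D x y z] Lh(3)]
        is_fun_cmp_eq[OF L x y z] wr_fcomp[OF pc eg[OF Lo(1,3)] p Lp is_cat_cmp[OF E Lo]]
        wr_prod[OF dh[OF x y] dh[OF y z] eg[OF Lo(1,2)] eg[OF Lo(2,3)] a b Lh(1,2)])
qed

lemma hcomp_precomp:
  assumes w: "w \<in> ob D" and f: "f \<in> ob (hom D w x)"
    and a: "gtr n X (hom D x y) a" and b: "gtr n Y (hom D y z) b"
  shows "whisker_r n (prod_cat n X Y)
      (whisker_r n (prod_cat n X Y) (prod_tr n X Y a b) (cmp D x y z)) (precomp n D w x z f) =
    whisker_r n (prod_cat n X Y)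
      (prod_tr n X Y (whisker_r n X a (precomp n D w x y f)) b) (cmp D w y z)"
proof -
  note p = gtr_prod[OF dg[OF x y] dg[OF y z] a b]
  note pc = is_cat_prod[OF dh[OF x y] dh[OF y z]] is_cat_prod[OF dh[OF w y] dh[OF y z]]
  note i = is_fun_id[OF dg[OF y z]]
  note pre = is_fun_precomp[OF D w x y f] is_fun_precomp[OF D w x z f]
  have "fcomp n (prod_cat n (hom D x y) (hom D y z)) (cmp D x y z) (precomp n D w x z f) =
    fcomp n (prod_cat n (hom D x y) (hom D y z)) (prod_fun n (hom D x y) (hom D y z)
      (precomp n D w x y f) (id_fun n (hom D y z))) (cmp D w y z)"
  proof (rule gmap_eqI[OF gmap_fcomp[OF gcat_cmp[OF D' x y z] is_fun_gmap[OF pre(2)]]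
        gmap_fcomp[OF gmap_prod[OF is_fun_gmap[OF pre(1)] gmap_id] gcat_cmp[OF D' w y z]]])
    fix c assume c: "is_cell n (prod_cat n (hom D x y) (hom D y z)) c"
    then have c': "is_cell n (hom D x y) (cfst c)" "is_cell n (hom D y z) (csnd c)"
      by (simp_all add: cell_prod_cat)
    then have "is_cell n (terminal n) (cbang c)"
      using cell_cbang[OF c'(1)] by simp
    moreover have "is_cell n (hom D x z) (capp (cmp D x y z) c)"
      using gmap_cell[OF gcat_cmp[OF D' x y z] c] .
    ultimately show "capp (fcomp n (prod_cat n (hom D x y) (hom D y z)) (cmp D x y z) (precomp n D w x z f)) c
       = capp (fcomp n (prod_cat n (hom D x y) (hom D y z)) (prod_fun n (hom D x y) (hom D y z)
      (precomp n D w x y f) (id_fun n (hom D y z))) (cmp D w y z)) c"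
      using cat_assoc[OF D w x y z cell_point[OF dg[OF w x] f] c'] c c' by simp
  qed
  then show ?thesis
    by (simp only: wr_fcomp[symmetric, OF pc(1) dh[OF x z] dg[OF w z] p is_cat_cmp[OF D x y z] pre(2)]
        wr_fcomp[OF pc dg[OF w z] p is_fun_prod[OF dg[OF x y] dg[OF y z] dg[OF w y] dg[OF y z] pre(1) i] is_cat_cmp[OF D w y z]]
        wr_prod[OF dh[OF x y] dh[OF y z] dg[OF w y] dg[OF y z] a b pre(1) i] wr_id_fun[OF dh[OF y z] b])
qed

lemma hcomp_postcomp:
  assumes w: "w \<in> ob D" and f: "f \<in> ob (hom D z w)"
    and a: "gtr n X (hom D x y) a" and b: "gtr n Y (hom D y z) b"
  shows "whisker_r n (prod_cat n X Y)
      (whisker_r n (prod_cat n X Y) (prod_tr n X Y a b) (cmp D x y z)) (postcomp n D x z w f) =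
    whisker_r n (prod_cat n X Y)
      (prod_tr n X Y a (whisker_r n Y b (postcomp n D y z w f))) (cmp D x y w)"
proof -
  note p = gtr_prod[OF dg[OF x y] dg[OF y z] a b]
  note pc = is_cat_prod[OF dh[OF x y] dh[OF y z]] is_cat_prod[OF dh[OF x y] dh[OF y w]]
  note i = is_fun_id[OF dg[OF x y]]
  note pre = is_fun_postcomp[OF D y z w f] is_fun_postcomp[OF D x z w f]
  have "fcomp n (prod_cat n (hom D x y) (hom D y z)) (cmp D x y z) (postcomp n D x z w f) =
    fcomp n (prod_cat n (hom D x y) (hom D y z)) (prod_fun n (hom D x y) (hom D y z)
      (id_fun n (hom D x y)) (postcomp n D y z w f)) (cmp D x y w)"
  proof (rule gmap_eqI[OF gmap_fcomp[OF gcat_cmp[OF D' x y z] is_fun_gmap[OF pre(2)]]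
        gmap_fcomp[OF gmap_prod[OF gmap_id is_fun_gmap[OF pre(1)]] gcat_cmp[OF D' x y w]]])
    fix c assume c: "is_cell n (prod_cat n (hom D x y) (hom D y z)) c"
    then have c': "is_cell n (hom D x y) (cfst c)" "is_cell n (hom D y z) (csnd c)"
      by (simp_all add: cell_prod_cat)
    then have "is_cell n (terminal n) (cbang c)"
      using cell_cbang[OF c'(1)] by simp
    moreover have "is_cell n (hom D x z) (capp (cmp D x y z) c)"
      using gmap_cell[OF gcat_cmp[OF D' x y z] c] .
    ultimately show "capp (fcomp n (prod_cat n (hom D x y) (hom D y z)) (cmp D x y z) (postcomp n D x z w f)) c
       = capp (fcomp n (prod_cat n (hom D x y) (hom D y z)) (prod_fun n (hom D x y) (hom D y z)
      (id_fun n (hom D x y)) (postcomp n D y z w f)) (cmp D x y w)) c"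
      using cat_assoc[OF D x y z w c' cell_point[OF dg[OF z w] f]] c c' by simp
  qed
  then show ?thesis
    by (simp only: wr_fcomp[symmetric, OF pc(1) dh[OF x z] dg[OF x w] p is_cat_cmp[OF D x y z] pre(2)]
        wr_fcomp[OF pc dg[OF x w] p is_fun_prod[OF dg[OF x y] dg[OF y z] dg[OF x y] dg[OF y w] i pre(1)] is_cat_cmp[OF D x y w]]
        wr_prod[OF dh[OF x y] dh[OF y z] dg[OF x y] dg[OF y w] a b i pre(1)] wr_id_fun[OF dh[OF x y] a])
qed

lemma hcomp_mid_fun:
  assumes w: "w \<in> ob D" and f: "f \<in> ob (hom D y z)"
  shows "fcomp n (prod_cat n (hom D x y) (hom D z w)) (prod_fun n (hom D x y) (hom D z w)
      (postcomp n D x y z f) (id_fun n (hom D z w))) (cmp D x z w)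
    = fcomp n (prod_cat n (hom D x y) (hom D z w)) (prod_fun n (hom D x y) (hom D z w)
      (id_fun n (hom D x y)) (precomp n D y z w f)) (cmp D x y w)" (is "?l = ?r")
proof (rule gmap_eqI)
  show "gmap n (prod_cat n (hom D x y) (hom D z w)) (hom D x w) ?l"
    by (intro gmap_fcomp[OF gmap_prod[OF gmap_postcomp[OF D x y z f] gmap_id]] gcat_cmp[OF D'] x y z w)
  show "gmap n (prod_cat n (hom D x y) (hom D z w)) (hom D x w) ?r"
    by (intro gmap_fcomp[OF gmap_prod[OF gmap_id gmap_precomp[OF D y z w f]]] gcat_cmp[OF D'] x y z w)
  fix c assume c: "is_cell n (prod_cat n (hom D x y) (hom D z w)) c"
  then have c': "is_cell n (hom D x y) (cfst c)" "is_cell n (hom D z w) (csnd c)"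
    by (simp_all add: cell_prod_cat)
  then have "is_cell n (terminal n) (cbang c)"
    using cell_cbang[OF c'(1)] by simp
  then show "capp ?l c = capp ?r c"
    using cat_assoc[OF D x y z w c'(1) cell_point[OF dg[OF y z] f] c'(2)] c c' by simp
qed

lemma hcomp_mid:
  assumes w: "w \<in> ob D" and f: "f \<in> ob (hom D y z)"
    and a: "gtr n X (hom D x y) a" and b: "gtr n Y (hom D z w) b"
  shows "whisker_r n (prod_cat n X Y)
      (prod_tr n X Y (whisker_r n X a (postcomp n D x y z f)) b) (cmp D x z w) =
    whisker_r n (prod_cat n X Y)
      (prod_tr n X Y a (whisker_r n Y b (precomp n D y z w f))) (cmp D x y w)"
proof -
  note p = gtr_prod[OF dg[OF x y] dg[OF z w] a b]
  note pc = is_cat_prod[OF dh[OF x y] dh[OF z w]] is_cat_prod[OF dh[OF x z] dh[OF z w]]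
     is_cat_prod[OF dh[OF x y] dh[OF y w]]
  note i = is_fun_id[OF dg[OF x y]] is_fun_id[OF dg[OF z w]]
  note pre = is_fun_postcomp[OF D x y z f] is_fun_precomp[OF D y z w f]
  note h = wr_fcomp[OF pc(1,2) dg[OF x w] p is_fun_prod[OF dg[OF x y] dg[OF z w] dg[OF x z] dg[OF z w] pre(1) i(2)] is_cat_cmp[OF D x z w]]
     wr_fcomp[OF pc(1,3) dg[OF x w] p is_fun_prod[OF dg[OF x y] dg[OF z w] dg[OF x y] dg[OF y w] i(1) pre(2)] is_cat_cmp[OF D x y w]]
  show ?thesis
    using h unfolding hcomp_mid_fun[OF w f]
     wr_prod[OF dh[OF x y] dh[OF z w] dg[OF x z] dg[OF z w] a b pre(1) i(2)] wr_id_fun[OF dh[OF z w] b]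
     wr_prod[OF dh[OF x y] dh[OF z w] dg[OF x y] dg[OF y w] a b i(1) pre(2)] wr_id_fun[OF dh[OF x y] a]
    by simp
qed

lemma hcomp_mid_map:
  assumes w: "w \<in> ob D" and f: "f \<in> ob (hom D y z)"
    and F: "gmap n X (hom D x y) F" and G: "gmap n Y (hom D z w) G"
  shows "fcomp n (prod_cat n X Y) (prod_fun n X Y (fcomp n X F (postcomp n D x y z f)) G) (cmp D x z w)
    = fcomp n (prod_cat n X Y) (prod_fun n X Y F (fcomp n Y G (precomp n D y z w f))) (cmp D x y w)"
proof -
  note pre = gmap_postcomp[OF D x y z f] gmap_precomp[OF D y z w f]
  have "fcomp n (prod_cat n X Y) (prod_fun n X Y F G) (fcomp n (prod_cat n (hom D x y) (hom D z w)) (prod_fun n (hom D x y) (hom D z w)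
      (postcomp n D x y z f) (id_fun n (hom D z w))) (cmp D x z w))
    = fcomp n (prod_cat n X Y) (prod_fun n X Y F G) (fcomp n (prod_cat n (hom D x y) (hom D z w)) (prod_fun n (hom D x y) (hom D z w)
      (id_fun n (hom D x y)) (precomp n D y z w f)) (cmp D x y w))"
    by (simp only: hcomp_mid_fun[OF w f])
  then show ?thesis
    by (simp only: fcomp_assoc[symmetric, OF gmap_prod[OF F G] gmap_prod[OF pre(1) gmap_id] gcat_cmp[OF D' x z w]]
       fcomp_assoc[symmetric, OF gmap_prod[OF F G] gmap_prod[OF gmap_id pre(2)] gcat_cmp[OF D' x y w]]
       fcomp_prod[OF F G pre(1) gmap_id] fcomp_prod[OF F G gmap_id pre(2)]
       fcomp_id_right[OF F] fcomp_id_right[OF G])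
qed

end

lemma tr_comp_mid:
  assumes D: "is_cat (Suc n) D" and \<alpha>: "gtr (Suc n) C D \<alpha>"
    and c: "c \<in> ob C" "c' \<in> ob C" "c'' \<in> ob C"
  defines "X \<equiv> hom C c c'" and "Y \<equiv> hom C c' c''" and "F \<equiv> src \<alpha>" and "G \<equiv> tgt \<alpha>"
  defines "a \<equiv> whisker_r n (prod_cat n X Y)
         (prod_tr n X Y (thom \<alpha> c c') (id_tr n Y (hom D (fob G c') (fob G c'')) (fhom G c' c'')))
         (cmp D (fob F c) (fob G c') (fob G c''))"
    and "b \<equiv> whisker_r n (prod_cat n X Y)
         (prod_tr n X Y (id_tr n X (hom D (fob F c) (fob F c')) (fhom F c c')) (thom \<alpha> c' c''))
         (cmp D (fob F c) (fob F c') (fob G c''))"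
  shows "tr_comp n C D \<alpha> c c' c'' = vcomp n (prod_cat n X Y) (hom D (fob F c) (fob G c'')) a b"
    and "gtr n (prod_cat n X Y) (hom D (fob F c) (fob G c'')) a"
    and "gtr n (prod_cat n X Y) (hom D (fob F c) (fob G c'')) b"
    and "tgt a = src b"
proof -
  note fob = gtr_fob_src[OF \<alpha>] gtr_fob_tgt[OF \<alpha>]
  note dh = is_cat_hom[OF D]
  have i: "gtr n Y (hom D (fob G c') (fob G c'')) (id_tr n Y (hom D (fob G c') (fob G c'')) (fhom G c' c''))"
    "gtr n X (hom D (fob F c) (fob F c')) (id_tr n X (hom D (fob F c) (fob F c')) (fhom F c c'))"
    unfolding X_def Y_def F_def G_def
    using c fob gmap_fhom[OF gtr_src[OF \<alpha>]] gmap_fhom[OF gtr_tgt[OF \<alpha>]] by (auto intro!: gtr_id dh simp del: is_cat.simps)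
  note t = gtr_thom[OF \<alpha>, folded F_def G_def]
  note fob' = fob[folded F_def G_def]
  show "tr_comp n C D \<alpha> c c' c'' = vcomp n (prod_cat n X Y) (hom D (fob F c) (fob G c'')) a b"
    unfolding tr_comp_def a_def b_def X_def Y_def F_def G_def by (simp add: Let_def)
  show "gtr n (prod_cat n X Y) (hom D (fob F c) (fob G c'')) a"
    unfolding a_def by (rule gtr_hcomp[OF D]) (use c fob' t i in \<open>auto simp: X_def Y_def\<close>)
  show "gtr n (prod_cat n X Y) (hom D (fob F c) (fob G c'')) b"
    unfolding b_def by (rule gtr_hcomp[OF D]) (use c fob' t i in \<open>auto simp: X_def Y_def\<close>)
  have a: "tgt a = fcomp n (prod_cat n X Y) (prod_fun n X Y (tgt (thom \<alpha> c c')) (fhom G c' c''))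
      (cmp D (fob F c) (fob G c') (fob G c''))"
    unfolding a_def using c fob' t i(1) by (simp add: tgt_hcomp[OF D] X_def Y_def)
  show "tgt a = src b"
    using c fob' gtr_tob[OF \<alpha>] gmap_fhom[OF gtr_src[OF \<alpha>]] gmap_fhom[OF gtr_tgt[OF \<alpha>]] unfolding a
    unfolding b_def by (simp add: gtr_thom_tgt[OF \<alpha>] gtr_thom_src[OF \<alpha>] hcomp_mid_map[OF D] F_def G_def X_def Y_def)
qed

lemma tr_comp_wl:
  assumes D: "is_cat (Suc n) D" and N': "gmap (Suc n) B C N" and \<alpha>': "gtr (Suc n) C D \<alpha>"
    and c: "c \<in> ob B" "c' \<in> ob B" "c'' \<in> ob B"
  shows "whisker_l n (prod_cat n (hom B c c') (hom B c' c''))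
      (prod_fun n (hom B c c') (hom B c' c'') (fhom N c c') (fhom N c' c''))
      (tr_comp n C D \<alpha> (fob N c) (fob N c') (fob N c'')) =
    tr_comp n B D (whisker_l (Suc n) B N \<alpha>) c c' c''"
proof -
  note D' = is_cat_gcat[OF D]
  note fob = gmap_fob[OF N'] gtr_fob_src[OF \<alpha>'] gtr_fob_tgt[OF \<alpha>']
  note tgt = tgt_whisker_l[OF \<alpha>']
  note dh = is_cat_hom[OF D] and dg = gcat_hom[OF D'] and Nh = gmap_fhom[OF N'] and th = gtr_thom[OF \<alpha>']
  note gh = gmap_fhom[OF gtr_src[OF \<alpha>']] gmap_fhom[OF gtr_tgt[OF \<alpha>']]
  note Nc = fob(1)[OF c(1)] fob(1)[OF c(2)] fob(1)[OF c(3)]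
  note Np = gmap_prod[OF Nh[OF c(1,2)] Nh[OF c(2,3)]]
  note m = tr_comp_mid[OF D \<alpha>' Nc]
  note F = fob(2,3)[OF Nc(1)] fob(2,3)[OF Nc(2)] fob(2,3)[OF Nc(3)]
  show ?thesis
      unfolding m(1) wl_vcomp[OF dh[OF F(1,6)] Np m(2-4)] 
        wl_wr[OF is_cat_prod[OF dh[OF F(1,4)] dh[OF F(4,6)]] dg[OF F(1,6)] Np
          gtr_prod[OF dg[OF F(1,4)] dg[OF F(4,6)] th[OF Nc(1,2)] gtr_id[OF dh[OF F(4,6)] gh(2)[OF Nc(2,3)]]] is_cat_cmp[OF D F(1,4,6)]]
        wl_wr[OF is_cat_prod[OF dh[OF F(1,3)] dh[OF F(3,6)]] dg[OF F(1,6)] Np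
          gtr_prod[OF dg[OF F(1,3)] dg[OF F(3,6)] gtr_id[OF dh[OF F(1,3)] gh(1)[OF Nc(1,2)]] th[OF Nc(2,3)]] is_cat_cmp[OF D F(1,3,6)]]
        wl_prod[OF dg[OF F(1,4)] dg[OF F(4,6)] Nh[OF c(1,2)] Nh[OF c(2,3)] th[OF Nc(1,2)] gtr_id[OF dh[OF F(4,6)] gh(2)[OF Nc(2,3)]]]
        wl_prod[OF dg[OF F(1,3)] dg[OF F(3,6)] Nh[OF c(1,2)] Nh[OF c(2,3)] gtr_id[OF dh[OF F(1,3)] gh(1)[OF Nc(1,2)]] th[OF Nc(2,3)]]
        wl_id[OF dh[OF F(4,6)] Nh[OF c(2,3)] gh(2)[OF Nc(2,3)]] wl_id[OF dh[OF F(1,3)] Nh[OF c(1,2)] gh(1)[OF Nc(1,2)]]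
      unfolding tr_comp_def Let_def src_whisker_l tgt thom_whisker_l[OF c(1,2)] thom_whisker_l[OF c(2,3)]
      using c by simp
qed

lemma is_tr_wl:
  "gcat n B \<Longrightarrow> gcat n C \<Longrightarrow> is_cat n D \<Longrightarrow> is_fun n B C N \<Longrightarrow> is_tr n C D \<alpha>
   \<Longrightarrow> is_tr n B D (whisker_l n B N \<alpha>)"
proof (induction n arbitrary: B C D N \<alpha>)
  case 0
  then show ?case
    using is_fun_fcomp[of 0 B C D N] by (auto simp del: fcomp.simps is_fun.simps)
next
  case (Suc n)
  note B = Suc.prems(1) and C = Suc.prems(2) and D = Suc.prems(3) and N = Suc.prems(4) and \<alpha> = Suc.prems(5)
  note D' = is_cat_gcat[OF D] and N' = is_fun_gmap[OF N] and \<alpha>' = is_tr_gtr[OF \<alpha>]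
  note wl = gtr_wl[OF D' N' \<alpha>']
  note fob = gmap_fob[OF N'] gtr_fob_src[OF \<alpha>'] gtr_fob_tgt[OF \<alpha>']
  note tgt = tgt_whisker_l[OF \<alpha>']
  note dh = is_cat_hom[OF D] and dg = gcat_hom[OF D'] and Nh = gmap_fhom[OF N'] and th = gtr_thom[OF \<alpha>']
  note gh = gmap_fhom[OF gtr_src[OF \<alpha>']] gmap_fhom[OF gtr_tgt[OF \<alpha>']]
  show ?case
  proof (rule is_tr_SucI[OF wl], goal_cases)
    case 1
    show ?case unfolding src_whisker_l by (rule is_fun_fcomp[OF B C D' N is_tr_src[OF \<alpha>]])
  next
    case 2
    show ?case unfolding tgt by (rule is_fun_fcomp[OF B C D' N is_tr_tgt[OF \<alpha>]])
  next
    case (3 c c')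
    then show ?case
      unfolding src_whisker_l tgt thom_whisker_l[OF 3]
      using Suc.IH[OF gcat_hom[OF B] gcat_hom[OF C] dh is_fun_hom[OF N] is_tr_thom[OF \<alpha>]] fob
      by (simp del: is_tr.simps is_fun.simps is_cat.simps)
  next
    case (4 c)
    then show ?case
      unfolding thom_whisker_l[OF 4 4] src_whisker_l tgt tob_whisker_l[OF 4] fob_fcomp[OF 4]
      using is_tr_unt[OF \<alpha> fob(1)[OF 4]] fob wl_fcomp[OF dg gcat_unt[OF B] Nh th]
      by (simp add: is_fun_unt_eq[OF N] del: gcat.simps is_fun.simps is_cat.simps)
  next
    case c: (5 c c' c'')
    note Nc = fob(1)[OF c(1)] fob(1)[OF c(2)] fob(1)[OF c(3)]
    note F = fob(2)[OF Nc(1)] fob(3)[OF Nc(3)]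
    note Np = gmap_prod[OF Nh[OF c(1,2)] Nh[OF c(2,3)]]
    show ?case
      by (simp only: thom_whisker_l[OF c(1,3)] wl_fcomp[OF dg[OF F] gcat_cmp[OF B c] Nh[OF c(1,3)] th[OF Nc(1,3)], symmetric]
          is_fun_cmp_eq[OF N c] wl_fcomp[OF dg[OF F] Np gcat_cmp[OF C Nc] th[OF Nc(1,3)]]
          is_tr_cmp[OF \<alpha> Nc] tr_comp_wl[OF D N' \<alpha>' c])
  qed
qed

lemma is_tr_wr:
  "gcat n C \<Longrightarrow> is_cat n D \<Longrightarrow> is_cat n E \<Longrightarrow> is_tr n C D \<alpha> \<Longrightarrow> is_fun n D E L
   \<Longrightarrow> is_tr n C E (whisker_r n C \<alpha> L)"
proof (induction n arbitrary: C D E L \<alpha>)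
  case 0
  then show ?case
    using is_fun_fcomp[of 0 C D E _ L] by (auto simp del: fcomp.simps is_fun.simps)
next
  case (Suc n)
  note C = Suc.prems(1) and D = Suc.prems(2) and E = Suc.prems(3) and \<alpha> = Suc.prems(4) and L = Suc.prems(5)
  note D' = is_cat_gcat[OF D] and E' = is_cat_gcat[OF E] and L' = is_fun_gmap[OF L]
    and \<alpha>' = is_tr_gtr[OF \<alpha>]
  note wr = gtr_wr[OF D E' \<alpha>' L]
  note fob = gtr_fob_src[OF \<alpha>'] gtr_fob_tgt[OF \<alpha>'] gmap_fob[OF L']
  note tgt = tgt_whisker_r[OF \<alpha>']
  note dh = is_cat_hom[OF D] and dg = gcat_hom[OF D'] and Lh = is_fun_hom[OF L] and th = gtr_thom[OF \<alpha>']
  note eh = is_cat_hom[OF E] and eg = gcat_hom[OF E']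
  note gh = gmap_fhom[OF gtr_src[OF \<alpha>']] gmap_fhom[OF gtr_tgt[OF \<alpha>']]
  note tob = gtr_tob[OF \<alpha>']
  show ?case
  proof (rule is_tr_SucI[OF wr], goal_cases)
    case 1
    show ?case unfolding src_whisker_r by (rule is_fun_fcomp[OF C D' E' is_tr_src[OF \<alpha>] L])
  next
    case 2
    show ?case unfolding tgt by (rule is_fun_fcomp[OF C D' E' is_tr_tgt[OF \<alpha>] L])
  next
    case (3 c c')
    then show ?case
      unfolding src_whisker_r tgt thom_whisker_r[OF 3]
      using Suc.IH[OF gcat_hom[OF C] dh eh is_tr_thom[OF \<alpha>] Lh] fob
      by (simp del: is_tr.simps is_fun.simps is_cat.simps)
  next
    case c: (4 c)
    note F = fob(1,2)[OF c]
    note LF = fob(3)[OF F(1)] fob(3)[OF F(2)]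
    show ?case
      by (simp only: thom_whisker_r[OF c c] src_whisker_r tgt tob_whisker_r[OF c] fob_fcomp[OF c]
          wl_wr[OF dh[OF F] eg[OF LF] gcat_unt[OF C c] th[OF c c] Lh[OF F]] is_tr_unt[OF \<alpha> c]
          wr_id[OF dh[OF F] eh[OF LF] gmap_point[OF dg[OF F] tob[OF c]] Lh[OF F]]
          point_fun_fcomp[OF dg[OF F] eg[OF LF] Lh[OF F] tob[OF c]])
  next
    case c: (5 c c' c'')
    note m = tr_comp_mid[OF D \<alpha>' c]
    note F = fob(1,2)[OF c(1)] fob(1,2)[OF c(2)] fob(1,2)[OF c(3)]
    note LF = fob(3)[OF F(1)] fob(3)[OF F(2)] fob(3)[OF F(3)] fob(3)[OF F(4)] fob(3)[OF F(5)] fob(3)[OF F(6)]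
    show ?case
      unfolding thom_whisker_r[OF c(1,3)] wl_wr[OF dh[OF F(1,6)] eg[OF LF(1,6)] gcat_cmp[OF C c] th[OF c(1,3)] Lh[OF F(1,6)]]
        is_tr_cmp[OF \<alpha> c] m(1) wr_vcomp[OF dh[OF F(1,6)] eh[OF LF(1,6)] Lh[OF F(1,6)] m(2-4)]
        hcomp_fun[OF D F(1,4,6) E L th[OF c(1,2)] gtr_id[OF dh[OF F(4,6)] gh(2)[OF c(2,3)]]]
        hcomp_fun[OF D F(1,3,6) E L gtr_id[OF dh[OF F(1,3)] gh(1)[OF c(1,2)]] th[OF c(2,3)]]
        wr_id[OF dh[OF F(4,6)] eh[OF LF(4,6)] gh(2)[OF c(2,3)] Lh[OF F(4,6)]]
        wr_id[OF dh[OF F(1,3)] eh[OF LF(1,3)] gh(1)[OF c(1,2)] Lh[OF F(1,3)]]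
      unfolding tr_comp_def Let_def src_whisker_r tgt thom_whisker_r[OF c(1,2)] thom_whisker_r[OF c(2,3)]
      using c by simp
  qed
qed

text \<open>
  In the composition law of a vertical composite, both sides are fourfold vertical composites with the
  same outer factors.
\<close>

lemma vcomp_middle:
  assumes D: "is_cat n D"
    and g: "gtr n C D p" "gtr n C D q" "gtr n C D q'" "gtr n C D r" "gtr n C D r'" "gtr n C D s"
    and e: "tgt p = src q" "tgt q = src q'" "tgt q' = src s" "tgt p = src r" "tgt r = src r'" "tgt r' = src s"
    and eq: "vcomp n C D q q' = vcomp n C D r r'"
  shows "vcomp n C D (vcomp n C D p q) (vcomp n C D q' s) = vcomp n C D (vcomp n C D p r) (vcomp n C D r' s)"
proof -
  note v = gtr_vcomp[OF D]
  have "vcomp n C D (vcomp n C D p q) (vcomp n C D q' s) = vcomp n C D p (vcomp n C D (vcomp n C D q q') s)"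
    using g e by (simp add: vcomp_assoc[OF D] v tgt_vcomp)
  also have "\<dots> = vcomp n C D p (vcomp n C D (vcomp n C D r r') s)"
    by (simp only: eq)
  also have "\<dots> = vcomp n C D (vcomp n C D p r) (vcomp n C D r' s)"
    using g e by (simp add: vcomp_assoc[OF D] v tgt_vcomp)
  finally show ?thesis .
qed

lemma hcomp_interchange:
  assumes D: "is_cat (Suc n) D" and o: "x \<in> ob D" "y \<in> ob D" "z \<in> ob D"
    and a: "gtr n X (hom D x y) a" and b: "gtr n Y (hom D y z) b"
  defines "h \<equiv> \<lambda>u v. whisker_r n (prod_cat n X Y) (prod_tr n X Y u v) (cmp D x y z)"
  shows "vcomp n (prod_cat n X Y) (hom D x z)
      (h (id_tr n X (hom D x y) (src a)) b) (h a (id_tr n Y (hom D y z) (tgt b)))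
    = vcomp n (prod_cat n X Y) (hom D x z)
      (h a (id_tr n Y (hom D y z) (src b))) (h (id_tr n X (hom D x y) (tgt a)) b)"
proof -
  note dh = is_cat_hom[OF D] and dg = gcat_hom[OF is_cat_gcat[OF D]]
  note i = gtr_id[OF dh[OF o(1,2)] gtr_src[OF a]] gtr_id[OF dh[OF o(1,2)] gtr_tgt[OF a]]
    gtr_id[OF dh[OF o(2,3)] gtr_src[OF b]] gtr_id[OF dh[OF o(2,3)] gtr_tgt[OF b]]
  note p = gtr_prod[OF dg[OF o(1,2)] dg[OF o(2,3)]]
  note w = wr_vcomp[symmetric, OF is_cat_prod[OF dh[OF o(1,2)] dh[OF o(2,3)]] dh[OF o(1,3)] is_cat_cmp[OF D o]]
  show ?thesis unfolding h_def
    by (subst (1 2) w) (simp_all add: p i a b tgt_prod_tr[OF i(1) b] tgt_prod_tr[OF a i(3)]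
        prod_interchange[OF dh[OF o(1,2)] dh[OF o(2,3)] a b])
qed

text \<open>
  In the composition law for \<open>(c, c', c'')\<close>, write a1, a2 for \<alpha> and o1, o2 for \<omega> on the first and on the
  second factor. The left-hand side is the composite of the laws for \<alpha> and for \<omega>, in the order a1, a2,
  o1, o2; the right-hand side expands the composite 2-morphism on each factor, in the order a1, o1, a2,
  o2. The middle two act on different factors, so they can be interchanged.
\<close>

lemma is_tr_vcomp:
  "gcat n C \<Longrightarrow> is_cat n D \<Longrightarrow> is_tr n C D \<omega> \<Longrightarrow> is_tr n C D \<alpha> \<Longrightarrow> tgt \<omega> = src \<alpha>
   \<Longrightarrow> is_tr n C D (vcomp n C D \<omega> \<alpha>)"
proof (induction n arbitrary: C D \<omega> \<alpha>)
  case 0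
  then show ?case by auto
next
  case (Suc n)
  note C = Suc.prems(1) and D = Suc.prems(2) and t\<omega> = Suc.prems(3) and t\<alpha> = Suc.prems(4)
    and eq = Suc.prems(5)
  note D' = is_cat_gcat[OF D]
  note \<omega> = is_tr_gtr[OF t\<omega>] and \<alpha> = is_tr_gtr[OF t\<alpha>]
  note v = gtr_vcomp[OF D \<omega> \<alpha> eq]
  note tv = tgt_vcomp[OF \<omega> \<alpha> eq]
  note fob = gtr_fob_src[OF \<omega>] gtr_fob_src[OF \<alpha>] gtr_fob_tgt[OF \<alpha>]
  note tob = gtr_tob[OF \<omega>, unfolded eq] gtr_tob[OF \<alpha>]
  note dh = is_cat_hom[OF D] and dg = gcat_hom[OF D']
  note tho = gtr_thom[OF \<omega>, unfolded eq] and tha = gtr_thom[OF \<alpha>]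
  note gh = gmap_fhom[OF gtr_src[OF \<omega>]] gmap_fhom[OF gtr_src[OF \<alpha>]] gmap_fhom[OF gtr_tgt[OF \<alpha>]]
  show ?case
  proof (rule is_tr_SucI[OF v], goal_cases)
    case 1
    show ?case unfolding src_vcomp by (rule is_tr_src[OF t\<omega>])
  next
    case 2
    show ?case unfolding tv by (rule is_tr_tgt[OF t\<alpha>])
  next
    case c: (3 c c')
    show ?case
      unfolding src_vcomp tv thom_vcomp[OF c] eq
      by (rule Suc.IH[OF gcat_hom[OF C] dh is_tr_wr[OF gcat_hom[OF C] dh dh is_tr_thom[OF t\<alpha>] is_fun_precomp[OF D]]
          is_tr_wr[OF gcat_hom[OF C] dh dh is_tr_thom[OF t\<omega>, unfolded eq] is_fun_postcomp[OF D]]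
            vcomp_mid(3)[OF D \<omega> \<alpha> eq c, unfolded eq]])
        (use c fob tob eq in auto)
  next
    case c: (4 c)
    note F = fob(1)[OF c] fob(2)[OF c] fob(3)[OF c]
    note t = tob(1)[OF c] tob(2)[OF c]
    let ?T = "terminal n" and ?u = "unt C c"
    let ?F = "fob (src \<omega>) c" and ?G = "fob (src \<alpha>) c" and ?H = "fob (tgt \<alpha>) c"
    let ?pt = "point_fun n (hom D ?F ?H) (fob (cmp D ?F ?G ?H) (tob \<omega> c, tob \<alpha> c))"
    note pre = is_fun_precomp[OF D F t(1)] and post = is_fun_postcomp[OF D F t(2)]
    have pg: "gmap n ?T (hom D ?F ?H) ?pt"
      by (rule gmap_point[OF dg[OF F(1,3)] fob_cmp[OF D' F t]])
    have a: "fcomp n ?T (point_fun n (hom D ?G ?H) (tob \<alpha> c)) (precomp n D ?F ?G ?H (tob \<omega> c)) = ?pt"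
      by (rule gmap_eqI[OF gmap_fcomp[OF gmap_point[OF dg[OF F(2,3)] t(2)] is_fun_gmap[OF pre]] pg])
        (simp add: t cell_point[OF dg[OF F(2,3)]] point_cmp[OF D F])
    have b: "fcomp n ?T (point_fun n (hom D ?F ?G) (tob \<omega> c)) (postcomp n D ?F ?G ?H (tob \<alpha> c)) = ?pt"
      by (rule gmap_eqI[OF gmap_fcomp[OF gmap_point[OF dg[OF F(1,2)] t(1)] is_fun_gmap[OF post]] pg])
        (simp add: t cell_point[OF dg[OF F(1,2)]] point_cmp[OF D F])
    have 1: "whisker_l n ?T ?u (whisker_r n (hom C c c) (thom \<alpha> c c) (precomp n D ?F ?G ?H (tob \<omega> c)))
        = id_tr n ?T (hom D ?F ?H) ?pt"
      unfolding wl_wr[OF dh[OF F(2,3)] dg[OF F(1,3)] gcat_unt[OF C c] tha[OF c c] pre] is_tr_unt[OF t\<alpha> c]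
        wr_id[OF dh[OF F(2,3)] dh[OF F(1,3)] gmap_point[OF dg[OF F(2,3)] t(2)] pre] a ..
    have 2: "whisker_l n ?T ?u (whisker_r n (hom C c c) (thom \<omega> c c) (postcomp n D ?F ?G ?H (tob \<alpha> c)))
        = id_tr n ?T (hom D ?F ?H) ?pt"
      unfolding wl_wr[OF dh[OF F(1,2)] dg[OF F(1,3)] gcat_unt[OF C c] tho[OF c c] post] is_tr_unt[OF t\<omega> c, unfolded eq]
        wr_id[OF dh[OF F(1,2)] dh[OF F(1,3)] gmap_point[OF dg[OF F(1,2)] t(1)] post] b ..
    have 3: "vcomp n ?T (hom D ?F ?H) (id_tr n ?T (hom D ?F ?H) ?pt) (id_tr n ?T (hom D ?F ?H) ?pt)
        = id_tr n ?T (hom D ?F ?H) ?pt"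
      using vcomp_id[OF dh[OF F(1,3)] gtr_id[OF dh[OF F(1,3)] pg]] by simp
    show ?case
      unfolding src_vcomp tv thom_vcomp[OF c c] tob_vcomp[OF c] eq
        wl_vcomp[OF dh[OF F(1,3)] gcat_unt[OF C c] vcomp_mid[OF D \<omega> \<alpha> eq c c, unfolded eq]] 1 2 3 ..
  next
    case c: (5 c c' c'')
    let ?X = "hom C c c'" and ?Y = "hom C c' c''"
    let ?P = "prod_cat n ?X ?Y"
    let ?F = "fob (src \<omega>)" and ?G = "fob (src \<alpha>)" and ?H = "fob (tgt \<alpha>)"
    let ?w = "whisker_r n ?P" and ?p = "prod_tr n ?X ?Y"
    let ?v = "vcomp n ?P (hom D (?F c) (?H c''))"
    let ?pre = "precomp n D (?F c) (?G c) (?H c'') (tob \<omega> c)"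
    let ?post = "postcomp n D (?F c) (?G c'') (?H c'') (tob \<alpha> c'')"
    let ?mFH = "cmp D (?F c) (?H c') (?H c'')" and ?mFG = "cmp D (?F c) (?G c') (?H c'')"
      and ?mFF = "cmp D (?F c) (?F c') (?H c'')"
    let ?idH = "id_tr n ?Y (hom D (?H c') (?H c'')) (fhom (tgt \<alpha>) c' c'')"
    let ?idF = "id_tr n ?X (hom D (?F c) (?F c')) (fhom (src \<omega>) c c')"
    let ?\<alpha> = "thom \<alpha>" and ?\<omega> = "thom \<omega>"
    let ?a1 = "whisker_r n ?X (?\<alpha> c c') (precomp n D (?F c) (?G c) (?H c') (tob \<omega> c))"
    let ?o1 = "whisker_r n ?X (?\<omega> c c') (postcomp n D (?F c) (?G c') (?H c') (tob \<alpha> c'))"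
    let ?a2 = "whisker_r n ?Y (?\<alpha> c' c'') (precomp n D (?F c') (?G c') (?H c'') (tob \<omega> c'))"
    let ?o2 = "whisker_r n ?Y (?\<omega> c' c'') (postcomp n D (?F c') (?G c'') (?H c'') (tob \<alpha> c''))"
    let ?p1 = "?w (?p ?a1 ?idH) ?mFH"
    let ?q1 = "?w (?p (id_tr n ?X (hom D (?F c) (?G c')) (src (?\<omega> c c'))) (?\<alpha> c' c'')) ?mFG"
    let ?q2 = "?w (?p (?\<omega> c c') (id_tr n ?Y (hom D (?G c') (?H c'')) (tgt (?\<alpha> c' c'')))) ?mFG"
    let ?r1 = "?w (?p (?\<omega> c c') (id_tr n ?Y (hom D (?G c') (?H c'')) (src (?\<alpha> c' c'')))) ?mFG"
    let ?r2 = "?w (?p (id_tr n ?X (hom D (?F c) (?G c')) (tgt (?\<omega> c c'))) (?\<alpha> c' c'')) ?mFG"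
    let ?p4 = "?w (?p ?idF ?o2) ?mFF"
    note f = fob(1)[OF c(1)] fob(1)[OF c(2)] fob(1)[OF c(3)]
    note g = fob(2)[OF c(1)] fob(2)[OF c(2)] fob(2)[OF c(3)]
    note h = fob(3)[OF c(1)] fob(3)[OF c(2)] fob(3)[OF c(3)]
    note a1 = vcomp_mid(1)[OF D \<omega> \<alpha> eq c(1,2), unfolded eq]
      and o1 = vcomp_mid(2)[OF D \<omega> \<alpha> eq c(1,2), unfolded eq]
      and ao1 = vcomp_mid(3)[OF D \<omega> \<alpha> eq c(1,2), unfolded eq]
      and a2 = vcomp_mid(1)[OF D \<omega> \<alpha> eq c(2,3), unfolded eq]
      and o2 = vcomp_mid(2)[OF D \<omega> \<alpha> eq c(2,3), unfolded eq]
      and ao2 = vcomp_mid(3)[OF D \<omega> \<alpha> eq c(2,3), unfolded eq]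
      and a3 = vcomp_mid(1)[OF D \<omega> \<alpha> eq c(1,3), unfolded eq]
      and o3 = vcomp_mid(2)[OF D \<omega> \<alpha> eq c(1,3), unfolded eq]
      and ao3 = vcomp_mid(3)[OF D \<omega> \<alpha> eq c(1,3), unfolded eq]
    note t1 = tob(1)[OF c(1)] tob(1)[OF c(2)] and t2 = tob(2)[OF c(2)] tob(2)[OF c(3)]
    note iH = gtr_id[OF dh[OF h(2,3)] gh(3)[OF c(2,3)]]
      and iF = gtr_id[OF dh[OF f(1,2)] gh(1)[OF c(1,2)]]
    note iG = gtr_id[OF dh[OF g(2,3)] gh(2)[OF c(2,3)]]
      and iG' = gtr_id[OF dh[OF g(1,2)] gh(2)[OF c(1,2)]]
    note pre = is_fun_precomp[OF D f(1) g(1) h(3) t1(1)] and post = is_fun_postcomp[OF D f(1) g(3) h(3) t2(2)]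
    note m\<alpha> = tr_comp_mid[OF D \<alpha> c] and m\<omega> = tr_comp_mid[OF D \<omega> c, unfolded eq]
    have src_o: "fcomp n ?X (fhom (src \<alpha>) c c') (precomp n D (?F c) (?G c) (?G c') (tob \<omega> c)) = src (?\<omega> c c')"
      using gtr_thom_src[OF \<omega> c(1,2)] eq by simp
    have tgt_o: "fcomp n ?X (fhom (src \<omega>) c c') (postcomp n D (?F c) (?F c') (?G c') (tob \<omega> c')) = tgt (?\<omega> c c')"
      using gtr_thom_tgt[OF \<omega> c(1,2)] eq by simp
    have src_a: "fcomp n ?Y (fhom (tgt \<alpha>) c' c'') (precomp n D (?G c') (?H c') (?H c'') (tob \<alpha> c')) = src (?\<alpha> c' c'')"
      using gtr_thom_src[OF \<alpha> c(2,3)] by simp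
    have tgt_a: "fcomp n ?Y (fhom (src \<alpha>) c' c'') (postcomp n D (?G c') (?G c'') (?H c'') (tob \<alpha> c'')) = tgt (?\<alpha> c' c'')"
      using gtr_thom_tgt[OF \<alpha> c(2,3)] by simp
    have A: "?w (whisker_l n ?P (cmp C c c' c'') (?\<alpha> c c'')) ?pre = ?v ?p1 ?q1"
      unfolding is_tr_cmp[OF t\<alpha> c] m\<alpha>(1) wr_vcomp[OF dh[OF g(1) h(3)] dh[OF f(1) h(3)] pre m\<alpha>(2-4)]
        hcomp_precomp[OF D g(1) h(2) h(3) f(1) t1(1) tha[OF c(1,2)] iH]
        hcomp_precomp[OF D g(1) g(2) h(3) f(1) t1(1) iG' tha[OF c(2,3)]]
        wr_id[OF dh[OF g(1,2)] dh[OF f(1) g(2)] gh(2)[OF c(1,2)] is_fun_precomp[OF D f(1) g(1) g(2) t1(1)]]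
        src_o ..
    have W: "?w (whisker_l n ?P (cmp C c c' c'') (?\<omega> c c'')) ?post = ?v ?q2 ?p4"
      unfolding is_tr_cmp[OF t\<omega> c] m\<omega>(1) wr_vcomp[OF dh[OF f(1) g(3)] dh[OF f(1) h(3)] post m\<omega>(2-4)]
        hcomp_postcomp[OF D f(1) g(2) g(3) h(3) t2(2) tho[OF c(1,2)] iG]
        hcomp_postcomp[OF D f(1) f(2) g(3) h(3) t2(2) iF tho[OF c(2,3)]]
        wr_id[OF dh[OF g(2,3)] dh[OF g(2) h(3)] gh(2)[OF c(2,3)] is_fun_postcomp[OF D g(2) g(3) h(3) t2(2)]]
        tgt_a ..
    have L: "whisker_l n ?P (cmp C c c' c'') (thom (vcomp (Suc n) C D \<omega> \<alpha>) c c'') = ?v (?v ?p1 ?q1) (?v ?q2 ?p4)"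
      unfolding thom_vcomp[OF c(1,3)] eq wl_vcomp[OF dh[OF f(1) h(3)] gcat_cmp[OF C c] a3 o3 ao3]
        wl_wr[OF dh[OF g(1) h(3)] dg[OF f(1) h(3)] gcat_cmp[OF C c] tha[OF c(1,3)] pre]
        wl_wr[OF dh[OF f(1) g(3)] dg[OF f(1) h(3)] gcat_cmp[OF C c] tho[OF c(1,3)] post] A W ..
    have idH: "?idH = vcomp n ?Y (hom D (?H c') (?H c'')) ?idH ?idH"
      using vcomp_id[OF dh[OF h(2,3)] iH] by simp
    have idF: "?idF = vcomp n ?X (hom D (?F c) (?F c')) ?idF ?idF"
      using vcomp_id[OF dh[OF f(1,2)] iF] by simp
    have R1: "?w (?p ?o1 ?idH) ?mFH = ?r1"
      unfolding hcomp_mid[OF D f(1) g(2) h(2) h(3) t2(1) tho[OF c(1,2)] iH]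
        wr_id[OF dh[OF h(2,3)] dh[OF g(2) h(3)] gh(3)[OF c(2,3)] is_fun_precomp[OF D g(2) h(2) h(3) t2(1)]]
        src_a ..
    have R2: "?w (?p ?idF ?a2) ?mFF = ?r2"
      unfolding hcomp_mid[OF D f(1) f(2) g(2) h(3) t1(2) iF tha[OF c(2,3)], symmetric]
        wr_id[OF dh[OF f(1,2)] dh[OF f(1) g(2)] gh(1)[OF c(1,2)] is_fun_postcomp[OF D f(1) f(2) g(2) t1(2)]]
        tgt_o ..
    note pF = gtr_prod[OF dg[OF f(1) h(2)] dg[OF h(2,3)]] and pF' = gtr_prod[OF dg[OF f(1,2)] dg[OF f(2) h(3)]]
    have R\<alpha>: "?w (?p (vcomp n ?X (hom D (?F c) (?H c')) ?a1 ?o1) ?idH) ?mFH = ?v ?p1 ?r1"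
    proof -
      have "?p (vcomp n ?X (hom D (?F c) (?H c')) ?a1 ?o1) ?idH =
        vcomp n ?P (prod_cat n (hom D (?F c) (?H c')) (hom D (?H c') (?H c''))) (?p ?a1 ?idH) (?p ?o1 ?idH)"
        by (subst idH) (rule prod_vcomp[OF dh[OF f(1) h(2)] dh[OF h(2,3)] a1 o1 ao1 iH iH], simp)
      moreover have "tgt (?p ?a1 ?idH) = src (?p ?o1 ?idH)"
        by (simp add: tgt_prod_tr[OF a1 iH] ao1[unfolded src_whisker_r])
      ultimately show ?thesis
        using wr_vcomp[OF is_cat_prod[OF dh[OF f(1) h(2)] dh[OF h(2,3)]] dh[OF f(1) h(3)] is_cat_cmp[OF D f(1) h(2) h(3)] pF[OF a1 iH] pF[OF o1 iH]]
          R1 by simp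
    qed
    have R\<omega>: "?w (?p ?idF (vcomp n ?Y (hom D (?F c') (?H c'')) ?a2 ?o2)) ?mFF = ?v ?r2 ?p4"
    proof -
      have "?p ?idF (vcomp n ?Y (hom D (?F c') (?H c'')) ?a2 ?o2) =
        vcomp n ?P (prod_cat n (hom D (?F c) (?F c')) (hom D (?F c') (?H c''))) (?p ?idF ?a2) (?p ?idF ?o2)"
        by (subst idF) (rule prod_vcomp[OF dh[OF f(1,2)] dh[OF f(2) h(3)] iF iF _ a2 o2 ao2], simp)
      moreover have "tgt (?p ?idF ?a2) = src (?p ?idF ?o2)"
        by (simp add: tgt_prod_tr[OF iF a2] ao2[unfolded src_whisker_r])
      ultimately show ?thesis
        using wr_vcomp[OF is_cat_prod[OF dh[OF f(1,2)] dh[OF f(2) h(3)]] dh[OF f(1) h(3)] is_cat_cmp[OF D f(1) f(2) h(3)] pF'[OF iF a2] pF'[OF iF o2]]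
          R2 by simp
    qed
    have R: "tr_comp n C D (vcomp (Suc n) C D \<omega> \<alpha>) c c' c'' = ?v (?v ?p1 ?r1) (?v ?r2 ?p4)"
      unfolding tr_comp_def Let_def src_vcomp tv thom_vcomp[OF c(1,2)] thom_vcomp[OF c(2,3)] eq R\<alpha> R\<omega> ..
    note hc = gtr_hcomp[OF D] and ht = tgt_hcomp[OF D]
    note jo = gtr_id[OF dh[OF f(1) g(2)] gtr_src[OF tho[OF c(1,2)]]] gtr_id[OF dh[OF f(1) g(2)] gtr_tgt[OF tho[OF c(1,2)]]]
    note ja = gtr_id[OF dh[OF g(2) h(3)] gtr_src[OF tha[OF c(2,3)]]] gtr_id[OF dh[OF g(2) h(3)] gtr_tgt[OF tha[OF c(2,3)]]]
    note G = hc[OF f(1) h(2) h(3) a1 iH] hc[OF f(1) g(2) h(3) jo(1) tha[OF c(2,3)]]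
      hc[OF f(1) g(2) h(3) tho[OF c(1,2)] ja(2)] hc[OF f(1) g(2) h(3) tho[OF c(1,2)] ja(1)]
      hc[OF f(1) g(2) h(3) jo(2) tha[OF c(2,3)]] hc[OF f(1) f(2) h(3) iF o2]
    note T = ht[OF f(1) h(2) h(3) a1 iH] ht[OF f(1) g(2) h(3) jo(1) tha[OF c(2,3)]]
      ht[OF f(1) g(2) h(3) tho[OF c(1,2)] ja(2)] ht[OF f(1) g(2) h(3) tho[OF c(1,2)] ja(1)]
      ht[OF f(1) g(2) h(3) jo(2) tha[OF c(2,3)]] ht[OF f(1) f(2) h(3) iF o2]
    have s: "src ?p4 = fcomp n ?P (prod_fun n ?X ?Y (tgt (?\<omega> c c')) (tgt (?\<alpha> c' c''))) ?mFG"
    proof -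
      have "src ?o2 = fcomp n ?Y (tgt (?\<alpha> c' c'')) (precomp n D (?F c') (?G c') (?H c'') (tob \<omega> c'))"
        using ao2 by (simp add: tgt_whisker_r[OF tha[OF c(2,3)]])
      then show ?thesis
        using hcomp_mid_map[OF D f(1) f(2) g(2) h(3) t1(2) gh(1)[OF c(1,2)] gtr_tgt[OF tha[OF c(2,3)]]] tgt_o
        by simp
    qed
    have t: "tgt ?p1 = fcomp n ?P (prod_fun n ?X ?Y (src (?\<omega> c c')) (src (?\<alpha> c' c''))) ?mFG"
      using hcomp_mid_map[OF D f(1) g(2) h(2) h(3) t2(1) gtr_src[OF tho[OF c(1,2)]] gh(3)[OF c(2,3)]] src_a
      by (simp add: T ao1[unfolded src_whisker_r])
    show ?case
      unfolding L R
      by (rule vcomp_middle[OF dh[OF f(1) h(3)] G(1) G(2) G(3) G(4) G(5) G(6)])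
        (simp_all add: s t T(2-) hcomp_interchange[OF D f(1) g(2) h(3) tho[OF c(1,2)] tha[OF c(2,3)]]
          del: src_whisker_r, simp_all)
  qed
qed

section \<open>The sesqui-category of n-groupoids\<close>

lemma is_gpd_cat: "is_gpd n C \<Longrightarrow> is_cat n C"
  by (cases n) (auto simp del: is_cat.simps)

lemma is_sesqui_nGpd: "is_sesqui (nGpd n)"
proof -
  note c = is_gpd_cat and g = is_cat_gcat[OF is_gpd_cat] and m = is_fun_gmap and t = is_tr_gtr
  show ?thesis
    unfolding is_sesqui_def nGpd_def
    by (clarsimp, intro conjI allI impI)
      (auto intro: is_fun_id[OF g] is_fun_fcomp[OF g g g] is_tr_id[OF g c] is_tr_vcomp[OF g c]
        is_tr_wl[OF g g c] is_tr_wr[OF g c c]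
        simp: fcomp_id_left[OF m] fcomp_id_right[OF m] fcomp_assoc[OF m m m] tgt_vcomp[OF t t]
         vcomp_id[OF c t] vcomp_assoc[OF c t t t] tgt_whisker_l[OF t] tgt_whisker_r[OF t]
         wl_id[OF c m m] wl_vcomp[OF c m t t] wl_id_fun[OF g t] wl_fcomp[OF g m m t]
         wr_id[OF c c m] wr_vcomp[OF c c _ t t] wr_id_fun[OF c t] wr_fcomp[OF c c g t]
         wl_wr[OF c g m t])
qed

section \<open>The discrete functor on categories and functors\<close>

text \<open>
  The cells of \<open>D C\<close> are those of C and, over each cell of top dimension of C, one identity cell
  (\<open>is_cell_disc_cases\<close>). A functor \<open>D F\<close> acts on both as F does, so D commutes with all operations on
  functors, and the laws of \<open>D C\<close> and \<open>D F\<close> are those of C and F.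
\<close>

lemma ob_disc [simp]: "ob (disc_cat (Suc n) C) = ob C"
  by (cases n) auto

lemma hom_disc_Suc [simp]: "hom (disc_cat (Suc (Suc n)) C) x y = disc_cat (Suc n) (hom C x y)"
  by simp

lemma fob_disc [simp]: "x \<in> ob C \<Longrightarrow> fob (disc_fun (Suc n) C F) x = fob F x"
  by (cases n) auto

lemma mem_disc_hom [simp]: "z \<in> disc_hom x y \<longleftrightarrow> z = x \<and> x = y"
  by (auto simp: disc_hom_def)

lemma disc_triv: "disc_fun (Suc n) (terminal n) (triv_fun n) = triv_fun (Suc n)"
  by (induction n) (auto simp: fun_eq_iff)

lemma disc_triv_prod:
  "disc_fun (Suc n) (prod_cat n (terminal n) (terminal n)) (triv_fun n) = triv_fun (Suc n)"
  by (induction n) (auto simp: fun_eq_iff simp del: prod_cat.simps)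

lemma disc_terminal [simp]: "disc_cat (Suc n) (terminal n) = terminal (Suc n)"
proof (induction n)
  case 0
  then show ?case by (auto simp: fun_eq_iff disc_hom_def)
next
  case (Suc n)
  then show ?case
    using disc_triv[of n] disc_triv_prod[of n] by simp
qed

lemma disc_hom_times [simp]:
  "disc_hom (fst x) (fst y) \<times> disc_hom (snd x) (snd y) = disc_hom x y"
  by (cases x; cases y) (auto simp: disc_hom_def)

lemma disc_pair:
  "disc_fun (Suc n) E (pair_fun n E F G) =
   pair_fun (Suc n) (disc_cat (Suc n) E) (disc_fun (Suc n) E F) (disc_fun (Suc n) E G)"
proof (induction n arbitrary: E F G)
  case 0
  then show ?case by (simp cong: restrict_cong)
next
  case (Suc n)
  then show ?case by (simp cong: restrict_cong)
qed

lemma disc_prod_cmp: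
  "disc_fun (Suc n) (prod_cat n (prod_cat n A B) (prod_cat n A' B')) (prod_cmp n A B A' B' M N) =
   prod_cmp (Suc n) (disc_cat (Suc n) A) (disc_cat (Suc n) B) (disc_cat (Suc n) A') (disc_cat (Suc n) B')
     (disc_fun (Suc n) (prod_cat n A A') M) (disc_fun (Suc n) (prod_cat n B B') N)"
proof (induction n arbitrary: A B A' B' M N)
  case 0
  show ?case
    apply (simp only: disc_fun.simps prod_cmp.simps ob_prod_cat disc_cat.simps ncat.sel nfun.sel
        case_prod_beta' hom_prod_cat)
    apply (simp only: prod_cat.simps ncat.sel disc_hom_times)
    apply (rule arg_cong2[where f = Fun]; (rule restrict_ext)+; clarsimp simp: split_beta)
    apply (auto simp: restrict_def fun_eq_iff disc_hom_def)
    done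
next
  case (Suc n)
  have fo: "fob (prod_cmp (Suc n) A B A' B' M N) ((a, b), (a', b')) = (fob M (a, a'), fob N (b, b'))"
    if "a \<in> ob A" "b \<in> ob B" "a' \<in> ob A'" "b' \<in> ob B'" for a b a' b'
    using that by simp
  have fh: "fhom (prod_cmp (Suc n) A B A' B' M N) ((a, b), (a', b')) ((x, y), (x', y')) =
      prod_cmp n (hom A a x) (hom B b y) (hom A' a' x') (hom B' b' y')
        (fhom M (a, a') (x, x')) (fhom N (b, b') (y, y'))"
    if "a \<in> ob A" "b \<in> ob B" "a' \<in> ob A'" "b' \<in> ob B'" "x \<in> ob A" "y \<in> ob B" "x' \<in> ob A'" "y' \<in> ob B'"
    for a b a' b' x y x' y'
    using that by simp
  show ?case
    apply (simp only: disc_fun.simps prod_cmp.simps(2)[of "Suc n"] ob_prod_cat ob_disc ncat.sel nfun.sel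
        case_prod_beta' hom_prod_cat hom_disc_Suc)
    apply (rule arg_cong2[where f = Fun]; (rule restrict_ext)+; clarsimp simp: Suc.IH fo fh simp del: prod_cmp.simps)
    done
qed

lemma disc_prod [simp]:
  "disc_cat (Suc n) (prod_cat n C D) = prod_cat (Suc n) (disc_cat (Suc n) C) (disc_cat (Suc n) D)"
proof (induction n arbitrary: C D)
  case 0
  show ?case
    apply (simp only: disc_cat.simps prod_cat.simps ncat.sel case_prod_beta' disc_hom_times
        ncat.inject simp_thms)
    apply (intro conjI ext)
     apply (simp add: restrict_def)
    apply (simp only: prod_cmp.simps ncat.sel nfun.sel nfun.inject case_prod_beta' disc_hom_times)
    apply (rule restrict_ext)
    apply clarsimp
    done
next
  case (Suc n)
  show ?case
    by (simp add: fun_eq_iff Suc disc_pair disc_prod_cmp)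
qed

declare fcomp.simps(2) [simp del] id_fun.simps(2) [simp del] pair_fun.simps(2) [simp del]
  prod_fun.simps(2) [simp del] fst_fun.simps(2) [simp del] snd_fun.simps(2) [simp del]
  assoc_fun.simps(2) [simp del] bang_fun.simps(2) [simp del]

text \<open>
  The identity, in \<open>D C\<close>, of a cell of top dimension of C. Its top entry repeats the object, because
  the identity of x in a discrete groupoid is x.
\<close>

primrec degen :: "'a cell \<Rightarrow> 'a cell" where
  "degen (Top x) = Step x x (Top x)"
| "degen (Step x y z) = Step x y (degen z)"

lemma map_cell_degen [simp]: "map_cell f (degen z) = degen (map_cell f z)"
  by (induction z) auto

lemma dim_degen [simp]: "dim (degen z) = Suc (dim z)"
  by (induction z) auto

lemma cpair_degen [simp]: "dim a = dim b \<Longrightarrow> cpair (degen a) (degen b) = degen (cpair a b)"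
  by (induction a b rule: cpair.induct) auto

lemma is_cell_disc: "is_cell n C z \<Longrightarrow> is_cell (Suc n) (disc_cat (Suc n) C) z"
proof (induction n C z rule: is_cell.induct)
  case (3 n C x y z)
  then show ?case by (simp del: disc_cat.simps(2))
qed auto

lemma is_cell_degen:
  "is_cell n C z \<Longrightarrow> dim z = n \<Longrightarrow> is_cell (Suc n) (disc_cat (Suc n) C) (degen z)"
  by (induction n C z rule: is_cell.induct) (auto simp: disc_hom_def)

lemma is_cell_disc_cases:
  assumes "is_cell (Suc n) (disc_cat (Suc n) C) z"
  obtains "is_cell n C z" | w where "is_cell n C w" "dim w = n" "z = degen w"
proof -
  have "is_cell n C z \<or> (\<exists>w. is_cell n C w \<and> dim w = n \<and> z = degen w)"
    using assms
  proof (induction n arbitrary: C z)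
    case 0
    show ?case
    proof (cases z)
      case (Step x y w)
      then have "z = degen (Top x)" "x \<in> ob C" using 0 by (cases w; auto)+
      then show ?thesis by (intro disjI2 exI[of _ "Top x"]) auto
    qed (use 0 in auto)
  next
    case (Suc n)
    show ?case
    proof (cases z)
      case (Step x y w)
      then have xy: "x \<in> ob C" "y \<in> ob C" and w: "is_cell (Suc n) (disc_cat (Suc n) (hom C x y)) w"
        using Suc.prems by auto
      from Suc.IH[OF w] show ?thesis
      proof
        assume "\<exists>v. is_cell n (hom C x y) v \<and> dim v = n \<and> w = degen v"
        then obtain v where "is_cell n (hom C x y) v" "dim v = n" "w = degen v" by blast
        with xy Step show ?thesis by (intro disjI2 exI[of _ "Step x y v"]) auto
      qed (use xy Step in auto)
    qed (use Suc.prems in auto)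
  qed
  then show thesis using that by blast
qed

lemma disc_eqI:
  assumes "gmap (Suc n) (disc_cat (Suc n) C) D F" "gmap (Suc n) (disc_cat (Suc n) C) D' G"
    and "\<And>z. is_cell n C z \<Longrightarrow> capp F z = capp G z"
    and "\<And>z. is_cell n C z \<Longrightarrow> dim z = n \<Longrightarrow> capp F (degen z) = capp G (degen z)"
  shows "F = G"
  by (rule gmap_eqI[OF assms(1,2)]) (auto elim!: is_cell_disc_cases intro: assms(3,4))

lemma capp_disc [simp]: "is_cell n C z \<Longrightarrow> capp (disc_fun (Suc n) C F) z = capp F z"
proof (induction n C z arbitrary: F rule: is_cell.induct)
  case (3 n C x y z)
  then show ?case by (simp del: disc_cat.simps(2))
qed auto

lemma capp_disc_degen [simp]:
  "is_cell n C z \<Longrightarrow> dim z = n \<Longrightarrow> capp (disc_fun (Suc n) C F) (degen z) = degen (capp F z)"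
  by (induction n C z arbitrary: F rule: is_cell.induct) (auto simp: disc_hom_def)

lemma gmap_disc:
  "gmap n C D F \<Longrightarrow> gmap (Suc n) (disc_cat (Suc n) C) (disc_cat (Suc n) D) (disc_fun (Suc n) C F)"
proof (induction n arbitrary: C D F)
  case 0
  show ?case
    using gmap_0D[OF 0] by (auto simp: disc_hom_def)
next
  case (Suc n)
  show ?case
    by (simp add: gmap_fob[OF Suc.prems] Suc.IH[OF gmap_fhom[OF Suc.prems]])
qed

lemma gcat_disc: "gcat n C \<Longrightarrow> gcat (Suc n) (disc_cat (Suc n) C)"
proof (induction n arbitrary: C)
  case 0
  then show ?case by (auto simp: disc_hom_def)
next
  case (Suc n)
  note C = Suc.prems
  show ?case
  proof (rule gcat_SucI)
    fix x y z assume x: "x \<in> ob (disc_cat (Suc (Suc n)) C)" "y \<in> ob (disc_cat (Suc (Suc n)) C)"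
      "z \<in> ob (disc_cat (Suc (Suc n)) C)"
    then show "gcat (Suc n) (hom (disc_cat (Suc (Suc n)) C) x y)"
      using Suc.IH gcat_hom[OF C] by simp
    show "gmap (Suc n) (terminal (Suc n)) (hom (disc_cat (Suc (Suc n)) C) x x) (unt (disc_cat (Suc (Suc n)) C) x)"
      using gmap_disc[OF gcat_unt[OF C]] x by (simp del: terminal.simps)
    show "gmap (Suc n) (prod_cat (Suc n) (hom (disc_cat (Suc (Suc n)) C) x y) (hom (disc_cat (Suc (Suc n)) C) y z))
      (hom (disc_cat (Suc (Suc n)) C) x z) (cmp (disc_cat (Suc (Suc n)) C) x y z)"
      using gmap_disc[OF gcat_cmp[OF C]] x by (simp del: prod_cat.simps)
  qed simp
qed

lemma disc_fun_inj:
  assumes "gmap n C D F" "gmap n C D' G" "disc_fun (Suc n) C F = disc_fun (Suc n) C G"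
  shows "F = G"
  by (rule gmap_eqI[OF assms(1,2)]) (metis assms(3) capp_disc)

lemma disc_fcomp:
  assumes "gmap n C D F" "gmap n D E G"
  shows "disc_fun (Suc n) C (fcomp n C F G) =
    fcomp (Suc n) (disc_cat (Suc n) C) (disc_fun (Suc n) C F) (disc_fun (Suc n) D G)"
  by (rule disc_eqI[OF gmap_disc[OF gmap_fcomp[OF assms]] gmap_fcomp[OF gmap_disc[OF assms(1)] gmap_disc[OF assms(2)]]])
    (simp_all add: assms is_cell_disc is_cell_degen gmap_cell[OF assms(1)])

lemma disc_id: "disc_fun (Suc n) C (id_fun n C) = id_fun (Suc n) (disc_cat (Suc n) C)"
  by (rule disc_eqI[OF gmap_disc[OF gmap_id] gmap_id]) (simp_all add: is_cell_disc is_cell_degen)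

lemma disc_prod_fun:
  assumes "gmap n A C F" "gmap n B D G"
  shows "disc_fun (Suc n) (prod_cat n A B) (prod_fun n A B F G) =
    prod_fun (Suc n) (disc_cat (Suc n) A) (disc_cat (Suc n) B) (disc_fun (Suc n) A F) (disc_fun (Suc n) B G)"
  by (rule disc_eqI[OF gmap_disc[OF gmap_prod[OF assms]]
        gmap_prod[OF gmap_disc[OF assms(1)] gmap_disc[OF assms(2)], folded disc_prod]])
    (simp_all add: assms is_cell_disc is_cell_degen cell_prod_cat)

lemma disc_point:
  "disc_fun (Suc n) (terminal n) (point_fun n Y y) = point_fun (Suc n) (disc_cat (Suc n) Y) y"
  by (cases n) (auto simp: fun_eq_iff disc_hom_def)

lemma disc_bang: "disc_fun (Suc n) C (bang_fun n C) = bang_fun (Suc n) (disc_cat (Suc n) C)"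
  by (rule disc_eqI[OF gmap_disc[OF gmap_bang] gmap_bang]) simp_all

lemma disc_const:
  assumes "gcat n Y" "y \<in> ob Y"
  shows "disc_fun (Suc n) X (const_fun n X Y y) =
    const_fun (Suc n) (disc_cat (Suc n) X) (disc_cat (Suc n) Y) y"
  unfolding const_fun_def by (simp only: disc_fcomp[OF gmap_bang gmap_point[OF assms]] disc_point disc_bang)

lemma disc_precomp:
  assumes D: "gcat (Suc n) D" and o: "x \<in> ob D" "y \<in> ob D" "z \<in> ob D" "f \<in> ob (hom D x y)"
  shows "disc_fun (Suc n) (hom D y z) (precomp n D x y z f) =
    precomp (Suc n) (disc_cat (Suc (Suc n)) D) x y z f"
  unfolding precomp_def using o
  by (simp add: disc_fcomp[OF gmap_pair[OF gmap_const[OF gcat_hom[OF D]] gmap_id] gcat_cmp[OF D]]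
      disc_pair disc_id disc_const[OF gcat_hom[OF D]]
      del: fcomp.simps pair_fun.simps id_fun.simps gcat.simps disc_cat.simps(2))
   simp

lemma disc_postcomp:
  assumes D: "gcat (Suc n) D" and o: "x \<in> ob D" "y \<in> ob D" "z \<in> ob D" "g \<in> ob (hom D y z)"
  shows "disc_fun (Suc n) (hom D x y) (postcomp n D x y z g) =
    postcomp (Suc n) (disc_cat (Suc (Suc n)) D) x y z g"
  unfolding postcomp_def using o
  by (simp add: disc_fcomp[OF gmap_pair[OF gmap_id gmap_const[OF gcat_hom[OF D]]] gcat_cmp[OF D]]
      disc_pair disc_id disc_const[OF gcat_hom[OF D]]
      del: fcomp.simps pair_fun.simps id_fun.simps gcat.simps disc_cat.simps(2))
   simp

lemma unt_disc_Suc: "unt (disc_cat (Suc (Suc n)) C) x = disc_fun (Suc n) (terminal n) (unt C x)"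
  by simp

lemma cmp_disc_Suc: "cmp (disc_cat (Suc (Suc n)) C) x y z =
    disc_fun (Suc n) (prod_cat n (hom C x y) (hom C y z)) (cmp C x y z)"
  by simp

lemma fhom_disc_Suc: "x \<in> ob C \<Longrightarrow> y \<in> ob C \<Longrightarrow>
    fhom (disc_fun (Suc (Suc n)) C F) x y = disc_fun (Suc n) (hom C x y) (fhom F x y)"
  by simp

lemma dim_is_cell: "is_cell n C z \<Longrightarrow> dim z \<le> n"
  by (induction n C z rule: is_cell.induct) auto

text \<open>
  D reflects the laws because the cells of C are among those of \<open>D C\<close>. Reflection is used to establish
  structure on \<open>\<pi>\<^sub>0 C\<close>: laws descend along functors, and the quotient functor of an n-groupoid C ends
  not in \<open>\<pi>\<^sub>0 C\<close>, which is of level n - 1, but in \<open>D (\<pi>\<^sub>0 C)\<close>.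
\<close>

lemma is_fun_disc_iff:
  "gcat n C \<Longrightarrow> gcat n D \<Longrightarrow> gmap n C D F
   \<Longrightarrow> is_fun (Suc n) (disc_cat (Suc n) C) (disc_cat (Suc n) D) (disc_fun (Suc n) C F) \<longleftrightarrow> is_fun n C D F"
proof (induction n arbitrary: C D F)
  case 0
  note g = gcat_disc[OF 0(1)] gcat_disc[OF 0(2)] gmap_disc[OF 0(3)]
  have "is_fun (Suc 0) (disc_cat (Suc 0) C) (disc_cat (Suc 0) D) (disc_fun (Suc 0) C F)"
  proof (rule is_fun_SucI[OF g], goal_cases)
    case (1 x y)
    then show ?case using gmap_fhom[OF g(3) 1] by (simp only: is_fun.simps gmap.simps)
  next
    case (2 x t)
    then show ?case by (cases t) auto
  next
    case (3 x y z a b)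
    then show ?case by (cases a; cases b) auto
  qed
  moreover have "is_fun 0 C D F" using 0(3) by (simp only: is_fun.simps gmap.simps)
  ultimately show ?case by blast
next
  case (Suc n)
  note C = Suc.prems(1) and D = Suc.prems(2) and F = Suc.prems(3)
  note fob = gmap_fob[OF F] and hom = gmap_fhom[OF F]
  note IH = Suc.IH[OF gcat_hom[OF C] gcat_hom[OF D] hom]
  note simps = hom_disc_Suc unt_disc_Suc cmp_disc_Suc fhom_disc_Suc ob_disc fob_disc
  note uc = gmap_cell[OF gcat_unt[OF C]] and cc = gcat_cmp_cell[OF C] and hc = gmap_cell[OF hom]
  show ?case (is "?L \<longleftrightarrow> ?R")
  proof
    assume F': ?R
    show ?L
    proof (rule is_fun_SucI[OF gcat_disc[OF C] gcat_disc[OF D] gmap_disc[OF F]], goal_cases)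
      case (1 x y)
      then show ?case using IH[of x y] is_fun_hom[OF F'] by (simp add: fob simps del: is_fun.simps disc_cat.simps)
    next
      case (2 x t)
      then have x: "x \<in> ob C" by simp
      from 2(2) have "is_cell (Suc n) (disc_cat (Suc n) (terminal n)) t" by simp
      then show ?case
        by (cases rule: is_cell_disc_cases)
          (simp_all add: simps x uc fob is_fun_unt[OF F'] del: disc_cat.simps)
    next
      case (3 x y z a b)
      then have o: "x \<in> ob C" "y \<in> ob C" "z \<in> ob C" by simp_all
      have a: "is_cell (Suc n) (disc_cat (Suc n) (hom C x y)) a"
        and b: "is_cell (Suc n) (disc_cat (Suc n) (hom C y z)) b" using 3 by simp_all
      show ?case
        by (rule is_cell_disc_cases[OF a]; rule is_cell_disc_cases[OF b])
          (use o 3(6) in \<open>auto simp: simps cell_prod_cat cc hc fob is_fun_cmp[OF F'] dest: dim_is_cell simp del: disc_cat.simps\<close>)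
    qed
  next
    assume F': ?L
    note t = is_cell_disc[of n "terminal n", unfolded disc_terminal]
    show ?R
    proof (rule is_fun_SucI[OF C D F], goal_cases)
      case (1 x y)
      then show ?case using IH[OF 1] is_fun_hom[OF F', of x y] by (simp add: fob simps del: is_fun.simps disc_cat.simps)
    next
      case (2 x t)
      then show ?case using is_fun_unt[OF F' _ t[OF 2(2)], of x]
        by (simp add: simps uc fob del: disc_cat.simps)
    next
      case (3 x y z a b)
      then show ?case
        using is_fun_cmp[OF F', of x y z a b] is_cell_disc[OF 3(4)] is_cell_disc[OF 3(5)]
        by (simp add: simps cell_prod_cat cc hc fob del: disc_cat.simps)
    qed
  qed
qed

lemma is_cat_disc_iff: "gcat n C \<Longrightarrow> is_cat (Suc n) (disc_cat (Suc n) C) \<longleftrightarrow> is_cat n C"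
proof (induction n arbitrary: C)
  case 0
  have "is_cat (Suc 0) (disc_cat (Suc 0) C)"
  proof (rule is_cat_SucI[OF gcat_disc[OF 0]], goal_cases)
    case (4 x y a)
    then show ?case by (cases a) auto
  next
    case (5 x y a)
    then show ?case by (cases a) auto
  next
    case (6 w x y z a b c)
    then show ?case by (cases a; cases b; cases c) auto
  qed auto
  then show ?case using 0 by simp
next
  case (Suc n)
  note C = Suc.prems
  note cg = gcat_hom[OF C] and u = gcat_unt[OF C] and m = gcat_cmp[OF C]
  note simps = hom_disc_Suc unt_disc_Suc cmp_disc_Suc
  have U: "is_fun (Suc n) (terminal (Suc n)) (disc_cat (Suc n) (hom C x x)) (disc_fun (Suc n) (terminal n) (unt C x))
     \<longleftrightarrow> is_fun n (terminal n) (hom C x x) (unt C x)" if "x \<in> ob C" for x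
    using is_fun_disc_iff[OF gcat_terminal cg u] that by (simp only: disc_terminal)
  have M: "is_fun (Suc n) (prod_cat (Suc n) (disc_cat (Suc n) (hom C x y)) (disc_cat (Suc n) (hom C y z)))
      (disc_cat (Suc n) (hom C x z)) (disc_fun (Suc n) (prod_cat n (hom C x y) (hom C y z)) (cmp C x y z))
     \<longleftrightarrow> is_fun n (prod_cat n (hom C x y) (hom C y z)) (hom C x z) (cmp C x y z)"
    if "x \<in> ob C" "y \<in> ob C" "z \<in> ob C" for x y z
    using is_fun_disc_iff[OF gcat_prod[OF cg cg] cg m] that by (simp only: disc_prod)
  note uc = gmap_cell[OF gcat_unt[OF C]] and cc = gcat_cmp_cell[OF C]
  show ?case (is "?L \<longleftrightarrow> ?R")
  proof
    assume C': ?R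
    show ?L
    proof (rule is_cat_SucI[OF gcat_disc[OF C]], goal_cases)
      case (1 x y)
      then show ?case using Suc.IH[OF cg] is_cat_hom[OF C'] by (simp add: simps del: is_cat.simps disc_cat.simps)
    next
      case (2 x)
      then show ?case using U is_cat_unt[OF C'] by (simp add: simps del: is_cat.simps disc_cat.simps is_fun.simps terminal.simps)
    next
      case (3 x y z)
      then show ?case using M is_cat_cmp[OF C'] by (simp add: simps del: is_cat.simps disc_cat.simps is_fun.simps)
    next
      case (4 x y a)
      then have o: "x \<in> ob C" "y \<in> ob C" and a: "is_cell (Suc n) (disc_cat (Suc n) (hom C x y)) a" by simp_all
      show ?case
        by (rule is_cell_disc_cases[OF a])
          (use o in \<open>simp_all add: simps cell_prod_cat cell_cbang uc cat_unit_left[OF C'] del: disc_cat.simps\<close>)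
    next
      case (5 x y a)
      then have o: "x \<in> ob C" "y \<in> ob C" and a: "is_cell (Suc n) (disc_cat (Suc n) (hom C x y)) a" by simp_all
      show ?case
        by (rule is_cell_disc_cases[OF a])
          (use o in \<open>simp_all add: simps cell_prod_cat cell_cbang uc cat_unit_right[OF C'] del: disc_cat.simps\<close>)
    next
      case (6 w x y z a b c)
      then have o: "w \<in> ob C" "x \<in> ob C" "y \<in> ob C" "z \<in> ob C" by simp_all
      have a: "is_cell (Suc n) (disc_cat (Suc n) (hom C w x)) a"
        and b: "is_cell (Suc n) (disc_cat (Suc n) (hom C x y)) b"
        and c: "is_cell (Suc n) (disc_cat (Suc n) (hom C y z)) c" using 6 by simp_all
      show ?case
        by (rule is_cell_disc_cases[OF a]; rule is_cell_disc_cases[OF b]; rule is_cell_disc_cases[OF c])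
          (use o 6(8,9) in \<open>auto simp: simps cell_prod_cat cc cat_assoc[OF C'] dest: dim_is_cell simp del: disc_cat.simps\<close>)
    qed
  next
    assume C': ?L
    show ?R
    proof (rule is_cat_SucI[OF C], goal_cases)
      case (1 x y)
      then show ?case using Suc.IH[OF cg[OF 1]] is_cat_hom[OF C', of x y] by (simp add: simps del: is_cat.simps disc_cat.simps)
    next
      case (2 x)
      then show ?case using U[OF 2] is_cat_unt[OF C', of x] by (simp add: simps del: is_cat.simps disc_cat.simps is_fun.simps terminal.simps)
    next
      case (3 x y z)
      then show ?case using M[OF 3] is_cat_cmp[OF C', of x y z] by (simp add: simps del: is_cat.simps disc_cat.simps is_fun.simps)
    next
      case (4 x y a)
      then show ?case using cat_unit_left[OF C', of x y a "cbang a"] is_cell_disc[OF 4(3)]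
        by (simp add: simps cell_prod_cat cell_cbang uc del: disc_cat.simps)
    next
      case (5 x y a)
      then show ?case using cat_unit_right[OF C', of x y a "cbang a"] is_cell_disc[OF 5(3)]
        by (simp add: simps cell_prod_cat cell_cbang uc del: disc_cat.simps)
    next
      case (6 w x y z a b c)
      then show ?case
        using cat_assoc[OF C', of w x y z a b c] is_cell_disc[OF 6(5)] is_cell_disc[OF 6(6)] is_cell_disc[OF 6(7)]
        by (simp add: simps cell_prod_cat cc del: disc_cat.simps)
    qed
  qed
qed

section \<open>The discrete functor on 2-morphisms\<close>

text \<open>
  D is injective on 2-morphisms and commutes strictly with identities, whiskerings, products and
  vertical composition. The laws of a 2-morphism are equations between expressions in these
  operations, so they hold for \<alpha> if and only if they hold for \<open>D \<alpha>\<close>.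
\<close>

lemma src_disc_tr [simp]: "src (disc_tr (Suc n) C D \<alpha>) = disc_fun (Suc n) C (src \<alpha>)"
  by (cases n) auto

lemma tgt_disc_tr: "gtr n C D \<alpha> \<Longrightarrow> tgt (disc_tr (Suc n) C D \<alpha>) = disc_fun (Suc n) C (tgt \<alpha>)"
  using gtr_0[of C D \<alpha>] by (cases n) auto

lemma tob_disc_tr [simp]: "c \<in> ob C \<Longrightarrow> tob (disc_tr (Suc (Suc n)) C D \<alpha>) c = tob \<alpha> c"
  by simp

lemma thom_disc_tr [simp]: "c \<in> ob C \<Longrightarrow> c' \<in> ob C \<Longrightarrow> thom (disc_tr (Suc (Suc n)) C D \<alpha>) c c' =
    disc_tr (Suc n) (hom C c c') (hom D (fob (src \<alpha>) c) (fob (tgt \<alpha>) c')) (thom \<alpha> c c')"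
  by simp

lemma is_cat_disc: "is_cat n C \<Longrightarrow> is_cat (Suc n) (disc_cat (Suc n) C)"
  by (simp only: is_cat_disc_iff is_cat_gcat)

lemma is_fun_disc: "gcat n C \<Longrightarrow> gcat n D \<Longrightarrow> is_fun n C D F
    \<Longrightarrow> is_fun (Suc n) (disc_cat (Suc n) C) (disc_cat (Suc n) D) (disc_fun (Suc n) C F)"
  by (simp only: is_fun_disc_iff is_fun_gmap)

lemma tob_prod_tr: "a \<in> ob A \<Longrightarrow> b \<in> ob B \<Longrightarrow> tob (prod_tr (Suc n) A B \<alpha> \<beta>) (a, b) = (tob \<alpha> a, tob \<beta> b)"
  by simp

lemma thom_prod_tr:
  "a \<in> ob A \<Longrightarrow> b \<in> ob B \<Longrightarrow> a' \<in> ob A \<Longrightarrow> b' \<in> ob B \<Longrightarrow> thom (prod_tr (Suc n) A B \<alpha> \<beta>) (a, b) (a', b') =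
     prod_tr n (hom A a a') (hom B b b') (thom \<alpha> a a') (thom \<beta> b b')"
  by simp

lemma gtr_disc:
  "is_cat n D \<Longrightarrow> gtr n C D \<alpha>
   \<Longrightarrow> gtr (Suc n) (disc_cat (Suc n) C) (disc_cat (Suc n) D) (disc_tr (Suc n) C D \<alpha>)"
proof (induction n arbitrary: C D \<alpha>)
  case 0
  show ?case unfolding disc_tr.simps
    by (rule gtr_id[OF is_cat_disc[OF 0(1)] gmap_disc[OF gtr_src[OF 0(2)]]])
next
  case (Suc n)
  note D = Suc.prems(1) and \<alpha> = Suc.prems(2)
  note D' = is_cat_gcat[OF D]
  note fob = gtr_fob_src[OF \<alpha>] gtr_fob_tgt[OF \<alpha>] and tob = gtr_tob[OF \<alpha>] and th = gtr_thom[OF \<alpha>]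
  note hom = gmap_fhom[OF gtr_src[OF \<alpha>]] gmap_fhom[OF gtr_tgt[OF \<alpha>]]
  have eq: "disc_tr (Suc (Suc n)) C D \<alpha> =
     Tr (disc_fun (Suc (Suc n)) C (src \<alpha>)) (disc_fun (Suc (Suc n)) C (tgt \<alpha>))
       (\<lambda>c\<in>ob (disc_cat (Suc (Suc n)) C). tob \<alpha> c)
       (\<lambda>c\<in>ob (disc_cat (Suc (Suc n)) C). \<lambda>c'\<in>ob (disc_cat (Suc (Suc n)) C).
          disc_tr (Suc n) (hom C c c') (hom D (fob (src \<alpha>) c) (fob (tgt \<alpha>) c')) (thom \<alpha> c c'))"
    by simp
  show ?case unfolding eq
  proof (rule gtr_TrI[OF gmap_disc[OF gtr_src[OF \<alpha>]] gmap_disc[OF gtr_tgt[OF \<alpha>]]], goal_cases)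
    case (1 c)
    then show ?case using tob[of c] fob by simp
  next
    case (2 c c')
    then show ?case using Suc.IH[OF is_cat_hom[OF D] th, of c c'] fob by (simp del: gtr.simps)
  next
    case (3 c c')
    then show ?case using fob tob disc_fcomp[OF hom(2) gmap_precomp_weak[OF D']]
      by (simp add: gtr_thom_src[OF \<alpha>] fhom_disc_Suc disc_precomp[OF D'] del: gcat.simps disc_fun.simps disc_cat.simps)
  next
    case (4 c c')
    then show ?case using fob tob disc_fcomp[OF hom(1) gmap_postcomp_weak[OF D']]
      by (simp add: gtr_thom_tgt[OF \<alpha>] tgt_disc_tr[OF th] fhom_disc_Suc disc_postcomp[OF D'] del: gcat.simps disc_fun.simps disc_cat.simps)
  qed
qed

lemma disc_tr_inj:
  "gtr n C D \<alpha> \<Longrightarrow> gtr n C D \<beta> \<Longrightarrow> disc_tr (Suc n) C D \<alpha> = disc_tr (Suc n) C D \<beta> \<Longrightarrow> \<alpha> = \<beta>"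
proof (induction n arbitrary: C D \<alpha> \<beta>)
  case 0
  have "disc_fun (Suc 0) C (src \<alpha>) = disc_fun (Suc 0) C (src \<beta>)"
    using arg_cong[OF 0(3), of src] by (simp only: src_disc_tr)
  then have "src \<alpha> = src \<beta>"
    using disc_fun_inj[OF gtr_src[OF 0(1)] gtr_src[OF 0(2)]] by blast
  then show ?case using gtr_0[OF 0(1)] gtr_0[OF 0(2)] by metis
next
  case (Suc n)
  note \<alpha> = Suc.prems(1) and \<beta> = Suc.prems(2) and eq = Suc.prems(3)
  have s: "src \<alpha> = src \<beta>"
    using arg_cong[OF eq, of src] disc_fun_inj[OF gtr_src[OF \<alpha>] gtr_src[OF \<beta>]] by (simp only: src_disc_tr)
  have t: "tgt \<alpha> = tgt \<beta>"
    using arg_cong[OF eq, of tgt] disc_fun_inj[OF gtr_tgt[OF \<alpha>] gtr_tgt[OF \<beta>]]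
    by (simp only: tgt_disc_tr[OF \<alpha>] tgt_disc_tr[OF \<beta>])
  show ?case
  proof (rule gtr_Suc_eqI[OF \<alpha> \<beta> s t])
    show "tob \<alpha> c = tob \<beta> c" if c: "c \<in> ob C" for c
      using arg_cong[OF eq, of "\<lambda>x. tob x c"] by (simp only: tob_disc_tr[OF c])
    fix c c' assume c: "c \<in> ob C" "c' \<in> ob C"
    show "thom \<alpha> c c' = thom \<beta> c c'"
      using arg_cong[OF eq, of "\<lambda>x. thom x c c'"] Suc.IH[OF gtr_thom[OF \<alpha> c] gtr_thom[OF \<beta> c, folded s t]]
      by (simp only: thom_disc_tr[OF c] s t)
  qed
qed

lemma disc_tr_id:
  "disc_tr (Suc n) C D (id_tr n C D F) =
   id_tr (Suc n) (disc_cat (Suc n) C) (disc_cat (Suc n) D) (disc_fun (Suc n) C F)"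
proof (induction n arbitrary: C D F)
  case (Suc n)
  then show ?case by (simp cong: restrict_cong)
qed simp

lemma disc_tr_wl:
  "is_cat n D \<Longrightarrow> gmap n B C N \<Longrightarrow> gtr n C D \<alpha>
   \<Longrightarrow> disc_tr (Suc n) B D (whisker_l n B N \<alpha>) =
      whisker_l (Suc n) (disc_cat (Suc n) B) (disc_fun (Suc n) B N) (disc_tr (Suc n) C D \<alpha>)"
proof (induction n arbitrary: B C D N \<alpha>)
  case 0
  show ?case
    using wl_id[OF is_cat_disc[OF 0(1)] gmap_disc[OF 0(2)] gmap_disc[OF gtr_src[OF 0(3)]]]
    by (simp only: disc_tr.simps src_whisker_l disc_fcomp[OF 0(2) gtr_src[OF 0(3)]])
next
  case (Suc n)
  note D = Suc.prems(1) and N = Suc.prems(2) and \<alpha> = Suc.prems(3)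
  note D' = is_cat_gcat[OF D] and wl = gtr_wl[OF is_cat_gcat[OF D] N \<alpha>]
  note fob = gmap_fob[OF N] gtr_fob_src[OF \<alpha>] gtr_fob_tgt[OF \<alpha>]
  note tgt = tgt_disc_tr[OF wl] tgt_disc_tr[OF \<alpha>] tgt_whisker_l[OF \<alpha>] tgt_whisker_l[OF gtr_disc[OF D \<alpha>]]
  note IH = Suc.IH[OF is_cat_hom[OF D] gmap_fhom[OF N] gtr_thom[OF \<alpha>]]
  show ?case
  proof (rule gtr_Suc_eqI[OF gtr_disc[OF D wl] gtr_wl[OF gcat_disc[OF D'] gmap_disc[OF N] gtr_disc[OF D \<alpha>]]], goal_cases)
    case 1
    show ?case by (simp only: src_disc_tr src_whisker_l disc_fcomp[OF N gtr_src[OF \<alpha>]])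
  next
    case 2
    show ?case by (simp only: tgt disc_fcomp[OF N gtr_tgt[OF \<alpha>]])
  next
    case (3 c)
    then show ?case by (simp add: tob_whisker_l fob del: disc_tr.simps whisker_l.simps disc_cat.simps)
  next
    case (4 c c')
    then show ?case
      by (simp add: thom_whisker_l fob tgt fhom_disc_Suc IH
        del: disc_tr.simps whisker_l.simps disc_cat.simps disc_fun.simps)
  qed
qed

lemma disc_tr_wr:
  "is_cat n D \<Longrightarrow> is_cat n E \<Longrightarrow> gtr n C D \<alpha> \<Longrightarrow> is_fun n D E L
   \<Longrightarrow> disc_tr (Suc n) C E (whisker_r n C \<alpha> L) =
      whisker_r (Suc n) (disc_cat (Suc n) C) (disc_tr (Suc n) C D \<alpha>) (disc_fun (Suc n) D L)"
proof (induction n arbitrary: C D E L \<alpha>)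
  case 0
  show ?case
    using wr_id[OF is_cat_disc[OF 0(1)] is_cat_disc[OF 0(2)] gmap_disc[OF gtr_src[OF 0(3)]]
        is_fun_disc[OF is_cat_gcat[OF 0(1)] is_cat_gcat[OF 0(2)] 0(4)]]
    by (simp only: disc_tr.simps src_whisker_r disc_fcomp[OF gtr_src[OF 0(3)] is_fun_gmap[OF 0(4)]])
next
  case (Suc n)
  note D = Suc.prems(1) and E = Suc.prems(2) and \<alpha> = Suc.prems(3) and L = Suc.prems(4)
  note D' = is_cat_gcat[OF D] and E' = is_cat_gcat[OF E] and L' = is_fun_gmap[OF L]
  note wr = gtr_wr[OF D E' \<alpha> L]
  note fob = gtr_fob_src[OF \<alpha>] gtr_fob_tgt[OF \<alpha>] gmap_fob[OF L'] gtr_tob[OF \<alpha>]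
  note tgt = tgt_disc_tr[OF wr] tgt_disc_tr[OF \<alpha>] tgt_whisker_r[OF \<alpha>] tgt_whisker_r[OF gtr_disc[OF D \<alpha>]]
  note IH = Suc.IH[OF is_cat_hom[OF D] is_cat_hom[OF E] gtr_thom[OF \<alpha>] is_fun_hom[OF L]]
  show ?case
  proof (rule gtr_Suc_eqI[OF gtr_disc[OF E wr]
        gtr_wr[OF is_cat_disc[OF D] gcat_disc[OF E'] gtr_disc[OF D \<alpha>] is_fun_disc[OF D' E' L]]], goal_cases)
    case 1
    show ?case by (simp only: src_disc_tr src_whisker_r disc_fcomp[OF gtr_src[OF \<alpha>] L'])
  next
    case 2
    show ?case by (simp only: tgt disc_fcomp[OF gtr_tgt[OF \<alpha>] L'])
  next
    case (3 c)
    then show ?case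
      by (simp add: tob_whisker_r fob tgt fhom_disc_Suc del: disc_tr.simps whisker_r.simps disc_cat.simps disc_fun.simps)
  next
    case (4 c c')
    then show ?case
      by (simp add: thom_whisker_r fob tgt fhom_disc_Suc IH
        del: disc_tr.simps whisker_r.simps disc_cat.simps disc_fun.simps)
  qed
qed

lemma disc_tr_prod:
  "is_cat n C \<Longrightarrow> is_cat n D \<Longrightarrow> gtr n A C \<alpha> \<Longrightarrow> gtr n B D \<beta>
   \<Longrightarrow> disc_tr (Suc n) (prod_cat n A B) (prod_cat n C D) (prod_tr n A B \<alpha> \<beta>) =
      prod_tr (Suc n) (disc_cat (Suc n) A) (disc_cat (Suc n) B) (disc_tr (Suc n) A C \<alpha>) (disc_tr (Suc n) B D \<beta>)"
proof (induction n arbitrary: A B C D \<alpha> \<beta>)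
  case 0
  show ?case
    using prod_id[OF is_cat_disc[OF 0(1)] is_cat_disc[OF 0(2)] gmap_disc[OF gtr_src[OF 0(3)]] gmap_disc[OF gtr_src[OF 0(4)]]]
    by (simp only: disc_tr.simps src_prod_tr disc_prod_fun[OF gtr_src[OF 0(3)] gtr_src[OF 0(4)]] disc_prod)
next
  case (Suc n)
  note C = Suc.prems(1) and D = Suc.prems(2) and \<alpha> = Suc.prems(3) and \<beta> = Suc.prems(4)
  note C' = is_cat_gcat[OF C] and D' = is_cat_gcat[OF D]
  note p = gtr_prod[OF C' D' \<alpha> \<beta>]
  note fob = gtr_fob_src[OF \<alpha>] gtr_fob_tgt[OF \<alpha>] gtr_fob_src[OF \<beta>] gtr_fob_tgt[OF \<beta>]
  note d = gtr_disc[OF C \<alpha>] gtr_disc[OF D \<beta>]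
  note tgt = tgt_disc_tr[OF p] tgt_disc_tr[OF \<alpha>] tgt_disc_tr[OF \<beta>] tgt_prod_tr[OF \<alpha> \<beta>] tgt_prod_tr[OF d]
  note IH = Suc.IH[OF is_cat_hom[OF C] is_cat_hom[OF D] gtr_thom[OF \<alpha>] gtr_thom[OF \<beta>]]
  show ?case
  proof (rule gtr_Suc_eqI[OF gtr_disc[OF is_cat_prod[OF C D] p, unfolded disc_prod]
        gtr_prod[OF gcat_disc[OF C'] gcat_disc[OF D'] d]], goal_cases)
    case 1
    show ?case by (simp only: src_disc_tr src_prod_tr disc_prod_fun[OF gtr_src[OF \<alpha>] gtr_src[OF \<beta>]])
  next
    case 2
    show ?case by (simp only: tgt disc_prod_fun[OF gtr_tgt[OF \<alpha>] gtr_tgt[OF \<beta>]])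
  next
    case (3 c)
    then show ?case by (auto simp: tob_prod_tr simp del: prod_tr.simps disc_tr.simps)
  next
    case (4 c c')
    then show ?case
      by (auto simp: thom_prod_tr tgt prod_fun.simps(2) fob IH simp del: prod_tr.simps disc_tr.simps prod_cat.simps)
  qed
qed

lemma disc_tr_vcomp:
  "is_cat n D \<Longrightarrow> gtr n C D \<omega> \<Longrightarrow> gtr n C D \<alpha> \<Longrightarrow> tgt \<omega> = src \<alpha>
   \<Longrightarrow> disc_tr (Suc n) C D (vcomp n C D \<omega> \<alpha>) =
      vcomp (Suc n) (disc_cat (Suc n) C) (disc_cat (Suc n) D) (disc_tr (Suc n) C D \<omega>) (disc_tr (Suc n) C D \<alpha>)"
proof (induction n arbitrary: C D \<omega> \<alpha>)
  case 0
  have "src \<omega> = src \<alpha>" using gtr_0[OF 0(2)] 0(4) by metis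
  then show ?case
    using vcomp_id[OF is_cat_disc[OF 0(1)] gtr_id[OF is_cat_disc[OF 0(1)] gmap_disc[OF gtr_src[OF 0(3)]]]]
    by (simp only: disc_tr.simps src_vcomp src_id_tr tgt_id_tr)
next
  case (Suc n)
  note D = Suc.prems(1) and \<omega> = Suc.prems(2) and \<alpha> = Suc.prems(3) and eq = Suc.prems(4)
  note D' = is_cat_gcat[OF D]
  note v = gtr_vcomp[OF D \<omega> \<alpha> eq] and d = gtr_disc[OF D \<omega>] gtr_disc[OF D \<alpha>]
  have eq': "tgt (disc_tr (Suc (Suc n)) C D \<omega>) = src (disc_tr (Suc (Suc n)) C D \<alpha>)"
    by (simp only: tgt_disc_tr[OF \<omega>] src_disc_tr eq)
  note fob = gtr_fob_src[OF \<omega>] gtr_fob_src[OF \<alpha>] gtr_fob_tgt[OF \<alpha>]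
  note tob = gtr_tob[OF \<omega>, unfolded eq] gtr_tob[OF \<alpha>]
  note tgt = tgt_disc_tr[OF v] tgt_disc_tr[OF \<omega>] tgt_disc_tr[OF \<alpha>] tgt_vcomp[OF \<omega> \<alpha> eq] tgt_vcomp[OF d eq']
  note dh = is_cat_hom[OF D]
  note IH = Suc.IH[OF dh vcomp_mid[OF D \<omega> \<alpha> eq], unfolded eq]
  show ?case
  proof (rule gtr_Suc_eqI[OF gtr_disc[OF D v] gtr_vcomp[OF is_cat_disc[OF D] d eq']], goal_cases)
    case 1
    show ?case by (simp only: src_disc_tr src_vcomp)
  next
    case 2
    show ?case by (simp only: tgt)
  next
    case (3 c)
    then show ?case
      by (simp add: tob_vcomp tgt eq tob cmp_disc_Suc del: vcomp.simps disc_tr.simps disc_cat.simps disc_fun.simps)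
  next
    case (4 c c')
    then show ?case
      by (simp add: thom_vcomp tgt eq fob tob IH
        disc_tr_wr[OF dh dh gtr_thom[OF \<alpha>] is_fun_precomp[OF D]]
        disc_tr_wr[OF dh dh gtr_thom[OF \<omega>, unfolded eq] is_fun_postcomp[OF D]]
        disc_precomp[OF D'] disc_postcomp[OF D'] del: vcomp.simps disc_tr.simps disc_cat.simps disc_fun.simps)
  qed
qed

lemma is_tr_Suc_iff:
  assumes \<alpha>: "gtr (Suc n) C D \<alpha>"
  shows "is_tr (Suc n) C D \<alpha> \<longleftrightarrow> is_fun (Suc n) C D (src \<alpha>) \<and> is_fun (Suc n) C D (tgt \<alpha>) \<and>
    (\<forall>c\<in>ob C. \<forall>c'\<in>ob C. is_tr n (hom C c c') (hom D (fob (src \<alpha>) c) (fob (tgt \<alpha>) c')) (thom \<alpha> c c')) \<and>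
    (\<forall>c\<in>ob C. whisker_l n (terminal n) (unt C c) (thom \<alpha> c c) =
     id_tr n (terminal n) (hom D (fob (src \<alpha>) c) (fob (tgt \<alpha>) c))
       (point_fun n (hom D (fob (src \<alpha>) c) (fob (tgt \<alpha>) c)) (tob \<alpha> c))) \<and>
    (\<forall>c\<in>ob C. \<forall>c'\<in>ob C. \<forall>c''\<in>ob C.
      whisker_l n (prod_cat n (hom C c c') (hom C c' c'')) (cmp C c c' c'') (thom \<alpha> c c'') =
         tr_comp n C D \<alpha> c c' c'')" (is "?L \<longleftrightarrow> ?R")
proof
  assume ?L then show ?R
    using is_tr_src is_tr_tgt is_tr_thom is_tr_unt is_tr_cmp by (metis (no_types, lifting))
next
  assume ?R then show ?L
    by (intro is_tr_SucI[OF \<alpha>]) blast+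
qed

lemma disc_tr_comp:
  assumes D: "is_cat (Suc n) D" and \<alpha>: "gtr (Suc n) C D \<alpha>"
    and c: "c \<in> ob C" "c' \<in> ob C" "c'' \<in> ob C"
  shows "tr_comp (Suc n) (disc_cat (Suc (Suc n)) C) (disc_cat (Suc (Suc n)) D) (disc_tr (Suc (Suc n)) C D \<alpha>) c c' c'' =
    disc_tr (Suc n) (prod_cat n (hom C c c') (hom C c' c'')) (hom D (fob (src \<alpha>) c) (fob (tgt \<alpha>) c''))
      (tr_comp n C D \<alpha> c c' c'')"
proof -
  note fob = gtr_fob_src[OF \<alpha>] gtr_fob_tgt[OF \<alpha>]
  note F = fob[OF c(1)] fob[OF c(2)] fob[OF c(3)]
  note dh = is_cat_hom[OF D] and dg = gcat_hom[OF is_cat_gcat[OF D]]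
  note m = tr_comp_mid[OF D \<alpha> c]
  note t1 = gtr_thom[OF \<alpha> c(1,2)] and t2 = gtr_thom[OF \<alpha> c(2,3)]
  note i1 = gtr_id[OF dh[OF F(4,6)] gmap_fhom[OF gtr_tgt[OF \<alpha>] c(2,3)]]
    and i2 = gtr_id[OF dh[OF F(1,3)] gmap_fhom[OF gtr_src[OF \<alpha>] c(1,2)]]
  show ?thesis
    unfolding m(1) disc_tr_vcomp[OF dh[OF F(1,6)] m(2-4)]
      disc_tr_wr[OF is_cat_prod[OF dh[OF F(1,4)] dh[OF F(4,6)]] dh[OF F(1,6)] gtr_prod[OF dg[OF F(1,4)] dg[OF F(4,6)] t1 i1] is_cat_cmp[OF D F(1,4,6)]]
      disc_tr_wr[OF is_cat_prod[OF dh[OF F(1,3)] dh[OF F(3,6)]] dh[OF F(1,6)] gtr_prod[OF dg[OF F(1,3)] dg[OF F(3,6)] i2 t2] is_cat_cmp[OF D F(1,3,6)]]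
      disc_tr_prod[OF dh[OF F(1,4)] dh[OF F(4,6)] t1 i1] disc_tr_prod[OF dh[OF F(1,3)] dh[OF F(3,6)] i2 t2]
      disc_tr_id disc_prod
    unfolding tr_comp_def Let_def src_disc_tr tgt_disc_tr[OF \<alpha>] fob_disc[OF c(1)] fob_disc[OF c(2)] fob_disc[OF c(3)]
      thom_disc_tr[OF c(1,2)] thom_disc_tr[OF c(2,3)] hom_disc_Suc fhom_disc_Suc[OF c(1,2)] fhom_disc_Suc[OF c(2,3)] cmp_disc_Suc
    ..
qed

lemma is_tr_disc_iff:
  "gcat n C \<Longrightarrow> is_cat n D \<Longrightarrow> gtr n C D \<alpha>
   \<Longrightarrow> is_tr (Suc n) (disc_cat (Suc n) C) (disc_cat (Suc n) D) (disc_tr (Suc n) C D \<alpha>) \<longleftrightarrow> is_tr n C D \<alpha>"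
proof (induction n arbitrary: C D \<alpha>)
  case 0
  have f: "is_fun 0 C D (src \<alpha>)" using gtr_src[OF 0(3)] by (simp only: is_fun.simps gmap.simps)
  have "is_tr 0 C D \<alpha>" using f gtr_0[OF 0(3)] by (auto simp del: is_fun.simps)
  moreover have "is_tr (Suc 0) (disc_cat (Suc 0) C) (disc_cat (Suc 0) D) (disc_tr (Suc 0) C D \<alpha>)"
    unfolding disc_tr.simps
    by (rule is_tr_id[OF gcat_disc[OF 0(1)] is_cat_disc[OF 0(2)] is_fun_disc[OF 0(1) is_cat_gcat[OF 0(2)] f]])
  ultimately show ?case by blast
next
  case (Suc n)
  note C = Suc.prems(1) and D = Suc.prems(2) and \<alpha> = Suc.prems(3)
  note D' = is_cat_gcat[OF D]
  note fob = gtr_fob_src[OF \<alpha>] gtr_fob_tgt[OF \<alpha>] and th = gtr_thom[OF \<alpha>] and tob = gtr_tob[OF \<alpha>]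
  note dh = is_cat_hom[OF D] and dg = gcat_hom[OF D']
  have U: "whisker_l (Suc n) (terminal (Suc n)) (disc_fun (Suc n) (terminal n) (unt C c))
      (disc_tr (Suc n) (hom C c c) (hom D (fob (src \<alpha>) c) (fob (tgt \<alpha>) c)) (thom \<alpha> c c)) =
     id_tr (Suc n) (terminal (Suc n)) (disc_cat (Suc n) (hom D (fob (src \<alpha>) c) (fob (tgt \<alpha>) c)))
       (point_fun (Suc n) (disc_cat (Suc n) (hom D (fob (src \<alpha>) c) (fob (tgt \<alpha>) c))) (tob \<alpha> c))
    \<longleftrightarrow> whisker_l n (terminal n) (unt C c) (thom \<alpha> c c) =
     id_tr n (terminal n) (hom D (fob (src \<alpha>) c) (fob (tgt \<alpha>) c))
       (point_fun n (hom D (fob (src \<alpha>) c) (fob (tgt \<alpha>) c)) (tob \<alpha> c))" if c: "c \<in> ob C" for c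
  proof -
    note F = fob(1)[OF c] fob(2)[OF c]
    show ?thesis
      unfolding disc_terminal[symmetric] disc_point[symmetric] disc_tr_id[symmetric]
        disc_tr_wl[OF dh[OF F] gcat_unt[OF C c] th[OF c c], symmetric]
      by (rule iffI[OF disc_tr_inj[OF gtr_wl[OF dg[OF F] gcat_unt[OF C c] th[OF c c]]
              gtr_id[OF dh[OF F] gmap_point[OF dg[OF F] tob[OF c]]]]], assumption, simp)
  qed
  have M: "whisker_l (Suc n) (prod_cat (Suc n) (disc_cat (Suc n) (hom C c c')) (disc_cat (Suc n) (hom C c' c'')))
      (disc_fun (Suc n) (prod_cat n (hom C c c') (hom C c' c'')) (cmp C c c' c''))
      (disc_tr (Suc n) (hom C c c'') (hom D (fob (src \<alpha>) c) (fob (tgt \<alpha>) c'')) (thom \<alpha> c c'')) =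
    tr_comp (Suc n) (disc_cat (Suc (Suc n)) C) (disc_cat (Suc (Suc n)) D) (disc_tr (Suc (Suc n)) C D \<alpha>) c c' c''
    \<longleftrightarrow> whisker_l n (prod_cat n (hom C c c') (hom C c' c'')) (cmp C c c' c'') (thom \<alpha> c c'') =
         tr_comp n C D \<alpha> c c' c''" if c: "c \<in> ob C" "c' \<in> ob C" "c'' \<in> ob C" for c c' c''
  proof -
    note F = fob(1)[OF c(1)] fob(2)[OF c(3)]
    note m = tr_comp_mid[OF D \<alpha> c]
    show ?thesis
      unfolding disc_prod[symmetric] disc_tr_comp[OF D \<alpha> c]
        disc_tr_wl[OF dh[OF F] gcat_cmp[OF C c] th[OF c(1,3)], symmetric]
      by (rule iffI[OF disc_tr_inj[OF gtr_wl[OF dg[OF F] gcat_cmp[OF C c] th[OF c(1,3)]]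
              gtr_vcomp[OF dh[OF F] m(2-4), folded m(1)]]], assumption, simp)
  qed
  show ?case
    unfolding is_tr_Suc_iff[OF \<alpha>] is_tr_Suc_iff[OF gtr_disc[OF D \<alpha>]] src_disc_tr tgt_disc_tr[OF \<alpha>]
      is_fun_disc_iff[OF C D' gtr_src[OF \<alpha>]] is_fun_disc_iff[OF C D' gtr_tgt[OF \<alpha>]]
    by (simp add: hom_disc_Suc unt_disc_Suc cmp_disc_Suc U M Suc.IH[OF gcat_hom[OF C] dh th] fob
        del: disc_tr.simps is_tr.simps is_fun.simps disc_cat.simps disc_fun.simps
         whisker_l.simps id_tr.simps terminal.simps point_fun.simps prod_cat.simps is_cat.simps gcat.simps)
qed

section \<open>Full surjective functors\<close>

text \<open>
  Surjective on objects, and full at every level. Such a functor is surjective on cells, even between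
  given lifts of the boundary, so it can be cancelled on the left and laws descend along it.
\<close>

fun fsurj :: "nat \<Rightarrow> 'a ncat \<Rightarrow> 'b ncat \<Rightarrow> ('a, 'b) nfun \<Rightarrow> bool" where
  "fsurj 0 C D F \<longleftrightarrow> fob F ` ob C = ob D"
| "fsurj (Suc n) C D F \<longleftrightarrow> fob F ` ob C = ob D \<and>
     (\<forall>x\<in>ob C. \<forall>y\<in>ob C. fsurj n (hom C x y) (hom D (fob F x) (fob F y)) (fhom F x y))"

lemma fsurj_fob: "fsurj n C D F \<Longrightarrow> y \<in> ob D \<Longrightarrow> \<exists>x\<in>ob C. y = fob F x"
  by (cases n) auto

lemma fsurj_fhom: "fsurj (Suc n) C D F \<Longrightarrow> x \<in> ob C \<Longrightarrow> y \<in> ob C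
    \<Longrightarrow> fsurj n (hom C x y) (hom D (fob F x) (fob F y)) (fhom F x y)"
  by simp

lemma fsurj_cell: "fsurj n C D F \<Longrightarrow> is_cell n D z \<Longrightarrow> \<exists>w. is_cell n C w \<and> z = capp F w"
proof (induction z arbitrary: n C D F)
  case (Top y)
  then obtain x where "x \<in> ob C" "y = fob F x" using fsurj_fob by fastforce
  then show ?case by (intro exI[of _ "Top x"]) simp
next
  case (Step y y' z)
  then obtain m where n: "n = Suc m" by (cases n) auto
  note F = Step.prems(1)[unfolded n]
  have "y \<in> ob D" "y' \<in> ob D" "is_cell m (hom D y y') z" using Step.prems(2) n by auto
  moreover from this obtain x x' where x: "x \<in> ob C" "x' \<in> ob C" "y = fob F x" "y' = fob F x'"
    using fsurj_fob[OF F] by blast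
  ultimately obtain w where "is_cell m (hom C x x') w" "z = capp (fhom F x x') w"
    using Step.IH[OF fsurj_fhom[OF F x(1,2)]] by auto
  then show ?case using x n by (intro exI[of _ "Step x x' w"]) simp
qed

lemma fsurj_prod:
  "fsurj n A C F \<Longrightarrow> fsurj n B D G \<Longrightarrow> fsurj n (prod_cat n A B) (prod_cat n C D) (prod_fun n A B F G)"
proof (induction n arbitrary: A B C D F G)
  case 0
  have "fob (prod_fun 0 A B F G) ` (ob A \<times> ob B) = map_prod (fob F) (fob G) ` (ob A \<times> ob B)"
    by (rule image_cong[OF refl]) auto
  then show ?case using 0 by (simp add: map_prod_surj_on)
next
  case (Suc n)
  have fob: "fob (prod_fun (Suc n) A B F G) p = map_prod (fob F) (fob G) p" if "p \<in> ob A \<times> ob B" for p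
    using that by (auto simp: prod_fun.simps)
  have "fob (prod_fun (Suc n) A B F G) ` (ob A \<times> ob B) = map_prod (fob F) (fob G) ` (ob A \<times> ob B)"
    using fob by (rule image_cong[OF refl])
  also have "\<dots> = ob C \<times> ob D"
    using Suc.prems by (simp add: map_prod_surj_on)
  finally have "fob (prod_fun (Suc n) A B F G) ` (ob A \<times> ob B) = ob C \<times> ob D" .
  moreover have "fsurj n (hom (prod_cat (Suc n) A B) x y) (hom (prod_cat (Suc n) C D)
      (fob (prod_fun (Suc n) A B F G) x) (fob (prod_fun (Suc n) A B F G) y)) (fhom (prod_fun (Suc n) A B F G) x y)"
    if xy: "x \<in> ob A \<times> ob B" "y \<in> ob A \<times> ob B" for x y
  proof -
    have "fsurj n (prod_cat n (hom A (fst x) (fst y)) (hom B (snd x) (snd y)))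
      (prod_cat n (hom C (fob F (fst x)) (fob F (fst y))) (hom D (fob G (snd x)) (fob G (snd y))))
      (prod_fun n (hom A (fst x) (fst y)) (hom B (snd x) (snd y)) (fhom F (fst x) (fst y)) (fhom G (snd x) (snd y)))"
      by (rule Suc.IH[OF fsurj_fhom[OF Suc.prems(1)] fsurj_fhom[OF Suc.prems(2)]]) (use xy in auto)
    then show ?thesis
      using xy unfolding fob[OF xy(1)] fob[OF xy(2)] hom_prod_cat by (auto simp: prod_fun.simps)
  qed
  ultimately show ?case by simp
qed

lemma fcomp_cancel:
  assumes q: "gmap n C D q" "fsurj n C D q" and "gmap n D E F" "gmap n D E' G"
    and eq: "fcomp n C q F = fcomp n C q G"
  shows "F = G"
proof (rule gmap_eqI[OF assms(3,4)])
  fix z assume "is_cell n D z"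
  then obtain w where "is_cell n C w" "z = capp q w" using fsurj_cell[OF q(2)] by blast
  then show "capp F z = capp G z" using fcomp_eq_capp[OF eq] by simp
qed

lemma wl_cancel:
  assumes q: "gmap n C D q" "fsurj n C D q" and \<alpha>: "gtr n D E \<alpha>" "gtr n D E \<beta>"
    and eq: "whisker_l n C q \<alpha> = whisker_l n C q \<beta>"
  shows "\<alpha> = \<beta>"
proof (rule gtr_eqI[OF \<alpha>])
  show "src \<alpha> = src \<beta>"
    by (rule fcomp_cancel[OF q gtr_src[OF \<alpha>(1)] gtr_src[OF \<alpha>(2)]])
      (use arg_cong[OF eq, of src] in simp)
  show "tgt \<alpha> = tgt \<beta>"
    by (rule fcomp_cancel[OF q gtr_tgt[OF \<alpha>(1)] gtr_tgt[OF \<alpha>(2)]])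
      (use arg_cong[OF eq, of tgt] in \<open>simp add: tgt_whisker_l[OF \<alpha>(1)] tgt_whisker_l[OF \<alpha>(2)]\<close>)
  fix z assume "is_cell n D z"
  then obtain w where "is_cell n C w" "z = capp q w" using fsurj_cell[OF q(2)] by blast
  then show "tapp \<alpha> z = tapp \<beta> z"
    using arg_cong[OF eq, of "\<lambda>\<gamma>. tapp \<gamma> w"] by (simp add: tapp_wl[OF \<alpha>(1) q(1)] tapp_wl[OF \<alpha>(2) q(1)])
qed

lemma fhom_fcomp [simp]: "x \<in> ob C \<Longrightarrow> y \<in> ob C \<Longrightarrow>
    fhom (fcomp (Suc n) C F G) x y = fcomp n (hom C x y) (fhom F x y) (fhom G (fob F x) (fob F y))"
  by (simp add: fcomp.simps)

lemma is_fun_cancel: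
  "gcat n C \<Longrightarrow> gcat n C' \<Longrightarrow> gcat n E \<Longrightarrow> is_fun n C C' q \<Longrightarrow> fsurj n C C' q \<Longrightarrow> gmap n C' E F
   \<Longrightarrow> is_fun n C E (fcomp n C q F) \<Longrightarrow> is_fun n C' E F"
proof (induction n arbitrary: C C' E q F)
  case 0
  then show ?case by (simp only: gmap.simps is_fun.simps)
next
  case (Suc n)
  note C = Suc.prems(1) and C' = Suc.prems(2) and E = Suc.prems(3) and q = Suc.prems(4)
    and s = Suc.prems(5) and F = Suc.prems(6) and qF = Suc.prems(7)
  note qo = is_fun_fob[OF q]
  show ?case
  proof (rule is_fun_SucI[OF C' E F])
    fix x y assume "x \<in> ob C'" "y \<in> ob C'"
    then obtain a b where a: "a \<in> ob C" "x = fob q a" and b: "b \<in> ob C" "y = fob q b"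
      using fsurj_fob[OF s] by metis
    have "is_fun n (hom C a b) (hom E (fob F x) (fob F y)) (fcomp n (hom C a b) (fhom q a b) (fhom F x y))"
      using is_fun_hom[OF qF a(1) b(1)] a b by (simp del: is_fun.simps)
    from Suc.IH[OF gcat_hom[OF C a(1) b(1)] gcat_hom[OF C'] gcat_hom[OF E] is_fun_hom[OF q a(1) b(1)]
        fsurj_fhom[OF s a(1) b(1)] gmap_fhom[OF F] this[unfolded a(2) b(2)]]
    show "is_fun n (hom C' x y) (hom E (fob F x) (fob F y)) (fhom F x y)"
      using a b qo gmap_fob[OF F] by blast
  next
    fix x t assume "x \<in> ob C'" and t: "is_cell n (terminal n) t"
    then obtain a where a: "a \<in> ob C" "x = fob q a"
      using fsurj_fob[OF s] by metis
    show "capp (fhom F x x) (capp (unt C' x) t) = capp (unt E (fob F x)) t"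
      using is_fun_unt[OF qF a(1) t] is_fun_unt[OF q a(1) t] a gmap_cell[OF gcat_unt[OF C a(1)] t] by simp
  next
    fix x y z u v assume "x \<in> ob C'" "y \<in> ob C'" "z \<in> ob C'" and u: "is_cell n (hom C' x y) u"
      and v: "is_cell n (hom C' y z) v" and d: "dim u = dim v"
    then obtain a b c where a: "a \<in> ob C" "x = fob q a" and b: "b \<in> ob C" "y = fob q b"
      and c: "c \<in> ob C" "z = fob q c"
      using fsurj_fob[OF s] by metis
    obtain u' where u': "is_cell n (hom C a b) u'" "u = capp (fhom q a b) u'"
      using fsurj_cell[OF fsurj_fhom[OF s a(1) b(1)]] u a b by blast
    obtain v' where v': "is_cell n (hom C b c) v'" "v = capp (fhom q b c) v'"
      using fsurj_cell[OF fsurj_fhom[OF s b(1) c(1)]] v c b by blast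
    have d': "dim u' = dim v'" using d u' v' by simp
    show "capp (fhom F x z) (capp (cmp C' x y z) (cpair u v)) =
       capp (cmp E (fob F x) (fob F y) (fob F z)) (cpair (capp (fhom F x y) u) (capp (fhom F y z) v))"
      using is_fun_cmp[OF qF a(1) b(1) c(1) u'(1) v'(1) d'] is_fun_cmp[OF q a(1) b(1) c(1) u'(1) v'(1) d']
        gcat_cmp_cell[OF C a(1) b(1) c(1) u'(1) v'(1) d'] a b c u' v' by simp
  qed
qed

text \<open>
  A composable configuration of cells of C' lifts to C: first the objects are lifted, then, by
  fullness, the cells between the chosen lifts. The laws of C' are thus images of the laws of C.
\<close>

lemma is_cat_quotient:
  "is_cat n C \<Longrightarrow> gcat n C' \<Longrightarrow> is_fun n C C' q \<Longrightarrow> fsurj n C C' q \<Longrightarrow> is_cat n C'"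
proof (induction n arbitrary: C C' q)
  case 0
  then show ?case by simp
next
  case (Suc n)
  note C = Suc.prems(1) and C' = Suc.prems(2) and q = Suc.prems(3) and s = Suc.prems(4)
  note Cg = is_cat_gcat[OF C]
  note qo = is_fun_fob[OF q] and qh = is_fun_hom[OF q] and sh = fsurj_fhom[OF s]
  note cg = gcat_hom[OF Cg] and cg' = gcat_hom[OF C'] and ch = is_cat_hom[OF C]
  show ?case
  proof (rule is_cat_SucI[OF C'])
    fix x y assume "x \<in> ob C'" "y \<in> ob C'"
    then obtain a b where a: "a \<in> ob C" "x = fob q a" and b: "b \<in> ob C" "y = fob q b"
      using fsurj_fob[OF s] by metis
    show "is_cat n (hom C' x y)"
      using Suc.IH[OF ch[OF a(1) b(1)] cg'[OF qo[OF a(1)] qo[OF b(1)]] qh[OF a(1) b(1)] sh[OF a(1) b(1)]] a b by simp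
    fix u assume "is_cell n (hom C' x y) u"
    then obtain u' where u': "is_cell n (hom C a b) u'" "u = capp (fhom q a b) u'"
      using fsurj_cell[OF sh[OF a(1) b(1)]] a b by blast
    note t = cell_cbang[OF u'(1)]
    note ua = gmap_cell[OF gcat_unt[OF Cg a(1)] t] and ub = gmap_cell[OF gcat_unt[OF Cg b(1)] t]
    show "capp (cmp C' x x y) (cpair (capp (unt C' x) (cbang u)) u) = u"
      using is_fun_cmp[OF q a(1,1) b(1) ua u'(1)] is_fun_unt[OF q a(1) t] cat_unit_left[OF C a(1) b(1) u'(1), of "cbang u'"] a b u'
      by simp
    show "capp (cmp C' x y y) (cpair u (capp (unt C' y) (cbang u))) = u"
      using is_fun_cmp[OF q a(1) b(1,1) u'(1) ub] is_fun_unt[OF q b(1) t] cat_unit_right[OF C a(1) b(1) u'(1), of "cbang u'"] a b u'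
      by simp
  next
    fix x assume "x \<in> ob C'"
    then obtain a where a: "a \<in> ob C" "x = fob q a"
      using fsurj_fob[OF s] by metis
    show "is_fun n (terminal n) (hom C' x x) (unt C' x)"
      using is_fun_fcomp[OF gcat_terminal cg[OF a(1,1)] cg'[OF qo[OF a(1)] qo[OF a(1)]] is_cat_unt[OF C a(1)] qh[OF a(1,1)]]
        is_fun_unt_eq[OF q a(1)] a by simp
  next
    fix x y z assume "x \<in> ob C'" "y \<in> ob C'" "z \<in> ob C'"
    then obtain a b c where a: "a \<in> ob C" "x = fob q a" and b: "b \<in> ob C" "y = fob q b"
      and c: "c \<in> ob C" "z = fob q c"
      using fsurj_fob[OF s] by metis
    note o = qo[OF a(1)] qo[OF b(1)] qo[OF c(1)]
    note P = gcat_prod[OF cg[OF a(1) b(1)] cg[OF b(1) c(1)]] and P' = gcat_prod[OF cg'[OF o(1,2)] cg'[OF o(2,3)]]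
    show "is_fun n (prod_cat n (hom C' x y) (hom C' y z)) (hom C' x z) (cmp C' x y z)"
      unfolding a b c
      by (rule is_fun_cancel[OF P P' cg'[OF o(1,3)]
            is_fun_prod[OF cg[OF a(1) b(1)] cg[OF b(1) c(1)] cg'[OF o(1,2)] cg'[OF o(2,3)] qh[OF a(1) b(1)] qh[OF b(1) c(1)]]
            fsurj_prod[OF sh[OF a(1) b(1)] sh[OF b(1) c(1)]] gcat_cmp[OF C' o]
            is_fun_fcomp[OF P cg[OF a(1) c(1)] cg'[OF o(1,3)] is_cat_cmp[OF C a(1) b(1) c(1)] qh[OF a(1) c(1)],
              unfolded is_fun_cmp_eq[OF q a(1) b(1) c(1)]]])
  next
    fix w x y z u v r assume "w \<in> ob C'" "x \<in> ob C'" "y \<in> ob C'" "z \<in> ob C'"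
      and u: "is_cell n (hom C' w x) u" and v: "is_cell n (hom C' x y) v" and r: "is_cell n (hom C' y z) r"
      and d: "dim u = dim v" "dim v = dim r"
    then obtain a b c e where a: "a \<in> ob C" "w = fob q a" and b: "b \<in> ob C" "x = fob q b"
      and c: "c \<in> ob C" "y = fob q c" and e: "e \<in> ob C" "z = fob q e"
      using fsurj_fob[OF s] by metis
    obtain u' where u': "is_cell n (hom C a b) u'" "u = capp (fhom q a b) u'"
      using fsurj_cell[OF sh[OF a(1) b(1)]] u a b by blast
    obtain v' where v': "is_cell n (hom C b c) v'" "v = capp (fhom q b c) v'"
      using fsurj_cell[OF sh[OF b(1) c(1)]] v c b by blast
    obtain r' where r': "is_cell n (hom C c e) r'" "r = capp (fhom q c e) r'"
      using fsurj_cell[OF sh[OF c(1) e(1)]] r c e by blast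
    have d': "dim u' = dim v'" "dim v' = dim r'" using d u' v' r' by simp_all
    have d'': "dim (capp (cmp C a b c) (cpair u' v')) = dim r'"
      "dim u' = dim (capp (cmp C b c e) (cpair v' r'))"
      using d' by simp_all
    note uv = gcat_cmp_cell[OF Cg a(1) b(1) c(1) u'(1) v'(1) d'(1)]
      and vr = gcat_cmp_cell[OF Cg b(1) c(1) e(1) v'(1) r'(1) d'(2)]
    show "capp (cmp C' w y z) (cpair (capp (cmp C' w x y) (cpair u v)) r) =
       capp (cmp C' w x z) (cpair u (capp (cmp C' x y z) (cpair v r)))"
      using arg_cong[OF cat_assoc[OF C a(1) b(1) c(1) e(1) u'(1) v'(1) r'(1) d'], of "capp (fhom q a e)"]
      unfolding is_fun_cmp[OF q a(1) c(1) e(1) uv r'(1) d''(1)] is_fun_cmp[OF q a(1) b(1) e(1) u'(1) vr d''(2)]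
        is_fun_cmp[OF q a(1) b(1) c(1) u'(1) v'(1) d'(1)] is_fun_cmp[OF q b(1) c(1) e(1) v'(1) r'(1) d'(2)]
        a(2) b(2) c(2) e(2) u'(2) v'(2) r'(2) .
  qed
qed

text \<open>
  The unit law descends directly; the composition law is an equation of 2-morphisms with domain a
  product of homs, where the product of two full surjective functors can be cancelled.
\<close>

lemma is_tr_cancel:
  "gcat n C \<Longrightarrow> gcat n C' \<Longrightarrow> is_cat n E \<Longrightarrow> is_fun n C C' q \<Longrightarrow> fsurj n C C' q \<Longrightarrow> gtr n C' E \<alpha>
   \<Longrightarrow> is_tr n C E (whisker_l n C q \<alpha>) \<Longrightarrow> is_tr n C' E \<alpha>"
proof (induction n arbitrary: C C' E q \<alpha>)
  case 0
  have "is_fun 0 C' E (src \<alpha>)" using gtr_src[OF 0(6)] by (simp only: is_fun.simps gmap.simps)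
  then show ?case using gtr_0[OF 0(6)] by (auto simp del: is_fun.simps)
next
  case (Suc n)
  note C = Suc.prems(1) and C' = Suc.prems(2) and E = Suc.prems(3) and q = Suc.prems(4)
    and s = Suc.prems(5) and \<alpha> = Suc.prems(6) and q\<alpha> = Suc.prems(7)
  note E' = is_cat_gcat[OF E] and q' = is_fun_gmap[OF q]
  note qo = is_fun_fob[OF q] and qh = is_fun_hom[OF q] and sh = fsurj_fhom[OF s]
  note qg = is_fun_gmap[OF qh]
  note eh = is_cat_hom[OF E] and eg = gcat_hom[OF E'] and cg = gcat_hom[OF C] and cg' = gcat_hom[OF C']
  note fob = gtr_fob_src[OF \<alpha>] gtr_fob_tgt[OF \<alpha>] and th = gtr_thom[OF \<alpha>]
  note tw = tgt_whisker_l[OF \<alpha>]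
  show ?case
  proof (rule is_tr_SucI[OF \<alpha>], goal_cases)
    case 1
    show ?case by (rule is_fun_cancel[OF C C' E' q s gtr_src[OF \<alpha>] is_tr_src[OF q\<alpha>, unfolded src_whisker_l]])
  next
    case 2
    show ?case by (rule is_fun_cancel[OF C C' E' q s gtr_tgt[OF \<alpha>] is_tr_tgt[OF q\<alpha>, unfolded tw]])
  next
    case (3 x y)
    then obtain a b where a: "a \<in> ob C" "x = fob q a" and b: "b \<in> ob C" "y = fob q b"
      using fsurj_fob[OF s] by metis
    note o = qo[OF a(1)] qo[OF b(1)]
    show ?case
      unfolding a b
      by (rule Suc.IH[OF cg[OF a(1) b(1)] cg'[OF o] eh[OF fob(1)[OF o(1)] fob(2)[OF o(2)]] qh[OF a(1) b(1)]
            sh[OF a(1) b(1)] th[OF o] is_tr_thom[OF q\<alpha> a(1) b(1), unfolded src_whisker_l tw fob_fcomp[OF a(1)] fob_fcomp[OF b(1)]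
              thom_whisker_l[OF a(1) b(1)]]])
  next
    case (4 x)
    then obtain a where a: "a \<in> ob C" "x = fob q a"
      using fsurj_fob[OF s] by metis
    note o = qo[OF a(1)]
    show ?case
      unfolding a(2) is_fun_unt_eq[OF q a(1), symmetric]
        wl_fcomp[OF eg[OF fob(1)[OF o] fob(2)[OF o]] gcat_unt[OF C a(1)] qg[OF a(1,1)] th[OF o o]]
      using is_tr_unt[OF q\<alpha> a(1)]
      by (simp only: src_whisker_l tw fob_fcomp[OF a(1)] thom_whisker_l[OF a(1,1)] tob_whisker_l[OF a(1)])
  next
    case (5 x y z)
    then obtain a b c where a: "a \<in> ob C" "x = fob q a" and b: "b \<in> ob C" "y = fob q b"
      and c: "c \<in> ob C" "z = fob q c"
      using fsurj_fob[OF s] by metis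
    note o = qo[OF a(1)] qo[OF b(1)] qo[OF c(1)]
    note F = fob(1)[OF o(1)] fob(2)[OF o(3)]
    note m = tr_comp_mid[OF E \<alpha> o]
    note qq = gmap_prod[OF qg[OF a(1) b(1)] qg[OF b(1) c(1)]]
    note t = th[OF o(1,3)]
    show ?case
      unfolding a(2) b(2) c(2)
      by (rule wl_cancel[OF qq fsurj_prod[OF sh[OF a(1) b(1)] sh[OF b(1) c(1)]] gtr_wl[OF eg[OF F] gcat_cmp[OF C' o] t]
            gtr_vcomp[OF eh[OF F] m(2-4), folded m(1)]])
        (simp only: wl_fcomp[OF eg[OF F] qq gcat_cmp[OF C' o] t, symmetric] is_fun_cmp_eq[OF q a(1) b(1) c(1), symmetric]
          wl_fcomp[OF eg[OF F] gcat_cmp[OF C a(1) b(1) c(1)] qg[OF a(1) c(1)] t] thom_whisker_l[OF a(1) c(1), symmetric]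
          is_tr_cmp[OF q\<alpha> a(1) b(1) c(1)] tr_comp_wl[OF E q' \<alpha> a(1) b(1) c(1)])
  qed
qed

section \<open>Isomorphism classes\<close>

lemma small_mono: "small S \<Longrightarrow> T \<subseteq> S \<Longrightarrow> small T"
  by (auto simp: small_def)

lemma small_image:
  fixes f :: "'k univ \<Rightarrow> 'k univ"
  assumes "small S"
  shows "small (f ` S)"
proof -
  obtain g :: "'k \<Rightarrow> 'k univ" where "S \<subseteq> range g"
    using assms by (auto simp: small_def)
  then have "f ` S \<subseteq> range (f \<circ> g)" by auto
  then show ?thesis unfolding small_def by blast
qed

lemma small_cat_ob: "small_cat n C \<Longrightarrow> small (ob C)"
  by (cases n) auto

definition isomorphic :: "'a ncat \<Rightarrow> 'a \<Rightarrow> 'a \<Rightarrow> bool" where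
  "isomorphic C x y \<longleftrightarrow> (\<exists>f\<in>ob (hom C x y). \<exists>g\<in>ob (hom C y x).
     fob (cmp C x y x) (f, g) = fob (unt C x) () \<and> fob (cmp C y x y) (g, f) = fob (unt C y) ())"

lemma iso_class_def': "iso_class C x = code {y \<in> ob C. isomorphic C x y}"
  by (simp add: iso_class_def isomorphic_def)

lemma isomorphic_sym: "isomorphic C x y \<Longrightarrow> isomorphic C y x"
  by (auto simp: isomorphic_def)

lemma isomorphic_refl:
  assumes C: "is_cat (Suc n) C" and x: "x \<in> ob C"
  shows "isomorphic C x x"
proof -
  note u = fob_unt[OF is_cat_gcat[OF C] x]
  show ?thesis
    unfolding isomorphic_def
    by (intro bexI[OF _ u] conjI fob_unit_left[OF C x x u])
qed

lemma isomorphic_trans: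
  assumes C: "is_cat (Suc n) C" and o: "x \<in> ob C" "y \<in> ob C" "z \<in> ob C"
    and xy: "isomorphic C x y" and yz: "isomorphic C y z"
  shows "isomorphic C x z"
proof -
  obtain f g where f: "f \<in> ob (hom C x y)" "g \<in> ob (hom C y x)"
    "fob (cmp C x y x) (f, g) = fob (unt C x) ()" "fob (cmp C y x y) (g, f) = fob (unt C y) ()"
    using xy by (auto simp: isomorphic_def)
  obtain h k where h: "h \<in> ob (hom C y z)" "k \<in> ob (hom C z y)"
    "fob (cmp C y z y) (h, k) = fob (unt C y) ()" "fob (cmp C z y z) (k, h) = fob (unt C z) ()"
    using yz by (auto simp: isomorphic_def)
  note c = fob_cmp[OF is_cat_gcat[OF C]]
  let ?fh = "fob (cmp C x y z) (f, h)" and ?kg = "fob (cmp C z y x) (k, g)"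
  have m: "?fh \<in> ob (hom C x z)" "?kg \<in> ob (hom C z x)" using c o f h by auto
  have "fob (cmp C x z x) (?fh, ?kg) = fob (cmp C x y x) (f, fob (cmp C y z x) (h, ?kg))"
    by (rule fob_cmp_assoc[OF C o(1,2,3,1) f(1) h(1) m(2)])
  also have "fob (cmp C y z x) (h, ?kg) = g"
    using fob_cmp_assoc[OF C o(2,3,2,1) h(1,2) f(2)] h(3) fob_unit_left[OF C o(2,1) f(2)] by simp
  finally have 1: "fob (cmp C x z x) (?fh, ?kg) = fob (unt C x) ()" using f by simp
  have "fob (cmp C z x z) (?kg, ?fh) = fob (cmp C z y z) (k, fob (cmp C y x z) (g, ?fh))"
    by (rule fob_cmp_assoc[OF C o(3,2,1,3) h(2) f(2) m(1)])
  also have "fob (cmp C y x z) (g, ?fh) = h"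
    using fob_cmp_assoc[OF C o(2,1,2,3) f(2,1) h(1)] f(4) fob_unit_left[OF C o(2,3) h(1)] by simp
  finally have 2: "fob (cmp C z x z) (?kg, ?fh) = fob (unt C z) ()" using h by simp
  show ?thesis using 1 2 m unfolding isomorphic_def by blast
qed

context
  fixes C :: "'k univ ncat"
  assumes C: "is_cat (Suc 0) C" and small: "small (ob C)"
begin

lemma elts_iso_class: "x \<in> ob C \<Longrightarrow> elts (iso_class C x) = {y \<in> ob C. isomorphic C x y}"
  unfolding iso_class_def'
  by (rule elts_code) (use isomorphic_refl[OF C] small_mono[OF small] in auto)

lemma iso_class_eq_iff:
  assumes "x \<in> ob C" "y \<in> ob C"
  shows "iso_class C x = iso_class C y \<longleftrightarrow> isomorphic C x y"
proof
  assume "iso_class C x = iso_class C y"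
  then have "y \<in> elts (iso_class C x)"
    using elts_iso_class[OF assms(2)] isomorphic_refl[OF C assms(2)] assms by simp
  then show "isomorphic C x y" using elts_iso_class[OF assms(1)] by simp
next
  assume "isomorphic C x y"
  then have "{z \<in> ob C. isomorphic C x z} = {z \<in> ob C. isomorphic C y z}"
    by (auto intro: isomorphic_trans[OF C] isomorphic_sym assms)
  then show "iso_class C x = iso_class C y" by (simp add: iso_class_def')
qed

lemma rep_iso_class:
  assumes "x \<in> ob C"
  shows "rep (iso_class C x) \<in> ob C" "isomorphic C (rep (iso_class C x)) x"
proof -
  have "rep (iso_class C x) \<in> elts (iso_class C x)"
    unfolding rep_def
    by (rule someI[of _ x]) (use elts_iso_class[OF assms] isomorphic_refl[OF C assms] assms in simp)
  then show "rep (iso_class C x) \<in> ob C" "isomorphic C (rep (iso_class C x)) x"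
    using elts_iso_class[OF assms] isomorphic_sym by auto
qed

end

text \<open>
  In a 1-groupoid, composition with f is bijective on both sides, which gives a right and a left
  inverse of f; they coincide.
\<close>

lemma gpd_isomorphic:
  assumes C: "is_gpd (Suc 0) C" and o: "x \<in> ob C" "y \<in> ob C" and f: "f \<in> ob (hom C x y)"
  shows "isomorphic C x y"
proof -
  have c: "is_cat (Suc 0) C" and e: "is_equiv1 (is_equiv 0) 0 C x y f" using C o f by auto
  note c' = is_cat_gcat[OF c]
  have pre: "fob (precomp 0 C x y z f) w = fob (cmp C x y z) (f, w)"
    if "w \<in> ob (hom C y z)" "z \<in> ob C" for w z
    using capp_precomp[of 0 C y z "Top w" x f] that by simp
  have post: "fob (postcomp 0 C z x y f) w = fob (cmp C z x y) (w, f)"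
    if "w \<in> ob (hom C z x)" "z \<in> ob C" for w z
    using capp_postcomp[of 0 C z x "Top w" y f] that by simp
  have "bij_betw (fob (precomp 0 C x y x f)) (ob (hom C y x)) (ob (hom C x x))"
    using e o by (simp add: is_equiv1_def)
  then obtain g where g: "g \<in> ob (hom C y x)" "fob (cmp C x y x) (f, g) = fob (unt C x) ()"
    using bij_betw_imp_surj_on[THEN equalityD2, THEN subsetD, OF _ fob_unt[OF c' o(1)]] pre[OF _ o(1)] that
    by (smt (verit, best) imageE)
  have "bij_betw (fob (postcomp 0 C y x y f)) (ob (hom C y x)) (ob (hom C y y))"
    using e o by (simp add: is_equiv1_def)
  then obtain h where h: "h \<in> ob (hom C y x)" "fob (cmp C y x y) (h, f) = fob (unt C y) ()"
    using bij_betw_imp_surj_on[THEN equalityD2, THEN subsetD, OF _ fob_unt[OF c' o(2)]] post[OF _ o(2)] that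
    by (smt (verit, best) imageE)
  have "h = g"
    using fob_cmp_assoc[OF c o(2,1,2,1) h(1) f g(1)] g(2) h(2)
      fob_unit_left[OF c o(2,1) g(1)] fob_unit_right[OF c o(2,1) h(1)] by simp
  then show ?thesis using f g h unfolding isomorphic_def by blast
qed

section \<open>The quotient functor\<close>

text \<open>The objects of the sesqui-category \<open>nGpd n\<close>.\<close>

definition sgpd :: "nat \<Rightarrow> 'k univ ncat \<Rightarrow> bool" where
  "sgpd n C \<longleftrightarrow> is_gpd n C \<and> small_cat n C"

lemma sgpd_hom: "sgpd (Suc n) C \<Longrightarrow> x \<in> ob C \<Longrightarrow> y \<in> ob C \<Longrightarrow> sgpd n (hom C x y)"
  by (auto simp: sgpd_def)

lemma sgpd_cat: "sgpd n C \<Longrightarrow> is_cat n C"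
  by (simp add: sgpd_def is_gpd_cat)

lemma sgpd_gcat: "sgpd n C \<Longrightarrow> gcat n C"
  by (simp add: sgpd_cat is_cat_gcat)

lemma sgpd_class_eq_iff:
  assumes "sgpd (Suc 0) C" "x \<in> ob C" "y \<in> ob C"
  shows "iso_class C x = iso_class C y \<longleftrightarrow> ob (hom C x y) \<noteq> {}"
proof -
  have "isomorphic C x y \<longleftrightarrow> ob (hom C x y) \<noteq> {}"
    using assms gpd_isomorphic[of C x y] by (auto simp: sgpd_def isomorphic_def)
  then show ?thesis
    using iso_class_eq_iff[OF sgpd_cat[OF assms(1)] _ assms(2,3)] small_cat_ob assms(1)
    unfolding sgpd_def by blast
qed

lemma sgpd_rep:
  assumes "sgpd (Suc 0) C" "x \<in> ob C"
  shows "rep (iso_class C x) \<in> ob C" "ob (hom C (rep (iso_class C x)) x) \<noteq> {}"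
  using rep_iso_class[OF sgpd_cat[OF assms(1)] _ assms(2)] small_cat_ob assms(1)
  unfolding sgpd_def isomorphic_def by blast+

text \<open>
  The quotient functor from C to \<open>D (\<pi>\<^sub>0 C)\<close>, which is the unit of the adjunction. Every 1-cell of a
  1-groupoid goes to the identity of the class of its source, which in a discrete groupoid is that
  class itself.
\<close>

fun eta :: "nat \<Rightarrow> 'k univ ncat \<Rightarrow> ('k univ, 'k univ) nfun" where
  "eta (Suc 0) C = Fun (\<lambda>x\<in>ob C. iso_class C x)
     (\<lambda>x\<in>ob C. \<lambda>y\<in>ob C. Map0 (\<lambda>f\<in>ob (hom C x y). iso_class C x))"
| "eta (Suc (Suc n)) C = Fun (\<lambda>x\<in>ob C. x) (\<lambda>x\<in>ob C. \<lambda>y\<in>ob C. eta (Suc n) (hom C x y))"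

lemma ob_pi0_Suc [simp]: "ob (pi0_cat (Suc (Suc n)) C) = ob C"
  by simp

lemma hom_pi0_Suc [simp]: "hom (pi0_cat (Suc (Suc n)) C) x y = pi0_cat (Suc n) (hom C x y)"
  by simp

lemma fob_eta_Suc [simp]: "x \<in> ob C \<Longrightarrow> fob (eta (Suc (Suc n)) C) x = x"
  by simp

lemma fhom_eta_Suc [simp]:
  "x \<in> ob C \<Longrightarrow> y \<in> ob C \<Longrightarrow> fhom (eta (Suc (Suc n)) C) x y = eta (Suc n) (hom C x y)"
  by simp

lemma gmap_eta:
  "sgpd (Suc n) C \<Longrightarrow> gmap (Suc n) C (disc_cat (Suc n) (pi0_cat (Suc n) C)) (eta (Suc n) C)"
proof (induction n arbitrary: C)
  case 0
  then show ?case using sgpd_class_eq_iff[OF 0] by auto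
next
  case (Suc n)
  then show ?case using sgpd_hom[OF Suc.prems] by (simp del: disc_cat.simps)
qed

lemma fob_eta: "sgpd (Suc n) C \<Longrightarrow> x \<in> ob C \<Longrightarrow> fob (eta (Suc n) C) x \<in> ob (pi0_cat (Suc n) C)"
  using gmap_fob[OF gmap_eta] by simp

lemma fsurj_eta:
  "sgpd (Suc n) C \<Longrightarrow> fsurj (Suc n) C (disc_cat (Suc n) (pi0_cat (Suc n) C)) (eta (Suc n) C)"
proof (induction n arbitrary: C)
  case 0
  then show ?case using sgpd_class_eq_iff[OF 0] by (auto simp: disc_hom_def)
next
  case (Suc n)
  then show ?case using sgpd_hom[OF Suc.prems]
    by (simp del: disc_cat.simps fsurj.simps add: fsurj.simps(2)[of "Suc n"])
qed

subsection \<open>Presentations\<close>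

text \<open>
  The map \<open>pi0_map\<close> is applied to functors with three kinds of domain: \<open>\<pi>\<^sub>0 C\<close>, the product of two of
  these, and the terminal category. In each case the domain P at level n comes with a quotient map q
  from an (n+1)-category A to \<open>D P\<close>, and at the lowest level r chooses, for the image of an object a,
  an object of A that is connected with a.
\<close>

fun pres :: "nat \<Rightarrow> ('p \<Rightarrow> 'p) \<Rightarrow> 'p ncat \<Rightarrow> 'p ncat \<Rightarrow> ('p, 'p) nfun \<Rightarrow> bool" where
  "pres 0 r A P q \<longleftrightarrow> (\<forall>p\<in>ob P. r p \<in> ob A) \<and>
     (\<forall>a\<in>ob A. fob q a \<in> ob P \<and> ob (hom A (r (fob q a)) a) \<noteq> {})"
| "pres (Suc n) r A P q \<longleftrightarrow> ob P = ob A \<and> (\<forall>a\<in>ob A. fob q a = a) \<and>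
     (\<forall>a\<in>ob A. \<forall>b\<in>ob A. pres n r (hom A a b) (hom P a b) (fhom q a b))"

lemma pres_eta: "sgpd (Suc n) C \<Longrightarrow> pres n rep C (pi0_cat (Suc n) C) (eta (Suc n) C)"
proof (induction n arbitrary: C)
  case 0
  then show ?case using sgpd_rep[OF 0] by auto
next
  case (Suc n)
  then show ?case using sgpd_hom[OF Suc.prems] by simp
qed

lemma pres_prod:
  "pres n r A P q \<Longrightarrow> pres n r' B Q q'
   \<Longrightarrow> pres n (map_prod r r') (prod_cat (Suc n) A B) (prod_cat n P Q) (prod_fun (Suc n) A B q q')"
proof (induction n arbitrary: A P q B Q q')
  case 0
  then show ?case by (auto simp: prod_fun.simps)
next
  case (Suc n)
  then show ?case by (auto simp: prod_fun.simps(2)[of "Suc n"] simp del: prod_cat.simps)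
qed

lemma pres_terminal: "pres n id (terminal (Suc n)) (terminal n) (id_fun (Suc n) (terminal (Suc n)))"
proof (induction n)
  case 0
  then show ?case by (simp add: id_fun.simps)
next
  case (Suc n)
  then show ?case by (simp add: id_fun.simps(2)[of "Suc n"] del: terminal.simps)
qed

lemma gmap_pi0_map:
  "pres n r A P q \<Longrightarrow> gmap (Suc n) A B F \<Longrightarrow> gmap n P (pi0_cat (Suc n) B) (pi0_map (Suc n) r P B F)"
proof (induction n arbitrary: A P q B F)
  case 0
  then show ?case by (auto dest: gmap_fob)
next
  case (Suc n)
  note p = Suc.prems(1) and F = Suc.prems(2)
  have "gmap n (hom P x y) (pi0_cat (Suc n) (hom B (fob F x) (fob F y)))
      (pi0_map (Suc n) r (hom P x y) (hom B (fob F x) (fob F y)) (fhom F x y))"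
    if "x \<in> ob A" "y \<in> ob A" for x y
  proof -
    have "pres n r (hom A x y) (hom P x y) (fhom q x y)" using p that by simp
    then show ?thesis by (rule Suc.IH[OF _ gmap_fhom[OF F that]])
  qed
  then show ?case using p gmap_fob[OF F] by simp
qed

text \<open>
  This is where the choice of representatives is shown to be irrelevant: \<open>r (q a)\<close> is connected with a,
  so their images under F are connected in B and have the same class.
\<close>

lemma pi0_map_natural:
  "pres n r A P q \<Longrightarrow> gmap (Suc n) A (disc_cat (Suc n) P) q \<Longrightarrow> sgpd (Suc n) B \<Longrightarrow> gmap (Suc n) A B F
   \<Longrightarrow> fcomp (Suc n) A q (disc_fun (Suc n) P (pi0_map (Suc n) r P B F)) =
      fcomp (Suc n) A F (eta (Suc n) B)"
proof (induction n arbitrary: A P q B F)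
  case 0
  note p = 0(1) and q = 0(2) and B = 0(3) and F = 0(4)
  have 1: "iso_class B (fob F (r (fob q a))) = iso_class B (fob F a)" if a: "a \<in> ob A" for a
  proof -
    obtain f where f: "f \<in> ob (hom A (r (fob q a)) a)" and r: "r (fob q a) \<in> ob A"
      using p a by fastforce
    then have "fob (fhom F (r (fob q a)) a) f \<in> ob (hom B (fob F (r (fob q a))) (fob F a))"
      using gmap_fob[OF gmap_fhom[OF F r a]] by simp
    then show ?thesis
      using sgpd_class_eq_iff[OF B] gmap_fob[OF F] r a by blast
  qed
  have qo: "fob q a \<in> ob P" if "a \<in> ob A" for a using p that by simp
  have qh: "fob (fhom q a b) f = fob q a" "fob q b = fob q a"
    if "a \<in> ob A" "b \<in> ob A" "f \<in> ob (hom A a b)" for a b f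
    using gmap_fob[OF gmap_fhom[OF q that(1,2)] that(3)] by auto
  have 2: "iso_class B (fob F a) = iso_class B (fob F b)"
    if "a \<in> ob A" "b \<in> ob A" "f \<in> ob (hom A a b)" for a b f
    using 1[OF that(1)] 1[OF that(2)] qh(2)[OF that] by simp
  show ?case
    by (simp add: fcomp.simps 1 qo qh gmap_fob[OF F] gmap_fob[OF gmap_fhom[OF F]] cong: restrict_cong)
      (intro restrict_ext arg_cong[where f = Map0] 2[symmetric])
next
  case (Suc n)
  note p = Suc.prems(1) and q = Suc.prems(2) and B = Suc.prems(3) and F = Suc.prems(4)
  have p': "ob P = ob A" "\<And>a. a \<in> ob A \<Longrightarrow> fob q a = a"
    "\<And>a b. a \<in> ob A \<Longrightarrow> b \<in> ob A \<Longrightarrow> pres n r (hom A a b) (hom P a b) (fhom q a b)"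
    using p by auto
  have q': "gmap (Suc n) (hom A a b) (disc_cat (Suc n) (hom P a b)) (fhom q a b)"
    if "a \<in> ob A" "b \<in> ob A" for a b
    using gmap_fhom[OF q that] that by (simp add: p' del: disc_cat.simps)
  have h: "fcomp (Suc n) (hom A a b) (fhom q a b) (disc_fun (Suc n) (hom P a b)
       (pi0_map (Suc n) r (hom P a b) (hom B (fob F a) (fob F b)) (fhom F a b))) =
     fcomp (Suc n) (hom A a b) (fhom F a b) (eta (Suc n) (hom B (fob F a) (fob F b)))"
    if "a \<in> ob A" "b \<in> ob A" for a b
    by (rule Suc.IH[OF p'(3) q' sgpd_hom[OF B] gmap_fhom[OF F]]) (use that gmap_fob[OF F] in auto)
  show ?case
    by (simp add: fcomp.simps(2)[of "Suc n"] p' h gmap_fob[OF F] cong: restrict_cong)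
qed

lemma gmap_id_terminal:
  "gmap (Suc n) (terminal (Suc n)) (disc_cat (Suc n) (terminal n)) (id_fun (Suc n) (terminal (Suc n)))"
  unfolding disc_terminal by (rule gmap_id)

lemma gcat_pi0: "sgpd (Suc n) C \<Longrightarrow> gcat n (pi0_cat (Suc n) C)"
proof (induction n arbitrary: C)
  case 0
  then show ?case by simp
next
  case (Suc n)
  note C = Suc.prems
  note Cg = sgpd_gcat[OF C]
  note p = pres_eta[OF sgpd_hom[OF C]]
  show ?case
  proof (rule gcat_SucI, goal_cases)
    case (1 x y)
    then show ?case using Suc.IH[OF sgpd_hom[OF C]] by simp
  next
    case (2 x)
    then show ?case using gmap_pi0_map[OF pres_terminal gcat_unt[OF Cg]] by simp
  next
    case (3 x y z)
    then show ?case using gmap_pi0_map[OF pres_prod[OF p p] gcat_cmp[OF Cg]] by simp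
  qed simp
qed

text \<open>
  The unit and composition of \<open>\<pi>\<^sub>0 C\<close> are defined by \<open>pi0_map\<close>, so that their naturality, for the
  presentations of the terminal category and of a product, says that eta preserves them.
\<close>

lemma is_fun_eta:
  "sgpd (Suc n) C \<Longrightarrow> is_fun (Suc n) C (disc_cat (Suc n) (pi0_cat (Suc n) C)) (eta (Suc n) C)"
proof (induction n arbitrary: C)
  case 0
  note Cg = sgpd_gcat[OF 0]
  show ?case
  proof (rule is_fun_SucI[OF Cg gcat_disc[OF gcat_pi0[OF 0]] gmap_eta[OF 0]], goal_cases)
    case (1 x y)
    then show ?case
      using gmap_fhom[OF gmap_eta[OF 0]] by (simp only: is_fun.simps gmap.simps)
  next
    case (2 x t)
    then show ?case using fob_unt[OF Cg] by (cases t) auto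
  next
    case (3 x y z a b)
    then obtain f g where f: "a = Top f" "f \<in> ob (hom C x y)" and g: "b = Top g" "g \<in> ob (hom C y z)"
      by (cases a; cases b) auto
    then have "iso_class C x = iso_class C y" "iso_class C y = iso_class C z"
      using sgpd_class_eq_iff[OF 0] 3(1-3) by auto
    then show ?case
      using 3(1-3) f g fob_cmp[OF Cg 3(1-3) f(2) g(2)] by simp
  qed
next
  case (Suc n)
  note C = Suc.prems
  note Cg = sgpd_gcat[OF C]
  note sh = sgpd_hom[OF C]
  show ?case
  proof (rule is_fun_SucI_eq[OF gmap_eta[OF C]], goal_cases)
    case (1 x y)
    then show ?case using Suc.IH[OF sh] by (simp del: is_fun.simps disc_cat.simps)
  next
    case (2 x)
    then show ?case
      using pi0_map_natural[OF pres_terminal gmap_id_terminal sh[OF 2 2] gcat_unt[OF Cg 2], symmetric]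
        fcomp_id_left[OF gmap_disc[OF gmap_pi0_map[OF pres_terminal gcat_unt[OF Cg 2]], unfolded disc_terminal]]
      by (simp del: terminal.simps)
  next
    case (3 x y z)
    note e = gmap_eta[OF sh[OF 3(1,2)]] gmap_eta[OF sh[OF 3(2,3)]]
    show ?case
      using pi0_map_natural[OF pres_prod[OF pres_eta[OF sh[OF 3(1,2)]] pres_eta[OF sh[OF 3(2,3)]]]
            gmap_prod[OF e, folded disc_prod] sh[OF 3(1,3)] gcat_cmp[OF Cg 3], symmetric] 3
      by (simp del: prod_cat.simps disc_fun.simps eta.simps disc_prod)
  qed
qed

text \<open>The laws descend from C to its quotient \<open>D (\<pi>\<^sub>0 C)\<close>, and D reflects them.\<close>

lemma is_cat_pi0: "sgpd (Suc n) C \<Longrightarrow> is_cat n (pi0_cat (Suc n) C)"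
  using is_cat_quotient[OF sgpd_cat gcat_disc[OF gcat_pi0] is_fun_eta fsurj_eta]
    is_cat_disc_iff[OF gcat_pi0] by blast

subsection \<open>Isomorphism classes of functors\<close>

lemma gmap_pi0_fun:
  "sgpd (Suc n) C \<Longrightarrow> gmap (Suc n) C D F
   \<Longrightarrow> gmap n (pi0_cat (Suc n) C) (pi0_cat (Suc n) D) (pi0_fun (Suc n) C D F)"
  unfolding pi0_fun_def by (rule gmap_pi0_map[OF pres_eta])

lemma eta_natural:
  "sgpd (Suc n) C \<Longrightarrow> sgpd (Suc n) D \<Longrightarrow> gmap (Suc n) C D F
   \<Longrightarrow> fcomp (Suc n) C (eta (Suc n) C) (disc_fun (Suc n) (pi0_cat (Suc n) C) (pi0_fun (Suc n) C D F)) =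
      fcomp (Suc n) C F (eta (Suc n) D)"
  unfolding pi0_fun_def by (rule pi0_map_natural[OF pres_eta gmap_eta])

text \<open>
  By \<open>eta_natural\<close>, this makes \<open>\<pi>\<^sub>0 F\<close> the only solution X of the equation \<open>\<eta> \<cdot> D X = F \<cdot> \<eta>\<close>. All
  further properties of \<open>\<pi>\<^sub>0\<close> on functors follow by comparing two candidates after this operation.
\<close>

lemma eta_cancel:
  assumes "sgpd (Suc n) C" "gmap n (pi0_cat (Suc n) C) X F" "gmap n (pi0_cat (Suc n) C) Y G"
    and "fcomp (Suc n) C (eta (Suc n) C) (disc_fun (Suc n) (pi0_cat (Suc n) C) F) =
      fcomp (Suc n) C (eta (Suc n) C) (disc_fun (Suc n) (pi0_cat (Suc n) C) G)"
  shows "F = G"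
  using disc_fun_inj[OF assms(2,3) fcomp_cancel[OF gmap_eta[OF assms(1)] fsurj_eta[OF assms(1)]
        gmap_disc[OF assms(2)] gmap_disc[OF assms(3)] assms(4)]] .

lemma is_fun_pi0:
  assumes C: "sgpd (Suc n) C" and D: "sgpd (Suc n) D" and F: "is_fun (Suc n) C D F"
  shows "is_fun n (pi0_cat (Suc n) C) (pi0_cat (Suc n) D) (pi0_fun (Suc n) C D F)"
proof -
  note g = gcat_pi0[OF C] gcat_pi0[OF D]
  note p = gmap_pi0_fun[OF C is_fun_gmap[OF F]]
  show ?thesis
    by (rule is_fun_disc_iff[OF g p, THEN iffD1])
     (rule is_fun_cancel[OF sgpd_gcat[OF C] gcat_disc[OF g(1)] gcat_disc[OF g(2)] is_fun_eta[OF C] fsurj_eta[OF C]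
        gmap_disc[OF p] is_fun_fcomp[OF sgpd_gcat[OF C] sgpd_gcat[OF D] gcat_disc[OF g(2)] F is_fun_eta[OF D],
          folded eta_natural[OF C D is_fun_gmap[OF F]]]])
qed

lemma pi0_fun_id:
  assumes C: "sgpd (Suc n) C"
  shows "pi0_fun (Suc n) C C (id_fun (Suc n) C) = id_fun n (pi0_cat (Suc n) C)"
  by (rule eta_cancel[OF C gmap_pi0_fun[OF C gmap_id] gmap_id])
    (simp only: eta_natural[OF C C gmap_id] fcomp_id_left[OF gmap_eta[OF C]] disc_id
      fcomp_id_right[OF gmap_eta[OF C]])

lemma pi0_fun_fcomp:
  assumes C: "sgpd (Suc n) C" and D: "sgpd (Suc n) D" and E: "sgpd (Suc n) E"
    and F: "gmap (Suc n) C D F" and G: "gmap (Suc n) D E G"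
  shows "pi0_fun (Suc n) C E (fcomp (Suc n) C F G) =
    fcomp n (pi0_cat (Suc n) C) (pi0_fun (Suc n) C D F) (pi0_fun (Suc n) D E G)"
proof (rule eta_cancel[OF C gmap_pi0_fun[OF C gmap_fcomp[OF F G]] gmap_fcomp[OF gmap_pi0_fun[OF C F] gmap_pi0_fun[OF D G]]])
  note p = gmap_disc[OF gmap_pi0_fun[OF C F]] gmap_disc[OF gmap_pi0_fun[OF D G]]
  show "fcomp (Suc n) C (eta (Suc n) C) (disc_fun (Suc n) (pi0_cat (Suc n) C) (pi0_fun (Suc n) C E (fcomp (Suc n) C F G))) =
    fcomp (Suc n) C (eta (Suc n) C) (disc_fun (Suc n) (pi0_cat (Suc n) C)
      (fcomp n (pi0_cat (Suc n) C) (pi0_fun (Suc n) C D F) (pi0_fun (Suc n) D E G)))"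
    by (simp only: eta_natural[OF C E gmap_fcomp[OF F G]] disc_fcomp[OF gmap_pi0_fun[OF C F] gmap_pi0_fun[OF D G]]
        fcomp_assoc[OF gmap_eta[OF C] p, symmetric] eta_natural[OF C D F] fcomp_assoc[OF F gmap_eta[OF D] p(2)]
        eta_natural[OF D E G] fcomp_assoc[OF F G gmap_eta[OF E]])
qed

context
  fixes n C x y z
  assumes C: "sgpd (Suc (Suc n)) C" and o: "x \<in> ob C" "y \<in> ob C" "z \<in> ob C"
begin

text \<open>
  The functor eta carries composition with f to composition with its image in \<open>D (\<pi>\<^sub>0 C)\<close>, and this is
  the image under D of a composition functor of \<open>\<pi>\<^sub>0 C\<close>.
\<close>

lemma pi0_precomp:
  assumes f: "f \<in> ob (hom C x y)"
  shows "pi0_fun (Suc n) (hom C y z) (hom C x z) (precomp (Suc n) C x y z f) =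
    precomp n (pi0_cat (Suc (Suc n)) C) x y z (fob (eta (Suc n) (hom C x y)) f)"
proof -
  let ?Q = "pi0_cat (Suc (Suc n)) C" and ?f = "fob (eta (Suc n) (hom C x y)) f"
  note sh = sgpd_hom[OF C]
  note g = gcat_pi0[OF C]
  have oQ: "x \<in> ob ?Q" "y \<in> ob ?Q" "z \<in> ob ?Q" using o by simp_all
  have fQ: "?f \<in> ob (hom ?Q x y)" using fob_eta[OF sh[OF o(1,2)] f] by simp
  note pre = gmap_precomp[OF sgpd_cat[OF C] o f]
  have "fcomp (Suc n) (hom C y z) (precomp (Suc n) C x y z f) (eta (Suc n) (hom C x z)) =
    fcomp (Suc n) (hom C y z) (eta (Suc n) (hom C y z)) (precomp (Suc n) (disc_cat (Suc (Suc n)) ?Q) x y z ?f)"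
    using precomp_fun[OF sgpd_cat[OF C] gcat_disc[OF g] is_fun_eta[OF C] o f] o by (simp del: eta.simps disc_cat.simps pi0_cat.simps)
  also have "precomp (Suc n) (disc_cat (Suc (Suc n)) ?Q) x y z ?f = disc_fun (Suc n) (hom ?Q y z) (precomp n ?Q x y z ?f)"
    by (rule disc_precomp[OF g oQ fQ, symmetric])
  finally have "fcomp (Suc n) (hom C y z) (eta (Suc n) (hom C y z)) (disc_fun (Suc n) (pi0_cat (Suc n) (hom C y z))
       (pi0_fun (Suc n) (hom C y z) (hom C x z) (precomp (Suc n) C x y z f))) =
     fcomp (Suc n) (hom C y z) (eta (Suc n) (hom C y z)) (disc_fun (Suc n) (pi0_cat (Suc n) (hom C y z)) (precomp n ?Q x y z ?f))"
    by (simp only: eta_natural[OF sh[OF o(2,3)] sh[OF o(1,3)] pre] hom_pi0_Suc)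
  then show ?thesis
    by (rule eta_cancel[OF sh[OF o(2,3)] gmap_pi0_fun[OF sh[OF o(2,3)] pre]
       gmap_precomp_weak[OF g oQ fQ, unfolded hom_pi0_Suc]])
qed

lemma pi0_postcomp:
  assumes f: "f \<in> ob (hom C y z)"
  shows "pi0_fun (Suc n) (hom C x y) (hom C x z) (postcomp (Suc n) C x y z f) =
    postcomp n (pi0_cat (Suc (Suc n)) C) x y z (fob (eta (Suc n) (hom C y z)) f)"
proof -
  let ?Q = "pi0_cat (Suc (Suc n)) C" and ?f = "fob (eta (Suc n) (hom C y z)) f"
  note sh = sgpd_hom[OF C]
  note g = gcat_pi0[OF C]
  have oQ: "x \<in> ob ?Q" "y \<in> ob ?Q" "z \<in> ob ?Q" using o by simp_all
  have fQ: "?f \<in> ob (hom ?Q y z)" using fob_eta[OF sh[OF o(2,3)] f] by simp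
  note post = gmap_postcomp[OF sgpd_cat[OF C] o f]
  have "fcomp (Suc n) (hom C x y) (postcomp (Suc n) C x y z f) (eta (Suc n) (hom C x z)) =
    fcomp (Suc n) (hom C x y) (eta (Suc n) (hom C x y)) (postcomp (Suc n) (disc_cat (Suc (Suc n)) ?Q) x y z ?f)"
    using postcomp_fun[OF sgpd_cat[OF C] gcat_disc[OF g] is_fun_eta[OF C] o f] o by (simp del: eta.simps disc_cat.simps pi0_cat.simps)
  also have "postcomp (Suc n) (disc_cat (Suc (Suc n)) ?Q) x y z ?f = disc_fun (Suc n) (hom ?Q x y) (postcomp n ?Q x y z ?f)"
    by (rule disc_postcomp[OF g oQ fQ, symmetric])
  finally have "fcomp (Suc n) (hom C x y) (eta (Suc n) (hom C x y)) (disc_fun (Suc n) (pi0_cat (Suc n) (hom C x y))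
       (pi0_fun (Suc n) (hom C x y) (hom C x z) (postcomp (Suc n) C x y z f))) =
     fcomp (Suc n) (hom C x y) (eta (Suc n) (hom C x y)) (disc_fun (Suc n) (pi0_cat (Suc n) (hom C x y)) (postcomp n ?Q x y z ?f))"
    by (simp only: eta_natural[OF sh[OF o(1,2)] sh[OF o(1,3)] post] hom_pi0_Suc)
  then show ?thesis
    by (rule eta_cancel[OF sh[OF o(1,2)] gmap_pi0_fun[OF sh[OF o(1,2)] post]
       gmap_postcomp_weak[OF g oQ fQ, unfolded hom_pi0_Suc]])
qed

end

section \<open>Isomorphism classes of 2-morphisms\<close>

lemma gtr_class_eq:
  assumes D: "sgpd (Suc 0) D" and \<alpha>: "gtr (Suc 0) C D \<alpha>" and x: "x \<in> ob C"
  shows "iso_class D (fob (src \<alpha>) x) = iso_class D (fob (tgt \<alpha>) x)"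
  using sgpd_class_eq_iff[OF D gtr_fob_src[OF \<alpha> x] gtr_fob_tgt[OF \<alpha> x]] gtr_tob[OF \<alpha> x] by blast

text \<open>The components of \<alpha> connect the values of its source and target.\<close>

lemma pi0_fun_src_tgt:
  assumes C: "sgpd (Suc 0) C" and D: "sgpd (Suc 0) D" and \<alpha>: "gtr (Suc 0) C D \<alpha>"
  shows "pi0_fun (Suc 0) C D (src \<alpha>) = pi0_fun (Suc 0) C D (tgt \<alpha>)"
proof -
  have "rep p \<in> ob C" if "p \<in> ob (pi0_cat (Suc 0) C)" for p
    using that sgpd_rep[OF C] by auto
  then show ?thesis
    unfolding pi0_fun_def pi0_map.simps by (intro arg_cong[where f = Map0] restrict_ext gtr_class_eq[OF D \<alpha>])
qed

lemma src_pi0_tr [simp]: "src (pi0_tr (Suc n) C D \<alpha>) = pi0_fun (Suc n) C D (src \<alpha>)"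
  by (cases n) auto

lemma tgt_pi0_tr:
  "sgpd (Suc n) C \<Longrightarrow> sgpd (Suc n) D \<Longrightarrow> gtr (Suc n) C D \<alpha>
   \<Longrightarrow> tgt (pi0_tr (Suc n) C D \<alpha>) = pi0_fun (Suc n) C D (tgt \<alpha>)"
  by (cases n) (simp_all add: pi0_fun_src_tgt del: gtr.simps)

text \<open>
  At the lowest level the component becomes its isomorphism class, above it stays the same; eta
  describes both cases at once.
\<close>

lemma tob_pi0_tr:
  assumes "c \<in> ob C" "tob \<alpha> c \<in> ob (hom D (fob (src \<alpha>) c) (fob (tgt \<alpha>) c))"
  shows "tob (pi0_tr (Suc (Suc n)) C D \<alpha>) c =
    fob (eta (Suc n) (hom D (fob (src \<alpha>) c) (fob (tgt \<alpha>) c))) (tob \<alpha> c)"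
  using assms by (cases n) auto

lemma thom_pi0_tr: "c \<in> ob C \<Longrightarrow> c' \<in> ob C \<Longrightarrow> thom (pi0_tr (Suc (Suc n)) C D \<alpha>) c c' =
    pi0_tr (Suc n) (hom C c c') (hom D (fob (src \<alpha>) c) (fob (tgt \<alpha>) c')) (thom \<alpha> c c')"
  by simp

lemma fob_pi0_Suc: "x \<in> ob C \<Longrightarrow> fob (pi0_fun (Suc (Suc n)) C D F) x = fob F x"
  by (simp add: pi0_fun_def)

lemma fhom_pi0_Suc: "x \<in> ob C \<Longrightarrow> y \<in> ob C \<Longrightarrow>
   fhom (pi0_fun (Suc (Suc n)) C D F) x y =
     pi0_fun (Suc n) (hom C x y) (hom D (fob F x) (fob F y)) (fhom F x y)"
  by (simp add: pi0_fun_def)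

lemma gtr_pi0:
  "sgpd (Suc n) C \<Longrightarrow> sgpd (Suc n) D \<Longrightarrow> gtr (Suc n) C D \<alpha>
   \<Longrightarrow> gtr n (pi0_cat (Suc n) C) (pi0_cat (Suc n) D) (pi0_tr (Suc n) C D \<alpha>)"
proof (induction n arbitrary: C D \<alpha>)
  case 0
  show ?case using gmap_pi0_fun[OF 0(1) gtr_src[OF 0(3)]] by auto
next
  case (Suc n)
  note C = Suc.prems(1) and D = Suc.prems(2) and \<alpha> = Suc.prems(3)
  note fob = gtr_fob_src[OF \<alpha>] gtr_fob_tgt[OF \<alpha>] and tob = gtr_tob[OF \<alpha>] and th = gtr_thom[OF \<alpha>]
  note sc = sgpd_hom[OF C] and sd = sgpd_hom[OF D]
  note hom = gmap_fhom[OF gtr_src[OF \<alpha>]] gmap_fhom[OF gtr_tgt[OF \<alpha>]]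
  let ?C = "pi0_cat (Suc (Suc n)) C" and ?D = "pi0_cat (Suc (Suc n)) D" and ?\<alpha> = "pi0_tr (Suc (Suc n)) C D \<alpha>"
  have eq: "?\<alpha> = Tr (src ?\<alpha>) (tgt ?\<alpha>) (\<lambda>c\<in>ob ?C. tob ?\<alpha> c) (\<lambda>c\<in>ob ?C. \<lambda>c'\<in>ob ?C. thom ?\<alpha> c c')"
    by (simp cong: restrict_cong)
  have s: "src ?\<alpha> = pi0_fun (Suc (Suc n)) C D (src \<alpha>)" and t: "tgt ?\<alpha> = pi0_fun (Suc (Suc n)) C D (tgt \<alpha>)"
    using tgt_pi0_tr[OF C D \<alpha>] by simp_all
  show ?case
  proof (subst eq, rule gtr_TrI, goal_cases)
    case 1
    show ?case unfolding s by (rule gmap_pi0_fun[OF C gtr_src[OF \<alpha>]])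
  next
    case 2
    show ?case unfolding t by (rule gmap_pi0_fun[OF C gtr_tgt[OF \<alpha>]])
  next
    case (3 c)
    then have c: "c \<in> ob C" by simp
    show ?case
      unfolding s t fob_pi0_Suc[OF c] tob_pi0_tr[OF c tob[OF c]] hom_pi0_Suc
      by (rule fob_eta[OF sd[OF fob(1)[OF c] fob(2)[OF c]] tob[OF c]])
  next
    case (4 c c')
    then have c: "c \<in> ob C" and c': "c' \<in> ob C" by simp_all
    show ?case
      unfolding s t fob_pi0_Suc[OF c] fob_pi0_Suc[OF c'] thom_pi0_tr[OF c c'] hom_pi0_Suc
      by (rule Suc.IH[OF sc[OF c c'] sd[OF fob(1)[OF c] fob(2)[OF c']] th[OF c c']])
  next
    case (5 c c')
    then have c: "c \<in> ob C" and c': "c' \<in> ob C" by simp_all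
    note F = fob(1)[OF c] fob(2)[OF c] fob(2)[OF c']
    show ?case
      unfolding s t fob_pi0_Suc[OF c] fob_pi0_Suc[OF c'] thom_pi0_tr[OF c c'] hom_pi0_Suc src_pi0_tr gtr_thom_src[OF \<alpha> c c']
        fhom_pi0_Suc[OF c c'] tob_pi0_tr[OF c tob[OF c]] pi0_precomp[OF D F tob[OF c], symmetric]
      by (rule pi0_fun_fcomp[OF sc[OF c c'] sd[OF F(2,3)] sd[OF F(1,3)] hom(2)[OF c c']
            gmap_precomp[OF sgpd_cat[OF D] F tob[OF c]]])
  next
    case (6 c c')
    then have c: "c \<in> ob C" and c': "c' \<in> ob C" by simp_all
    note F = fob(1)[OF c] fob(1)[OF c'] fob(2)[OF c']
    show ?case
      unfolding s t fob_pi0_Suc[OF c] fob_pi0_Suc[OF c'] thom_pi0_tr[OF c c'] hom_pi0_Suc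
        tgt_pi0_tr[OF sc[OF c c'] sd[OF F(1,3)] th[OF c c']] gtr_thom_tgt[OF \<alpha> c c']
        fhom_pi0_Suc[OF c c'] tob_pi0_tr[OF c' tob[OF c']] pi0_postcomp[OF D F tob[OF c'], symmetric]
      by (rule pi0_fun_fcomp[OF sc[OF c c'] sd[OF F(1,2)] sd[OF F(1,3)] hom(1)[OF c c']
            gmap_postcomp[OF sgpd_cat[OF D] F tob[OF c']]])
  qed
qed

lemma gtr_1_eqI:
  assumes \<alpha>: "gtr (Suc 0) C D \<alpha>" and \<beta>: "gtr (Suc 0) C D \<beta>"
    and s: "src \<alpha> = src \<beta>" "tgt \<alpha> = tgt \<beta>" and a: "\<And>c. c \<in> ob C \<Longrightarrow> tob \<alpha> c = tob \<beta> c"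
  shows "\<alpha> = \<beta>"
proof (rule gtr_Suc_eqI[OF \<alpha> \<beta> s a])
  fix c c' assume c: "c \<in> ob C" "c' \<in> ob C"
  have "src (thom \<alpha> c c') = src (thom \<beta> c c')"
    by (simp only: gtr_thom_src[OF \<alpha> c] gtr_thom_src[OF \<beta> c] s a[OF c(1)])
  then show "thom \<alpha> c c' = thom \<beta> c c'"
    using gtr_0[OF gtr_thom[OF \<alpha> c]] gtr_0[OF gtr_thom[OF \<beta> c]] by metis
qed

text \<open>
  At the lowest level both sides are 2-morphisms into a discrete groupoid, hence identities; at higher
  levels the components are those of the homs.
\<close>

lemma eta_natural_tr:
  "sgpd (Suc n) C \<Longrightarrow> sgpd (Suc n) D \<Longrightarrow> gtr (Suc n) C D \<alpha>
   \<Longrightarrow> whisker_l (Suc n) C (eta (Suc n) C)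
        (disc_tr (Suc n) (pi0_cat (Suc n) C) (pi0_cat (Suc n) D) (pi0_tr (Suc n) C D \<alpha>)) =
      whisker_r (Suc n) C \<alpha> (eta (Suc n) D)"
proof (induction n arbitrary: C D \<alpha>)
  case 0
  note C = 0(1) and D = 0(2) and \<alpha> = 0(3)
  let ?D = "disc_cat (Suc 0) (pi0_cat (Suc 0) D)"
  note cD = is_cat_disc[OF is_cat_pi0[OF D]]
  note s = gtr_src[OF \<alpha>] and t = gtr_tgt[OF \<alpha>]
  note e = eta_natural[OF C D s] eta_natural[OF C D t]
  have eq: "fcomp (Suc 0) C (src \<alpha>) (eta (Suc 0) D) = fcomp (Suc 0) C (tgt \<alpha>) (eta (Suc 0) D)"
    by (simp only: e[symmetric] pi0_fun_src_tgt[OF C D \<alpha>])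
  note g = gmap_fcomp[OF s gmap_eta[OF D]]
  have "whisker_l (Suc 0) C (eta (Suc 0) C)
      (disc_tr (Suc 0) (pi0_cat (Suc 0) C) (pi0_cat (Suc 0) D) (pi0_tr (Suc 0) C D \<alpha>))
    = id_tr (Suc 0) C ?D (fcomp (Suc 0) C (src \<alpha>) (eta (Suc 0) D))"
    by (simp only: disc_tr.simps src_pi0_tr wl_id[OF cD gmap_eta[OF C] gmap_disc[OF gmap_pi0_fun[OF C s]]] e)
  also have "\<dots> = whisker_r (Suc 0) C \<alpha> (eta (Suc 0) D)"
  proof (rule gtr_1_eqI[OF gtr_id[OF cD g] gtr_wr[OF sgpd_cat[OF D] is_cat_gcat[OF cD] \<alpha> is_fun_eta[OF D]]])
    fix c assume c: "c \<in> ob C"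
    then show "tob (id_tr (Suc 0) C ?D (fcomp (Suc 0) C (src \<alpha>) (eta (Suc 0) D))) c =
      tob (whisker_r (Suc 0) C \<alpha> (eta (Suc 0) D)) c"
      unfolding tob_whisker_r[OF c] tob_id_tr[OF c] fob_fcomp[OF c]
      using gtr_tob[OF \<alpha> c] gtr_fob_src[OF \<alpha> c] gtr_fob_tgt[OF \<alpha> c] by simp
  qed (simp_all only: src_id_tr tgt_id_tr src_whisker_r tgt_whisker_r[OF \<alpha>] eq)
  finally show ?case .
next
  case (Suc n)
  note C = Suc.prems(1) and D = Suc.prems(2) and \<alpha> = Suc.prems(3)
  note fob = gtr_fob_src[OF \<alpha>] gtr_fob_tgt[OF \<alpha>] and tob = gtr_tob[OF \<alpha>] and th = gtr_thom[OF \<alpha>]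
  let ?C = "pi0_cat (Suc (Suc n)) C" and ?D = "pi0_cat (Suc (Suc n)) D" and ?\<alpha> = "pi0_tr (Suc (Suc n)) C D \<alpha>"
  note cD = is_cat_pi0[OF D] 
  note p = gtr_pi0[OF C D \<alpha>]
  note d = gtr_disc[OF cD p]
  note t = tgt_pi0_tr[OF C D \<alpha>]
  note gD = gcat_disc[OF is_cat_gcat[OF cD]]
  show ?case
  proof (rule gtr_Suc_eqI[OF gtr_wl[OF gD gmap_eta[OF C] d] gtr_wr[OF sgpd_cat[OF D] gD \<alpha> is_fun_eta[OF D]]], goal_cases)
    case 1
    show ?case by (simp only: src_whisker_l src_whisker_r src_disc_tr src_pi0_tr eta_natural[OF C D gtr_src[OF \<alpha>]])
  next
    case 2
    show ?case
      by (simp only: tgt_whisker_l[OF d] tgt_whisker_r[OF \<alpha>] tgt_disc_tr[OF p] t eta_natural[OF C D gtr_tgt[OF \<alpha>]])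
  next
    case (3 c)
    then show ?case
      by (simp add: tob_whisker_l tob_whisker_r fob tob tob_pi0_tr
        del: whisker_l.simps whisker_r.simps disc_tr.simps pi0_tr.simps eta.simps pi0_cat.simps)
  next
    case (4 c c')
    then show ?case
      by (simp add: thom_whisker_l thom_whisker_r fob thom_pi0_tr t fob_pi0_Suc Suc.IH[OF sgpd_hom[OF C] sgpd_hom[OF D] th]
        del: whisker_l.simps whisker_r.simps disc_tr.simps pi0_tr.simps eta.simps pi0_cat.simps)
  qed
qed

lemma eta_cancel_tr:
  assumes C: "sgpd (Suc n) C" and E: "is_cat n E" and \<alpha>: "gtr n (pi0_cat (Suc n) C) E \<alpha>" "gtr n (pi0_cat (Suc n) C) E \<beta>"
    and eq: "whisker_l (Suc n) C (eta (Suc n) C) (disc_tr (Suc n) (pi0_cat (Suc n) C) E \<alpha>) =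
      whisker_l (Suc n) C (eta (Suc n) C) (disc_tr (Suc n) (pi0_cat (Suc n) C) E \<beta>)"
  shows "\<alpha> = \<beta>"
  by (rule disc_tr_inj[OF \<alpha> wl_cancel[OF gmap_eta[OF C] fsurj_eta[OF C] gtr_disc[OF E \<alpha>(1)] gtr_disc[OF E \<alpha>(2)] eq]])

lemma is_tr_pi0:
  assumes C: "sgpd (Suc n) C" and D: "sgpd (Suc n) D" and \<alpha>: "is_tr (Suc n) C D \<alpha>"
  shows "is_tr n (pi0_cat (Suc n) C) (pi0_cat (Suc n) D) (pi0_tr (Suc n) C D \<alpha>)"
proof -
  note \<alpha>' = is_tr_gtr[OF \<alpha>]
  note p = gtr_pi0[OF C D \<alpha>'] and c = is_cat_pi0[OF C] is_cat_pi0[OF D]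
  note g = is_cat_gcat[OF c(1)] is_cat_gcat[OF c(2)]
  have w: "is_tr (Suc n) C (disc_cat (Suc n) (pi0_cat (Suc n) D)) (whisker_r (Suc n) C \<alpha> (eta (Suc n) D))"
    by (rule is_tr_wr[OF sgpd_gcat[OF C] sgpd_cat[OF D] is_cat_disc[OF c(2)] \<alpha> is_fun_eta[OF D]])
  show ?thesis
    by (rule is_tr_disc_iff[OF g(1) c(2) p, THEN iffD1])
      (rule is_tr_cancel[OF sgpd_gcat[OF C] gcat_disc[OF g(1)] is_cat_disc[OF c(2)] is_fun_eta[OF C] fsurj_eta[OF C]
        gtr_disc[OF c(2) p] w[folded eta_natural_tr[OF C D \<alpha>']]])
qed

section \<open>Groupoids\<close>

lemma is_equiv1_disc_0:
  assumes f: "f \<in> ob (hom (disc_cat (Suc 0) D) x y)" and x: "x \<in> ob D" "y \<in> ob D"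
  shows "is_equiv1 (is_equiv 0) 0 (disc_cat (Suc 0) D) x y f"
proof -
  have xy: "f = x" "y = x" using f by auto
  have 1: "fob (precomp 0 (disc_cat (Suc 0) D) x x z x) w = w"
    if "w \<in> ob (hom (disc_cat (Suc 0) D) x z)" for w z
  proof -
    from that have z: "z = x" "w = x" by auto
    show ?thesis unfolding z by (simp add: precomp_def const_fun_def fcomp.simps)
  qed
  have 2: "fob (postcomp 0 (disc_cat (Suc 0) D) z x x x) w = w"
    if "w \<in> ob (hom (disc_cat (Suc 0) D) z x)" for w z
  proof -
    from that have z: "z = x" "w = x" by auto
    show ?thesis unfolding z by (simp add: postcomp_def const_fun_def fcomp.simps)
  qed
  have id: "bij_betw g A A" if "\<And>w. w \<in> A \<Longrightarrow> g w = w" for g and A :: "'a set"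
    using that bij_betw_cong[of A g id A] by simp
  show ?thesis
    unfolding is_equiv1_def is_equiv.simps xy by (intro conjI ballI id 1 2)
qed

text \<open>
  Composition with f in the discrete category is the image under D of composition with f. The premise \<open>IH\<close> is the
  preservation of equivalences by D one level below: the two statements are proved by a mutual
  induction.
\<close>

lemma is_equiv1_disc:
  fixes D :: "'a ncat"
  assumes IH: "\<And>(C :: 'a ncat) D F. is_cat n C \<Longrightarrow> is_cat n D \<Longrightarrow> gmap n C D F \<Longrightarrow> is_equiv n C D F
      \<Longrightarrow> is_equiv (Suc n) (disc_cat (Suc n) C) (disc_cat (Suc n) D) (disc_fun (Suc n) C F)"
    and D: "is_cat (Suc n) D" and o: "x \<in> ob D" "y \<in> ob D" and f: "f \<in> ob (hom D x y)"
    and i: "is_equiv1 (is_equiv n) n D x y f"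
  shows "is_equiv1 (is_equiv (Suc n)) (Suc n) (disc_cat (Suc (Suc n)) D) x y f"
  unfolding is_equiv1_def
proof (intro conjI ballI, goal_cases)
  note D' = is_cat_gcat[OF D] and dh = is_cat_hom[OF D]
  case (1 z)
  then have z: "z \<in> ob D" by simp
  show ?case
    unfolding disc_precomp[OF D' o z f, symmetric] hom_disc_Suc
    by (rule IH[OF dh[OF o(2) z] dh[OF o(1) z] gmap_precomp[OF D o z f]]) (use i z in \<open>simp add: is_equiv1_def\<close>)
next
  note D' = is_cat_gcat[OF D] and dh = is_cat_hom[OF D]
  case (2 z)
  then have z: "z \<in> ob D" by simp
  show ?case
    unfolding disc_postcomp[OF D' z o f, symmetric] hom_disc_Suc
    by (rule IH[OF dh[OF z o(1)] dh[OF z o(2)] gmap_postcomp[OF D z o f]]) (use i z in \<open>simp add: is_equiv1_def\<close>)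
qed

lemma is_equiv_disc:
  "is_cat n C \<Longrightarrow> is_cat n D \<Longrightarrow> gmap n C D F \<Longrightarrow> is_equiv n C D F
   \<Longrightarrow> is_equiv (Suc n) (disc_cat (Suc n) C) (disc_cat (Suc n) D) (disc_fun (Suc n) C F)"
proof (induction n arbitrary: C D F)
  case 0
  have F: "bij_betw (fob F) (ob C) (ob D)" using 0(4) by simp
  show ?case unfolding is_equiv.simps(2)
  proof (intro conjI ballI, goal_cases)
    case (1 d)
    then have d: "d \<in> ob D" by simp
    then have "d \<in> fob F ` ob C" using bij_betw_imp_surj_on[OF F] by simp
    then obtain c where c: "c \<in> ob C" "fob F c = d" by auto
    then have f: "d \<in> ob (hom (disc_cat (Suc 0) D) (fob (disc_fun (Suc 0) C F) c) d)"
      unfolding fob_disc[OF c(1)] by simp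
    show ?case
      using is_equiv1_disc_0[OF f gmap_fob[OF 0(3) c(1), folded fob_disc[OF c(1), of 0 F]] d] f c(1)
      unfolding ob_disc by blast
  next
    case (2 c c')
    then show ?case
      using F inj_onD[OF bij_betw_imp_inj_on[OF F], of c c']
      by (cases "c = c'") (auto simp: bij_betw_def disc_hom_def)
  qed
next
  case (Suc n)
  note C = Suc.prems(1) and D = Suc.prems(2) and F = Suc.prems(3) and e = Suc.prems(4)
  note fob = gmap_fob[OF F]
  show ?case unfolding is_equiv.simps(2)[of "Suc n"]
  proof (intro conjI ballI, goal_cases)
    case (1 d)
    then have d: "d \<in> ob D" by simp
    then obtain c f where c: "c \<in> ob C" and f: "f \<in> ob (hom D (fob F c) d)"
      and i: "is_equiv1 (is_equiv n) n D (fob F c) d f" using e unfolding is_equiv.simps by blast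
    have "is_equiv1 (is_equiv (Suc n)) (Suc n) (disc_cat (Suc (Suc n)) D) (fob F c) d f"
      by (rule is_equiv1_disc[OF _ D fob[OF c] d f i], rule Suc.IH; assumption)
    then show ?case
      using c d f by (intro bexI[of _ c] bexI[of _ f]) (simp_all del: disc_cat.simps disc_fun.simps is_equiv.simps)
  next
    case (2 c c')
    then have c: "c \<in> ob C" "c' \<in> ob C" by simp_all
    show ?case
      unfolding hom_disc_Suc fob_disc[OF c(1)] fob_disc[OF c(2)] fhom_disc_Suc[OF c]
      by (rule Suc.IH[OF is_cat_hom[OF C c] is_cat_hom[OF D fob[OF c(1)] fob[OF c(2)]] gmap_fhom[OF F c]])
        (use e c in \<open>simp only: is_equiv.simps(2)\<close>)
  qed
qed

lemma is_gpd_disc: "is_gpd n C \<Longrightarrow> is_gpd (Suc n) (disc_cat (Suc n) C)"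
proof (induction n arbitrary: C)
  case 0
  then show ?case
    using is_cat_disc[of 0 C] is_equiv1_disc_0[of _ C] by (simp del: is_cat.simps(2) disc_cat.simps add: is_gpd.simps(2)) simp
next
  case (Suc n)
  note c = is_gpd_cat[OF Suc.prems]
  show ?case unfolding is_gpd.simps(2)[of "Suc n"]
  proof (intro conjI ballI, goal_cases)
    case 1
    show ?case by (rule is_cat_disc[OF c])
  next
    case (2 x y f)
    then have o: "x \<in> ob C" "y \<in> ob C" "f \<in> ob (hom C x y)" by simp_all
    show ?case
      by (rule is_equiv1_disc[OF is_equiv_disc c o]) (use Suc.prems o in simp_all)
  next
    case (3 x y)
    then show ?case using Suc.IH Suc.prems by (simp del: is_cat.simps)
  qed
qed

lemma small_disc:
  fixes C :: "'k univ ncat"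
  shows "small_cat n C \<Longrightarrow> small_cat (Suc n) (disc_cat (Suc n) C)"
proof (induction n arbitrary: C)
  case 0
  have "small (disc_hom x y)" for x y :: "'k univ"
    unfolding small_def by (rule exI[of _ "\<lambda>_. x"]) (auto simp: disc_hom_def)
  then show ?case using 0 by simp
next
  case (Suc n)
  then show ?case by (simp del: disc_cat.simps add: small_cat.simps(2)[of "Suc n"])
qed

lemma sgpd_disc: "sgpd n C \<Longrightarrow> sgpd (Suc n) (disc_cat (Suc n) C)"
  by (simp only: sgpd_def is_gpd_disc small_disc)

text \<open>
  Since eta is full, f is the image of a 1-cell of the groupoid C, which is an equivalence; composition
  with f is the image under \<open>\<pi>\<^sub>0\<close> of composition with that 1-cell. The premise \<open>IH\<close> is the lemma
  \<open>is_equiv_pi0\<close> one level below.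
\<close>

lemma pi0_is_equiv1:
  fixes C :: "'k univ ncat"
  assumes IH: "\<And>(C :: 'k univ ncat) D F. sgpd (Suc n) C \<Longrightarrow> sgpd (Suc n) D \<Longrightarrow> gmap (Suc n) C D F \<Longrightarrow> is_equiv (Suc n) C D F
      \<Longrightarrow> is_equiv n (pi0_cat (Suc n) C) (pi0_cat (Suc n) D) (pi0_fun (Suc n) C D F)"
    and C: "sgpd (Suc (Suc n)) C" and o: "x \<in> ob C" "y \<in> ob C"
    and f: "f \<in> ob (hom (pi0_cat (Suc (Suc n)) C) x y)"
  shows "is_equiv1 (is_equiv n) n (pi0_cat (Suc (Suc n)) C) x y f"
proof -
  note sh = sgpd_hom[OF C] and c = sgpd_cat[OF C]
  have "f \<in> ob (disc_cat (Suc n) (pi0_cat (Suc n) (hom C x y)))" using f by simp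
  then obtain f0 where f0: "f0 \<in> ob (hom C x y)" and f: "f = fob (eta (Suc n) (hom C x y)) f0"
    using fsurj_fob[OF fsurj_eta[OF sh[OF o]]] by blast
  have i: "is_equiv1 (is_equiv (Suc n)) (Suc n) C x y f0"
    using C o f0 by (simp add: sgpd_def del: is_equiv.simps)
  show ?thesis unfolding is_equiv1_def
  proof (intro conjI ballI, goal_cases)
    case (1 z)
    then have z: "z \<in> ob C" by simp
    show ?case
      unfolding f pi0_precomp[OF C o z f0, symmetric] hom_pi0_Suc
      by (rule IH[OF sh[OF o(2) z] sh[OF o(1) z] gmap_precomp[OF c o z f0]]) (use i z in \<open>simp add: is_equiv1_def del: is_equiv.simps\<close>)
  next
    case (2 z)
    then have z: "z \<in> ob C" by simp
    show ?case
      unfolding f pi0_postcomp[OF C z o f0, symmetric] hom_pi0_Suc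
      by (rule IH[OF sh[OF z o(1)] sh[OF z o(2)] gmap_postcomp[OF c z o f0]]) (use i z in \<open>simp add: is_equiv1_def del: is_equiv.simps\<close>)
  qed
qed

lemma is_equiv_pi0:
  "sgpd (Suc n) C \<Longrightarrow> sgpd (Suc n) D \<Longrightarrow> gmap (Suc n) C D F \<Longrightarrow> is_equiv (Suc n) C D F
   \<Longrightarrow> is_equiv n (pi0_cat (Suc n) C) (pi0_cat (Suc n) D) (pi0_fun (Suc n) C D F)"
proof (induction n arbitrary: C D F)
  case 0
  note C = 0(1) and D = 0(2) and F = 0(3) and e = 0(4)
  (* At the lowest level: a functor that is bijective on homs reflects being connected, so it is
     injective on classes, and it is surjective on them by essential surjectivity. *)
  have ess: "\<exists>c\<in>ob C. ob (hom D (fob F c) d) \<noteq> {}" if "d \<in> ob D" for d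
    using e[unfolded is_equiv.simps(2)] that by blast
  have ff: "bij_betw (fob (fhom F c c')) (ob (hom C c c')) (ob (hom D (fob F c) (fob F c')))"
    if "c \<in> ob C" "c' \<in> ob C" for c c'
    using e that by simp
  have p: "fob (pi0_fun (Suc 0) C D F) (iso_class C c) = iso_class D (fob F c)" if c: "c \<in> ob C" for c
    using arg_cong[OF eta_natural[OF C D F], of "\<lambda>G. fob G c"] c gmap_fob[OF F c] by (simp add: fob_eta[OF C, simplified])
  have inj: "iso_class C c = iso_class C c'"
    if "c \<in> ob C" "c' \<in> ob C" "iso_class D (fob F c) = iso_class D (fob F c')" for c c'
  proof -
    have "ob (hom D (fob F c) (fob F c')) \<noteq> {}"
      using that sgpd_class_eq_iff[OF D] gmap_fob[OF F] by blast
    then have "ob (hom C c c') \<noteq> {}"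
      using ff[OF that(1,2)] unfolding bij_betw_def by blast
    then show ?thesis using sgpd_class_eq_iff[OF C that(1,2)] by blast
  qed
  have "iso_class D d \<in> fob (pi0_fun (Suc 0) C D F) ` iso_class C ` ob C" if d: "d \<in> ob D" for d
  proof -
    obtain c where c: "c \<in> ob C" "ob (hom D (fob F c) d) \<noteq> {}" using ess[OF d] by blast
    then have "iso_class D d = fob (pi0_fun (Suc 0) C D F) (iso_class C c)"
      using sgpd_class_eq_iff[OF D gmap_fob[OF F c(1)] d] p[OF c(1)] by simp
    then show ?thesis using c by blast
  qed
  moreover have "fob (pi0_fun (Suc 0) C D F) ` iso_class C ` ob C \<subseteq> iso_class D ` ob D"
    using p gmap_fob[OF F] by auto
  ultimately have "fob (pi0_fun (Suc 0) C D F) ` iso_class C ` ob C = iso_class D ` ob D" by blast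
  moreover have "inj_on (fob (pi0_fun (Suc 0) C D F)) (iso_class C ` ob C)"
  proof (rule inj_onI, elim imageE)
    fix a b c c' assume eq: "fob (pi0_fun (Suc 0) C D F) a = fob (pi0_fun (Suc 0) C D F) b"
      and c: "a = iso_class C c" "c \<in> ob C" "b = iso_class C c'" "c' \<in> ob C"
    have "iso_class D (fob F c) = iso_class D (fob F c')"
      using eq unfolding c(1,3) p[OF c(2)] p[OF c(4)] .
    then show "a = b" unfolding c(1,3) by (rule inj[OF c(2,4)])
  qed
  ultimately show ?case by (simp add: bij_betw_def)
next
  case (Suc n)
  note C = Suc.prems(1) and D = Suc.prems(2) and F = Suc.prems(3) and e = Suc.prems(4)
  note sc = sgpd_hom[OF C] and sd = sgpd_hom[OF D]
  note fob = gmap_fob[OF F]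
  show ?case unfolding is_equiv.simps(2)
  proof (intro conjI ballI, goal_cases)
    case (1 d)
    then have d: "d \<in> ob D" by simp
    then obtain c f where c: "c \<in> ob C" and f: "f \<in> ob (hom D (fob F c) d)"
      using e by (auto simp add: is_equiv.simps(2)[of "Suc n"] simp del: is_equiv.simps)
    have f': "fob (eta (Suc n) (hom D (fob F c) d)) f \<in> ob (hom (pi0_cat (Suc (Suc n)) D) (fob F c) d)"
      using fob_eta[OF sd[OF fob[OF c] d] f] by simp
    have cp: "c \<in> ob (pi0_cat (Suc (Suc n)) C)" using c by simp
    have "is_equiv1 (is_equiv n) n (pi0_cat (Suc (Suc n)) D) (fob F c) d (fob (eta (Suc n) (hom D (fob F c) d)) f)"
      by (rule pi0_is_equiv1[OF _ D fob[OF c] d f'], rule Suc.IH; assumption)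
    with f' show ?case by (intro bexI[OF _ cp], unfold fob_pi0_Suc[OF c]) blast
  next
    case (2 c c')
    then have c: "c \<in> ob C" "c' \<in> ob C" by simp_all
    show ?case
      unfolding hom_pi0_Suc fob_pi0_Suc[OF c(1)] fob_pi0_Suc[OF c(2)] fhom_pi0_Suc[OF c]
      by (rule Suc.IH[OF sc[OF c] sd[OF fob[OF c(1)] fob[OF c(2)]] gmap_fhom[OF F c]])
        (use e c in \<open>simp add: is_equiv.simps(2)[of "Suc n"] del: is_equiv.simps\<close>)
  qed
qed

lemma is_gpd_pi0: "sgpd (Suc n) C \<Longrightarrow> is_gpd n (pi0_cat (Suc n) C)"
proof (induction n arbitrary: C)
  case 0
  then show ?case by simp
next
  case (Suc n)
  note C = Suc.prems
  show ?case unfolding is_gpd.simps(2)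
  proof (intro conjI ballI, goal_cases)
    case 1
    show ?case by (rule is_cat_pi0[OF C])
  next
    case (2 x y f)
    then have o: "x \<in> ob C" "y \<in> ob C" by simp_all
    show ?case by (rule pi0_is_equiv1[OF _ C o 2(3)], rule is_equiv_pi0; assumption)
  next
    case (3 x y)
    then show ?case using Suc.IH[OF sgpd_hom[OF C]] by simp
  qed
qed

lemma small_pi0: "small_cat (Suc n) C \<Longrightarrow> small_cat n (pi0_cat (Suc n) C)"
proof (induction n arbitrary: C)
  case 0
  then show ?case by (simp add: small_image)
next
  case (Suc n)
  then show ?case by (simp del: pi0_cat.simps add: small_cat.simps(2)[of "Suc n"])
qed

lemma sgpd_pi0: "sgpd (Suc n) C \<Longrightarrow> sgpd n (pi0_cat (Suc n) C)"
  using is_gpd_pi0[of n C] small_pi0[of n C] unfolding sgpd_def by blast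

section \<open>The two sesqui-functors\<close>

lemma Ob_nGpd: "Ob (nGpd n) = {C. sgpd n C}"
  by (simp add: nGpd_def sgpd_def)

text \<open>
  Each equation between 2-morphisms is an instance of \<open>eta_cancel_tr\<close>. After whiskering with eta and
  applying D, naturality of eta removes \<open>\<pi>\<^sub>0\<close> from both sides, and an equation between whiskerings and
  vertical composites in the domain of \<open>\<pi>\<^sub>0\<close> remains.
\<close>

lemma is_sfunctor_pi0: "is_sfunctor (nGpd (Suc n)) (nGpd n) (pi0 (Suc n))"
proof -
  note ic = is_cat_disc[OF is_cat_pi0] and gp = gcat_disc[OF gcat_pi0]
  have Id2: "pi0_tr (Suc n) A B (id_tr (Suc n) A B F) =
      id_tr n (pi0_cat (Suc n) A) (pi0_cat (Suc n) B) (pi0_fun (Suc n) A B F)"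
    if A: "sgpd (Suc n) A" and B: "sgpd (Suc n) B" and F: "is_fun (Suc n) A B F" for A B :: "'k univ ncat" and F
  proof -
    note F' = is_fun_gmap[OF F]
    note i = gtr_id[OF sgpd_cat[OF B] F']
    note p = gmap_pi0_fun[OF A F']
    show ?thesis
      by (rule eta_cancel_tr[OF A is_cat_pi0[OF B] gtr_pi0[OF A B i]
            gtr_id[OF is_cat_pi0[OF B] p]])
        (simp only: eta_natural_tr[OF A B i] disc_tr_id wl_id[OF ic[OF B] gmap_eta[OF A] gmap_disc[OF p]]
          wr_id[OF sgpd_cat[OF B] ic[OF B] F' is_fun_eta[OF B]] eta_natural[OF A B F'])
  qed
  have V: "pi0_tr (Suc n) A B (vcomp (Suc n) A B \<alpha> \<beta>) =
      vcomp n (pi0_cat (Suc n) A) (pi0_cat (Suc n) B) (pi0_tr (Suc n) A B \<alpha>) (pi0_tr (Suc n) A B \<beta>)"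
    if A: "sgpd (Suc n) A" and B: "sgpd (Suc n) B" and \<alpha>: "gtr (Suc n) A B \<alpha>" and \<beta>: "gtr (Suc n) A B \<beta>"
      and eq: "tgt \<alpha> = src \<beta>" for A B :: "'k univ ncat" and \<alpha> \<beta>
  proof -
    note v = gtr_vcomp[OF sgpd_cat[OF B] \<alpha> \<beta> eq]
    note p = gtr_pi0[OF A B \<alpha>] gtr_pi0[OF A B \<beta>]
    note d = gtr_disc[OF is_cat_pi0[OF B] p(1)] gtr_disc[OF is_cat_pi0[OF B] p(2)]
    have e: "tgt (pi0_tr (Suc n) A B \<alpha>) = src (pi0_tr (Suc n) A B \<beta>)"
      by (simp only: tgt_pi0_tr[OF A B \<alpha>] src_pi0_tr eq)
    have e': "tgt (disc_tr (Suc n) (pi0_cat (Suc n) A) (pi0_cat (Suc n) B) (pi0_tr (Suc n) A B \<alpha>)) =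
        src (disc_tr (Suc n) (pi0_cat (Suc n) A) (pi0_cat (Suc n) B) (pi0_tr (Suc n) A B \<beta>))"
      by (simp only: tgt_disc_tr[OF p(1)] src_disc_tr e)
    show ?thesis
      by (rule eta_cancel_tr[OF A is_cat_pi0[OF B] gtr_pi0[OF A B v]
            gtr_vcomp[OF is_cat_pi0[OF B] p e]])
        (simp only: eta_natural_tr[OF A B v] wr_vcomp[OF sgpd_cat[OF B] ic[OF B] is_fun_eta[OF B] \<alpha> \<beta> eq]
          disc_tr_vcomp[OF is_cat_pi0[OF B] p e] wl_vcomp[OF ic[OF B] gmap_eta[OF A] d e']
          eta_natural_tr[OF A B \<alpha>] eta_natural_tr[OF A B \<beta>])
  qed
  have L: "pi0_tr (Suc n) A E (whisker_l (Suc n) A F \<alpha>) =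
      whisker_l n (pi0_cat (Suc n) A) (pi0_fun (Suc n) A B F) (pi0_tr (Suc n) B E \<alpha>)"
    if A: "sgpd (Suc n) A" and B: "sgpd (Suc n) B" and E: "sgpd (Suc n) E" and F: "is_fun (Suc n) A B F"
      and \<alpha>: "gtr (Suc n) B E \<alpha>" for A B E :: "'k univ ncat" and F \<alpha>
  proof -
    note F' = is_fun_gmap[OF F]
    note w = gtr_wl[OF sgpd_gcat[OF E] F' \<alpha>]
    note p = gtr_pi0[OF B E \<alpha>] and pF = gmap_pi0_fun[OF A F']
    note d = gtr_disc[OF is_cat_pi0[OF E] p]
    show ?thesis
      by (rule eta_cancel_tr[OF A is_cat_pi0[OF E] gtr_pi0[OF A E w]
            gtr_wl[OF gcat_pi0[OF E] pF p]])
        (simp only: eta_natural_tr[OF A E w] wl_wr[OF sgpd_cat[OF E] gp[OF E] F' \<alpha> is_fun_eta[OF E], symmetric]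
          eta_natural_tr[OF B E \<alpha>, symmetric] wl_fcomp[OF gp[OF E] F' gmap_eta[OF B] d, symmetric]
          eta_natural[OF A B F', symmetric] wl_fcomp[OF gp[OF E] gmap_eta[OF A] gmap_disc[OF pF] d]
          disc_tr_wl[OF is_cat_pi0[OF E] pF p])
  qed
  have R: "pi0_tr (Suc n) A E (whisker_r (Suc n) A \<alpha> H) =
      whisker_r n (pi0_cat (Suc n) A) (pi0_tr (Suc n) A B \<alpha>) (pi0_fun (Suc n) B E H)"
    if A: "sgpd (Suc n) A" and B: "sgpd (Suc n) B" and E: "sgpd (Suc n) E" and \<alpha>: "gtr (Suc n) A B \<alpha>"
      and H: "is_fun (Suc n) B E H" for A B E :: "'k univ ncat" and H \<alpha>
  proof -
    note H' = is_fun_gmap[OF H]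
    note w = gtr_wr[OF sgpd_cat[OF B] sgpd_gcat[OF E] \<alpha> H]
    note p = gtr_pi0[OF A B \<alpha>] and pH = is_fun_pi0[OF B E H]
    note d = gtr_disc[OF is_cat_pi0[OF B] p] and dH = is_fun_disc[OF gcat_pi0[OF B] gcat_pi0[OF E] pH]
    show ?thesis
      by (rule eta_cancel_tr[OF A is_cat_pi0[OF E] gtr_pi0[OF A E w]
            gtr_wr[OF is_cat_pi0[OF B] gcat_pi0[OF E] p pH]])
        (simp only: eta_natural_tr[OF A E w] wr_fcomp[OF sgpd_cat[OF B] sgpd_cat[OF E] gp[OF E] \<alpha> H is_fun_eta[OF E], symmetric]
          eta_natural[OF B E H', symmetric] wr_fcomp[OF sgpd_cat[OF B] ic[OF B] gp[OF E] \<alpha> is_fun_eta[OF B] dH]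
          eta_natural_tr[OF A B \<alpha>, symmetric] wl_wr[OF ic[OF B] gp[OF E] gmap_eta[OF A] d dH, symmetric]
          disc_tr_wr[OF is_cat_pi0[OF B] is_cat_pi0[OF E] p pH])
  qed
  show ?thesis
    unfolding is_sfunctor_def Ob_nGpd
    unfolding nGpd_def pi0_def
    by (intro conjI ballI)
      (auto simp add: sgpd_pi0 is_fun_pi0 pi0_fun_id is_tr_pi0 tgt_pi0_tr is_tr_gtr Id2 
        simp del: is_tr.simps is_fun.simps gtr.simps pi0_tr.simps pi0_cat.simps id_tr.simps id_fun.simps whisker_l.simps whisker_r.simps vcomp.simps fcomp.simps
        intro: pi0_fun_fcomp[OF _ _ _ is_fun_gmap is_fun_gmap] V[OF _ _ is_tr_gtr is_tr_gtr] L[OF _ _ _ _ is_tr_gtr] R[OF _ _ _ is_tr_gtr])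
qed

lemma is_sfunctor_Disc: "is_sfunctor (nGpd n) (nGpd (Suc n)) (Disc (Suc n))"
proof -
  have T: "is_tr (Suc n) (disc_cat (Suc n) A) (disc_cat (Suc n) B) (disc_tr (Suc n) A B \<alpha>)"
    if "sgpd n A" "sgpd n B" "is_tr n A B \<alpha>" for A B :: "'k univ ncat" and \<alpha>
    using is_tr_disc_iff[OF sgpd_gcat[OF that(1)] sgpd_cat[OF that(2)] is_tr_gtr[OF that(3)]] that(3) by blast
  show ?thesis
    unfolding is_sfunctor_def Ob_nGpd
    unfolding nGpd_def Disc_def
    by (intro conjI ballI)
      (auto simp add: sgpd_disc is_fun_disc sgpd_gcat disc_id T tgt_disc_tr is_tr_gtr disc_tr_id
        simp del: is_tr.simps is_fun.simps disc_tr.simps disc_fun.simps disc_cat.simps id_tr.simps id_fun.simps whisker_l.simps whisker_r.simps vcomp.simps fcomp.simps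
        intro: disc_fcomp[OF is_fun_gmap is_fun_gmap] disc_tr_vcomp[OF sgpd_cat is_tr_gtr is_tr_gtr]
          disc_tr_wl[OF sgpd_cat is_fun_gmap is_tr_gtr] disc_tr_wr[OF sgpd_cat sgpd_cat is_tr_gtr])
qed

section \<open>The counit\<close>

text \<open>The isomorphism classes of a discrete groupoid are singletons, and \<open>rep\<close> extracts their elements.\<close>

fun eps :: "nat \<Rightarrow> 'k univ ncat \<Rightarrow> ('k univ, 'k univ) nfun" where
  "eps 0 B = Map0 (\<lambda>p\<in>iso_class (disc_cat (Suc 0) B) ` ob B. rep p)"
| "eps (Suc n) B = Fun (\<lambda>x\<in>ob B. x) (\<lambda>x\<in>ob B. \<lambda>y\<in>ob B. eps n (hom B x y))"

lemma rep_iso_class_disc: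
  assumes B: "sgpd 0 B" and x: "x \<in> ob B"
  shows "rep (iso_class (disc_cat (Suc 0) B) x) = x"
  using sgpd_rep(2)[OF sgpd_disc[OF B], of x] x by auto

lemma gmap_eps: "sgpd n B \<Longrightarrow> gmap n (pi0_cat (Suc n) (disc_cat (Suc n) B)) B (eps n B)"
proof (induction n arbitrary: B)
  case 0
  then show ?case using rep_iso_class_disc[OF 0] by auto
next
  case (Suc n)
  then show ?case using sgpd_hom[OF Suc.prems] by simp
qed

text \<open>
  This triangular identity determines the counit, because the unit can be cancelled. The functor laws
  and the naturality of the counit, and the other triangular identity, are derived from it.
\<close>

lemma eta_eps:
  "sgpd n B \<Longrightarrow> fcomp (Suc n) (disc_cat (Suc n) B) (eta (Suc n) (disc_cat (Suc n) B))
     (disc_fun (Suc n) (pi0_cat (Suc n) (disc_cat (Suc n) B)) (eps n B)) = id_fun (Suc n) (disc_cat (Suc n) B)"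
proof (induction n arbitrary: B)
  case 0
  note r = rep_iso_class_disc[OF 0]
  have "rep (iso_class (Cat (ob B) (\<lambda>x y. Set0 (disc_hom x y)) (\<lambda>x. Map0 (\<lambda>_. x))
         (\<lambda>x y z. Map0 (\<lambda>(f, g)\<in>disc_hom x y \<times> disc_hom y z. f))) x) = x" if "x \<in> ob B" for x
    using r[OF that] by simp
  then show ?case
    by (simp add: fcomp.simps id_fun.simps cong: restrict_cong)
next
  case (Suc n)
  have IH: "fcomp (Suc n) (disc_cat (Suc n) (hom B x y)) (eta (Suc n) (disc_cat (Suc n) (hom B x y)))
     (disc_fun (Suc n) (pi0_cat (Suc n) (disc_cat (Suc n) (hom B x y))) (eps n (hom B x y))) =
     id_fun (Suc n) (disc_cat (Suc n) (hom B x y))" if "x \<in> ob B" "y \<in> ob B" for x y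
    by (rule Suc.IH[OF sgpd_hom[OF Suc.prems that]])
  show ?case
    by (simp add: fcomp.simps(2)[of "Suc n"] id_fun.simps(2)[of "Suc n"] IH cong: restrict_cong)
qed

lemma is_fun_eps:
  assumes B: "sgpd n B"
  shows "is_fun n (pi0_cat (Suc n) (disc_cat (Suc n) B)) B (eps n B)"
proof -
  note DB = sgpd_disc[OF B]
  note g = gcat_pi0[OF DB]
  show ?thesis
    by (rule is_fun_disc_iff[OF g sgpd_gcat[OF B] gmap_eps[OF B], THEN iffD1])
      (rule is_fun_cancel[OF sgpd_gcat[OF DB] gcat_disc[OF g] sgpd_gcat[OF DB] is_fun_eta[OF DB] fsurj_eta[OF DB]
        gmap_disc[OF gmap_eps[OF B]] is_fun_id[OF sgpd_gcat[OF DB], folded eta_eps[OF B]]])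
qed

lemma eps_natural:
  assumes A: "sgpd n A" and B: "sgpd n B" and F: "is_fun n A B F"
  shows "fcomp n (pi0_cat (Suc n) (disc_cat (Suc n) A))
      (pi0_fun (Suc n) (disc_cat (Suc n) A) (disc_cat (Suc n) B) (disc_fun (Suc n) A F)) (eps n B) =
    fcomp n (pi0_cat (Suc n) (disc_cat (Suc n) A)) (eps n A) F"
proof -
  note DA = sgpd_disc[OF A] and DB = sgpd_disc[OF B]
  note F' = is_fun_gmap[OF F]
  note dF = gmap_disc[OF F']
  note pF = gmap_pi0_fun[OF DA dF]
  note e = gmap_eps[OF A] gmap_eps[OF B]
  note n = gmap_eta[OF DA] gmap_eta[OF DB]
  show ?thesis
    by (rule eta_cancel[OF DA gmap_fcomp[OF pF e(2)] gmap_fcomp[OF e(1) F']])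
      (simp only: disc_fcomp[OF pF e(2)] disc_fcomp[OF e(1) F'] fcomp_assoc[OF n(1) gmap_disc[OF pF] gmap_disc[OF e(2)], symmetric]
        eta_natural[OF DA DB dF] fcomp_assoc[OF dF n(2) gmap_disc[OF e(2)]] eta_eps[OF B] fcomp_id_right[OF dF]
        fcomp_assoc[OF n(1) gmap_disc[OF e(1)] dF, symmetric] eta_eps[OF A] fcomp_id_left[OF dF])
qed

lemma eps_natural_tr:
  assumes A: "sgpd n A" and B: "sgpd n B" and \<alpha>: "gtr n A B \<alpha>"
  shows "whisker_r n (pi0_cat (Suc n) (disc_cat (Suc n) A))
      (pi0_tr (Suc n) (disc_cat (Suc n) A) (disc_cat (Suc n) B) (disc_tr (Suc n) A B \<alpha>)) (eps n B) =
    whisker_l n (pi0_cat (Suc n) (disc_cat (Suc n) A)) (eps n A) \<alpha>"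
proof -
  note DA = sgpd_disc[OF A] and DB = sgpd_disc[OF B]
  note d = gtr_disc[OF sgpd_cat[OF B] \<alpha>]
  note p = gtr_pi0[OF DA DB d] and e = gmap_eps[OF A] and eB = is_fun_eps[OF B]
  note pB = is_cat_pi0[OF DB]
  note dp = gtr_disc[OF pB p] and deB = is_fun_disc[OF gcat_pi0[OF DB] sgpd_gcat[OF B] eB]
  note n = gmap_eta[OF DA]
  note cB = sgpd_cat[OF DB] sgpd_gcat[OF DB]
  show ?thesis
    by (rule eta_cancel_tr[OF DA sgpd_cat[OF B] gtr_wr[OF pB sgpd_gcat[OF B] p eB] gtr_wl[OF sgpd_gcat[OF B] e \<alpha>]])
      (simp only: disc_tr_wr[OF pB sgpd_cat[OF B] p eB] wl_wr[OF is_cat_disc[OF pB] cB(2) n dp deB]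
        eta_natural_tr[OF DA DB d] wr_fcomp[OF cB(1) is_cat_disc[OF pB] cB(2) d is_fun_eta[OF DB] deB, symmetric]
        eta_eps[OF B] wr_id_fun[OF cB(1) d] disc_tr_wl[OF sgpd_cat[OF B] e \<alpha>] wl_fcomp[OF cB(2) n gmap_disc[OF e] d, symmetric]
        eta_eps[OF A] wl_id_fun[OF cB(2) d])
qed

text \<open>
  After whiskering with the unit and applying D, naturality of the unit turns the left-hand side into
  the composite of the unit of A with the triangular identity \<open>eta_eps\<close> for \<open>\<pi>\<^sub>0 A\<close>.
\<close>

lemma pi0_eta_eps:
  assumes A: "sgpd (Suc n) A"
  shows "fcomp n (pi0_cat (Suc n) A)
      (pi0_fun (Suc n) A (disc_cat (Suc n) (pi0_cat (Suc n) A)) (eta (Suc n) A)) (eps n (pi0_cat (Suc n) A)) =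
    id_fun n (pi0_cat (Suc n) A)"
proof -
  note P = sgpd_pi0[OF A]
  note DP = sgpd_disc[OF P]
  note n = gmap_eta[OF A] gmap_eta[OF DP]
  note p = gmap_pi0_fun[OF A n(1)] and e = gmap_eps[OF P]
  show ?thesis
    by (rule eta_cancel[OF A gmap_fcomp[OF p e] gmap_id])
      (simp only: disc_fcomp[OF p e] fcomp_assoc[OF n(1) gmap_disc[OF p] gmap_disc[OF e], symmetric]
        eta_natural[OF A DP n(1)] fcomp_assoc[OF n(1) n(2) gmap_disc[OF e]] eta_eps[OF P] disc_id)
qed

section \<open>The adjunction\<close>

theorem theorem4p28:
  fixes n :: nat
  assumes "n \<ge> 1"
  shows "sesqui_left_adjoint (nGpd n) (nGpd (n - 1)) (pi0 n) (Disc n)"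
proof -
  obtain m where n: "n = Suc m" using assms by (cases n) auto
  have u: "is_strict_nat (nGpd (Suc m)) (nGpd (Suc m)) sid (scomp (pi0 (Suc m)) (Disc (Suc m))) (eta (Suc m))"
    unfolding is_strict_nat_def Ob_nGpd
    unfolding nGpd_def sid_def scomp_def pi0_def Disc_def
    by (simp add: is_fun_eta eta_natural eta_natural_tr is_fun_gmap is_tr_gtr
        del: is_tr.simps is_fun.simps gtr.simps whisker_l.simps whisker_r.simps disc_tr.simps pi0_tr.simps eta.simps disc_cat.simps pi0_cat.simps disc_fun.simps)
  have c: "is_strict_nat (nGpd m) (nGpd m) (scomp (Disc (Suc m)) (pi0 (Suc m))) sid (eps m)"
    unfolding is_strict_nat_def Ob_nGpd
    unfolding nGpd_def sid_def scomp_def pi0_def Disc_def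
    by (simp add: is_fun_eps eps_natural eps_natural_tr is_tr_gtr
        del: is_tr.simps is_fun.simps whisker_l.simps whisker_r.simps disc_tr.simps pi0_tr.simps eps.simps disc_cat.simps pi0_cat.simps disc_fun.simps)
  have t1: "\<forall>A\<in>Ob (nGpd (Suc m)).
      Comp1 (nGpd m) (on_Ob (pi0 (Suc m)) A) (on_Ob (pi0 (Suc m)) (on_Ob (Disc (Suc m)) (on_Ob (pi0 (Suc m)) A)))
        (on_Ob (pi0 (Suc m)) A) (on_Arr (pi0 (Suc m)) A (on_Ob (Disc (Suc m)) (on_Ob (pi0 (Suc m)) A)) (eta (Suc m) A))
        (eps m (on_Ob (pi0 (Suc m)) A)) = Id1 (nGpd m) (on_Ob (pi0 (Suc m)) A)"
    unfolding Ob_nGpd unfolding nGpd_def pi0_def Disc_def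
    using pi0_eta_eps by auto
  have t2: "\<forall>B\<in>Ob (nGpd m).
      Comp1 (nGpd (Suc m)) (on_Ob (Disc (Suc m)) B) (on_Ob (Disc (Suc m)) (on_Ob (pi0 (Suc m)) (on_Ob (Disc (Suc m)) B)))
        (on_Ob (Disc (Suc m)) B) (eta (Suc m) (on_Ob (Disc (Suc m)) B))
        (on_Arr (Disc (Suc m)) (on_Ob (pi0 (Suc m)) (on_Ob (Disc (Suc m)) B)) B (eps m B)) =
      Id1 (nGpd (Suc m)) (on_Ob (Disc (Suc m)) B)"
    unfolding Ob_nGpd unfolding nGpd_def pi0_def Disc_def
    using eta_eps by auto
  show ?thesis
    unfolding n sesqui_left_adjoint_def diff_Suc_1
    using is_sesqui_nGpd is_sfunctor_pi0 is_sfunctor_Disc u c t1 t2 by blast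
qed

end
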